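(* Let $F$ be a complete locally convex vector space separated by a family of 1-forms on $F$, and let $E$ be a (locally trivial vector) fiber bundle over a smooth manifold $M$ with typical fiber $F$. Then: \begin{itemize} \item the group $GL(F)$ is a structure group for $E$. Therefore, there exists a frame bundle $Fr_F(E)$ which is a principal $GL(F)$-bundle. The connection 1-forms on $Fr_F(E)$ define a class $\mathcal{CD}_{GL}$ of covariant derivatives on $E$; \item $\mathcal{CD}_{GL}\subset\mathcal{CD}$ and, if $\mathfrak{gl}(F)=L(F)$ as diffeological vector spaces, then $\mathcal{CD}_{GL}=\mathcal{CD}$. \end{itemize}
   Context: All locally convex spaces and manifolds carry their nebulae diffeologies (plots are the usual smooth maps from open subsets of Euclidean spaces). $L(F)$ is the diffeological algebra of smooth linear maps $F\to F$ with the functional diffeology, and $GL(F)$ is its group of invertible elements, with its diffeology as a diffeological subgroup of $\mathrm{Diff}(F)$ (inversion smooth). $\mathfrak{gl}(F)=T_{\mathrm{Id}}GL(F)$; when this notation is used, $GL(F)$ is assumed to be a diffeological Lie group, so that $\mathfrak{gl}(F)$ is a Lie algebra which is a diffeological vector subspace of $L(F)$, with its diffeology of internal tangent space (not necessarily the subset diffeology). $E$ is given by a system of local trivializations over an atlas of $M$, linear on fibers. $GL(F)$ being a structure group means that the changes of local trivializations define (smooth) transition maps with values in $GL(F)$. The frame bundle $Fr_F(E)$ is the associated principal $GL(F)$-bundle, with fiber over $x$ the isomorphisms $F\to E_x$. Connection 1-forms are the 1-forms $\theta\in\Omega^1(Fr_F(E),\mathfrak{gl}(F))$ with $(R_g)_*\theta=\mathrm{Ad}_{g^{-1}}\theta$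 (and reproducing the generators of the right action, as usual); in a local trivialization the induced covariant derivative is $\nabla_XY=D_XY+\theta_i(X)Y$, with $\theta_i$ the $\mathfrak{gl}(F)$-valued local connection form (pull-back of $\theta$ by the local frame section). $\mathcal{CD}_{GL}$ is the set of covariant derivatives so obtained. $\mathcal{CD}=\mathcal{CD}(E)$ is the set of covariant derivatives on $E$, i.e. collections $(p^*\nabla)_p$ over plots $p:O_p\to M$ such that: (i) $p^*\nabla:TO_p\times\Gamma(O_p,p^*E)\to p^*E$ is a smooth fiberwise bilinear map; (ii) for all $f\in C^\infty_c(O_p,\mathbb R)$, $p^*\nabla_{fX}Y=f\,p^*\nabla_XY$ and $p^*\nabla_X(fY)=(D_Xf)Y+f\,p^*\nabla_XY$; (iii) if $p'=p\circ g$ with $g$ smooth, then $(p')^*\nabla=g^*(p^*\nabla)$. *)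

theory Defs
  imports "HOL-Analysis.Analysis"
begin

section \<open>Locally convex spaces\<close>

class locally_convex_space = real_vector + topological_ab_group_add + t2_space +
  assumes tendsto_scaleR_nhds:
    "filterlim (\<lambda>(r, x). r *\<^sub>R x) (nhds (r *\<^sub>R a)) (nhds r \<times>\<^sub>F nhds a)"
  and locally_convex_zero:
    "open N \<Longrightarrow> 0 \<in> N \<Longrightarrow> \<exists>V. open V \<and> 0 \<in> V \<and> V \<subseteq> N \<and>
       (\<forall>x\<in>V. \<forall>y\<in>V. \<forall>a\<ge>0. \<forall>b\<ge>0. a + b = 1 \<longrightarrow> a *\<^sub>R x + b *\<^sub>R y \<in> V)"

class complete_locally_convex_space = locally_convex_space +
  assumes Cauchy_filter_converges:
    "Fil \<noteq> bot \<Longrightarrow> filterlim (\<lambda>(x, y). x - y) (nhds 0) (Fil \<times>\<^sub>F Fil) \<Longrightarrow> \<exists>x. Fil \<le> nhds x"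

instance real_normed_vector < locally_convex_space
proof
  fix r :: real and a :: 'a
  have "((\<lambda>z. fst z *\<^sub>R snd z) \<longlongrightarrow> r *\<^sub>R a) (nhds r \<times>\<^sub>F nhds a)"
    by (intro tendsto_scaleR filterlim_fst filterlim_snd)
  then show "filterlim (\<lambda>(r, x). r *\<^sub>R x) (nhds (r *\<^sub>R a)) (nhds r \<times>\<^sub>F nhds a)"
    by (simp add: case_prod_beta')
next
  fix N :: "'a set"
  assume "open N" "0 \<in> N"
  then obtain e where "e > 0" "ball 0 e \<subseteq> N"
    using openE by blast
  moreover have "convex (ball (0::'a) e)"
    by simp
  ultimately show "\<exists>V. open V \<and> 0 \<in> V \<and> V \<subseteq> N \<and>
      (\<forall>x\<in>V. \<forall>y\<in>V. \<forall>a\<ge>0. \<forall>b\<ge>0. a + b = 1 \<longrightarrow> a *\<^sub>R x + b *\<^sub>R y \<in> V)"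
    unfolding convex_def by (intro exI[of _ "ball 0 e"]) auto
qed

instance banach < complete_locally_convex_space
proof
  fix Fil :: "'a filter"
  assume nb: "Fil \<noteq> bot" and lim: "filterlim (\<lambda>(x, y). x - y) (nhds 0) (Fil \<times>\<^sub>F Fil)"
  have "cauchy_filter Fil"
    unfolding cauchy_filter_def uniformity_dist
  proof (intro INF_greatest)
    fix e :: real assume "e \<in> {0<..}"
    then have "eventually (\<lambda>z. norm (fst z - snd z) < e) (Fil \<times>\<^sub>F Fil)"
      using lim[unfolded tendsto_iff, rule_format, of e] by (simp add: case_prod_beta')
    then show "Fil \<times>\<^sub>F Fil \<le> principal {(x, y). dist x y < e}"
      by (simp add: le_principal dist_norm case_prod_beta')
  qed
  then show "\<exists>x. Fil \<le> nhds x"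
    using complete_uniform[of "UNIV :: 'a set"] nb complete_UNIV by auto
qed


section \<open>Smooth maps on open subsets of Euclidean spaces\<close>

text \<open>
  A point or vector of $R^n$ is an element of \<^term>\<open>topspace (Euclidean_space n)\<close>, i.e. a sequence
  vanishing from index \<open>n\<close> on. The topology is that of the ambient product space, so
  \<^const>\<open>continuous_on\<close> and \<^const>\<open>compact\<close> have their usual meaning.
\<close>

type_synonym vec = "nat \<Rightarrow> real"

abbreviation Rn :: "nat \<Rightarrow> vec set" where
  "Rn n \<equiv> topspace (Euclidean_space n)"

abbreviation e1 :: vec where
  "e1 \<equiv> (\<lambda>i. if i = 0 then 1 else 0)"

definition diff_quot :: "nat \<Rightarrow> (vec \<Rightarrow> 'a::real_vector) \<Rightarrow> vec \<Rightarrow> real \<Rightarrow> 'a" where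
  "diff_quot i f x h = (1 / h) *\<^sub>R (f (x(i := x i + h)) - f x)"

definition partial_deriv ::
    "nat \<Rightarrow> (vec \<Rightarrow> 'a::{real_vector, t2_space}) \<Rightarrow> vec \<Rightarrow> 'a" where
  "partial_deriv i f x = Lim (at 0) (diff_quot i f x)"

primrec Ck_on :: "nat \<Rightarrow> nat \<Rightarrow> vec set \<Rightarrow> (vec \<Rightarrow> 'a::{real_vector, t2_space}) \<Rightarrow> bool" where
  "Ck_on 0 n U f \<longleftrightarrow> continuous_on U f"
| "Ck_on (Suc k) n U f \<longleftrightarrow> continuous_on U f \<and>
     (\<forall>i<n. (\<forall>x\<in>U. \<exists>l. (diff_quot i f x \<longlongrightarrow> l) (at 0)) \<and> Ck_on k n U (partial_deriv i f))"

definition smooth_on :: "nat \<Rightarrow> vec set \<Rightarrow> (vec \<Rightarrow> 'a::{real_vector, t2_space}) \<Rightarrow> bool" where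
  "smooth_on n U f \<longleftrightarrow> (\<forall>k. Ck_on k n U f)"

definition dir_deriv ::
    "nat \<Rightarrow> (vec \<Rightarrow> 'a::{real_vector, t2_space}) \<Rightarrow> vec \<Rightarrow> vec \<Rightarrow> 'a" where
  "dir_deriv n f x v = (\<Sum>i<n. v i *\<^sub>R partial_deriv i f x)"

definition tangent_map :: "nat \<Rightarrow> nat \<Rightarrow> (vec \<Rightarrow> vec) \<Rightarrow> vec \<Rightarrow> vec \<Rightarrow> vec" where
  "tangent_map m n g x v = (\<lambda>i. if i < n then dir_deriv m (\<lambda>w. g w i) x v else 0)"

definition Cc_infinity :: "nat \<Rightarrow> vec set \<Rightarrow> (vec \<Rightarrow> real) set" where
  "Cc_infinity n U = {f. smooth_on n U f \<and> (\<exists>K. compact K \<and> K \<subseteq> U \<and> (\<forall>u\<in>U - K. f u = 0))}"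


section \<open>Diffeological spaces\<close>

text \<open>
  \<open>plots X n U\<close> is the set of plots of \<open>X\<close> with domain the open set \<open>U\<close> of $R^n$. Plots are
  extensional (\<open>undefined\<close> off \<open>U\<close>), so that they are determined by their values on \<open>U\<close>.
\<close>

record 'a dspace =
  points :: "'a set"
  plots :: "nat \<Rightarrow> vec set \<Rightarrow> (vec \<Rightarrow> 'a) set"

record 'a dvs = "'a dspace" +
  vadd :: "'a \<Rightarrow> 'a \<Rightarrow> 'a"
  vscale :: "real \<Rightarrow> 'a \<Rightarrow> 'a"

definition euclidean_domain :: "nat \<Rightarrow> vec set \<Rightarrow> vec dspace" where
  "euclidean_domain n U = \<lparr>points = U,
     plots = (\<lambda>m V. {g \<in> V \<rightarrow>\<^sub>E U. openin (Euclidean_space m) V \<and>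
                                 (\<forall>i<n. smooth_on m V (\<lambda>x. g x i))})\<rparr>"

definition diffeological_space :: "('a, 'x) dspace_scheme \<Rightarrow> bool" where
  "diffeological_space X \<longleftrightarrow>
     (\<forall>n U. \<forall>p\<in>plots X n U. openin (Euclidean_space n) U \<and> p \<in> U \<rightarrow>\<^sub>E points X) \<and>
     (\<forall>n U. \<forall>x\<in>points X. openin (Euclidean_space n) U \<longrightarrow> (\<lambda>u\<in>U. x) \<in> plots X n U) \<and>
     (\<forall>n U p. openin (Euclidean_space n) U \<longrightarrow> p \<in> U \<rightarrow>\<^sub>E points X \<longrightarrow>
        (\<forall>u\<in>U. \<exists>V. u \<in> V \<and> V \<subseteq> U \<and> restrict p V \<in> plots X n V) \<longrightarrow> p \<in> plots X n U) \<and>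
     (\<forall>n U m V. \<forall>p\<in>plots X n U. \<forall>g\<in>plots (euclidean_domain n U) m V. compose V p g \<in> plots X m V)"

definition smooth_map :: "('a, 'x) dspace_scheme \<Rightarrow> ('b, 'y) dspace_scheme \<Rightarrow> ('a \<Rightarrow> 'b) \<Rightarrow> bool" where
  "smooth_map X Y f \<longleftrightarrow> f \<in> points X \<rightarrow> points Y \<and>
     (\<forall>n U. \<forall>p\<in>plots X n U. compose U f p \<in> plots Y n U)"

definition diffeo :: "('a, 'x) dspace_scheme \<Rightarrow> ('b, 'y) dspace_scheme \<Rightarrow> ('a \<Rightarrow> 'b) \<Rightarrow> bool" where
  "diffeo X Y f \<longleftrightarrow> bij_betw f (points X) (points Y) \<and>
     smooth_map X Y f \<and> smooth_map Y X (inv_into (points X) f)"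

definition subdspace :: "('a, 'x) dspace_scheme \<Rightarrow> 'a set \<Rightarrow> 'a dspace" where
  "subdspace X A = \<lparr>points = points X \<inter> A, plots = (\<lambda>n U. {p \<in> plots X n U. p ` U \<subseteq> A})\<rparr>"

definition dprod :: "('a, 'x) dspace_scheme \<Rightarrow> ('b, 'y) dspace_scheme \<Rightarrow> ('a \<times> 'b) dspace" where
  "dprod X Y = \<lparr>points = points X \<times> points Y,
     plots = (\<lambda>n U. {p \<in> U \<rightarrow>\<^sub>E points X \<times> points Y.
                compose U fst p \<in> plots X n U \<and> compose U snd p \<in> plots Y n U})\<rparr>"

definition Cinf :: "('a, 'x) dspace_scheme \<Rightarrow> ('b, 'y) dspace_scheme \<Rightarrow> ('a \<Rightarrow> 'b) dspace" where
  "Cinf X Y = (let C = {f \<in> extensional (points X). smooth_map X Y f} in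
     \<lparr>points = C,
      plots = (\<lambda>n U. {p \<in> U \<rightarrow>\<^sub>E C. openin (Euclidean_space n) U \<and>
                 smooth_map (dprod (euclidean_domain n U) X) Y (\<lambda>(u, x). p u x)})\<rparr>)"

text \<open>The image \<open>f ` X\<close> with the quotient diffeology: plots are the maps lifting locally to plots of \<open>X\<close>.\<close>

definition pushforward :: "('a \<Rightarrow> 'b) \<Rightarrow> ('a, 'x) dspace_scheme \<Rightarrow> 'b dspace" where
  "pushforward f X = \<lparr>points = f ` points X,
     plots = (\<lambda>n U. {q \<in> U \<rightarrow>\<^sub>E f ` points X. openin (Euclidean_space n) U \<and>
        (\<forall>u\<in>U. \<exists>V. \<exists>p\<in>plots X n V. u \<in> V \<and> V \<subseteq> U \<and> (\<forall>v\<in>V. q v = f (p v)))})\<rparr>"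

definition nebula :: "('a::{real_vector, t2_space}) dvs" where
  "nebula = \<lparr>points = UNIV,
     plots = (\<lambda>n U. {p \<in> extensional U. openin (Euclidean_space n) U \<and> smooth_on n U p}),
     vadd = (+), vscale = (*\<^sub>R)\<rparr>"

text \<open>
  \<open>V\<close>-valued differential 1-forms: \<open>\<alpha> n U p\<close> is the 1-form \<open>(u, v) \<mapsto> \<alpha> n U p u v\<close> on the domain
  \<open>U\<close> of the plot \<open>p\<close>. Values off these domains are irrelevant and left unconstrained.
\<close>

type_synonym ('a, 'v) form = "nat \<Rightarrow> vec set \<Rightarrow> (vec \<Rightarrow> 'a) \<Rightarrow> vec \<Rightarrow> vec \<Rightarrow> 'v"

definition one_forms :: "('a, 'x) dspace_scheme \<Rightarrow> ('v, 'y) dvs_scheme \<Rightarrow> ('a, 'v) form set" where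
  "one_forms X V = {\<alpha>. \<forall>n U. \<forall>p\<in>plots X n U.
     smooth_map (dprod (euclidean_domain n U) (euclidean_domain n (Rn n))) V (\<lambda>(u, v). \<alpha> n U p u v) \<and>
     (\<forall>u\<in>U. \<forall>v\<in>Rn n. \<forall>w\<in>Rn n. \<forall>a b.
        \<alpha> n U p u (\<lambda>i. a * v i + b * w i) =
          vadd V (vscale V a (\<alpha> n U p u v)) (vscale V b (\<alpha> n U p u w))) \<and>
     (\<forall>m W. \<forall>g\<in>plots (euclidean_domain n U) m W. \<forall>u\<in>W. \<forall>v\<in>Rn m.
        \<alpha> m W (compose W p g) u v = \<alpha> n U p (g u) (tangent_map m n g u v))}"

text \<open>
  A family of 1-forms separates a locally convex space if at each point \<open>x\<close> it separates the tangent
  vectors; \<open>v\<close> is the velocity at 0 of the path \<open>t \<mapsto> x + t v\<close>.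
\<close>

definition line :: "'a::real_vector \<Rightarrow> 'a \<Rightarrow> vec \<Rightarrow> 'a" where
  "line x v = (\<lambda>t\<in>Rn 1. x + t 0 *\<^sub>R v)"

definition separated_by :: "('a::real_vector, real) form set \<Rightarrow> bool" where
  "separated_by S \<longleftrightarrow> (\<forall>x v w. v \<noteq> w \<longrightarrow>
     (\<exists>\<alpha>\<in>S. \<alpha> 1 (Rn 1) (line x v) (\<lambda>_. 0) e1 \<noteq> \<alpha> 1 (Rn 1) (line x w) (\<lambda>_. 0) e1))"


section \<open>Manifolds\<close>

text \<open>
  Smoothness of maps between open subsets of locally convex spaces (Michal--Bastiani):
  \<open>d k x v\<close> is the iterated derivative of \<open>f\<close> at \<open>x\<close> in the directions \<open>v 0, \<dots>, v (k - 1)\<close>, and all of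
  these must exist and be jointly continuous.
\<close>

definition bastiani_smooth_on ::
    "'a::locally_convex_space set \<Rightarrow> ('a \<Rightarrow> 'b::locally_convex_space) \<Rightarrow> bool" where
  "bastiani_smooth_on W f \<longleftrightarrow> (\<exists>d :: nat \<Rightarrow> 'a \<Rightarrow> (nat \<Rightarrow> 'a) \<Rightarrow> 'b.
     (\<forall>x\<in>W. \<forall>v. d 0 x v = f x) \<and>
     (\<forall>k. continuous_on (W \<times> UNIV) (\<lambda>(x, v). d k x v) \<and>
        (\<forall>x\<in>W. \<forall>v. ((\<lambda>h. (1 / h) *\<^sub>R (d k (x + h *\<^sub>R v k) v - d k x v)) \<longlongrightarrow> d (Suc k) x v) (at 0))))"

text \<open>
  A smooth manifold modelled on the locally convex space \<open>'b\<close> (of finite dimension for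
  \<open>'b = real ^ 'n\<close>): a Hausdorff space \<open>T\<close> with an atlas \<open>A\<close> of charts \<open>(W, \<phi>)\<close>.
\<close>

definition smooth_manifold ::
    "'m topology \<Rightarrow> ('m set \<times> ('m \<Rightarrow> 'b::locally_convex_space)) set \<Rightarrow> bool" where
  "smooth_manifold T A \<longleftrightarrow> Hausdorff_space T \<and> (\<Union>(fst ` A)) = topspace T \<and>
     (\<forall>(W, \<phi>)\<in>A. openin T W \<and> open (\<phi> ` W) \<and>
        homeomorphic_map (subtopology T W) (top_of_set (\<phi> ` W)) \<phi>) \<and>
     (\<forall>(W, \<phi>)\<in>A. \<forall>(W', \<phi>')\<in>A. bastiani_smooth_on (\<phi> ` (W \<inter> W')) (\<phi>' \<circ> inv_into W \<phi>))"

definition manifold_nebula ::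
    "'m topology \<Rightarrow> ('m set \<times> ('m \<Rightarrow> 'b::locally_convex_space)) set \<Rightarrow> 'm dspace" where
  "manifold_nebula T A = \<lparr>points = topspace T,
     plots = (\<lambda>n U. {p \<in> U \<rightarrow>\<^sub>E topspace T. openin (Euclidean_space n) U \<and>
        continuous_map (subtopology (Euclidean_space n) U) T p \<and>
        (\<forall>(W, \<phi>)\<in>A. smooth_on n {u \<in> U. p u \<in> W} (\<phi> \<circ> p))})\<rparr>"


section \<open>The algebra \<open>L(F)\<close>, the group \<open>GL(F)\<close> and \<open>gl(F)\<close>\<close>

definition L_space :: "('f::{real_vector, t2_space} \<Rightarrow> 'f) dvs" where
  "L_space = (let L = subdspace (Cinf nebula nebula) {l. linear l} in
     \<lparr>points = points L, plots = plots L,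
      vadd = (\<lambda>l k v. l v + k v), vscale = (\<lambda>a l v. a *\<^sub>R l v)\<rparr>)"

definition GL :: "('f::{real_vector, t2_space} \<Rightarrow> 'f) dspace" where
  "GL = (let G = {g \<in> points L_space. bij g \<and> inv g \<in> points L_space} in
     \<lparr>points = G,
      plots = (\<lambda>n U. {p \<in> U \<rightarrow>\<^sub>E G. p \<in> plots L_space n U \<and> (\<lambda>u\<in>U. inv (p u)) \<in> plots L_space n U})\<rparr>)"

definition GL_paths :: "(real \<Rightarrow> 'f::{real_vector, t2_space} \<Rightarrow> 'f) dspace" where
  "GL_paths = subdspace (Cinf nebula GL) {c. c 0 = id}"

definition velocity :: "(real \<Rightarrow> 'f \<Rightarrow> 'f::{real_vector, t2_space}) \<Rightarrow> 'f \<Rightarrow> 'f" where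
  "velocity c = (\<lambda>v. Lim (at 0) (\<lambda>h. (1 / h) *\<^sub>R (c h v - c 0 v)))"

text \<open>
  The internal tangent space of \<open>GL(F)\<close> at the identity, realized inside \<open>L(F)\<close>: tangent vectors are
  the velocities of smooth paths through the identity, and the diffeology is the quotient of the
  functional diffeology on these paths (so plots are locally $u \mapsto \partial_t c(u,t)|_{t=0}$).
  In general this is finer than the subset diffeology inherited from \<open>L(F)\<close>.
\<close>

definition gl :: "('f::{real_vector, t2_space} \<Rightarrow> 'f) dvs" where
  "gl = (let D = pushforward velocity GL_paths in
     \<lparr>points = points D, plots = plots D, vadd = vadd L_space, vscale = vscale L_space\<rparr>)"

definition lie_bracket_on :: "('v, 'y) dvs_scheme \<Rightarrow> ('v \<Rightarrow> 'v \<Rightarrow> 'v) \<Rightarrow> bool" where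
  "lie_bracket_on V br \<longleftrightarrow> (\<forall>X\<in>points V. \<forall>Y\<in>points V. \<forall>Z\<in>points V.
     br X Y \<in> points V \<and>
     (\<forall>a b. br (vadd V (vscale V a X) (vscale V b Y)) Z
               = vadd V (vscale V a (br X Z)) (vscale V b (br Y Z)) \<and>
            br Z (vadd V (vscale V a X) (vscale V b Y))
               = vadd V (vscale V a (br Z X)) (vscale V b (br Z Y))) \<and>
     br X X = vscale V 0 X \<and>
     vadd V (vadd V (br X (br Y Z)) (br Y (br Z X))) (br Z (br X Y)) = vscale V 0 X)"

text \<open>
  \<open>GL(F)\<close> is a diffeological Lie group: differentiating the adjoint action
  $\mathrm{Ad}_g Y = g Y g^{-1}$ at the identity defines a Lie bracket on \<open>gl(F)\<close>.
\<close>

definition GL_diffeological_Lie_group :: "'f::{real_vector, t2_space} itself \<Rightarrow> bool" where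
  "GL_diffeological_Lie_group _ \<longleftrightarrow> (\<exists>br. lie_bracket_on (gl :: ('f \<Rightarrow> 'f) dvs) br \<and>
     (\<forall>c\<in>points GL_paths. \<forall>Y\<in>points gl. br (velocity c) Y = velocity (\<lambda>t. c t \<circ> Y \<circ> inv (c t))))"


section \<open>Principal bundles\<close>

definition diffeological_group :: "('g, 'x) dspace_scheme \<Rightarrow> ('g \<Rightarrow> 'g \<Rightarrow> 'g) \<Rightarrow> 'g \<Rightarrow> bool" where
  "diffeological_group G mul one \<longleftrightarrow> diffeological_space G \<and>
     one \<in> points G \<and>
     (\<forall>g\<in>points G. mul one g = g \<and> mul g one = g) \<and>
     (\<forall>g\<in>points G. \<forall>h\<in>points G. \<forall>k\<in>points G. mul (mul g h) k = mul g (mul h k)) \<and>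
     smooth_map (dprod G G) G (\<lambda>(g, h). mul g h) \<and>
     (\<exists>i. smooth_map G G i \<and> (\<forall>g\<in>points G. mul g (i g) = one \<and> mul (i g) g = one))"

text \<open>
  A principal bundle \<open>pr : P \<rightarrow> B\<close> with right action \<open>act\<close> of the group \<open>G\<close>, locally trivial over
  open sets of the topology \<open>T\<close> of the base.
\<close>

definition principal_bundle ::
    "'m topology \<Rightarrow> 'm dspace \<Rightarrow> 'g dspace \<Rightarrow> ('g \<Rightarrow> 'g \<Rightarrow> 'g) \<Rightarrow> 'g \<Rightarrow>
     'p dspace \<Rightarrow> ('p \<Rightarrow> 'm) \<Rightarrow> ('p \<Rightarrow> 'g \<Rightarrow> 'p) \<Rightarrow> bool" where
  "principal_bundle T B G mul one P pr act \<longleftrightarrow>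
     diffeological_space P \<and> diffeological_group G mul one \<and> smooth_map P B pr \<and>
     smooth_map (dprod P G) P (\<lambda>(x, g). act x g) \<and>
     (\<forall>x\<in>points P. act x one = x \<and>
        (\<forall>g\<in>points G. pr (act x g) = pr x \<and> (\<forall>h\<in>points G. act (act x g) h = act x (mul g h)))) \<and>
     (\<forall>x\<in>points P. \<forall>y\<in>points P. pr x = pr y \<longrightarrow> (\<exists>!g. g \<in> points G \<and> act x g = y)) \<and>
     (\<forall>b\<in>points B. \<exists>W \<psi>. b \<in> W \<and> openin T W \<and>
        diffeo (subdspace P {x. pr x \<in> W}) (dprod (subdspace B W) G) (\<lambda>x. (pr x, \<psi> x)) \<and>
        (\<forall>x\<in>points P. \<forall>g\<in>points G. pr x \<in> W \<longrightarrow> \<psi> (act x g) = mul (\<psi> x) g))"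


section \<open>Vector bundles with typical fiber \<open>F\<close>\<close>

text \<open>
  \<open>fadd\<close> and \<open>fscale\<close> are the vector space operations of the fibers. A local trivialization over \<open>W\<close> is
  given by its second component \<open>\<tau>\<close>, i.e. it is the map \<open>e \<mapsto> (proj e, \<tau> e)\<close> from the part of the
  bundle over \<open>W\<close> to \<open>W \<times> F\<close>. Since \<open>\<tau>\<close> is bijective on fibers and commutes with the operations,
  the fibers are vector spaces isomorphic to \<open>F\<close>.
\<close>

record ('m, 'e, 'f) vbundle =
  total :: "'e dspace"
  proj :: "'e \<Rightarrow> 'm"
  fadd :: "'e \<Rightarrow> 'e \<Rightarrow> 'e"
  fscale :: "real \<Rightarrow> 'e \<Rightarrow> 'e"
  trivs :: "('m set \<times> ('e \<Rightarrow> 'f)) set"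

definition fiber :: "('m, 'e, 'f) vbundle \<Rightarrow> 'm \<Rightarrow> 'e set" where
  "fiber E x = {e \<in> points (total E). proj E e = x}"

definition vector_bundle ::
    "'m topology \<Rightarrow> ('m set \<times> ('m \<Rightarrow> 'b::locally_convex_space)) set \<Rightarrow>
     ('m, 'e, 'f::{real_vector, t2_space}) vbundle \<Rightarrow> bool" where
  "vector_bundle T A E \<longleftrightarrow>
     diffeological_space (total E) \<and>
     smooth_map (total E) (manifold_nebula T A) (proj E) \<and>
     (\<forall>x\<in>topspace T. \<forall>d\<in>fiber E x. \<forall>e\<in>fiber E x. \<forall>a.
        fadd E d e \<in> fiber E x \<and> fscale E a e \<in> fiber E x) \<and>
     (\<Union>(fst ` trivs E)) = topspace T \<and>
     (\<forall>(W, \<tau>)\<in>trivs E. W \<in> fst ` A \<and>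
        diffeo (subdspace (total E) {e. proj E e \<in> W})
               (dprod (subdspace (manifold_nebula T A) W) (nebula :: 'f dvs)) (\<lambda>e. (proj E e, \<tau> e)) \<and>
        (\<forall>x\<in>W. \<forall>d\<in>fiber E x. \<forall>e\<in>fiber E x. \<forall>a.
           \<tau> (fadd E d e) = \<tau> d + \<tau> e \<and> \<tau> (fscale E a e) = a *\<^sub>R \<tau> e))"

definition triv_inv :: "('m, 'e, 'f) vbundle \<Rightarrow> ('e \<Rightarrow> 'f) \<Rightarrow> 'm \<Rightarrow> 'f \<Rightarrow> 'e" where
  "triv_inv E \<tau> x = inv_into (fiber E x) \<tau>"

definition GL_structure_group ::
    "'m topology \<Rightarrow> ('m set \<times> ('m \<Rightarrow> 'b::locally_convex_space)) set \<Rightarrow>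
     ('m, 'e, 'f::{real_vector, t2_space}) vbundle \<Rightarrow> bool" where
  "GL_structure_group T A E \<longleftrightarrow> (\<forall>(W, \<tau>)\<in>trivs E. \<forall>(W', \<tau>')\<in>trivs E.
     smooth_map (subdspace (manifold_nebula T A) (W \<inter> W')) GL (\<lambda>x. \<tau> \<circ> triv_inv E \<tau>' x))"

text \<open>
  A point of the frame bundle over \<open>x\<close> is a pair \<open>(x, w)\<close> with \<open>w\<close> an isomorphism from \<open>F\<close> onto the
  fiber. Its diffeology is glued from the local models \<open>W \<times> GL(F)\<close> along
  \<open>(x, g) \<mapsto> (x, triv_inv E \<tau> x \<circ> g)\<close>.
\<close>

definition frames :: "('m, 'e, 'f::{real_vector, t2_space}) vbundle \<Rightarrow> 'm \<Rightarrow> ('f \<Rightarrow> 'e) set" where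
  "frames E x = {w. diffeo (nebula :: 'f dvs) (subdspace (total E) (fiber E x)) w \<and>
     (\<forall>u v a. w (u + v) = fadd E (w u) (w v) \<and> w (a *\<^sub>R v) = fscale E a (w v))}"

definition Fr ::
    "'m topology \<Rightarrow> ('m set \<times> ('m \<Rightarrow> 'b::locally_convex_space)) set \<Rightarrow>
     ('m, 'e, 'f::{real_vector, t2_space}) vbundle \<Rightarrow> ('m \<times> ('f \<Rightarrow> 'e)) dspace" where
  "Fr T A E = (let P = Sigma (topspace T) (frames E) in
     \<lparr>points = P,
      plots = (\<lambda>n U. {p \<in> U \<rightarrow>\<^sub>E P. openin (Euclidean_space n) U \<and>
        (\<forall>u\<in>U. \<exists>V. u \<in> V \<and> V \<subseteq> U \<and>
           (\<exists>(W, \<tau>)\<in>trivs E. \<exists>q\<in>plots (subdspace (manifold_nebula T A) W) n V. \<exists>g\<in>plots GL n V.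
              \<forall>v\<in>V. p v = (q v, triv_inv E \<tau> (q v) \<circ> g v)))})\<rparr>)"

definition Fr_act :: "'m \<times> ('f \<Rightarrow> 'e) \<Rightarrow> ('f \<Rightarrow> 'f) \<Rightarrow> 'm \<times> ('f \<Rightarrow> 'e)" where
  "Fr_act \<xi> g = (fst \<xi>, snd \<xi> \<circ> g)"


section \<open>Connection forms and covariant derivatives\<close>

text \<open>
  The last condition says that \<open>\<theta>\<close> reproduces the generators of the right action: it takes the value
  \<open>velocity c\<close> on the velocity at 0 of the path \<open>t \<mapsto> \<xi> c(t)\<close>.
\<close>

definition connection_forms ::
    "'m topology \<Rightarrow> ('m set \<times> ('m \<Rightarrow> 'b::locally_convex_space)) set \<Rightarrow>
     ('m, 'e, 'f::{real_vector, t2_space}) vbundle \<Rightarrow> ('m \<times> ('f \<Rightarrow> 'e), 'f \<Rightarrow> 'f) form set" where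
  "connection_forms T A E = {\<theta> \<in> one_forms (Fr T A E) gl.
     (\<forall>g\<in>points GL. \<forall>n U. \<forall>p\<in>plots (Fr T A E) n U. \<forall>u\<in>U. \<forall>X\<in>Rn n.
        \<theta> n U (\<lambda>u\<in>U. Fr_act (p u) g) u X = inv g \<circ> \<theta> n U p u X \<circ> g) \<and>
     (\<forall>\<xi>\<in>points (Fr T A E). \<forall>c\<in>points GL_paths.
        \<theta> 1 (Rn 1) (\<lambda>t\<in>Rn 1. Fr_act \<xi> (c (t 0))) (\<lambda>_. 0) e1 = velocity c)}"

text \<open>
  Smooth sections of \<open>p\<^sup>*E\<close> over the domain \<open>U\<close> of a plot \<open>p\<close>, identified with the smooth lifts of \<open>p\<close>
  to \<open>E\<close>, with the functional diffeology.
\<close>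

definition sections :: "('m, 'e, 'f) vbundle \<Rightarrow> nat \<Rightarrow> vec set \<Rightarrow> (vec \<Rightarrow> 'm) \<Rightarrow> (vec \<Rightarrow> 'e) dspace" where
  "sections E n U p =
     subdspace (Cinf (euclidean_domain n U) (total E)) {Y. \<forall>u\<in>U. proj E (Y u) = p u}"

text \<open>
  A collection \<open>(p\<^sup>*\<nabla>)\<close> over the plots of \<open>M\<close>: \<open>D n U p u X Y\<close> is the value at \<open>u\<close> of \<open>p\<^sup>*\<nabla>\<close> in the
  direction of the tangent vector \<open>X\<close> at \<open>u\<close>, applied to the section \<open>Y\<close>. It is made \<open>undefined\<close> off its
  domain so that equality of collections is equality of functions.
\<close>

type_synonym ('m, 'e) collection =
  "nat \<Rightarrow> vec set \<Rightarrow> (vec \<Rightarrow> 'm) \<Rightarrow> vec \<Rightarrow> vec \<Rightarrow> (vec \<Rightarrow> 'e) \<Rightarrow> 'e"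

definition collection_domain ::
    "'m dspace \<Rightarrow> ('m, 'e, 'f) vbundle \<Rightarrow> nat \<Rightarrow> vec set \<Rightarrow> (vec \<Rightarrow> 'm) \<Rightarrow> vec \<Rightarrow> vec \<Rightarrow> (vec \<Rightarrow> 'e) \<Rightarrow> bool" where
  "collection_domain M E n U p u X Y \<longleftrightarrow>
     p \<in> plots M n U \<and> u \<in> U \<and> X \<in> Rn n \<and> Y \<in> points (sections E n U p)"

definition collections :: "'m dspace \<Rightarrow> ('m, 'e, 'f) vbundle \<Rightarrow> ('m, 'e) collection set" where
  "collections M E = {D. \<forall>n U p u X Y.
     (collection_domain M E n U p u X Y \<longrightarrow> D n U p u X Y \<in> fiber E (p u)) \<and>
     (\<not> collection_domain M E n U p u X Y \<longrightarrow> D n U p u X Y = undefined)}"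

definition CD ::
    "'m topology \<Rightarrow> ('m set \<times> ('m \<Rightarrow> 'b::locally_convex_space)) set \<Rightarrow>
     ('m, 'e, 'f) vbundle \<Rightarrow> ('m, 'e) collection set" where
  "CD T A E = {D \<in> collections (manifold_nebula T A) E.
     \<forall>n U. \<forall>p\<in>plots (manifold_nebula T A) n U.
       smooth_map (dprod (dprod (euclidean_domain n U) (euclidean_domain n (Rn n))) (sections E n U p))
         (total E) (\<lambda>((u, X), Y). D n U p u X Y) \<and>
       (\<forall>u\<in>U. \<forall>X\<in>Rn n. \<forall>X'\<in>Rn n. \<forall>Y\<in>points (sections E n U p). \<forall>a b.
          D n U p u (\<lambda>i. a * X i + b * X' i) Y =
            fadd E (fscale E a (D n U p u X Y)) (fscale E b (D n U p u X' Y))) \<and>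
       (\<forall>u\<in>U. \<forall>X\<in>Rn n. \<forall>Y\<in>points (sections E n U p). \<forall>Z\<in>points (sections E n U p). \<forall>a b.
          D n U p u X (\<lambda>v\<in>U. fadd E (fscale E a (Y v)) (fscale E b (Z v))) =
            fadd E (fscale E a (D n U p u X Y)) (fscale E b (D n U p u X Z))) \<and>
       (\<forall>f\<in>Cc_infinity n U. \<forall>u\<in>U. \<forall>X\<in>Rn n. \<forall>Y\<in>points (sections E n U p).
          D n U p u (\<lambda>i. f u * X i) Y = fscale E (f u) (D n U p u X Y) \<and>
          D n U p u X (\<lambda>v\<in>U. fscale E (f v) (Y v)) =
            fadd E (fscale E (dir_deriv n f u X) (Y u)) (fscale E (f u) (D n U p u X Y))) \<and>
       (\<forall>m V. \<forall>g\<in>plots (euclidean_domain n U) m V. \<forall>v\<in>V. \<forall>X\<in>Rn m. \<forall>Y\<in>points (sections E n U p).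
          D m V (compose V p g) v X (compose V Y g) = D n U p (g v) (tangent_map m n g v X) Y)}"

text \<open>
  The collection induced by a connection form: in a trivialization \<open>\<tau>\<close> over \<open>W\<close> it is
  \<open>D\<^sub>X Y + \<theta>\<^sub>W(X) Y\<close>, where \<open>\<theta>\<^sub>W\<close> is the pull-back of \<open>\<theta>\<close> by the local frame section
  \<open>x \<mapsto> (x, triv_inv E \<tau> x)\<close>, evaluated on the restriction of \<open>p\<close> to the preimage of \<open>W\<close>.
\<close>

definition local_connection_form ::
    "('m, 'e, 'f) vbundle \<Rightarrow> ('m \<times> ('f \<Rightarrow> 'e), 'f \<Rightarrow> 'f) form \<Rightarrow> ('e \<Rightarrow> 'f) \<Rightarrow> ('m, 'f \<Rightarrow> 'f) form" where
  "local_connection_form E \<theta> \<tau> n V q = \<theta> n V (\<lambda>v\<in>V. (q v, triv_inv E \<tau> (q v)))"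

definition induced_by ::
    "'m topology \<Rightarrow> ('m set \<times> ('m \<Rightarrow> 'b::locally_convex_space)) set \<Rightarrow>
     ('m, 'e, 'f::{real_vector, t2_space}) vbundle \<Rightarrow> ('m \<times> ('f \<Rightarrow> 'e), 'f \<Rightarrow> 'f) form \<Rightarrow>
     ('m, 'e) collection \<Rightarrow> bool" where
  "induced_by T A E \<theta> D \<longleftrightarrow> D \<in> collections (manifold_nebula T A) E \<and>
     (\<forall>(W, \<tau>)\<in>trivs E. \<forall>n U p u X Y.
        collection_domain (manifold_nebula T A) E n U p u X Y \<longrightarrow> p u \<in> W \<longrightarrow>
        (let V = {v \<in> U. p v \<in> W} in
           \<tau> (D n U p u X Y) =
             dir_deriv n (\<tau> \<circ> Y) u X + local_connection_form E \<theta> \<tau> n V (restrict p V) u X (\<tau> (Y u))))"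

definition CD_GL ::
    "'m topology \<Rightarrow> ('m set \<times> ('m \<Rightarrow> 'b::locally_convex_space)) set \<Rightarrow>
     ('m, 'e, 'f::{real_vector, t2_space}) vbundle \<Rightarrow> ('m, 'e) collection set" where
  "CD_GL T A E = {D. \<exists>\<theta>\<in>connection_forms T A E. induced_by T A E \<theta> D}"

end

theory Submission
  imports Defs
begin

text \<open>
  Everything is reduced to calculus along plots. Linear maps are only smooth in the diffeological
  sense, so they need not be continuous; Hadamard's lemma (the difference quotient of a smooth curve
  is a smooth curve) shows that they still commute with derivatives, which yields the product rule
  for smooth families of linear maps and hence the change of the local connection forms under a
  change of trivialization.

  Conversely, the form of a covariant derivative \<open>D\<close> sends a tangent vector \<open>X\<close> of a plot \<open>w\<close> of
  frames to \<open>v \<mapsto> w\<^sup>-\<^sup>1 (D\<^sub>X (w v))\<close>. That it induces \<open>D\<close> again means that \<open>D\<close> is the ordinary derivative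
  on sections vanishing at a point: along a curve such a section is \<open>t Z\<close> with \<open>Z\<close> smooth, again by
  Hadamard's lemma, and the Leibniz rule applies. The hypothesis \<open>gl(F) = L(F)\<close> is only used to see
  that this form takes its values smoothly in \<open>gl(F)\<close>.
\<close>

section \<open>Calculus in locally convex spaces\<close>

text \<open>Hadamard's lemma usually comes from integrating the derivative. Here its source is a
  mean value theorem for convex open sets: slopes over an interval stay in a convex open set that
  contains all derivatives. The same theorem gives the chain rule, and the derivatives of the
  Hadamard quotient are written down by an explicit recursion. Global definitions shape the second
  half. Paths in \<open>GL\<close> and the test for vertical vectors live on all of R while plots
  live on arbitrary open sets, so a tangent vector X at u is represented by u + d sin(r/d) X, which
  never leaves the domain. A 1-form is known only through its values on plots, hence the doubled
  domain in the change of frame. Inverses of frames go from a fiber to F and are not elements of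
  \<open>GL\<close>, so their smoothness is read off in trivializations. That the form of
  \<open>D\<close> reproduces velocities of paths in \<open>GL\<close> needs \<open>D\<close> to
  vanish on constant sections over constant curves; this holds because such a curve factors through
  R^0, whose only tangent vector is 0.\<close>

lemma lcs_tendsto_scaleR:
  fixes g :: "'c \<Rightarrow> 'a::locally_convex_space"
  assumes "(f \<longlongrightarrow> r) F" "(g \<longlongrightarrow> a) F"
  shows "((\<lambda>x. f x *\<^sub>R g x) \<longlongrightarrow> r *\<^sub>R a) F"
  using filterlim_compose[OF tendsto_scaleR_nhds filterlim_Pair[OF assms]] by simp

lemma lcs_continuous_on_scaleR:
  fixes g :: "'c::topological_space \<Rightarrow> 'a::locally_convex_space"
  shows "continuous_on S f \<Longrightarrow> continuous_on S g \<Longrightarrow> continuous_on S (\<lambda>x. f x *\<^sub>R g x)"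
  by (simp add: continuous_on_def lcs_tendsto_scaleR)

text \<open>Local convexity makes the convex open neighbourhoods of 0 a base at 0, and translation
  by \<open>l\<close> is continuous. Limits are tested in this form because
  \<open>mean_value_convex\<close> delivers values in a convex open set.\<close>

lemma lcs_tendsto_iff:
  fixes f :: "'c \<Rightarrow> 'a::locally_convex_space"
  shows "(f \<longlongrightarrow> l) F \<longleftrightarrow>
    (\<forall>V. open V \<longrightarrow> 0 \<in> V \<longrightarrow> convex V \<longrightarrow> eventually (\<lambda>x. f x - l \<in> V) F)" (is "_ \<longleftrightarrow> ?R")
proof
  assume "(f \<longlongrightarrow> l) F"
  then have "((\<lambda>x. f x - l) \<longlongrightarrow> l - l) F" by (intro tendsto_diff tendsto_const)
  then show ?R by (auto dest: topological_tendstoD)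
next
  assume R: ?R
  show "(f \<longlongrightarrow> l) F"
  proof (rule topological_tendstoI)
    fix S assume S: "open S" "l \<in> S"
    have "continuous_on UNIV (\<lambda>x. x + l)" by (intro continuous_intros)
    with S(1) have "open ((\<lambda>x. x + l) -` S)" by (metis open_vimage)
    moreover have "0 \<in> (\<lambda>x. x + l) -` S" using S by simp
    ultimately obtain V where V: "open V" "0 \<in> V" "V \<subseteq> (\<lambda>x. x + l) -` S" "convex V"
      using locally_convex_zero[of "(\<lambda>x. x + l) -` S"] unfolding convex_def by blast
    then have "eventually (\<lambda>x. f x - l \<in> V) F" using R by blast
    then show "eventually (\<lambda>x. f x \<in> S) F"
      by eventually_elim (use V(3) in auto)
  qed
qed

section \<open>Derivatives of curves and the mean value theorem\<close>

definition has_dv :: "(real \<Rightarrow> 'a::{real_vector, t2_space}) \<Rightarrow> 'a \<Rightarrow> real \<Rightarrow> bool" where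
  "has_dv \<gamma> v t \<longleftrightarrow> ((\<lambda>h. (1 / h) *\<^sub>R (\<gamma> (t + h) - \<gamma> t)) \<longlongrightarrow> v) (at 0)"

lemma has_dv_real_iff: "has_dv f d t \<longleftrightarrow> DERIV f t :> d"
  by (simp add: has_dv_def DERIV_def divide_inverse_commute)

lemma has_dv_transform:
  assumes "has_dv \<gamma> v t" "eventually (\<lambda>s. \<gamma> s = \<delta> s) (nhds t)"
  shows "has_dv \<delta> v t"
proof -
  have "filterlim (\<lambda>h. t + h) (nhds t) (at 0)"
    by (rule tendsto_eq_intros | simp)+
  from eventually_compose_filterlim[OF assms(2) this]
  have "eventually (\<lambda>h. \<gamma> (t + h) = \<delta> (t + h)) (at 0)" .
  then have "eventually (\<lambda>h. (1 / h) *\<^sub>R (\<gamma> (t + h) - \<gamma> t) = (1 / h) *\<^sub>R (\<delta> (t + h) - \<delta> t)) (at 0)"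
    using eventually_nhds_x_imp_x[OF assms(2)] by (auto elim: eventually_mono)
  from tendsto_cong[OF this] assms(1) show ?thesis unfolding has_dv_def by blast
qed

lemma has_dv_const: "has_dv (\<lambda>_. c) 0 t"
  by (simp add: has_dv_def)

lemma has_dv_add:
  fixes f :: "real \<Rightarrow> 'a::locally_convex_space"
  assumes "has_dv f v t" "has_dv g w t"
  shows "has_dv (\<lambda>s. f s + g s) (v + w) t"
  using tendsto_add[OF assms[unfolded has_dv_def]] unfolding has_dv_def
  by (simp add: scaleR_right_diff_distrib scaleR_right_distrib algebra_simps)

lemma has_dv_tendsto:
  fixes f :: "real \<Rightarrow> 'a::locally_convex_space"
  assumes "has_dv f v t"
  shows "((\<lambda>h. f (t + h)) \<longlongrightarrow> f t) (at 0)"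
proof -
  have "((\<lambda>h. h *\<^sub>R ((1 / h) *\<^sub>R (f (t + h) - f t)) + f t) \<longlongrightarrow> 0 *\<^sub>R v + f t) (at 0)"
    using assms unfolding has_dv_def by (intro tendsto_add lcs_tendsto_scaleR tendsto_const) (auto intro: tendsto_ident_at)
  then have "((\<lambda>h. h *\<^sub>R ((1 / h) *\<^sub>R (f (t + h) - f t)) + f t) \<longlongrightarrow> f t) (at 0)" by simp
  then show ?thesis
    by (rule tendsto_cong[THEN iffD1, rotated]) (auto simp: eventually_at_filter)
qed

lemma has_dv_isCont:
  fixes f :: "real \<Rightarrow> 'a::locally_convex_space"
  assumes "has_dv f v t"
  shows "isCont f t"
  using has_dv_tendsto[OF assms] by (simp add: isCont_iff)

lemma has_dv_scaleR:
  fixes f :: "real \<Rightarrow> 'a::locally_convex_space"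
  assumes "has_dv r r' t" "has_dv f v t"
  shows "has_dv (\<lambda>s. r s *\<^sub>R f s) (r' *\<^sub>R f t + r t *\<^sub>R v) t"
proof -
  \<comment> \<open>The increment of the product is split with \<open>f\<close> taken at the moved
    point in the first term; \<open>has_dv_tendsto\<close> gives its limit.\<close>
  have "((\<lambda>h. ((1 / h) *\<^sub>R (r (t + h) - r t)) *\<^sub>R f (t + h) + r t *\<^sub>R ((1 / h) *\<^sub>R (f (t + h) - f t)))
      \<longlongrightarrow> r' *\<^sub>R f t + r t *\<^sub>R v) (at 0)"
    using assms has_dv_tendsto[OF assms(2)] unfolding has_dv_def
    by (intro tendsto_add lcs_tendsto_scaleR tendsto_const)
  then show ?thesis unfolding has_dv_def
    by (rule tendsto_cong[THEN iffD1, rotated, OF _ always_eventually])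
       (simp add: algebra_simps scaleR_right_diff_distrib scaleR_left_diff_distrib)
qed

lemma has_dv_cmult:
  fixes f :: "real \<Rightarrow> 'a::locally_convex_space"
  shows "has_dv f v t \<Longrightarrow> has_dv (\<lambda>s. c *\<^sub>R f s) (c *\<^sub>R v) t"
  using has_dv_scaleR[OF has_dv_const, of f v t c] by simp

lemma has_dv_diff:
  fixes f :: "real \<Rightarrow> 'a::locally_convex_space"
  assumes "has_dv f v t" "has_dv g w t"
  shows "has_dv (\<lambda>s. f s - g s) (v - w) t"
  using has_dv_add[OF assms(1) has_dv_cmult[OF assms(2), of "-1"]] by simp

lemma has_dv_affine:
  fixes f :: "real \<Rightarrow> 'a::locally_convex_space"
  assumes "has_dv f v (a + t * b)"
  shows "has_dv (\<lambda>s. f (a + s * b)) (b *\<^sub>R v) t"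
\<comment> \<open>For b = 0 the substitution h -> h b would not stay away from 0, as a limit at 0
  demands.\<close>
proof (cases "b = 0")
  case True then show ?thesis by (simp add: has_dv_const)
next
  case False
  have "filterlim (\<lambda>h. h * b) (at 0) (at 0)"
    unfolding filterlim_at using False
    by (auto simp: eventually_at_filter intro!: tendsto_eq_intros)
  from filterlim_compose[OF assms[unfolded has_dv_def] this]
  have "((\<lambda>h. b *\<^sub>R ((1 / (h * b)) *\<^sub>R (f (a + t * b + h * b) - f (a + t * b)))) \<longlongrightarrow> b *\<^sub>R v) (at 0)"
    by (intro lcs_tendsto_scaleR tendsto_const)
  then show ?thesis unfolding has_dv_def using False by (simp add: algebra_simps)
qed

text \<open>The slope over a union of adjacent intervals is a convex combination of the slopes over
  the pieces, and slopes over short intervals around a point are close to the derivative there,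
  which lies in the open set \<open>V\<close>. Bisection (\<open>Bolzano\<close>) passes from short
  intervals to the whole one. This replaces the mean value inequality where no norm is at
  hand.\<close>

lemma mean_value_convex:
  fixes \<gamma> :: "real \<Rightarrow> 'a::locally_convex_space"
  assumes "a \<le> b" "open V" "convex V"
    and d: "\<And>t. a \<le> t \<Longrightarrow> t \<le> b \<Longrightarrow> \<exists>v\<in>V. has_dv \<gamma> v t"
  shows "\<exists>v\<in>V. \<gamma> b - \<gamma> a = (b - a) *\<^sub>R v"
  using \<open>a \<le> b\<close>
proof (induction rule: Bolzano[where P="\<lambda>a b. \<exists>v\<in>V. \<gamma> b - \<gamma> a = (b - a) *\<^sub>R v"])
  case (trans x y z)
  then obtain v w where vw: "v \<in> V" "w \<in> V" "\<gamma> y - \<gamma> x = (y - x) *\<^sub>R v" "\<gamma> z - \<gamma> y = (z - y) *\<^sub>R w"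
    by blast
  show ?case
  proof (cases "x = z")
    case True then show ?thesis using vw(1) by auto
  next
    case False
    then have pos: "z - x > 0" using trans by simp
    \<comment> \<open>The weights are the relative lengths of the two pieces.\<close>
    let ?u = "((y - x) / (z - x)) *\<^sub>R v + ((z - y) / (z - x)) *\<^sub>R w"
    have "?u \<in> V"
      using assms(3) vw(1,2) trans pos
      by (intro convexD) (auto simp: add_divide_distrib[symmetric])
    moreover have "(z - x) *\<^sub>R ?u = (\<gamma> z - \<gamma> y) + (\<gamma> y - \<gamma> x)"
      using pos by (simp add: vw scaleR_right_distrib)
    then have "\<gamma> z - \<gamma> x = (z - x) *\<^sub>R ?u" by (simp only:) simp
    ultimately show ?thesis by blast
  qed
next
  case (local x)
  then obtain v where v: "v \<in> V" "has_dv \<gamma> v x" using d by blast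
  then have "eventually (\<lambda>h. (1 / h) *\<^sub>R (\<gamma> (x + h) - \<gamma> x) \<in> V) (at 0)"
    unfolding has_dv_def using assms(2) by (auto dest: topological_tendstoD)
  then obtain e where e: "e > 0" "\<And>h. h \<noteq> 0 \<Longrightarrow> \<bar>h\<bar> < e \<Longrightarrow> (1 / h) *\<^sub>R (\<gamma> (x + h) - \<gamma> x) \<in> V"
    unfolding eventually_at by (auto simp: dist_real_def)
  show ?case
  proof (intro exI[of _ e] conjI allI impI e(1), elim conjE)
    fix a b assume ab: "a \<le> x" "x \<le> b" "b - a < e"
    have 1: "\<exists>w\<in>V. \<gamma> b - \<gamma> x = (b - x) *\<^sub>R w"
    proof (cases "b = x")
      case False then show ?thesis using e(2)[of "b - x"] ab
        by (intro bexI[of _ "(1 / (b - x)) *\<^sub>R (\<gamma> b - \<gamma> x)"]) auto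
    qed (use v in auto)
    have 2: "\<exists>w\<in>V. \<gamma> x - \<gamma> a = (x - a) *\<^sub>R w"
    proof (cases "a = x")
      case False
      \<comment> \<open>The difference quotient is taken with the negative step a - x; the two signs
        cancel, so it is also the slope over [a, x].\<close>
      then have "(x - a) *\<^sub>R ((1 / (a - x)) *\<^sub>R (\<gamma> a - \<gamma> x)) = (- 1) *\<^sub>R (\<gamma> a - \<gamma> x)"
        proof -
          have "(x - a) * (1 / (a - x)) = - 1" using False by (simp add: field_simps)
          then show ?thesis by (simp only: scaleR_scaleR)
        qed
      then show ?thesis using e(2)[of "a - x"] ab False
        by (intro bexI[of _ "(1 / (a - x)) *\<^sub>R (\<gamma> a - \<gamma> x)"]) auto
    qed (use v in auto)
    obtain w1 w2 where w: "w1 \<in> V" "w2 \<in> V" "\<gamma> b - \<gamma> x = (b - x) *\<^sub>R w1" "\<gamma> x - \<gamma> a = (x - a) *\<^sub>R w2"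
      using 1 2 by blast
    show "\<exists>v\<in>V. \<gamma> b - \<gamma> a = (b - a) *\<^sub>R v"
    proof (cases "a = b")
      case True then show ?thesis using v(1) by auto
    next
      case False
      then have pos: "b - a > 0" using ab by simp
      let ?u = "((b - x) / (b - a)) *\<^sub>R w1 + ((x - a) / (b - a)) *\<^sub>R w2"
      have "?u \<in> V"
        using assms(3) w(1,2) ab pos
        by (intro convexD) (auto simp: add_divide_distrib[symmetric])
      moreover have "(b - a) *\<^sub>R ?u = (\<gamma> b - \<gamma> x) + (\<gamma> x - \<gamma> a)"
        using pos by (simp add: w scaleR_right_distrib)
      then have "\<gamma> b - \<gamma> a = (b - a) *\<^sub>R ?u" by (simp only:) simp
      ultimately show ?thesis by blast
    qed
  qed
qed

section \<open>Smooth maps on Euclidean domains\<close>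

lemma Euclidean_space_eq: "Euclidean_space n = top_of_set (Rn n)"
  unfolding topspace_Euclidean_space
  by (simp add: Euclidean_space_def euclidean_product_topology)

lemma Rn_iff: "x \<in> Rn n \<longleftrightarrow> (\<forall>i\<ge>n. x i = 0)"
  by (simp add: topspace_Euclidean_space)

lemma Rn_update: "x \<in> Rn n \<Longrightarrow> i < n \<Longrightarrow> x(i := r) \<in> Rn n"
  by (auto simp: Rn_iff)

lemma open_Rn_subset: "openin (Euclidean_space n) U \<Longrightarrow> U \<subseteq> Rn n"
  by (rule openin_subset)

text \<open>An open set of the ambient product topology contains a product of open sets around
  \<open>x\<close>. Only coordinates below \<open>n\<close> need a bound, since all points of
  \<open>Rn n\<close> are 0 from index \<open>n\<close> on.\<close>

lemma open_Rn_box: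
  assumes "openin (Euclidean_space n) U" "x \<in> U"
  shows "\<exists>e>0. \<forall>y\<in>Rn n. (\<forall>j<n. \<bar>y j - x j\<bar> < e) \<longrightarrow> y \<in> U"
proof -
  obtain S where S: "openin (powertop_real UNIV) S" "U = S \<inter> {x. \<forall>i\<ge>n. x i = 0}"
    using assms(1) unfolding Euclidean_space_def openin_subtopology by blast
  have xS: "x \<in> S" "\<forall>i\<ge>n. x i = 0" using assms(2) S(2) by auto
  from product_topology_open_contains_basis[OF S(1) xS(1)]
  obtain X where X: "x \<in> Pi\<^sub>E UNIV X" "\<And>i. open (X i)" "Pi\<^sub>E UNIV X \<subseteq> S" by auto
  have "\<forall>j. \<exists>e>0. \<forall>r. \<bar>r - x j\<bar> < e \<longrightarrow> r \<in> X j"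
  proof
    fix j
    have "x j \<in> X j" using X(1) by auto
    then show "\<exists>e>0. \<forall>r. \<bar>r - x j\<bar> < e \<longrightarrow> r \<in> X j"
      using X(2)[of j] unfolding open_dist dist_real_def by blast
  qed
  then obtain e where e: "\<And>j. e j > 0" "\<And>j r. \<bar>r - x j\<bar> < e j \<Longrightarrow> r \<in> X j" by metis
  \<comment> \<open>The element 1 keeps the minimum meaningful for n = 0.\<close>
  define d where "d = Min (insert 1 (e ` {..<n}))"
  have "d > 0" unfolding d_def using e(1) by (subst Min_gr_iff) auto
  moreover have "y \<in> U" if "y \<in> Rn n" "\<forall>j<n. \<bar>y j - x j\<bar> < d" for y
  proof -
    have "y j \<in> X j" for j
    proof (cases "j < n")
      case True
      then have "d \<le> e j" unfolding d_def by (intro Min_le) auto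
      then show ?thesis using that(2) True e(2) by force
    next
      case False
      then have "y j = x j" using that(1) xS(2) by (auto simp: Rn_iff)
      then show ?thesis using X(1) by auto
    qed
    then show ?thesis using X(3) that(1) unfolding S(2) by (auto simp: Rn_iff)
  qed
  ultimately show ?thesis by blast
qed

lemma openin_top_of_Rn_iff: "openin (top_of_set (Rn n)) U \<longleftrightarrow> openin (Euclidean_space n) U"
  by (subst Euclidean_space_eq[symmetric]) (rule refl)

lemma eventually_in_open_Rn:
  assumes U: "openin (Euclidean_space n) U" "x \<in> U"
    and z: "eventually (\<lambda>a. z a \<in> Rn n) F" "\<And>j. j < n \<Longrightarrow> ((\<lambda>a. z a j) \<longlongrightarrow> x j) F"
  shows "eventually (\<lambda>a. z a \<in> U) F"
proof -
  obtain e where e: "e > 0" "\<forall>y\<in>Rn n. (\<forall>j<n. \<bar>y j - x j\<bar> < e) \<longrightarrow> y \<in> U"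
    using open_Rn_box[OF U] by blast
  have "eventually (\<lambda>a. \<forall>j\<in>{..<n}. \<bar>z a j - x j\<bar> < e) F"
    using z(2) e(1) by (intro eventually_ball_finite) (auto simp: tendsto_iff dist_real_def)
  with z(1) show ?thesis by eventually_elim (use e(2) in auto)
qed

lemma eventually_update_in:
  assumes "openin (Euclidean_space n) U" "x \<in> U" "i < n"
  shows "eventually (\<lambda>h. x(i := x i + h) \<in> U) (nhds 0)"
proof (rule eventually_in_open_Rn[OF assms(1,2)])
  have "x \<in> Rn n" using assms open_Rn_subset by blast
  then show "eventually (\<lambda>h. x(i := x i + h) \<in> Rn n) (nhds 0)"
    using Rn_update assms(3) by (intro always_eventually) blast
  show "((\<lambda>h. (x(i := x i + h)) j) \<longlongrightarrow> x j) (nhds 0)" for j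
    by (cases "j = i") (auto intro!: tendsto_eq_intros filterlim_ident)
qed

lemma open_Rn_Int:
  "openin (Euclidean_space n) U \<Longrightarrow> openin (Euclidean_space n) V \<Longrightarrow> openin (Euclidean_space n) (U \<inter> V)"
  by (rule openin_Int)

lemma continuous_on_open_preimage_Rn:
  fixes f :: "vec \<Rightarrow> 'a::topological_space"
  assumes "openin (Euclidean_space n) U" "continuous_on U f" "open S"
  shows "openin (Euclidean_space n) {x \<in> U. f x \<in> S}"
proof -
  have "openin (top_of_set U) (U \<inter> f -` S)"
    using continuous_openin_preimage_gen[OF assms(2,3)] .
  then have "openin (Euclidean_space n) (U \<inter> f -` S)"
    using openin_trans[OF _ assms(1)[folded openin_top_of_Rn_iff]] unfolding openin_top_of_Rn_iff by blast
  then show ?thesis by (simp add: vimage_def Int_def)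
qed

lemma continuous_on_tendsto_Rn:
  fixes f :: "vec \<Rightarrow> 'a::topological_space"
  assumes "openin (Euclidean_space n) U" "x \<in> U" "continuous_on U f"
    and "eventually (\<lambda>a. z a \<in> Rn n) F" "\<And>j. j < n \<Longrightarrow> ((\<lambda>a. z a j) \<longlongrightarrow> x j) F"
  shows "((\<lambda>a. f (z a)) \<longlongrightarrow> f x) F"
proof (rule topological_tendstoI)
  fix S assume "open S" "f x \<in> S"
  then have "openin (Euclidean_space n) {x \<in> U. f x \<in> S}" "x \<in> {x \<in> U. f x \<in> S}"
    using continuous_on_open_preimage_Rn assms by auto
  from eventually_in_open_Rn[OF this assms(4,5)]
  show "eventually (\<lambda>a. f (z a) \<in> S) F" by (auto elim: eventually_mono)
qed

lemma continuous_on_coords: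
  assumes "\<And>j. j < n \<Longrightarrow> continuous_on U (\<lambda>x. g x j)" "g ` U \<subseteq> Rn n"
  shows "continuous_on U (g :: 'a::topological_space \<Rightarrow> vec)"
proof (rule continuous_on_coordinatewise_then_product)
  fix j show "continuous_on U (\<lambda>x. g x j)"
  proof (cases "j < n")
    case False
    then have "\<And>x. x \<in> U \<Longrightarrow> g x j = 0" using assms(2) by (auto simp: Rn_iff image_subset_iff)
    then show ?thesis by (simp cong: continuous_on_cong)
  qed (use assms in auto)
qed

lemma continuous_on_coord: "continuous_on U (\<lambda>x::vec. x i)"
  using continuous_on_product_then_coordinatewise[OF continuous_on_id] .

subsection \<open>Partial derivatives\<close>

text \<open>Convergence is part of the relation, whereas \<open>partial_deriv\<close> is a
  \<open>Lim\<close> and says nothing when the limit fails to exist.\<close>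

definition has_pd :: "nat \<Rightarrow> (vec \<Rightarrow> 'a::{real_vector, t2_space}) \<Rightarrow> 'a \<Rightarrow> vec \<Rightarrow> bool" where
  "has_pd i f l x \<longleftrightarrow> (diff_quot i f x \<longlongrightarrow> l) (at 0)"

lemma has_pd_iff: "has_pd i f l x \<longleftrightarrow> has_dv (\<lambda>s. f (x(i := s))) l (x i)"
  by (simp add: has_pd_def has_dv_def diff_quot_def[abs_def])

lemma partial_deriv_eq: "has_pd i f l x \<Longrightarrow> partial_deriv i f x = l"
  unfolding has_pd_def partial_deriv_def by (rule tendsto_Lim[OF trivial_limit_at])

lemma has_pd_transform:
  assumes "openin (Euclidean_space n) U" "\<And>x. x \<in> U \<Longrightarrow> f x = g x" "x \<in> U" "i < n" "has_pd i f l x"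
  shows "has_pd i g l x"
proof -
  have "eventually (\<lambda>h. x(i := x i + h) \<in> U) (at 0)"
    using eventually_update_in[OF assms(1,3,4)] eventually_nhds_conv_at by blast
  then have "eventually (\<lambda>h. diff_quot i f x h = diff_quot i g x h) (at 0)"
    by eventually_elim (simp add: diff_quot_def assms)
  from tendsto_cong[OF this] assms(5) show ?thesis unfolding has_pd_def by blast
qed

text \<open>Both sides are defined from the same set of limits, so the equation holds whether or not
  a limit exists.\<close>

lemma partial_deriv_cong:
  assumes "openin (Euclidean_space n) U" "\<And>x. x \<in> U \<Longrightarrow> f x = g x" "x \<in> U" "i < n"
  shows "partial_deriv i f x = partial_deriv i g x"
proof -
  have "has_pd i f l x \<longleftrightarrow> has_pd i g l x" for l
    using has_pd_transform[OF assms(1) _ assms(3,4)] assms(2) by metis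
  then show ?thesis unfolding partial_deriv_def t2_space_class.Lim_def has_pd_def by simp
qed

lemma Ck_on_Suc:
  "Ck_on (Suc k) n U f \<longleftrightarrow> continuous_on U f \<and>
     (\<forall>i<n. (\<forall>x\<in>U. has_pd i f (partial_deriv i f x) x) \<and> Ck_on k n U (partial_deriv i f))"
proof -
  have "(\<exists>l. (diff_quot i f x \<longlongrightarrow> l) (at 0)) \<longleftrightarrow> has_pd i f (partial_deriv i f x) x" for i x
    using partial_deriv_eq[of i f _ x] unfolding has_pd_def by metis
  then show ?thesis by simp
qed

declare Ck_on.simps(2)[simp del]

lemma Ck_on_continuous: "Ck_on k n U f \<Longrightarrow> continuous_on U f"
  by (cases k) (auto simp: Ck_on_Suc)

lemma Ck_on_cong:
  assumes "openin (Euclidean_space n) U" "\<And>x. x \<in> U \<Longrightarrow> f x = g x"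
  shows "Ck_on k n U f \<longleftrightarrow> Ck_on k n U g"
proof -
  have "Ck_on k n U f \<Longrightarrow> Ck_on k n U g" if "\<And>x. x \<in> U \<Longrightarrow> f x = g x" for f g :: "vec \<Rightarrow> 'a"
    using that
  proof (induction k arbitrary: f g)
    case 0 then show ?case by (simp cong: continuous_on_cong)
  next
    case (Suc k)
    have c: "continuous_on U g" using Suc.prems by (auto simp: Ck_on_Suc cong: continuous_on_cong)
    have "Ck_on k n U (partial_deriv i g)" if "i < n" for i
    proof (rule Suc.IH)
      show "Ck_on k n U (partial_deriv i f)" using Suc.prems(1) that unfolding Ck_on_Suc by blast
      show "partial_deriv i f x = partial_deriv i g x" if "x \<in> U" for x
        using partial_deriv_cong[OF assms(1) Suc.prems(2) that \<open>i < n\<close>] .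
    qed
    moreover have "has_pd i g (partial_deriv i g x) x" if "i < n" "x \<in> U" for i x
    proof -
      have "has_pd i f (partial_deriv i f x) x" using Suc.prems(1) that unfolding Ck_on_Suc by blast
      from has_pd_transform[OF assms(1) Suc.prems(2) that(2,1) this]
      show ?thesis using partial_deriv_cong[OF assms(1) Suc.prems(2) that(2,1)] by simp
    qed
    ultimately show ?case using c unfolding Ck_on_Suc by blast
  qed
  from this[of f g] this[of g f] show ?thesis using assms(2) by auto
qed

lemma Ck_on_SucI:
  assumes "openin (Euclidean_space n) U" "continuous_on U f"
    and "\<And>i x. i < n \<Longrightarrow> x \<in> U \<Longrightarrow> has_pd i f (f' i x) x" "\<And>i. i < n \<Longrightarrow> Ck_on k n U (f' i)"
  shows "Ck_on (Suc k) n U f"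
  unfolding Ck_on_Suc
proof (intro conjI allI impI ballI assms(2))
  fix i x assume "i < n" "x \<in> U"
  then show "has_pd i f (partial_deriv i f x) x"
    using assms(3)[of i x] partial_deriv_eq[OF assms(3)[of i x]] by simp
next
  fix i assume "i < n"
  then show "Ck_on k n U (partial_deriv i f)"
    using assms(3)[THEN partial_deriv_eq] assms(4) Ck_on_cong[OF assms(1), of "partial_deriv i f" "f' i" k] by metis
qed

lemma Ck_on_mono: "Ck_on (Suc k) n U f \<Longrightarrow> Ck_on k n U f"
proof (induction k arbitrary: f)
  case 0 then show ?case by (simp add: Ck_on_continuous)
next
  case (Suc k)
  have "Ck_on k n U (partial_deriv i f)" if "i < n" for i
    using Suc.prems Suc.IH that unfolding Ck_on_Suc[of "Suc k"] by blast
  then show ?case using Suc.prems unfolding Ck_on_Suc[of "Suc k"] Ck_on_Suc[of k n U f] by blast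
qed

lemma Ck_on_subset:
  assumes "V \<subseteq> U"
  shows "Ck_on k n U f \<Longrightarrow> Ck_on k n V f"
proof (induction k arbitrary: f)
  case 0 then show ?case using assms by (auto intro: continuous_on_subset)
next
  case (Suc k)
  then show ?case using assms unfolding Ck_on_Suc by (meson continuous_on_subset subsetD)
qed

text \<open>Partial derivatives are defined pointwise, without reference to the domain, so only
  continuity has to be localized; the induction then runs over the order.\<close>

lemma Ck_on_local:
  assumes "openin (Euclidean_space n) U"
    and "\<And>x. x \<in> U \<Longrightarrow> \<exists>V. openin (Euclidean_space n) V \<and> x \<in> V \<and> Ck_on k n V f"
  shows "Ck_on k n U f"
  using assms(2)
proof (induction k arbitrary: f)
  case 0
  have "(f \<longlongrightarrow> f x) (at x within U)" if x: "x \<in> U" for x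
  proof -
    obtain V where V: "openin (Euclidean_space n) V" "x \<in> V" "continuous_on V f"
      using 0[OF x] by auto
    have lim: "((\<lambda>a::vec. a j) \<longlongrightarrow> x j) (at x within U)" for j
      using continuous_on_coord[of U j] x unfolding continuous_on_def by blast
    show ?thesis
      by (rule continuous_on_tendsto_Rn[OF V _ lim])
         (use open_Rn_subset[OF assms(1)] in \<open>auto simp: eventually_at_topological\<close>)
  qed
  then show ?case by (simp add: continuous_on_def)
next
  case (Suc k)
  have 1: "\<exists>V. openin (Euclidean_space n) V \<and> x \<in> V \<and> Ck_on k n V f" if "x \<in> U" for x
    using Suc.prems[OF that] Ck_on_mono by blast
  show ?case unfolding Ck_on_Suc
  proof (intro conjI allI impI ballI)
    show "continuous_on U f" using Suc.IH[OF 1] Ck_on_continuous by blast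
  next
    fix i x assume "i < n" "x \<in> U" then show "has_pd i f (partial_deriv i f x) x"
      using Suc.prems[of x] by (auto simp: Ck_on_Suc)
  next
    fix i assume i: "i < n"
    show "Ck_on k n U (partial_deriv i f)"
    proof (rule Suc.IH)
      fix x assume "x \<in> U"
      then obtain V where "openin (Euclidean_space n) V" "x \<in> V" "Ck_on (Suc k) n V f"
        using Suc.prems by blast
      then show "\<exists>V. openin (Euclidean_space n) V \<and> x \<in> V \<and> Ck_on k n V (partial_deriv i f)"
        using i unfolding Ck_on_Suc by blast
    qed
  qed
qed

subsection \<open>The chain rule\<close>

text \<open>The base point \<open>z a\<close> and the step \<open>s a\<close> vary together, as
  required for moving along several coordinates in turn. The mean value theorem on the segment from
  \<open>z a\<close> in direction \<open>i\<close> bounds the error, because \<open>f'\<close> stays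
  close to \<open>f' x\<close> on a box. The case distinction covers steps of length 0, which occur
  when a curve does not move in direction \<open>i\<close>.\<close>

lemma diff_quot_joint_tendsto:
  fixes f :: "vec \<Rightarrow> 'a::locally_convex_space"
  assumes U: "openin (Euclidean_space n) U" "x \<in> U" and i: "i < n"
    and f: "\<And>y. y \<in> U \<Longrightarrow> has_pd i f (f' y) y" "continuous_on U f'"
    and z: "eventually (\<lambda>a. z a \<in> Rn n) F" "\<And>j. j < n \<Longrightarrow> ((\<lambda>a. z a j) \<longlongrightarrow> x j) F"
    and s: "(s \<longlongrightarrow> 0) F"
  shows "((\<lambda>a. if s a = 0 then f' (z a) else diff_quot i f (z a) (s a)) \<longlongrightarrow> f' x) F"
  unfolding lcs_tendsto_iff
proof (intro allI impI)
  fix V :: "'a set" assume V: "open V" "0 \<in> V" "convex V"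
  have "continuous_on UNIV (\<lambda>y. y - f' x)" by (intro continuous_intros)
  with V(1) have "open ((\<lambda>y. y - f' x) -` V)" by (metis open_vimage)
  from continuous_on_open_preimage_Rn[OF U(1) f(2) this]
  have "openin (Euclidean_space n) {y \<in> U. f' y - f' x \<in> V}" by simp
  from open_Rn_box[OF this, of x] obtain e where e: "e > 0"
      "\<forall>y\<in>Rn n. (\<forall>j<n. \<bar>y j - x j\<bar> < e) \<longrightarrow> y \<in> {y \<in> U. f' y - f' x \<in> V}"
    using U V by auto
  \<comment> \<open>Half of \<open>e\<close> is kept for the displacement of \<open>z a\<close> and
    half for the step \<open>s a\<close>, so that the whole segment stays in the box.\<close>
  have "eventually (\<lambda>a. \<bar>z a j - x j\<bar> < e/2) F" if "j < n" for j
    using tendstoD[OF z(2)[OF that], of "e/2"] e(1) by (simp add: dist_real_def)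
  then have "eventually (\<lambda>a. \<forall>j\<in>{..<n}. \<bar>z a j - x j\<bar> < e/2) F"
    by (intro eventually_ball_finite) auto
  moreover have "eventually (\<lambda>a. \<bar>s a\<bar> < e/2) F"
    using tendstoD[OF s, of "e/2"] e(1) by (simp add: dist_real_def)
  ultimately show "eventually (\<lambda>a. (if s a = 0 then f' (z a) else diff_quot i f (z a) (s a)) - f' x \<in> V) F"
    using z(1)
  proof eventually_elim
    case (elim a)
    show ?case
    proof (cases "s a = 0")
      case True
      then show ?thesis using e elim by force
    next
      case False
      define p where "p r = (z a)(i := z a i + r * s a)" for r
      have pB: "p r \<in> U \<and> f' (p r) - f' x \<in> V" if "0 \<le> r" "r \<le> 1" for r
      proof -
        have "\<bar>r * s a\<bar> \<le> \<bar>s a\<bar>" using that by (simp add: abs_mult mult_left_le_one_le)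
        then have rs: "\<bar>r * s a\<bar> < e / 2" using elim by linarith
        have "\<bar>p r j - x j\<bar> < e" if "j < n" for j
        proof -
          have "\<bar>z a j - x j\<bar> < e / 2" using elim that by simp
          moreover have "p r j = z a j \<or> p r j = z a j + r * s a" unfolding p_def by simp
          ultimately show ?thesis using rs e(1) by linarith
        qed
        moreover have "p r \<in> Rn n" unfolding p_def using Rn_update elim i by blast
        ultimately show ?thesis using e(2) by blast
      qed
      \<comment> \<open>Subtracting \<open>r *\<^sub>R f' x\<close> turns the increment over [0, 1]
        into the error of the difference quotient and the derivative into
        \<open>f' (p r) - f' x\<close>.\<close>
      define \<gamma> where "\<gamma> r = (1 / s a) *\<^sub>R f (p r) - r *\<^sub>R f' x" for r
      have d: "has_dv \<gamma> (f' (p r) - f' x) r" if r: "0 \<le> r" "r \<le> 1" for r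
      proof -
        have "has_dv (\<lambda>s. f ((p r)(i := s))) (f' (p r)) (z a i + r * s a)"
          using f(1)[of "p r"] pB[OF r] unfolding has_pd_iff p_def by simp
        then have "has_dv (\<lambda>s. f ((z a)(i := s))) (f' (p r)) (z a i + r * s a)"
          by (simp add: p_def)
        from has_dv_affine[OF this]
        have "has_dv (\<lambda>r. f (p r)) (s a *\<^sub>R f' (p r)) r" by (simp add: p_def)
        from has_dv_cmult[OF this, of "1 / s a"]
        have 1: "has_dv (\<lambda>r. (1 / s a) *\<^sub>R f (p r)) (f' (p r)) r" using False by simp
        have "has_dv (\<lambda>r. r) 1 r" by (simp add: has_dv_real_iff)
        from has_dv_scaleR[OF this has_dv_const[of "f' x"]]
        have "has_dv (\<lambda>r. r *\<^sub>R f' x) (f' x) r" by simp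
        from has_dv_diff[OF 1 this] show ?thesis unfolding \<gamma>_def .
      qed
      have "\<exists>v\<in>V. \<gamma> 1 - \<gamma> 0 = (1 - 0) *\<^sub>R v"
        by (rule mean_value_convex) (use V d pB in auto)
      moreover have "\<gamma> 1 - \<gamma> 0 = diff_quot i f (z a) (s a) - f' x"
        by (simp add: \<gamma>_def p_def diff_quot_def scaleR_right_diff_distrib)
      ultimately show ?thesis using False by auto
    qed
  qed
qed

text \<open>The passage from \<open>c t\<close> to \<open>c (t + h)\<close> changes one coordinate
  at a time: \<open>z j h\<close> has its first \<open>j\<close> coordinates already moved. Each
  change is a difference quotient in direction \<open>j\<close> at a moving base point, handled by
  \<open>diff_quot_joint_tendsto\<close>, and the changes telescope. No total derivative of
  \<open>f\<close> is involved.\<close>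

lemma chain_curve:
  fixes f :: "vec \<Rightarrow> 'a::locally_convex_space"
  assumes U: "openin (Euclidean_space m) U" "c t \<in> U"
    and f: "\<And>j y. j < m \<Longrightarrow> y \<in> U \<Longrightarrow> has_pd j f (f' j y) y" "\<And>j. j < m \<Longrightarrow> continuous_on U (f' j)"
    and c: "eventually (\<lambda>s. c s \<in> Rn m) (nhds t)" "\<And>j. j < m \<Longrightarrow> has_dv (\<lambda>s. c s j) (c' j) t"
  shows "has_dv (\<lambda>s. f (c s)) (\<Sum>j<m. c' j *\<^sub>R f' j (c t)) t"
proof -
  have lim: "((\<lambda>h. c (t + h) j) \<longlongrightarrow> c t j) (at 0)" if "j < m" for j
    using has_dv_tendsto[OF c(2)[OF that]] .
  have "filterlim (\<lambda>h. t + h) (nhds t) (at 0)"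
    by (rule tendsto_eq_intros | simp)+
  from eventually_compose_filterlim[OF c(1) this]
  have ev: "eventually (\<lambda>h. c (t + h) \<in> Rn m) (at 0)" .
  have ct: "c t \<in> Rn m" using U open_Rn_subset by blast
  define z where "z j h = (\<lambda>i. if i < j then c (t + h) i else c t i)" for j h
  define s where "s j h = c (t + h) j - c t j" for j h
  define q where "q j h = (if s j h = 0 then f' j (z j h) else diff_quot j f (z j h) (s j h))" for j h
  have ql: "(q j \<longlongrightarrow> f' j (c t)) (at 0)" if j: "j < m" for j
    unfolding q_def[abs_def]
  proof (rule diff_quot_joint_tendsto[OF U j f(1)[OF j] f(2)[OF j]])
    show "eventually (\<lambda>h. z j h \<in> Rn m) (at 0)"
      using ev by eventually_elim (use ct in \<open>auto simp: z_def Rn_iff\<close>)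
    show "((\<lambda>h. z j h i) \<longlongrightarrow> c t i) (at 0)" if "i < m" for i
      using lim[OF that] by (cases "i < j") (simp_all add: z_def)
    have "((\<lambda>h. c (t + h) j - c t j) \<longlongrightarrow> c t j - c t j) (at 0)"
      by (intro tendsto_diff lim[OF j] tendsto_const)
    then show "(s j \<longlongrightarrow> 0) (at 0)" by (simp add: s_def[abs_def])
  qed
  have "((\<lambda>h. \<Sum>j<m. ((1 / h) *\<^sub>R s j h) *\<^sub>R q j h) \<longlongrightarrow> (\<Sum>j<m. c' j *\<^sub>R f' j (c t))) (at 0)"
    using c(2) unfolding has_dv_def s_def
    by (intro tendsto_sum lcs_tendsto_scaleR ql) auto
  moreover have "eventually (\<lambda>h. (\<Sum>j<m. ((1 / h) *\<^sub>R s j h) *\<^sub>R q j h) = (1 / h) *\<^sub>R (f (c (t + h)) - f (c t))) (at 0)"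
    using ev
  proof eventually_elim
    case (elim h)
    have "s j h *\<^sub>R q j h = f (z (Suc j) h) - f (z j h)" for j
    proof (cases "s j h = 0")
      case True
      then have "z (Suc j) h = z j h" by (auto simp: z_def s_def fun_eq_iff less_Suc_eq)
      with True show ?thesis by simp
    next
      case False
      have "(z j h)(j := z j h j + s j h) = z (Suc j) h"
        by (auto simp: z_def s_def fun_eq_iff less_Suc_eq)
      with False show ?thesis by (simp add: q_def diff_quot_def)
    qed
    then have "(\<Sum>j<m. s j h *\<^sub>R q j h) = f (z m h) - f (z 0 h)"
      by (simp add: sum_lessThan_telescope[of "\<lambda>j. f (z j h)"])
    moreover have "z m h = c (t + h)" "z 0 h = c t"
      using elim ct by (auto simp: z_def fun_eq_iff Rn_iff)
    moreover have "(\<Sum>j<m. ((1 / h) *\<^sub>R s j h) *\<^sub>R q j h) = (1 / h) *\<^sub>R (\<Sum>j<m. s j h *\<^sub>R q j h)"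
      by (simp add: scaleR_sum_right)
    ultimately show ?case by simp
  qed
  ultimately show ?thesis unfolding has_dv_def by (rule Lim_transform_eventually)
qed

lemma has_pd_const: "has_pd i (\<lambda>_. c) 0 x"
  by (simp add: has_pd_iff has_dv_const)

lemma has_pd_coord: "has_pd i (\<lambda>x. x j) (if i = j then 1 else 0) x"
  by (auto simp: has_pd_iff has_dv_real_iff)

lemma has_pd_add:
  fixes f :: "vec \<Rightarrow> 'a::locally_convex_space"
  shows "has_pd i f v x \<Longrightarrow> has_pd i g w x \<Longrightarrow> has_pd i (\<lambda>x. f x + g x) (v + w) x"
  unfolding has_pd_iff by (rule has_dv_add)

lemma has_pd_scaleR:
  fixes f :: "vec \<Rightarrow> 'a::locally_convex_space"
  shows "has_pd i r s x \<Longrightarrow> has_pd i f v x \<Longrightarrow> has_pd i (\<lambda>x. r x *\<^sub>R f x) (s *\<^sub>R f x + r x *\<^sub>R v) x"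
  unfolding has_pd_iff by (drule (1) has_dv_scaleR) simp

lemma has_pd_compose:
  fixes f :: "vec \<Rightarrow> 'a::locally_convex_space"
  assumes U: "openin (Euclidean_space n) U" "x \<in> U" "i < n"
    and V: "openin (Euclidean_space m) V" "g ` U \<subseteq> V"
    and f: "\<And>j y. j < m \<Longrightarrow> y \<in> V \<Longrightarrow> has_pd j f (f' j y) y" "\<And>j. j < m \<Longrightarrow> continuous_on V (f' j)"
    and g: "\<And>j. j < m \<Longrightarrow> has_pd i (\<lambda>x. g x j) (g' j) x"
  shows "has_pd i (\<lambda>x. f (g x)) (\<Sum>j<m. g' j *\<^sub>R f' j (g x)) x"
proof -
  have xR: "x \<in> Rn n" using U open_Rn_subset by blast
  have "eventually (\<lambda>s. x(i := s) \<in> U) (nhds (x i))"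
  proof (rule eventually_in_open_Rn[OF U(1,2)])
    show "eventually (\<lambda>s. x(i := s) \<in> Rn n) (nhds (x i))"
      using Rn_update xR U(3) by (intro always_eventually) blast
    show "((\<lambda>s. (x(i := s)) j) \<longlongrightarrow> x j) (nhds (x i))" for j
      by (cases "j = i") (auto intro: filterlim_ident)
  qed
  then have "eventually (\<lambda>s. g (x(i := s)) \<in> Rn m) (nhds (x i))"
    by eventually_elim (use V open_Rn_subset in blast)
  moreover have "g (x(i := x i)) \<in> V" using U V by auto
  ultimately have "has_dv (\<lambda>s. f (g (x(i := s)))) (\<Sum>j<m. g' j *\<^sub>R f' j (g (x(i := x i)))) (x i)"
    using g unfolding has_pd_iff by (intro chain_curve[OF V(1) _ f]) auto
  then show ?thesis by (simp add: has_pd_iff)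
qed

section \<open>Closure of smooth maps under sums, products and composition\<close>

lemma Ck_on_const:
  assumes "openin (Euclidean_space n) U" shows "Ck_on k n U (\<lambda>_. c)"
proof (induction k arbitrary: c)
  case (Suc k)
  show ?case
    by (rule Ck_on_SucI[where f'="\<lambda>_ _. 0"]) (use assms Suc in \<open>auto intro: has_pd_const\<close>)
qed simp

lemma Ck_on_coord:
  assumes "openin (Euclidean_space n) U" shows "Ck_on k n U (\<lambda>x. x i)"
proof (cases k)
  case (Suc k)
  show ?thesis unfolding Suc
    by (rule Ck_on_SucI[where f'="\<lambda>j _. if j = i then 1 else 0", OF assms continuous_on_coord has_pd_coord])
       (rule Ck_on_const[OF assms])
qed (simp add: continuous_on_coord)

lemma Ck_on_add:
  fixes f :: "vec \<Rightarrow> 'a::locally_convex_space"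
  assumes U: "openin (Euclidean_space n) U"
  shows "Ck_on k n U f \<Longrightarrow> Ck_on k n U g \<Longrightarrow> Ck_on k n U (\<lambda>x. f x + g x)"
proof (induction k arbitrary: f g)
  case 0 then show ?case by (simp add: continuous_on_add)
next
  case (Suc k)
  show ?case
  proof (rule Ck_on_SucI[where f'="\<lambda>i x. partial_deriv i f x + partial_deriv i g x", OF U])
    show "continuous_on U (\<lambda>x. f x + g x)"
      using Suc.prems by (intro continuous_on_add Ck_on_continuous)
    show "has_pd i (\<lambda>x. f x + g x) (partial_deriv i f x + partial_deriv i g x) x" if "i < n" "x \<in> U" for i x
      using Suc.prems that unfolding Ck_on_Suc by (intro has_pd_add) auto
    show "Ck_on k n U (\<lambda>x. partial_deriv i f x + partial_deriv i g x)" if "i < n" for i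
      using Suc.prems that unfolding Ck_on_Suc by (intro Suc.IH) auto
  qed
qed

lemma Ck_on_scaleR:
  fixes f :: "vec \<Rightarrow> 'a::locally_convex_space"
  assumes U: "openin (Euclidean_space n) U"
  shows "Ck_on k n U r \<Longrightarrow> Ck_on k n U f \<Longrightarrow> Ck_on k n U (\<lambda>x. r x *\<^sub>R f x)"
proof (induction k arbitrary: r f)
  case 0 then show ?case by (simp add: lcs_continuous_on_scaleR)
next
  case (Suc k)
  have r: "Ck_on k n U r" "Ck_on k n U f" using Suc.prems Ck_on_mono by blast+
  show ?case
  proof (rule Ck_on_SucI[where f'="\<lambda>i x. partial_deriv i r x *\<^sub>R f x + r x *\<^sub>R partial_deriv i f x", OF U])
    show "continuous_on U (\<lambda>x. r x *\<^sub>R f x)"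
      using Suc.prems by (intro lcs_continuous_on_scaleR Ck_on_continuous)
    show "has_pd i (\<lambda>x. r x *\<^sub>R f x) (partial_deriv i r x *\<^sub>R f x + r x *\<^sub>R partial_deriv i f x) x"
      if "i < n" "x \<in> U" for i x
      using Suc.prems that unfolding Ck_on_Suc by (intro has_pd_scaleR) auto
    show "Ck_on k n U (\<lambda>x. partial_deriv i r x *\<^sub>R f x + r x *\<^sub>R partial_deriv i f x)" if "i < n" for i
      using Suc.prems that r unfolding Ck_on_Suc by (intro Ck_on_add[OF U] Suc.IH) auto
  qed
qed

lemma Ck_on_sum:
  fixes f :: "'i \<Rightarrow> vec \<Rightarrow> 'a::locally_convex_space"
  assumes U: "openin (Euclidean_space n) U" and "\<And>i. i \<in> I \<Longrightarrow> Ck_on k n U (f i)"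
  shows "Ck_on k n U (\<lambda>x. \<Sum>i\<in>I. f i x)"
  using assms(2)
proof (induction I rule: infinite_finite_induct)
  case (insert i I)
  have "Ck_on k n U (\<lambda>x. f i x + (\<Sum>i\<in>I. f i x))"
    by (rule Ck_on_add[OF U]) (use insert in auto)
  with insert(1,2) show ?case by simp
qed (simp_all add: Ck_on_const U)

lemma Ck_on_compose:
  fixes f :: "vec \<Rightarrow> 'a::locally_convex_space"
  assumes U: "openin (Euclidean_space n) U" and V: "openin (Euclidean_space m) V" "g ` U \<subseteq> V"
  shows "Ck_on k m V f \<Longrightarrow> (\<And>j. j < m \<Longrightarrow> Ck_on k n U (\<lambda>x. g x j)) \<Longrightarrow> Ck_on k n U (\<lambda>x. f (g x))"
proof (induction k arbitrary: f)
  case 0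
  have "g ` U \<subseteq> Rn m" using V open_Rn_subset by blast
  then have "continuous_on U g" using 0 by (intro continuous_on_coords[of m]) auto
  then show ?case using 0 continuous_on_compose2[of V f U g] V(2) by simp
next
  case (Suc k)
  have g: "Ck_on k n U (\<lambda>x. g x j)" if "j < m" for j using Suc.prems(2)[OF that] by (rule Ck_on_mono)
  show ?case
  proof (rule Ck_on_SucI[where f'="\<lambda>i x. \<Sum>j<m. partial_deriv i (\<lambda>x. g x j) x *\<^sub>R partial_deriv j f (g x)", OF U])
    show "continuous_on U (\<lambda>x. f (g x))"
      using Suc.IH[OF Ck_on_mono[OF Suc.prems(1)] g] Ck_on_continuous by blast
    show "has_pd i (\<lambda>x. f (g x)) (\<Sum>j<m. partial_deriv i (\<lambda>x. g x j) x *\<^sub>R partial_deriv j f (g x)) x"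
      if ix: "i < n" "x \<in> U" for i x
    proof (rule has_pd_compose[OF U ix(2,1) V])
      show "has_pd j f (partial_deriv j f y) y" if "j < m" "y \<in> V" for j y
        using Suc.prems(1) that unfolding Ck_on_Suc by blast
      show "continuous_on V (partial_deriv j f)" if "j < m" for j
        using Suc.prems(1) that unfolding Ck_on_Suc by (blast intro: Ck_on_continuous)
      show "has_pd i (\<lambda>x. g x j) (partial_deriv i (\<lambda>x. g x j) x) x" if "j < m" for j
        using Suc.prems(2)[OF that] ix unfolding Ck_on_Suc by blast
    qed
    show "Ck_on k n U (\<lambda>x. \<Sum>j<m. partial_deriv i (\<lambda>x. g x j) x *\<^sub>R partial_deriv j f (g x))"
      if "i < n" for i
    proof (intro Ck_on_sum[OF U] Ck_on_scaleR[OF U])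
      fix j assume j: "j \<in> {..<m}"
      then show "Ck_on k n U (partial_deriv i (\<lambda>x. g x j))"
        using Suc.prems(2)[of j] that unfolding Ck_on_Suc by auto
      show "Ck_on k n U (\<lambda>x. partial_deriv j f (g x))"
      proof (rule Suc.IH)
        show "Ck_on k m V (partial_deriv j f)" using Suc.prems(1) j unfolding Ck_on_Suc by blast
      qed (rule g)
    qed
  qed
qed

lemma smooth_on_continuous: "smooth_on n U f \<Longrightarrow> continuous_on U f"
  unfolding smooth_on_def using Ck_on_continuous by blast

lemma smooth_on_has_pd: "smooth_on n U f \<Longrightarrow> i < n \<Longrightarrow> x \<in> U \<Longrightarrow> has_pd i f (partial_deriv i f x) x"
  unfolding smooth_on_def using Ck_on_Suc by blast

lemma smooth_on_partial_deriv: "smooth_on n U f \<Longrightarrow> i < n \<Longrightarrow> smooth_on n U (partial_deriv i f)"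
  unfolding smooth_on_def using Ck_on_Suc by blast

lemma smooth_on_cong:
  "openin (Euclidean_space n) U \<Longrightarrow> (\<And>x. x \<in> U \<Longrightarrow> f x = g x) \<Longrightarrow> smooth_on n U f \<longleftrightarrow> smooth_on n U g"
  unfolding smooth_on_def using Ck_on_cong by blast

lemma smooth_on_subset: "smooth_on n U f \<Longrightarrow> V \<subseteq> U \<Longrightarrow> smooth_on n V f"
  unfolding smooth_on_def using Ck_on_subset by blast

lemma smooth_on_local:
  assumes "openin (Euclidean_space n) U"
    and "\<And>x. x \<in> U \<Longrightarrow> \<exists>V. openin (Euclidean_space n) V \<and> x \<in> V \<and> smooth_on n V f"
  shows "smooth_on n U f"
  unfolding smooth_on_def
proof
  show "Ck_on k n U f" for k
    by (rule Ck_on_local[OF assms(1)]) (use assms(2) in \<open>unfold smooth_on_def, blast\<close>)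
qed

lemma smooth_on_const: "openin (Euclidean_space n) U \<Longrightarrow> smooth_on n U (\<lambda>_. c)"
  by (simp add: smooth_on_def Ck_on_const)

lemma smooth_on_coord: "openin (Euclidean_space n) U \<Longrightarrow> smooth_on n U (\<lambda>x. x i)"
  by (simp add: smooth_on_def Ck_on_coord)

lemma smooth_on_add:
  fixes f :: "vec \<Rightarrow> 'a::locally_convex_space"
  shows "openin (Euclidean_space n) U \<Longrightarrow> smooth_on n U f \<Longrightarrow> smooth_on n U g \<Longrightarrow> smooth_on n U (\<lambda>x. f x + g x)"
  by (simp add: smooth_on_def Ck_on_add)

lemma smooth_on_scaleR:
  fixes f :: "vec \<Rightarrow> 'a::locally_convex_space"
  shows "openin (Euclidean_space n) U \<Longrightarrow> smooth_on n U r \<Longrightarrow> smooth_on n U f \<Longrightarrow> smooth_on n U (\<lambda>x. r x *\<^sub>R f x)"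
  by (simp add: smooth_on_def Ck_on_scaleR)

lemma smooth_on_sum:
  fixes f :: "'i \<Rightarrow> vec \<Rightarrow> 'a::locally_convex_space"
  shows "openin (Euclidean_space n) U \<Longrightarrow> (\<And>i. i \<in> I \<Longrightarrow> smooth_on n U (f i)) \<Longrightarrow> smooth_on n U (\<lambda>x. \<Sum>i\<in>I. f i x)"
  by (simp add: smooth_on_def Ck_on_sum)

lemma smooth_on_compose:
  fixes f :: "vec \<Rightarrow> 'a::locally_convex_space"
  assumes "openin (Euclidean_space n) U" "openin (Euclidean_space m) V" "g ` U \<subseteq> V"
    and "smooth_on m V f" "\<And>j. j < m \<Longrightarrow> smooth_on n U (\<lambda>x. g x j)"
  shows "smooth_on n U (\<lambda>x. f (g x))"
  using assms(4,5) unfolding smooth_on_def by (blast intro: Ck_on_compose[OF assms(1-3)])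

text \<open>Induction on the order: the partial derivatives are again members of
  \<open>\<Phi>\<close>, hence continuous. It serves functions whose derivatives of all orders are
  given by formulas.\<close>

lemma smooth_on_family:
  assumes U: "openin (Euclidean_space n) U"
    and "\<And>f. f \<in> \<Phi> \<Longrightarrow> continuous_on U f"
    and "\<And>f i. f \<in> \<Phi> \<Longrightarrow> i < n \<Longrightarrow> \<exists>g\<in>\<Phi>. \<forall>x\<in>U. has_pd i f (g x) x"
    and "f \<in> \<Phi>"
  shows "smooth_on n U f"
proof -
  have "f \<in> \<Phi> \<Longrightarrow> Ck_on k n U f" for k f
  proof (induction k arbitrary: f)
    case (Suc k)
    have "\<forall>i. \<exists>g. i < n \<longrightarrow> g \<in> \<Phi> \<and> (\<forall>x\<in>U. has_pd i f (g x) x)"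
      using assms(3)[OF Suc.prems] by blast
    then obtain g where "\<And>i. i < n \<Longrightarrow> g i \<in> \<Phi> \<and> (\<forall>x\<in>U. has_pd i f (g i x) x)"
      by metis
    then show ?case using Suc assms(2) by (intro Ck_on_SucI[OF U, where f'=g]) auto
  qed (use assms(2) in simp)
  with assms(4) show ?thesis by (simp add: smooth_on_def)
qed

text \<open>\<open>y k\<close> stands for the k-th derivative of \<open>y 0\<close>. Hadamard
  quotients, sine curves and \<open>flat\<close> functions are all presented by such
  sequences.\<close>

lemma smooth_on_curve:
  fixes y :: "nat \<Rightarrow> real \<Rightarrow> 'a::locally_convex_space"
  assumes U: "openin (Euclidean_space 1) U"
    and y: "\<And>k w. w \<in> U \<Longrightarrow> has_dv (y k) (y (Suc k) (w 0)) (w 0)"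
  shows "smooth_on 1 U (\<lambda>w. y k (w 0))"
proof (rule smooth_on_family[OF U, where \<Phi>="range (\<lambda>k w. y k (w 0))"])
  show "continuous_on U f" if f: "f \<in> range (\<lambda>k w. y k (w 0))" for f
  proof -
    obtain k where k: "f = (\<lambda>w. y k (w 0))" using f by blast
    have "continuous_on ((\<lambda>w. w 0) ` U) (y k)"
      using has_dv_isCont[OF y] by (intro continuous_at_imp_continuous_on) auto
    from continuous_on_compose2[OF this continuous_on_coord] show ?thesis by (simp add: k)
  qed
  show "\<exists>g\<in>range (\<lambda>k w. y k (w 0)). \<forall>x\<in>U. has_pd i f (g x) x"
    if f: "f \<in> range (\<lambda>k w. y k (w 0))" and i: "i < 1" for f i
  proof -
    obtain k where k: "f = (\<lambda>w. y k (w 0))" using f by blast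
    have "\<forall>x\<in>U. has_pd i f (y (Suc k) (x 0)) x"
      using y[of _ k] i by (auto simp: k has_pd_iff)
    then show ?thesis by (intro bexI[of _ "\<lambda>w. y (Suc k) (w 0)"]) auto
  qed
qed auto

text \<open>One \<open>e\<close> serves all orders \<open>k\<close>, because it only keeps the
  coordinate line through \<open>x\<close> inside \<open>U\<close>.\<close>

lemma curve_derivatives:
  fixes f :: "vec \<Rightarrow> 'a::locally_convex_space"
  assumes "openin (Euclidean_space n) U" "smooth_on n U f" "x \<in> U" "i < n"
  shows "\<exists>e>0. \<forall>k t. \<bar>t\<bar> < e \<longrightarrow> has_dv (\<lambda>t. ((partial_deriv i ^^ k) f) (x(i := x i + t)))
    (((partial_deriv i ^^ Suc k) f) (x(i := x i + t))) t"
proof -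
  have "eventually (\<lambda>h. x(i := x i + h) \<in> U) (nhds 0)"
    by (rule eventually_update_in[OF assms(1,3,4)])
  then obtain e where e: "e > 0" "\<And>h. \<bar>h\<bar> < e \<Longrightarrow> x(i := x i + h) \<in> U"
    unfolding eventually_nhds_metric by (auto simp: dist_real_def)
  have sm: "smooth_on n U ((partial_deriv i ^^ k) f)" for k
    by (induction k) (use assms smooth_on_partial_deriv in auto)
  have "has_dv (\<lambda>t. ((partial_deriv i ^^ k) f) (x(i := x i + t)))
    (((partial_deriv i ^^ Suc k) f) (x(i := x i + t))) t" if t: "\<bar>t\<bar> < e" for t k
  proof -
    from smooth_on_has_pd[OF sm assms(4) e(2)[OF t], of k]
    have "has_dv (\<lambda>s. ((partial_deriv i ^^ k) f) (x(i := s)))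
      (((partial_deriv i ^^ Suc k) f) (x(i := x i + t))) (x i + t * 1)"
      by (simp add: has_pd_iff)
    from has_dv_affine[OF this] show ?thesis by simp
  qed
  with e(1) show ?thesis by blast
qed

subsection \<open>Hadamard's lemma for curves\<close>

text \<open>Let q(h) = (y(h) - y(0)) / h. Differentiating h q = y - y(0) k times gives h q_k + k
  q_(k-1) = y_k, with indices for derivatives. After multiplication by h^k this is the recursion for
  h^(k+1) q_k, an expression without division.\<close>

primrec hadamard_aux :: "(nat \<Rightarrow> real \<Rightarrow> 'a::real_vector) \<Rightarrow> nat \<Rightarrow> real \<Rightarrow> 'a" where
  "hadamard_aux y 0 h = y 0 h - y 0 0"
| "hadamard_aux y (Suc k) h = h ^ Suc k *\<^sub>R y (Suc k) h - real (Suc k) *\<^sub>R hadamard_aux y k h"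

text \<open>The \<open>k\<close>-th derivative of the difference quotient \<open>h \<mapsto> (y 0 h - y 0 0) / h\<close>.\<close>

definition hadamard_quot :: "(nat \<Rightarrow> real \<Rightarrow> 'a::real_vector) \<Rightarrow> nat \<Rightarrow> real \<Rightarrow> 'a" where
  "hadamard_quot y k h =
    (if h = 0 then (1 / real (Suc k)) *\<^sub>R y (Suc k) 0 else (1 / h ^ Suc k) *\<^sub>R hadamard_aux y k h)"

lemma hadamard_aux_0: "hadamard_aux y k 0 = 0"
  by (induction k) auto

text \<open>In the successor case, differentiating the power yields exactly the term that the
  induction hypothesis subtracts.\<close>

lemma has_dv_hadamard_aux:
  fixes y :: "nat \<Rightarrow> real \<Rightarrow> 'a::locally_convex_space"
  assumes "\<And>k. has_dv (y k) (y (Suc k) t) t"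
  shows "has_dv (hadamard_aux y k) (t ^ k *\<^sub>R y (Suc k) t) t"
proof (induction k)
  case 0
  show ?case using has_dv_diff[OF assms[of 0] has_dv_const[of "y 0 0"]] by simp
next
  case (Suc k)
  have "has_dv (\<lambda>s::real. s ^ Suc k) (real (Suc k) * t ^ k) t"
    unfolding has_dv_real_iff using DERIV_pow[of "Suc k" t] by (simp del: power_Suc)
  from has_dv_diff[OF has_dv_scaleR[OF this assms[of "Suc k"]] has_dv_cmult[OF Suc, of "real (Suc k)"]]
  have "has_dv (\<lambda>s. s ^ Suc k *\<^sub>R y (Suc k) s - real (Suc k) *\<^sub>R hadamard_aux y k s)
      ((real (Suc k) * t ^ k) *\<^sub>R y (Suc k) t + t ^ Suc k *\<^sub>R y (Suc (Suc k)) t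
      - real (Suc k) *\<^sub>R t ^ k *\<^sub>R y (Suc k) t) t" .
  moreover have "hadamard_aux y (Suc k) = (\<lambda>s. s ^ Suc k *\<^sub>R y (Suc k) s - real (Suc k) *\<^sub>R hadamard_aux y k s)"
    by (rule ext) (rule hadamard_aux.simps)
  moreover have "(real (Suc k) * t ^ k) *\<^sub>R y (Suc k) t + t ^ Suc k *\<^sub>R y (Suc (Suc k)) t
      - real (Suc k) *\<^sub>R t ^ k *\<^sub>R y (Suc k) t = t ^ Suc k *\<^sub>R y (Suc (Suc k)) t"
    by (simp del: power_Suc of_nat_Suc)
  ultimately show ?case by metis
qed

text \<open>Away from 0 this is the product rule. At 0 the error of the difference quotient is the
  increment over [0, 1] of a curve \<open>G\<close> whose derivative is the error of a difference
  quotient of \<open>y (Suc k)\<close>, times a factor in [0, 1]. Hence it lies in every convex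
  neighbourhood of 0 that contains those errors. The values at 0 in \<open>hadamard_quot\<close> are
  the ones predicted by Taylor expansion of \<open>y 0\<close>.\<close>

lemma has_dv_hadamard_quot:
  fixes y :: "nat \<Rightarrow> real \<Rightarrow> 'a::locally_convex_space"
  assumes y: "\<And>k t. \<bar>t\<bar> < e \<Longrightarrow> has_dv (y k) (y (Suc k) t) t" and t: "\<bar>t\<bar> < e"
  shows "has_dv (hadamard_quot y k) (hadamard_quot y (Suc k) t) t"
proof (cases "t = 0")
  case False
  have "((\<lambda>s. 1 / s ^ Suc k) has_real_derivative (- (real (Suc k) * t ^ k) / (t ^ Suc k * t ^ Suc k))) (at t)"
    using False by (auto intro!: derivative_eq_intros simp del: power_Suc)
  also have "- (real (Suc k) * t ^ k) / (t ^ Suc k * t ^ Suc k) = - real (Suc k) / t ^ Suc (Suc k)"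
    using False by (simp add: field_simps)
  finally have "has_dv (\<lambda>s. 1 / s ^ Suc k) (- real (Suc k) / t ^ Suc (Suc k)) t"
    by (simp only: has_dv_real_iff)
  from has_dv_scaleR[OF this has_dv_hadamard_aux[of y t k]] y[OF t]
  have "has_dv (\<lambda>s. (1 / s ^ Suc k) *\<^sub>R hadamard_aux y k s)
      ((- real (Suc k) / t ^ Suc (Suc k)) *\<^sub>R hadamard_aux y k t + (1 / t ^ Suc k) *\<^sub>R t ^ k *\<^sub>R y (Suc k) t) t"
    by blast
  moreover have "(1 / t ^ Suc k) * t ^ k = (1 / t ^ Suc (Suc k)) * t ^ Suc k"
    using False by (simp add: field_simps)
  then have "(- real (Suc k) / t ^ Suc (Suc k)) *\<^sub>R hadamard_aux y k t + (1 / t ^ Suc k) *\<^sub>R t ^ k *\<^sub>R y (Suc k) t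
      = hadamard_quot y (Suc k) t"
    using False by (simp add: hadamard_quot_def scaleR_right_diff_distrib del: power_Suc of_nat_Suc)
  ultimately have "has_dv (\<lambda>s. (1 / s ^ Suc k) *\<^sub>R hadamard_aux y k s) (hadamard_quot y (Suc k) t) t" by simp
  moreover have "eventually (\<lambda>s. s \<noteq> 0) (nhds t)"
    using False by (rule t1_space_nhds)
  then have "eventually (\<lambda>s. (1 / s ^ Suc k) *\<^sub>R hadamard_aux y k s = hadamard_quot y k s) (nhds t)"
    by eventually_elim (simp add: hadamard_quot_def)
  ultimately show ?thesis by (rule has_dv_transform)
next
  case True
  have e0: "e > 0" using t by simp
  have "((\<lambda>h. (1 / h) *\<^sub>R (hadamard_quot y k (0 + h) - hadamard_quot y k 0)) \<longlongrightarrow> hadamard_quot y (Suc k) 0) (at 0)"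
    unfolding lcs_tendsto_iff
  proof (intro allI impI)
    fix V :: "'a set" assume V: "open V" "0 \<in> V" "convex V"
    define D where "D s = (1 / s) *\<^sub>R (y (Suc k) s - y (Suc k) 0) - y (Suc (Suc k)) 0" for s
    have "eventually (\<lambda>s. D s \<in> V) (at 0)"
      using y[of 0 "Suc k"] e0 V unfolding has_dv_def lcs_tendsto_iff D_def by simp
    moreover have "eventually (\<lambda>s. \<bar>s\<bar> < e) (at (0::real))"
      using e0 by (auto simp: eventually_at dist_real_def)
    ultimately have "eventually (\<lambda>s. D s \<in> V \<and> \<bar>s\<bar> < e) (at 0)" by (rule eventually_conj)
    then obtain d where d: "d > 0" "\<And>s. s \<noteq> 0 \<Longrightarrow> \<bar>s\<bar> < d \<Longrightarrow> D s \<in> V \<and> \<bar>s\<bar> < e"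
      unfolding eventually_at by (auto simp: dist_real_def)
    have "(1 / h) *\<^sub>R (hadamard_quot y k h - hadamard_quot y k 0) - hadamard_quot y (Suc k) 0 \<in> V"
      if h: "h \<noteq> 0" "\<bar>h\<bar> < d" for h
    proof -
      \<comment> \<open>Replacing h by r h in \<open>hadamard_aux\<close> and scaling the two Taylor
        terms by the matching powers of \<open>r\<close> gives a curve from 0 to the error at step
        \<open>h\<close>.\<close>
      define G where "G r = (1 / h ^ Suc (Suc k)) *\<^sub>R hadamard_aux y k (0 + r * h)
        - (r ^ Suc k) *\<^sub>R ((1 / (real (Suc k) * h)) *\<^sub>R y (Suc k) 0)
        - (r ^ Suc (Suc k)) *\<^sub>R ((1 / real (Suc (Suc k))) *\<^sub>R y (Suc (Suc k)) 0)" for r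
      \<comment> \<open>At r = 0 the derivative is 0, while \<open>D 0\<close>, a quotient with step
        0, need not lie in \<open>V\<close>.\<close>
      define G' where "G' r = (if r = 0 then 0 else r ^ Suc k *\<^sub>R D (r * h))" for r
      have dG: "has_dv G (G' r) r" if r: "0 \<le> r" "r \<le> 1" for r
      proof -
        have "\<bar>r * h\<bar> \<le> \<bar>h\<bar>" using r by (simp add: abs_mult mult_left_le_one_le)
        then have "\<bar>r * h\<bar> < e" using d(2)[OF h] by linarith
        then have "has_dv (hadamard_aux y k) ((r * h) ^ k *\<^sub>R y (Suc k) (r * h)) (0 + r * h)"
          using has_dv_hadamard_aux[of y "r * h" k] y by simp
        note 1 = has_dv_cmult[OF has_dv_affine[OF this], of "1 / h ^ Suc (Suc k)"]
        have "has_dv (\<lambda>s::real. s ^ Suc k) (real (Suc k) * r ^ k) r"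
          unfolding has_dv_real_iff using DERIV_pow[of "Suc k" r] by (simp del: power_Suc)
        note 2 = has_dv_scaleR[OF this has_dv_const[of "(1 / (real (Suc k) * h)) *\<^sub>R y (Suc k) 0"]]
        have "has_dv (\<lambda>s::real. s ^ Suc (Suc k)) (real (Suc (Suc k)) * r ^ Suc k) r"
          unfolding has_dv_real_iff using DERIV_pow[of "Suc (Suc k)" r] by (simp del: power_Suc)
        note 3 = has_dv_scaleR[OF this has_dv_const[of "(1 / real (Suc (Suc k))) *\<^sub>R y (Suc (Suc k)) 0"]]
        have c1: "1 / h ^ Suc (Suc k) * (h * (r * h) ^ k) = r ^ k / h"
          using h by (simp add: power_mult_distrib field_simps)
        have c2: "real (Suc k) * r ^ k * (1 / (real (Suc k) * h)) = r ^ k / h"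
          using h by (simp add: field_simps del: of_nat_Suc)
        have c3: "real (Suc (Suc k)) * r ^ Suc k * (1 / real (Suc (Suc k))) = r ^ Suc k"
          by (simp del: of_nat_Suc)
        have "(1 / h ^ Suc (Suc k)) *\<^sub>R h *\<^sub>R (r * h) ^ k *\<^sub>R y (Suc k) (r * h) = (r ^ k / h) *\<^sub>R y (Suc k) (r * h)"
          by (simp only: scaleR_scaleR c1 mult.assoc)
        moreover have "(real (Suc k) * r ^ k) *\<^sub>R (1 / (real (Suc k) * h)) *\<^sub>R y (Suc k) 0 + r ^ Suc k *\<^sub>R 0
            = (r ^ k / h) *\<^sub>R y (Suc k) 0"
          by (simp only: scaleR_scaleR c2 scaleR_zero_right add_0_right)
        moreover have "(real (Suc (Suc k)) * r ^ Suc k) *\<^sub>R (1 / real (Suc (Suc k))) *\<^sub>R y (Suc (Suc k)) 0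
            + r ^ Suc (Suc k) *\<^sub>R 0 = r ^ Suc k *\<^sub>R y (Suc (Suc k)) 0"
          by (simp only: scaleR_scaleR c3 scaleR_zero_right add_0_right)
        ultimately have "has_dv G ((r ^ k / h) *\<^sub>R y (Suc k) (r * h) - (r ^ k / h) *\<^sub>R y (Suc k) 0
            - r ^ Suc k *\<^sub>R y (Suc (Suc k)) 0) r"
          using has_dv_diff[OF has_dv_diff[OF 1 2] 3] unfolding G_def[abs_def] by (simp only:)
        moreover have "(r ^ k / h) *\<^sub>R y (Suc k) (r * h) - (r ^ k / h) *\<^sub>R y (Suc k) 0
            - r ^ Suc k *\<^sub>R y (Suc (Suc k)) 0 = G' r"
        proof (cases "r = 0")
          case False
          then have "r ^ Suc k * (1 / (r * h)) = r ^ k / h" using h by simp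
          then show ?thesis using False
            by (simp add: G'_def D_def scaleR_right_diff_distrib del: power_Suc)
        qed (simp add: G'_def)
        ultimately show ?thesis by simp
      qed
      have G'V: "G' r \<in> V" if r: "0 \<le> r" "r \<le> 1" for r
      proof (cases "r = 0")
        case False
        have "\<bar>r * h\<bar> \<le> \<bar>h\<bar>" using r by (simp add: abs_mult mult_left_le_one_le)
        then have "D (r * h) \<in> V" using d(2)[of "r * h"] h False by auto
        moreover have "r ^ Suc k \<le> 1" "0 \<le> r ^ Suc k" using r by (auto intro: power_le_one simp del: power_Suc)
        \<comment> \<open>Since 0 lies in the convex set \<open>V\<close>, multiplication by a
          factor in [0, 1] does not leave \<open>V\<close>.\<close>
        ultimately have "r ^ Suc k *\<^sub>R D (r * h) + (1 - r ^ Suc k) *\<^sub>R 0 \<in> V"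
          using V by (intro convexD) (auto simp del: power_Suc)
        then show ?thesis using False by (simp add: G'_def del: power_Suc)
      qed (use V in \<open>simp add: G'_def\<close>)
      have "\<exists>v\<in>V. G 1 - G 0 = (1 - 0) *\<^sub>R v"
        by (rule mean_value_convex) (use V dG G'V in auto)
      moreover have "G 1 - G 0 = (1 / h) *\<^sub>R (hadamard_quot y k h - hadamard_quot y k 0) - hadamard_quot y (Suc k) 0"
        using h by (simp add: G_def hadamard_aux_0 hadamard_quot_def scaleR_right_diff_distrib mult.commute
            del: of_nat_Suc)
      ultimately show ?thesis by auto
    qed
    then show "eventually (\<lambda>h. (1 / h) *\<^sub>R (hadamard_quot y k (0 + h) - hadamard_quot y k 0) - hadamard_quot y (Suc k) 0 \<in> V) (at 0)"
      unfolding eventually_at using d(1) by (auto simp: dist_real_def intro!: exI[of _ d])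
  qed
  then show ?thesis by (simp add: has_dv_def True)
qed

lemma hadamard_quot_eq:
  "h *\<^sub>R hadamard_quot y 0 h = y 0 h - y 0 0" "hadamard_quot y 0 0 = y (Suc 0) 0"
  by (auto simp: hadamard_quot_def)

subsection \<open>A bump function\<close>

text \<open>For the constant polynomial 1 this is the classical exp(-1/x), continued by 0. A
  polynomial in 1/x is carried along because differentiation produces one.\<close>

definition flat :: "real poly \<Rightarrow> real \<Rightarrow> real" where
  "flat p x = (if x > 0 then poly p (1 / x) * exp (- (1 / x)) else 0)"

lemma tendsto_poly_exp: "((\<lambda>t. poly p t * exp (- t)) \<longlongrightarrow> 0) at_top" for p :: "real poly"
proof -
  have "((\<lambda>t. \<Sum>k\<le>degree p. coeff p k * (t ^ k / exp t)) \<longlongrightarrow> (\<Sum>k\<le>degree p. coeff p k * 0)) at_top"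
    by (intro tendsto_sum tendsto_mult tendsto_const tendsto_power_div_exp_0)
  then show ?thesis
    by (simp add: poly_altdef sum_distrib_right exp_minus divide_inverse mult.assoc)
qed

lemma flat_tendsto_0: "(flat p \<longlongrightarrow> 0) (at 0)"
proof -
  have "((\<lambda>x. poly p (inverse x) * exp (- inverse x)) \<longlongrightarrow> 0) (at_right 0)"
    by (rule filterlim_compose[OF tendsto_poly_exp filterlim_inverse_at_top_right])
  then have "(flat p \<longlongrightarrow> 0) (at_right 0)"
    by (rule Lim_transform_eventually)
       (auto simp: flat_def eventually_at_filter divide_inverse)
  moreover have "(flat p \<longlongrightarrow> 0) (at_left 0)"
    by (rule Lim_transform_eventually[OF tendsto_const])
       (auto simp: flat_def eventually_at_filter)
  ultimately show ?thesis by (simp add: filterlim_at_split)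
qed

text \<open>With u = 1/x one has d/dx = - u^2 d/du, which sends p(u) exp(-u) to u^2 (p - p')(u)
  exp(-u); \<open>[:0, 0, 1:]\<close> is the polynomial u^2.\<close>

lemma has_dv_flat: "has_dv (flat p) (flat ([:0, 0, 1:] * (p - pderiv p)) x) x"
proof (cases x "0::real" rule: linorder_cases)
  case less
  have "eventually (\<lambda>s. 0 = flat p s) (nhds x)"
    using eventually_nhds_in_open[of "{..<0}" x] less by (auto elim!: eventually_mono simp: flat_def)
  from has_dv_transform[OF has_dv_const this]
  have "has_dv (flat p) 0 x" .
  moreover have "flat ([:0, 0, 1:] * (p - pderiv p)) x = 0" using less by (simp add: flat_def)
  ultimately show ?thesis by simp
next
  case equal
  \<comment> \<open>Division by \<open>h\<close> multiplies the polynomial by its variable, so the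
    difference quotient at 0 is again a \<open>flat\<close> function and tends to 0.\<close>
  have "(\<lambda>h. (1 / h) *\<^sub>R (flat p (0 + h) - flat p 0)) = flat ([:0, 1:] * p)"
    by (auto simp: flat_def fun_eq_iff)
  with flat_tendsto_0[of "[:0, 1:] * p"] show ?thesis
    unfolding has_dv_def equal by (simp add: flat_def)
next
  case greater
  have "((\<lambda>s. poly p (1 / s) * exp (- (1 / s))) has_real_derivative
      poly (pderiv p) (1 / x) * (- 1 / x^2) * exp (- (1 / x)) + poly p (1 / x) * (exp (- (1 / x)) * (1 / x^2))) (at x)"
    using greater by (auto intro!: derivative_eq_intros DERIV_chain2[OF poly_DERIV] simp: power2_eq_square)
  moreover have "eventually (\<lambda>s. poly p (1 / s) * exp (- (1 / s)) = flat p s) (nhds x)"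
    using eventually_nhds_in_open[of "{0<..}" x] greater by (auto elim!: eventually_mono simp: flat_def)
  ultimately have "has_dv (flat p) (poly (pderiv p) (1 / x) * (- 1 / x^2) * exp (- (1 / x)) + poly p (1 / x) * (exp (- (1 / x)) * (1 / x^2))) x"
    unfolding has_dv_real_iff[symmetric] by (rule has_dv_transform)
  then show ?thesis using greater
    by (simp add: flat_def power2_eq_square algebra_simps)
qed

lemma open_Rn_UNIV: "openin (Euclidean_space n) (Rn n)"
  by (rule openin_topspace)

lemma smooth_on_real_curve_compose:
  fixes y :: "nat \<Rightarrow> real \<Rightarrow> 'a::locally_convex_space"
  assumes U: "openin (Euclidean_space n) U" and r: "smooth_on n U r"
    and y: "\<And>k t. has_dv (y k) (y (Suc k) t) t"
  shows "smooth_on n U (\<lambda>x. y k (r x))"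
proof -
  have s: "smooth_on 1 (Rn 1) (\<lambda>w. y k (w 0))"
    using y by (intro smooth_on_curve open_Rn_UNIV)
  have "(\<lambda>x i. if i = 0 then r x else 0) ` U \<subseteq> Rn 1" by (auto simp: Rn_iff)
  from smooth_on_compose[OF U open_Rn_UNIV[of 1] this s] r show ?thesis by simp
qed

text \<open>It is positive for |w 0| < 1 and 0 for all other \<open>w\<close>, where one of the two
  factors vanishes.\<close>

definition bump :: "vec \<Rightarrow> real" where
  "bump w = flat [:1:] (1 + w 0) * flat [:1:] (1 - w 0)"

lemma smooth_flat:
  assumes "openin (Euclidean_space n) U" "smooth_on n U r"
  shows "smooth_on n U (\<lambda>x. flat p (r x))"
  using smooth_on_real_curve_compose[OF assms,
      where y="\<lambda>k. flat (((\<lambda>p. [:0, 0, 1:] * (p - pderiv p)) ^^ k) p)" and k=0] has_dv_flat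
  by (simp del: mult_pCons_left)

lemma smooth_bump: "smooth_on 1 (Rn 1) bump"
proof -
  have "smooth_on 1 (Rn 1) (\<lambda>w. flat [:1:] (1 + w 0) *\<^sub>R flat [:1:] (1 + (- 1) *\<^sub>R w 0))"
    by (intro smooth_on_scaleR smooth_flat smooth_on_add smooth_on_const smooth_on_coord open_Rn_UNIV)
  then show ?thesis by (simp add: bump_def[abs_def])
qed

lemma bump_0: "bump (\<lambda>_. 0) \<noteq> 0"
  by (simp add: bump_def flat_def)

text \<open>Compactness refers to the topology of sequences; the set is the image of [-1, 1] under
  the embedding of the first axis. It is the support set required by
  \<open>Cc_infinity\<close>.\<close>

lemma compact_unit_interval_Rn: "compact {w \<in> Rn 1. \<bar>w 0\<bar> \<le> 1}"
proof -
  have "continuous_on {-1..1::real} (\<lambda>t i. if i = (0::nat) then t else 0)"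
  proof (rule continuous_on_coordinatewise_then_product)
    show "continuous_on {-1..1::real} (\<lambda>t. if i = (0::nat) then t else 0)" for i
      by (cases "i = 0") auto
  qed
  then have "compact ((\<lambda>t i. if i = (0::nat) then t else 0) ` {-1..1::real})"
    using compact_continuous_image by blast
  also have "(\<lambda>t i. if i = (0::nat) then t else 0) ` {-1..1::real} = {w \<in> Rn 1. \<bar>w 0\<bar> \<le> 1}"
  proof (intro equalityI subsetI)
    fix w :: vec assume "w \<in> {w \<in> Rn 1. \<bar>w 0\<bar> \<le> 1}"
    then show "w \<in> (\<lambda>t i. if i = (0::nat) then t else 0) ` {-1..1}"
      by (intro image_eqI[of _ _ "w 0"]) (auto simp: Rn_iff fun_eq_iff)
  qed (auto simp: Rn_iff)
  finally show ?thesis .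
qed

lemma bump_mult_Cc_infinity:
  assumes "smooth_on 1 (Rn 1) r"
  shows "(\<lambda>w. r w * bump w) \<in> Cc_infinity 1 (Rn 1)"
proof -
  have "smooth_on 1 (Rn 1) (\<lambda>w. r w *\<^sub>R bump w)"
    by (rule smooth_on_scaleR[OF open_Rn_UNIV assms smooth_bump])
  moreover have "\<forall>u\<in>Rn 1 - {w \<in> Rn 1. \<bar>w 0\<bar> \<le> 1}. r u * bump u = 0"
    by (auto simp: bump_def flat_def)
  ultimately show ?thesis
    unfolding Cc_infinity_def using compact_unit_interval_Rn
    by (auto intro!: exI[of _ "{w \<in> Rn 1. \<bar>w 0\<bar> \<le> 1}"])
qed

subsection \<open>Directional derivatives\<close>

text \<open>Plots of a Euclidean domain without the convention of being \<open>undefined\<close> off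
  the domain (see \<open>euclidean_plot_iff\<close>), so that smoothness can be stated for plain
  lambda terms.\<close>

definition smooth_into :: "nat \<Rightarrow> vec set \<Rightarrow> nat \<Rightarrow> vec set \<Rightarrow> (vec \<Rightarrow> vec) \<Rightarrow> bool" where
  "smooth_into m W n U g \<longleftrightarrow> openin (Euclidean_space m) W \<and> g ` W \<subseteq> U \<and> (\<forall>i<n. smooth_on m W (\<lambda>w. g w i))"

lemma smooth_into_compose:
  fixes f :: "vec \<Rightarrow> 'a::locally_convex_space"
  assumes "smooth_into m W n U g" "openin (Euclidean_space n) U" "smooth_on n U f"
  shows "smooth_on m W (\<lambda>w. f (g w))"
  using assms unfolding smooth_into_def by (auto intro: smooth_on_compose)

lemma smooth_into_trans:
  assumes "smooth_into m W n U g" "smooth_into n U k V f"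
  shows "smooth_into m W k V (\<lambda>w. f (g w))"
proof -
  have "smooth_on m W (\<lambda>w. f (g w) i)" if "i < k" for i
    using smooth_into_compose[OF assms(1), of "\<lambda>x. f x i"] assms(2) that by (simp add: smooth_into_def)
  then show ?thesis using assms unfolding smooth_into_def by (auto simp: image_subset_iff)
qed

lemma open_preimage_smooth_into:
  assumes g: "smooth_into m W n (Rn n) g" and V: "openin (Euclidean_space n) V"
  shows "openin (Euclidean_space m) {w \<in> W. g w \<in> V}"
proof -
  have W: "openin (Euclidean_space m) W" and gW: "g ` W \<subseteq> Rn n"
    using g by (auto simp: smooth_into_def)
  have c: "continuous_on W g"
    using g by (intro continuous_on_coords[of n]) (auto simp: smooth_into_def intro: smooth_on_continuous)
  obtain S where S: "open S" "V = Rn n \<inter> S"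
    using V unfolding openin_top_of_Rn_iff[symmetric] openin_open by blast
  have "{w \<in> W. g w \<in> V} = {w \<in> W. g w \<in> S}" using S gW by auto
  with continuous_on_open_preimage_Rn[OF W c S(1)] show ?thesis by simp
qed

lemma smooth_into_mono: "smooth_into m W n U g \<Longrightarrow> U \<subseteq> V \<Longrightarrow> smooth_into m W n V g"
  by (auto simp: smooth_into_def)

lemma smooth_into_subset:
  "smooth_into m W n U g \<Longrightarrow> openin (Euclidean_space m) V \<Longrightarrow> V \<subseteq> W \<Longrightarrow> smooth_into m V n U g"
  unfolding smooth_into_def using smooth_on_subset by blast

lemma smooth_into_id: "openin (Euclidean_space n) U \<Longrightarrow> smooth_into n U n U (\<lambda>w. w)"
  by (auto simp: smooth_into_def smooth_on_coord)

lemma smooth_into_const: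
  "openin (Euclidean_space m) W \<Longrightarrow> x \<in> U \<Longrightarrow> smooth_into m W n U (\<lambda>_. x)"
  by (auto simp: smooth_into_def smooth_on_const)

lemma dir_deriv_cong:
  assumes "openin (Euclidean_space n) U" "\<And>x. x \<in> U \<Longrightarrow> f x = g x" "x \<in> U"
  shows "dir_deriv n f x v = dir_deriv n g x v"
  unfolding dir_deriv_def
  by (intro sum.cong refl arg_cong[of _ _ "scaleR _"] partial_deriv_cong[OF assms(1) _ assms(3)]) (use assms in auto)

lemma dir_deriv_add_right:
  "dir_deriv n f x (\<lambda>i. a * v i + b * w i) = a *\<^sub>R dir_deriv n f x v + b *\<^sub>R dir_deriv n f x w"
  by (simp add: dir_deriv_def scaleR_left_distrib sum.distrib scaleR_sum_right)

lemma has_dv_dir_deriv: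
  fixes f :: "vec \<Rightarrow> 'a::locally_convex_space"
  assumes U: "openin (Euclidean_space m) U" "c t \<in> U" and f: "smooth_on m U f"
    and c: "eventually (\<lambda>s. c s \<in> Rn m) (nhds t)" "\<And>j. j < m \<Longrightarrow> has_dv (\<lambda>s. c s j) (c' j) t"
  shows "has_dv (\<lambda>s. f (c s)) (dir_deriv m f (c t) c') t"
  unfolding dir_deriv_def
proof (rule chain_curve[OF U _ _ c])
  show "has_pd j f (partial_deriv j f y) y" if "j < m" "y \<in> U" for j y
    using smooth_on_has_pd[OF f that] .
  show "continuous_on U (partial_deriv j f)" if "j < m" for j
    using smooth_on_continuous[OF smooth_on_partial_deriv[OF f that]] .
qed

lemma dir_deriv_eqI:
  assumes "\<And>i. i < n \<Longrightarrow> has_pd i f (l i) x"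
  shows "dir_deriv n f x v = (\<Sum>i<n. v i *\<^sub>R l i)"
  using assms[THEN partial_deriv_eq] by (simp add: dir_deriv_def)

lemma dir_deriv_lin:
  fixes f :: "vec \<Rightarrow> 'a::locally_convex_space"
  assumes "smooth_on n U f" "smooth_on n U g" "x \<in> U"
  shows "dir_deriv n (\<lambda>x. a *\<^sub>R f x + b *\<^sub>R g x) x v = a *\<^sub>R dir_deriv n f x v + b *\<^sub>R dir_deriv n g x v"
proof -
  have "has_pd i (\<lambda>x. a *\<^sub>R f x + b *\<^sub>R g x) (a *\<^sub>R partial_deriv i f x + b *\<^sub>R partial_deriv i g x) x"
    if i: "i < n" for i
    using has_pd_add[OF has_pd_scaleR[OF has_pd_const smooth_on_has_pd[OF assms(1) i assms(3)], of a]
        has_pd_scaleR[OF has_pd_const smooth_on_has_pd[OF assms(2) i assms(3)], of b]] by simp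
  from dir_deriv_eqI[OF this] show ?thesis
    by (simp add: dir_deriv_def scaleR_right_distrib sum.distrib scaleR_sum_right mult.commute)
qed

lemma dir_deriv_scaleR:
  fixes f :: "vec \<Rightarrow> 'a::locally_convex_space"
  assumes "smooth_on n U r" "smooth_on n U f" "x \<in> U"
  shows "dir_deriv n (\<lambda>x. r x *\<^sub>R f x) x v = dir_deriv n r x v *\<^sub>R f x + r x *\<^sub>R dir_deriv n f x v"
proof -
  have "has_pd i (\<lambda>x. r x *\<^sub>R f x) (partial_deriv i r x *\<^sub>R f x + r x *\<^sub>R partial_deriv i f x) x"
    if i: "i < n" for i
    by (rule has_pd_scaleR[OF smooth_on_has_pd[OF assms(1) i assms(3)] smooth_on_has_pd[OF assms(2) i assms(3)]])
  from dir_deriv_eqI[OF this] show ?thesis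
    by (simp add: dir_deriv_def scaleR_right_distrib sum.distrib scaleR_sum_right scaleR_sum_left mult.commute)
qed

lemma dir_deriv_const: "dir_deriv n (\<lambda>_. c) x v = 0"
  using dir_deriv_eqI[OF has_pd_const, of n c x v] by simp

lemma dir_deriv_coord: "i < n \<Longrightarrow> dir_deriv n (\<lambda>w. w i) x v = v i"
  using dir_deriv_eqI[OF has_pd_coord, of n i x v] by (simp add: if_distrib sum.delta cong: if_cong)

lemma dir_deriv_compose:
  fixes f :: "vec \<Rightarrow> 'a::locally_convex_space"
  assumes g: "smooth_into n U m V g" and V: "openin (Euclidean_space m) V"
    and f: "smooth_on m V f" and x: "x \<in> U"
  shows "dir_deriv n (\<lambda>w. f (g w)) x v = dir_deriv m f (g x) (tangent_map n m g x v)"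
proof -
  have "has_pd i (\<lambda>w. f (g w)) (\<Sum>j<m. partial_deriv i (\<lambda>w. g w j) x *\<^sub>R partial_deriv j f (g x)) x"
    if i: "i < n" for i
  proof (rule has_pd_compose[of n U x i m V])
    show "has_pd j f (partial_deriv j f y) y" if "j < m" "y \<in> V" for j y
      using smooth_on_has_pd[OF f that] .
    show "continuous_on V (partial_deriv j f)" if "j < m" for j
      using smooth_on_continuous[OF smooth_on_partial_deriv[OF f that]] .
    show "has_pd i (\<lambda>w. g w j) (partial_deriv i (\<lambda>w. g w j) x) x" if "j < m" for j
      using g smooth_on_has_pd[of n U "\<lambda>w. g w j", OF _ i x] that by (simp add: smooth_into_def)
  qed (use assms i in \<open>auto simp: smooth_into_def\<close>)
  then have "dir_deriv n (\<lambda>w. f (g w)) x v = (\<Sum>i<n. v i *\<^sub>R (\<Sum>j<m. partial_deriv i (\<lambda>w. g w j) x *\<^sub>R partial_deriv j f (g x)))"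
    by (rule dir_deriv_eqI)
  also have "\<dots> = (\<Sum>j<m. \<Sum>i<n. (v i * partial_deriv i (\<lambda>w. g w j) x) *\<^sub>R partial_deriv j f (g x))"
    by (simp add: scaleR_sum_right) (rule sum.swap)
  also have "\<dots> = dir_deriv m f (g x) (tangent_map n m g x v)"
    by (simp add: dir_deriv_def tangent_map_def scaleR_sum_left)
  finally show ?thesis .
qed

lemma tangent_map_in_Rn: "tangent_map m n g x v \<in> Rn n"
  by (auto simp: tangent_map_def Rn_iff)

lemma dir_deriv_e1: "dir_deriv 1 f x e1 = partial_deriv 0 f x"
  by (simp add: dir_deriv_def)

subsection \<open>Smooth linear maps\<close>

text \<open>Smoothness for the nebula diffeologies, see
  \<open>smooth_map_nebula_iff\<close>.\<close>

definition smooth_fun :: "('a::{real_vector, t2_space} \<Rightarrow> 'b::{real_vector, t2_space}) \<Rightarrow> bool" where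
  "smooth_fun l \<longleftrightarrow> (\<forall>n U f. openin (Euclidean_space n) U \<longrightarrow> smooth_on n U f \<longrightarrow> smooth_on n U (\<lambda>x. l (f x)))"

lemma smooth_funD:
  "smooth_fun l \<Longrightarrow> openin (Euclidean_space n) U \<Longrightarrow> smooth_on n U f \<Longrightarrow> smooth_on n U (\<lambda>x. l (f x))"
  by (simp add: smooth_fun_def)

text \<open>A smooth linear map need not be continuous; by Hadamard's lemma it is continuous along the
  difference quotients of a smooth curve, because these extend to a smooth curve.\<close>

lemma smooth_linear_has_pd:
  fixes l :: "'a::locally_convex_space \<Rightarrow> 'b::locally_convex_space"
  assumes l: "linear l" "smooth_fun l"
    and f: "openin (Euclidean_space n) U" "smooth_on n U f" "x \<in> U" "i < n"
  shows "has_pd i (\<lambda>x. l (f x)) (l (partial_deriv i f x)) x"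
proof -
  define y where "y k t = ((partial_deriv i ^^ k) f) (x(i := x i + t))" for k t
  obtain e where e: "e > 0" "\<And>k t. \<bar>t\<bar> < e \<Longrightarrow> has_dv (y k) (y (Suc k) t) t"
    using curve_derivatives[OF f] unfolding y_def[abs_def] by blast
  let ?U = "{w \<in> Rn 1. \<bar>w 0\<bar> < e}"
  have "continuous_on (Rn 1) (\<lambda>w. \<bar>w 0\<bar>)" by (intro continuous_intros continuous_on_coord)
  from continuous_on_open_preimage_Rn[OF open_Rn_UNIV this, of "{..<e}"]
  have U: "openin (Euclidean_space 1) ?U" by simp
  have "smooth_on 1 ?U (\<lambda>w. hadamard_quot y 0 (w 0))"
    by (rule smooth_on_curve[OF U]) (use has_dv_hadamard_quot[of e y] e(2) in auto)
  from smooth_on_continuous[OF smooth_funD[OF l(2) U this]]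
  have c: "continuous_on ?U (\<lambda>w. l (hadamard_quot y 0 (w 0)))" .
  have "((\<lambda>h. if j = 0 then h else 0) \<longlongrightarrow> 0) (at (0::real))" for j :: nat
    by (cases "j = 0") auto
  with continuous_on_tendsto_Rn[OF U _ c, of "\<lambda>_. 0" "\<lambda>h i. if i = 0 then h else 0" "at 0"] e(1)
  have "((\<lambda>h. l (hadamard_quot y 0 h)) \<longlongrightarrow> l (y (Suc 0) 0)) (at 0)"
    by (simp add: hadamard_quot_eq Rn_iff)
  moreover have "eventually (\<lambda>h. l (hadamard_quot y 0 h) = diff_quot i (\<lambda>x. l (f x)) x h) (at 0)"
  proof -
    have "l (hadamard_quot y 0 h) = diff_quot i (\<lambda>x. l (f x)) x h" if "h \<noteq> 0" for h
      using that l(1)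
      by (simp add: hadamard_quot_def diff_quot_def y_def linear_cmul linear_diff)
    then show ?thesis by (auto simp: eventually_at_filter)
  qed
  ultimately have "(diff_quot i (\<lambda>x. l (f x)) x \<longlongrightarrow> l (y (Suc 0) 0)) (at 0)"
    by (rule Lim_transform_eventually)
  then show ?thesis by (simp add: has_pd_def y_def)
qed

lemma smooth_linear_dir_deriv:
  fixes l :: "'a::locally_convex_space \<Rightarrow> 'b::locally_convex_space"
  assumes "linear l" "smooth_fun l" "openin (Euclidean_space n) U" "smooth_on n U f" "x \<in> U"
  shows "dir_deriv n (\<lambda>x. l (f x)) x v = l (dir_deriv n f x v)"
proof -
  have "dir_deriv n (\<lambda>x. l (f x)) x v = (\<Sum>i<n. v i *\<^sub>R l (partial_deriv i f x))"
    by (rule dir_deriv_eqI) (use smooth_linear_has_pd[OF assms] in auto)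
  then show ?thesis using assms(1) by (simp add: dir_deriv_def linear_sum linear_cmul)
qed

subsection \<open>Smooth families of linear maps\<close>

text \<open>The functional diffeology, tested by letting parameter and argument vary together along
  an arbitrary domain; see \<open>smooth_family_iff_smooth_map\<close>.\<close>

definition smooth_family :: "nat \<Rightarrow> vec set \<Rightarrow> (vec \<Rightarrow> 'a::{real_vector, t2_space} \<Rightarrow> 'b::{real_vector, t2_space}) \<Rightarrow> bool" where
  "smooth_family n U p \<longleftrightarrow> openin (Euclidean_space n) U \<and>
    (\<forall>m W g f. smooth_into m W n U g \<longrightarrow> smooth_on m W f \<longrightarrow> smooth_on m W (\<lambda>w. p (g w) (f w)))"

lemma smooth_familyD:
  "smooth_family n U p \<Longrightarrow> smooth_into m W n U g \<Longrightarrow> smooth_on m W f \<Longrightarrow> smooth_on m W (\<lambda>w. p (g w) (f w))"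
  by (simp add: smooth_family_def)

lemma smooth_family_open: "smooth_family n U p \<Longrightarrow> openin (Euclidean_space n) U"
  by (simp add: smooth_family_def)

lemma smooth_family_at:
  fixes p :: "vec \<Rightarrow> 'a::{real_vector, t2_space} \<Rightarrow> 'b::{real_vector, t2_space}"
  assumes "smooth_family n U p" "u \<in> U"
  shows "smooth_fun (p u)"
  unfolding smooth_fun_def
proof (intro allI impI)
  fix m W and f :: "vec \<Rightarrow> 'a" assume W: "openin (Euclidean_space m) W" and f: "smooth_on m W f"
  show "smooth_on m W (\<lambda>x. p u (f x))"
    by (rule smooth_familyD[OF assms(1) smooth_into_const[OF W assms(2)] f])
qed

text \<open>Let parameter and argument move independently along direction \<open>i\<close>: this
  gives a smooth function \<open>h\<close> of two real variables. Its derivative along the diagonal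
  is the sum of its two partial derivatives at the origin. The second one comes from
  \<open>smooth_linear_has_pd\<close>, as \<open>p x\<close> may fail to be continuous.\<close>

lemma has_pd_smooth_family:
  fixes p :: "vec \<Rightarrow> 'a::locally_convex_space \<Rightarrow> 'b::locally_convex_space"
  assumes p: "smooth_family n U p" "\<And>u. u \<in> U \<Longrightarrow> linear (p u)"
    and y: "smooth_on n U y" and x: "x \<in> U" and i: "i < n"
  shows "has_pd i (\<lambda>u. p u (y u)) (partial_deriv i (\<lambda>u. p u (y x)) x + p x (partial_deriv i y x)) x"
proof -
  note U = smooth_family_open[OF p(1)]
  have xR: "x \<in> Rn n" using open_Rn_subset[OF U] x by blast
  define a where "a k w = x(i := x i + w k)" for k :: nat and w :: vec
  have a: "smooth_into 2 (Rn 2) n (Rn n) (a k)" for k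
  proof -
    have "smooth_on 2 (Rn 2) (\<lambda>w. x j + (if j = i then w k else 0))" for j
      by (cases "j = i") (simp_all add: smooth_on_add[OF open_Rn_UNIV] smooth_on_const[OF open_Rn_UNIV] smooth_on_coord[OF open_Rn_UNIV])
    moreover have "a k w j = x j + (if j = i then w k else 0)" for w j by (simp add: a_def)
    ultimately show ?thesis
      using Rn_update[OF xR i] by (auto simp: smooth_into_def a_def[abs_def] open_Rn_UNIV)
  qed
  define W where "W = {w \<in> Rn 2. a 0 w \<in> U} \<inter> {w \<in> Rn 2. a 1 w \<in> U}"
  have W: "openin (Euclidean_space 2) W" unfolding W_def
    by (intro open_Rn_Int open_preimage_smooth_into[OF a U])
  have aW: "smooth_into 2 W n U (a k)" if "k < 2" for k
  proof -
    have "W \<subseteq> Rn 2" by (auto simp: W_def)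
    from smooth_into_subset[OF a W this] have "smooth_into 2 W n (Rn n) (a k)" .
    moreover have "k = 0 \<or> k = 1" using that by auto
    then have "a k ` W \<subseteq> U" by (auto simp: W_def)
    ultimately show ?thesis by (simp add: smooth_into_def)
  qed
  define h where "h w = p (a 0 w) (y (a 1 w))" for w
  have h: "smooth_on 2 W h" unfolding h_def[abs_def]
    by (rule smooth_familyD[OF p(1) aW smooth_into_compose[OF aW U y]]) auto
  define c where "c s = (\<lambda>j::nat. if j < 2 then s else (0::real))" for s
  have c0: "c 0 = (\<lambda>_. 0)" by (auto simp: c_def)
  have c0W: "c 0 \<in> W" using x by (auto simp: W_def c_def a_def Rn_iff)
  have "has_dv (\<lambda>s. h (c s)) (dir_deriv 2 h (c 0) (\<lambda>_. 1)) 0"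
  proof (rule has_dv_dir_deriv[where c=c, OF W c0W h])
    show "eventually (\<lambda>s. c s \<in> Rn 2) (nhds 0)" by (simp add: c_def Rn_iff)
    show "has_dv (\<lambda>s. c s j) 1 0" if "j < 2" for j
      using that by (simp add: c_def has_dv_real_iff)
  qed
  moreover have "has_pd 0 h (partial_deriv i (\<lambda>u. p u (y x)) x) (c 0)"
  proof -
    have "smooth_on n U (\<lambda>u. p u (y x))"
      by (rule smooth_familyD[OF p(1) smooth_into_id[OF U] smooth_on_const[OF U]])
    from smooth_on_has_pd[OF this i x]
    have "has_dv (\<lambda>s. p (x(i := s)) (y x)) (partial_deriv i (\<lambda>u. p u (y x)) x) (x i + 0 * 1)"
      by (simp add: has_pd_iff)
    from has_dv_affine[OF this] show ?thesis
      by (simp add: has_pd_iff h_def a_def c0)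
  qed
  moreover have "has_pd 1 h (p x (partial_deriv i y x)) (c 0)"
  proof -
    from smooth_linear_has_pd[OF p(2)[OF x] smooth_family_at[OF p(1) x] U y x i]
    have "has_dv (\<lambda>s. p x (y (x(i := s)))) (p x (partial_deriv i y x)) (x i + 0 * 1)"
      by (simp add: has_pd_iff)
    from has_dv_affine[OF this] show ?thesis
      by (simp add: has_pd_iff h_def a_def c0)
  qed
  ultimately have "has_dv (\<lambda>s. h (c s)) (partial_deriv i (\<lambda>u. p u (y x)) x + p x (partial_deriv i y x)) (x i + (x i * (-1)))"
    using partial_deriv_eq[of 0 h _ "c 0"] partial_deriv_eq[of 1 h _ "c 0"]
    by (simp add: dir_deriv_def numeral_2_eq_2)
  \<comment> \<open>The point 0 is written as \<open>- x i + x i * 1\<close> to match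
    \<open>has_dv_affine\<close>, which shifts the parameter so that the curve passes the origin at
    time \<open>x i\<close>.\<close>
  then have "has_dv (\<lambda>s. h (c s)) (partial_deriv i (\<lambda>u. p u (y x)) x + p x (partial_deriv i y x)) (- x i + x i * 1)"
    by simp
  from has_dv_affine[OF this] show ?thesis
    by (simp add: has_pd_iff h_def a_def c_def)
qed

lemma dir_deriv_smooth_family:
  fixes p :: "vec \<Rightarrow> 'a::locally_convex_space \<Rightarrow> 'b::locally_convex_space"
  assumes p: "smooth_family n U p" "\<And>u. u \<in> U \<Longrightarrow> linear (p u)"
    and y: "smooth_on n U y" and x: "x \<in> U"
  shows "dir_deriv n (\<lambda>u. p u (y u)) x v = dir_deriv n (\<lambda>u. p u (y x)) x v + p x (dir_deriv n y x v)"
proof -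
  have "dir_deriv n (\<lambda>u. p u (y u)) x v = (\<Sum>i<n. v i *\<^sub>R (partial_deriv i (\<lambda>u. p u (y x)) x + p x (partial_deriv i y x)))"
    by (rule dir_deriv_eqI) (rule has_pd_smooth_family[OF assms])
  then show ?thesis using p(2)[OF x]
    by (simp add: dir_deriv_def scaleR_right_distrib sum.distrib linear_sum linear_cmul)
qed

subsection \<open>Products of domains\<close>

text \<open>\<open>vfst\<close>, \<open>vsnd\<close> and \<open>vjoin\<close> realise the product of
  R^n and R^m as R^(n+m) by concatenation. A product of domains has to sit in a single Euclidean
  space because plots are indexed by such domains.\<close>

definition vfst :: "nat \<Rightarrow> vec \<Rightarrow> vec" where
  "vfst n w = (\<lambda>i. if i < n then w i else 0)"

definition vsnd :: "nat \<Rightarrow> nat \<Rightarrow> vec \<Rightarrow> vec" where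
  "vsnd n m w = (\<lambda>i. if i < m then w (n + i) else 0)"

definition vjoin :: "nat \<Rightarrow> nat \<Rightarrow> vec \<Rightarrow> vec \<Rightarrow> vec" where
  "vjoin n m a b = (\<lambda>i. if i < n then a i else if i < n + m then b (i - n) else 0)"

definition prod_domain :: "nat \<Rightarrow> nat \<Rightarrow> vec set \<Rightarrow> vec set \<Rightarrow> vec set" where
  "prod_domain n m U V = {w \<in> Rn (n + m). vfst n w \<in> U \<and> vsnd n m w \<in> V}"

lemma vfst_vjoin: "a \<in> Rn n \<Longrightarrow> vfst n (vjoin n m a b) = a"
  by (auto simp: vfst_def vjoin_def Rn_iff fun_eq_iff)

lemma vsnd_vjoin: "b \<in> Rn m \<Longrightarrow> vsnd n m (vjoin n m a b) = b"
  by (auto simp: vsnd_def vjoin_def Rn_iff fun_eq_iff)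

lemma vjoin_in_Rn: "vjoin n m a b \<in> Rn (n + m)"
  by (auto simp: vjoin_def Rn_iff)

lemma smooth_into_vfst: "openin (Euclidean_space (n + m)) W \<Longrightarrow> smooth_into (n + m) W n (Rn n) (vfst n)"
  by (auto simp: smooth_into_def vfst_def Rn_iff smooth_on_coord)

lemma smooth_into_vsnd: "openin (Euclidean_space (n + m)) W \<Longrightarrow> smooth_into (n + m) W m (Rn m) (vsnd n m)"
  by (auto simp: smooth_into_def vsnd_def Rn_iff smooth_on_coord)

lemma open_prod_domain:
  assumes "openin (Euclidean_space n) U" "openin (Euclidean_space m) V"
  shows "openin (Euclidean_space (n + m)) (prod_domain n m U V)"
proof -
  have "prod_domain n m U V = {w \<in> Rn (n + m). vfst n w \<in> U} \<inter> {w \<in> Rn (n + m). vsnd n m w \<in> V}"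
    by (auto simp: prod_domain_def)
  then show ?thesis
    using open_preimage_smooth_into[OF smooth_into_vfst[OF open_Rn_UNIV] assms(1)]
      open_preimage_smooth_into[OF smooth_into_vsnd[OF open_Rn_UNIV] assms(2)] open_Rn_Int by simp
qed

lemma smooth_into_prod_domain:
  assumes "openin (Euclidean_space n) U" "openin (Euclidean_space m) V"
  shows "smooth_into (n + m) (prod_domain n m U V) n U (vfst n)"
    "smooth_into (n + m) (prod_domain n m U V) m V (vsnd n m)"
proof -
  note W = open_prod_domain[OF assms]
  have "vfst n ` prod_domain n m U V \<subseteq> U" "vsnd n m ` prod_domain n m U V \<subseteq> V"
    by (auto simp: prod_domain_def)
  with smooth_into_vfst[OF W] smooth_into_vsnd[OF W]
  show "smooth_into (n + m) (prod_domain n m U V) n U (vfst n)"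
    "smooth_into (n + m) (prod_domain n m U V) m V (vsnd n m)"
    by (simp_all add: smooth_into_def)
qed

lemma smooth_into_vjoin:
  assumes a: "smooth_into k W n U a" and b: "smooth_into k W m V b"
    and UV: "openin (Euclidean_space n) U" "openin (Euclidean_space m) V"
  shows "smooth_into k W (n + m) (prod_domain n m U V) (\<lambda>w. vjoin n m (a w) (b w))"
  unfolding smooth_into_def
proof (intro conjI allI impI)
  show "openin (Euclidean_space k) W" using a by (simp add: smooth_into_def)
  have "vfst n (vjoin n m (a w) (b w)) = a w" "vsnd n m (vjoin n m (a w) (b w)) = b w" if "w \<in> W" for w
    using a b that UV[THEN open_Rn_subset]
    by (auto simp: smooth_into_def intro!: vfst_vjoin vsnd_vjoin)
  then show "(\<lambda>w. vjoin n m (a w) (b w)) ` W \<subseteq> prod_domain n m U V"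
    using a b vjoin_in_Rn by (auto simp: prod_domain_def smooth_into_def image_subset_iff)
  fix i assume i: "i < n + m"
  show "smooth_on k W (\<lambda>w. vjoin n m (a w) (b w) i)"
  proof (cases "i < n")
    case True then show ?thesis using a by (simp add: smooth_into_def vjoin_def)
  next
    case False
    then have "i - n < m" using i by simp
    then show ?thesis using b i False by (simp add: smooth_into_def vjoin_def)
  qed
qed

text \<open>The derivatives of \<open>F s\<close> at \<open>u s\<close> are the partial derivatives
  with indices n + i of one smooth function on the product domain, evaluated along the smooth map s
  -> (s, u s).\<close>

lemma smooth_parametric_dir_deriv:
  fixes F :: "vec \<Rightarrow> vec \<Rightarrow> 'a::locally_convex_space"
  assumes S: "openin (Euclidean_space n) S" and U: "openin (Euclidean_space m) U"
    and F: "smooth_on (n + m) (prod_domain n m S U) (\<lambda>w. F (vfst n w) (vsnd n m w))"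
    and u: "smooth_into n S m U u" and X: "smooth_into n S m V X"
  shows "smooth_on n S (\<lambda>s. dir_deriv m (F s) (u s) (X s))"
proof -
  let ?F = "\<lambda>w. F (vfst n w) (vsnd n m w)"
  note o = open_prod_domain[OF S U]
  have g: "smooth_into n S (n + m) (prod_domain n m S U) (\<lambda>s. vjoin n m s (u s))"
    by (rule smooth_into_vjoin[OF smooth_into_id[OF S] u S U])
  have "smooth_on n S (\<lambda>s. \<Sum>i<m. X s i *\<^sub>R partial_deriv (n + i) ?F (vjoin n m s (u s)))"
    by (intro smooth_on_sum smooth_on_scaleR S smooth_into_compose[OF g o] smooth_on_partial_deriv[OF F])
       (use X in \<open>auto simp: smooth_into_def\<close>)
  moreover have "(\<Sum>i<m. X s i *\<^sub>R partial_deriv (n + i) ?F (vjoin n m s (u s))) = dir_deriv m (F s) (u s) (X s)"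
    if s: "s \<in> S" for s
    unfolding dir_deriv_def
  proof (intro sum.cong refl arg_cong[of _ _ "scaleR _"])
    fix i assume i: "i \<in> {..<m}"
    have sR: "s \<in> Rn n" and uR: "u s \<in> Rn m"
      using open_Rn_subset[OF S] open_Rn_subset[OF U] u s by (auto simp: smooth_into_def)
    have "vjoin n m s (u s) \<in> prod_domain n m S U" using g s by (auto simp: smooth_into_def)
    from smooth_on_has_pd[OF F _ this, of "n + i"] i
    have "has_dv (\<lambda>r. ?F ((vjoin n m s (u s))(n + i := r)))
        (partial_deriv (n + i) ?F (vjoin n m s (u s))) (u s i)"
      by (simp add: has_pd_iff vjoin_def)
    moreover have "vfst n ((vjoin n m s (u s))(n + i := r)) = s" for r
      using sR by (auto simp: vfst_def vjoin_def Rn_iff fun_eq_iff)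
    moreover have "vsnd n m ((vjoin n m s (u s))(n + i := r)) = (u s)(i := r)" for r
      using uR i by (auto simp: vsnd_def vjoin_def Rn_iff fun_eq_iff)
    ultimately have "has_pd i (F s) (partial_deriv (n + i) ?F (vjoin n m s (u s))) (u s)"
      by (simp add: has_pd_iff)
    then show "partial_deriv (n + i) ?F (vjoin n m s (u s)) = partial_deriv i (F s) (u s)"
      by (rule partial_deriv_eq[symmetric])
  qed
  ultimately show ?thesis
    using smooth_on_cong[OF S, of "\<lambda>s. \<Sum>i<m. X s i *\<^sub>R partial_deriv (n + i) ?F (vjoin n m s (u s))"
        "\<lambda>s. dir_deriv m (F s) (u s) (X s)"] by blast
qed

section \<open>Diffeologies\<close>

lemma euclidean_plot_iff:
  "g \<in> plots (euclidean_domain n U) m V \<longleftrightarrow> g \<in> extensional V \<and> smooth_into m V n U g"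
  by (auto simp: euclidean_domain_def smooth_into_def PiE_def)

lemma points_euclidean_domain [simp]: "points (euclidean_domain n U) = U"
  by (simp add: euclidean_domain_def)

lemma smooth_into_cong:
  assumes "\<And>w. w \<in> W \<Longrightarrow> g w = h w"
  shows "smooth_into m W n U g \<longleftrightarrow> smooth_into m W n U h"
proof (cases "openin (Euclidean_space m) W")
  case True
  have "smooth_on m W (\<lambda>w. g w i) \<longleftrightarrow> smooth_on m W (\<lambda>w. h w i)" for i
    by (rule smooth_on_cong[OF True]) (use assms in simp)
  moreover have "g ` W \<subseteq> U \<longleftrightarrow> h ` W \<subseteq> U" using assms by (simp add: image_subset_iff)
  ultimately show ?thesis unfolding smooth_into_def by blast
qed (simp add: smooth_into_def)

lemma restrict_euclidean_plot:
  "smooth_into m V n U g \<Longrightarrow> restrict g V \<in> plots (euclidean_domain n U) m V"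
  unfolding euclidean_plot_iff by (subst smooth_into_cong[of V "restrict g V" g]) simp_all

lemma ds_open: "diffeological_space X \<Longrightarrow> p \<in> plots X n U \<Longrightarrow> openin (Euclidean_space n) U"
  and ds_PiE: "diffeological_space X \<Longrightarrow> p \<in> plots X n U \<Longrightarrow> p \<in> U \<rightarrow>\<^sub>E points X"
  unfolding diffeological_space_def by (drule conjunct1, simp)+

lemma ds_const:
  assumes "diffeological_space X" "x \<in> points X" "openin (Euclidean_space n) U"
  shows "(\<lambda>u\<in>U. x) \<in> plots X n U"
  using assms(1)[unfolded diffeological_space_def, THEN conjunct2, THEN conjunct1] assms(2,3) by simp

lemma ds_local:
  assumes "diffeological_space X" "openin (Euclidean_space n) U" "p \<in> U \<rightarrow>\<^sub>E points X"
    and "\<And>u. u \<in> U \<Longrightarrow> \<exists>V. u \<in> V \<and> V \<subseteq> U \<and> restrict p V \<in> plots X n V"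
  shows "p \<in> plots X n U"
  using assms(1)[unfolded diffeological_space_def, THEN conjunct2, THEN conjunct2, THEN conjunct1,
      rule_format, OF assms(2,3)] assms(4) by blast

lemma ds_compose:
  assumes "diffeological_space X" "p \<in> plots X n U" "smooth_into m V n U g"
  shows "(\<lambda>v\<in>V. p (g v)) \<in> plots X m V"
proof -
  have "compose V p (restrict g V) \<in> plots X m V"
    using assms(1)[unfolded diffeological_space_def, THEN conjunct2, THEN conjunct2, THEN conjunct2,
        rule_format, OF assms(2) restrict_euclidean_plot[OF assms(3)]] .
  moreover have "compose V p (restrict g V) = (\<lambda>v\<in>V. p (g v))"
    by (auto simp: compose_def)
  ultimately show ?thesis by simp
qed

lemma ds_restrict:
  assumes "diffeological_space X" "p \<in> plots X n U" "V \<subseteq> U" "openin (Euclidean_space n) V"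
  shows "restrict p V \<in> plots X n V"
  using ds_compose[OF assms(1,2), of n V "\<lambda>v. v"] assms(3,4) smooth_into_id smooth_into_mono by blast

text \<open>The local pieces may be any plots that agree with \<open>p\<close>; they also show that
  \<open>p\<close> takes its values in \<open>X\<close>.\<close>

lemma ds_glue:
  assumes X: "diffeological_space X" and U: "openin (Euclidean_space n) U" and p: "p \<in> extensional U"
    and loc: "\<And>u. u \<in> U \<Longrightarrow> \<exists>V q. u \<in> V \<and> V \<subseteq> U \<and> q \<in> plots X n V \<and> (\<forall>v\<in>V. p v = q v)"
  shows "p \<in> plots X n U"
proof -
  have "p u \<in> points X" if u: "u \<in> U" for u
  proof -
    obtain V q where V: "u \<in> V" "q \<in> plots X n V" "\<forall>v\<in>V. p v = q v" using loc[OF u] by blast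
    show ?thesis using ds_PiE[OF X V(2)] V(1,3) by (auto simp: PiE_def Pi_def)
  qed
  then have pP: "p \<in> U \<rightarrow>\<^sub>E points X" using p by (simp add: PiE_def)
  show ?thesis
  proof (rule ds_local[OF X U pP])
    show "\<exists>V. u \<in> V \<and> V \<subseteq> U \<and> restrict p V \<in> plots X n V" if u: "u \<in> U" for u
    proof -
      obtain V q where V: "u \<in> V" "V \<subseteq> U" "q \<in> plots X n V" "\<forall>v\<in>V. p v = q v"
        using loc[OF u] by blast
      have "restrict p V = q"
        using ds_PiE[OF X V(3)] V(4) by (auto simp: PiE_def extensional_def restrict_def)
      with V show ?thesis by auto
    qed
  qed
qed

lemma smooth_map_plot: "smooth_map X Y f \<Longrightarrow> p \<in> plots X n U \<Longrightarrow> (\<lambda>u\<in>U. f (p u)) \<in> plots Y n U"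
  unfolding smooth_map_def compose_def by blast

lemma points_dprod: "points (dprod X Y) = points X \<times> points Y"
  by (simp add: dprod_def)

lemma dprod_plot_pair:
  assumes "p \<in> plots X n U" "q \<in> plots Y n U" "p \<in> U \<rightarrow>\<^sub>E points X" "q \<in> U \<rightarrow>\<^sub>E points Y"
  shows "(\<lambda>u\<in>U. (p u, q u)) \<in> plots (dprod X Y) n U"
proof -
  have "compose U fst (\<lambda>u\<in>U. (p u, q u)) = p" "compose U snd (\<lambda>u\<in>U. (p u, q u)) = q"
    using assms by (auto simp: compose_def PiE_def extensional_def fun_eq_iff)
  then show ?thesis using assms by (auto simp: dprod_def)
qed

lemma smooth_map_dprodI:
  assumes "\<And>x y. x \<in> points X \<Longrightarrow> y \<in> points Y \<Longrightarrow> h x y \<in> points Z"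
    and "\<And>n U p q. p \<in> plots X n U \<Longrightarrow> q \<in> plots Y n U \<Longrightarrow> p \<in> U \<rightarrow> points X \<Longrightarrow> q \<in> U \<rightarrow> points Y \<Longrightarrow>
      (\<lambda>u\<in>U. h (p u) (q u)) \<in> plots Z n U"
  shows "smooth_map (dprod X Y) Z (\<lambda>(x, y). h x y)"
  unfolding smooth_map_def
proof (intro conjI allI ballI)
  show "(\<lambda>(x, y). h x y) \<in> points (dprod X Y) \<rightarrow> points Z"
    using assms(1) by (auto simp: points_dprod)
  fix n U P assume P: "P \<in> plots (dprod X Y) n U"
  then have "P \<in> U \<rightarrow>\<^sub>E points X \<times> points Y" "compose U fst P \<in> plots X n U" "compose U snd P \<in> plots Y n U"
    by (simp_all add: dprod_def)
  then have "(\<lambda>u\<in>U. h (compose U fst P u) (compose U snd P u)) \<in> plots Z n U"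
    by (intro assms(2)[of "compose U fst P" n U "compose U snd P"]) (auto simp: compose_def PiE_def Pi_def mem_Times_iff)
  also have "(\<lambda>u\<in>U. h (compose U fst P u) (compose U snd P u)) = compose U (\<lambda>(x, y). h x y) P"
    by (auto simp: compose_def case_prod_beta)
  finally show "compose U (\<lambda>(x, y). h x y) P \<in> plots Z n U" .
qed

lemma smooth_map_dprodD:
  assumes "smooth_map (dprod X Y) Z (\<lambda>(x, y). h x y)"
    and "p \<in> plots X n U" "q \<in> plots Y n U" "p \<in> U \<rightarrow>\<^sub>E points X" "q \<in> U \<rightarrow>\<^sub>E points Y"
  shows "(\<lambda>u\<in>U. h (p u) (q u)) \<in> plots Z n U"
  using smooth_map_plot[OF assms(1) dprod_plot_pair[OF assms(2-5)]] by (simp cong: restrict_cong)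

lemma subdspace_points: "points (subdspace X A) = points X \<inter> A"
  by (simp add: subdspace_def)

lemma subdspace_plots: "p \<in> plots (subdspace X A) n U \<longleftrightarrow> p \<in> plots X n U \<and> p ` U \<subseteq> A"
  by (simp add: subdspace_def)

lemma nebula_plot_iff:
  "p \<in> plots (nebula :: 'a::{real_vector, t2_space} dvs) n U \<longleftrightarrow>
    p \<in> extensional U \<and> openin (Euclidean_space n) U \<and> smooth_on n U p"
  by (auto simp: nebula_def)

lemma points_nebula [simp]: "points (nebula :: 'a::{real_vector, t2_space} dvs) = UNIV"
  by (simp add: nebula_def)

lemma nebula_restrict_plot:
  fixes f :: "vec \<Rightarrow> 'a::{real_vector, t2_space}"
  assumes "openin (Euclidean_space n) U" "smooth_on n U f"
  shows "restrict f U \<in> plots (nebula :: 'a dvs) n U"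
  unfolding nebula_plot_iff using assms smooth_on_cong[OF assms(1), of "restrict f U" f] by simp

section \<open>The diffeologies of \<open>L(F)\<close>, \<open>GL(F)\<close> and \<open>gl(F)\<close>\<close>

lemma smooth_map_nebula_iff:
  fixes l :: "'a::{real_vector, t2_space} \<Rightarrow> 'b::{real_vector, t2_space}"
  shows "smooth_map (nebula :: 'a dvs) (nebula :: 'b dvs) l \<longleftrightarrow> smooth_fun l"
proof
  assume l: "smooth_map (nebula :: 'a dvs) (nebula :: 'b dvs) l"
  show "smooth_fun l" unfolding smooth_fun_def
  proof (intro allI impI)
    fix n U and f :: "vec \<Rightarrow> 'a" assume U: "openin (Euclidean_space n) U" "smooth_on n U f"
    from smooth_map_plot[OF l nebula_restrict_plot[OF U]]
    have "smooth_on n U (\<lambda>u\<in>U. l (restrict f U u))" by (simp add: nebula_plot_iff)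
    then show "smooth_on n U (\<lambda>x. l (f x))"
      using smooth_on_cong[OF U(1), of "\<lambda>u\<in>U. l (restrict f U u)" "\<lambda>x. l (f x)"] by simp
  qed
next
  assume l: "smooth_fun l"
  show "smooth_map (nebula :: 'a dvs) (nebula :: 'b dvs) l"
    unfolding smooth_map_def compose_def
    by (auto simp: nebula_plot_iff[where ?'a='a] intro!: nebula_restrict_plot smooth_funD[OF l])
qed

lemma L_point_iff:
  "l \<in> points (L_space :: ('f::{real_vector, t2_space} \<Rightarrow> 'f) dvs) \<longleftrightarrow> linear l \<and> smooth_fun l"
  by (auto simp: L_space_def subdspace_def Cinf_def Let_def smooth_map_nebula_iff)

lemma smooth_family_iff_smooth_map:
  fixes p :: "vec \<Rightarrow> 'a::{real_vector, t2_space} \<Rightarrow> 'b::{real_vector, t2_space}"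
  shows "smooth_family n U p \<longleftrightarrow> openin (Euclidean_space n) U \<and>
    smooth_map (dprod (euclidean_domain n U) (nebula :: 'a dvs)) (nebula :: 'b dvs) (\<lambda>(u, x). p u x)"
    (is "_ \<longleftrightarrow> _ \<and> ?S")
proof (intro iffI conjI)
  assume p: "smooth_family n U p"
  show ?S
  proof (rule smooth_map_dprodI)
    fix m W g f
    assume g: "g \<in> plots (euclidean_domain n U) m W" and f: "f \<in> plots (nebula :: 'a dvs) m W"
    show "(\<lambda>w\<in>W. p (g w) (f w)) \<in> plots (nebula :: 'b dvs) m W"
      using f g by (intro nebula_restrict_plot smooth_familyD[OF p])
        (auto simp: nebula_plot_iff euclidean_plot_iff)
  qed auto
next
  assume *: "openin (Euclidean_space n) U \<and> ?S"
  show "smooth_family n U p" unfolding smooth_family_def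
  proof (intro conjI allI impI)
    fix m W g and f :: "vec \<Rightarrow> 'a"
    assume g: "smooth_into m W n U g" and f: "smooth_on m W f"
    have W: "openin (Euclidean_space m) W" using g by (simp add: smooth_into_def)
    have "(\<lambda>w\<in>W. p (restrict g W w) (restrict f W w)) \<in> plots (nebula :: 'b dvs) m W"
      by (rule smooth_map_dprodD[OF *[THEN conjunct2] restrict_euclidean_plot[OF g] nebula_restrict_plot[OF W f]])
         (use g in \<open>auto simp: smooth_into_def\<close>)
    then have "smooth_on m W (\<lambda>w\<in>W. p (restrict g W w) (restrict f W w))"
      by (simp add: nebula_plot_iff)
    then show "smooth_on m W (\<lambda>w. p (g w) (f w))"
      using smooth_on_cong[OF W, of "\<lambda>w\<in>W. p (restrict g W w) (restrict f W w)" "\<lambda>w. p (g w) (f w)"] by simp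
  qed (use * in blast)
qed (simp add: smooth_family_open)

lemma L_plot_iff:
  "p \<in> plots (L_space :: ('f::{real_vector, t2_space} \<Rightarrow> 'f) dvs) n U \<longleftrightarrow>
    p \<in> extensional U \<and> smooth_family n U p \<and> (\<forall>u\<in>U. linear (p u))"
proof -
  have "p \<in> plots (L_space :: ('f \<Rightarrow> 'f) dvs) n U \<longleftrightarrow>
    p \<in> extensional U \<and> (\<forall>u\<in>U. smooth_fun (p u) \<and> linear (p u)) \<and> smooth_family n U p"
    by (auto simp: L_space_def subdspace_def Cinf_def Let_def smooth_map_nebula_iff smooth_family_iff_smooth_map PiE_def Pi_def image_subset_iff)
  then show ?thesis using smooth_family_at[of n U p] by blast
qed

lemma smooth_family_cong:
  assumes "\<And>u. u \<in> U \<Longrightarrow> p u = q u"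
  shows "smooth_family n U p \<longleftrightarrow> smooth_family n U q"
proof -
  have "smooth_on m W (\<lambda>w. p (g w) (f w)) \<longleftrightarrow> smooth_on m W (\<lambda>w. q (g w) (f w))"
    if "smooth_into m W n U g" for m W g f
    by (rule smooth_on_cong) (use that assms in \<open>auto simp: smooth_into_def\<close>)
  then show ?thesis unfolding smooth_family_def by blast
qed

lemma smooth_family_compose:
  fixes p :: "vec \<Rightarrow> 'b::{real_vector, t2_space} \<Rightarrow> 'c::{real_vector, t2_space}"
  assumes "smooth_family n U p" "smooth_family n U q"
  shows "smooth_family n U (\<lambda>u. p u \<circ> q u)"
  using assms unfolding smooth_family_def o_def by blast

lemma smooth_family_reparam:
  fixes p :: "vec \<Rightarrow> 'a::{real_vector, t2_space} \<Rightarrow> 'b::{real_vector, t2_space}"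
  assumes "smooth_family n U p" "smooth_into m V n U g"
  shows "smooth_family m V (\<lambda>v. p (g v))"
  unfolding smooth_family_def
proof (intro conjI allI impI)
  show "openin (Euclidean_space m) V" using assms(2) by (simp add: smooth_into_def)
  fix k W h and f :: "vec \<Rightarrow> 'a" assume "smooth_into k W m V h" "smooth_on k W f"
  then show "smooth_on k W (\<lambda>w. p (g (h w)) (f w))"
    using smooth_familyD[OF assms(1) smooth_into_trans[OF _ assms(2)]] by blast
qed

lemma smooth_family_const:
  "smooth_fun l \<Longrightarrow> openin (Euclidean_space n) U \<Longrightarrow> smooth_family n U (\<lambda>_. l)"
  by (auto simp: smooth_family_def smooth_fun_def smooth_into_def)

lemma smooth_family_local:
  fixes p :: "vec \<Rightarrow> 'a::{real_vector, t2_space} \<Rightarrow> 'b::{real_vector, t2_space}"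
  assumes U: "openin (Euclidean_space n) U"
    and loc: "\<And>u. u \<in> U \<Longrightarrow> \<exists>V. u \<in> V \<and> smooth_family n V p"
  shows "smooth_family n U p"
  unfolding smooth_family_def
proof (intro conjI allI impI U)
  fix m W g and f :: "vec \<Rightarrow> 'a" assume g: "smooth_into m W n U g" and f: "smooth_on m W f"
  have W: "openin (Euclidean_space m) W" using g by (simp add: smooth_into_def)
  show "smooth_on m W (\<lambda>w. p (g w) (f w))"
  proof (rule smooth_on_local[OF W])
    fix w assume w: "w \<in> W"
    then have "g w \<in> U" using g by (auto simp: smooth_into_def)
    then obtain V where V: "g w \<in> V" "smooth_family n V p" using loc by blast
    let ?W = "{w \<in> W. g w \<in> V}"
    have o: "openin (Euclidean_space m) ?W"
      using open_preimage_smooth_into[OF smooth_into_mono[OF g open_Rn_subset[OF U]] smooth_family_open[OF V(2)]] .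
    have "smooth_into m ?W n V g"
      using smooth_into_subset[OF g o] by (auto simp: smooth_into_def)
    from smooth_familyD[OF V(2) this smooth_on_subset[OF f]]
    have "smooth_on m ?W (\<lambda>w. p (g w) (f w))" by auto
    with o w V(1) show "\<exists>V. openin (Euclidean_space m) V \<and> w \<in> V \<and> smooth_on m V (\<lambda>w. p (g w) (f w))"
      by blast
  qed
qed

section \<open>The diffeological group GL(F)\<close>

lemma GL_point_iff:
  "g \<in> points (GL :: ('f::{real_vector, t2_space} \<Rightarrow> 'f) dspace) \<longleftrightarrow>
    linear g \<and> smooth_fun g \<and> bij g \<and> linear (inv g) \<and> smooth_fun (inv g)"
  by (auto simp: GL_def Let_def L_point_iff)

lemma GL_plot_iff:
  "p \<in> plots (GL :: ('f::{real_vector, t2_space} \<Rightarrow> 'f) dspace) n U \<longleftrightarrow>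
    p \<in> extensional U \<and> (\<forall>u\<in>U. p u \<in> points GL) \<and> smooth_family n U p \<and> smooth_family n U (\<lambda>u. inv (p u))"
proof -
  have "smooth_family n U (\<lambda>u\<in>U. inv (p u)) \<longleftrightarrow> smooth_family n U (\<lambda>u. inv (p u))"
    by (rule smooth_family_cong) simp
  then have "p \<in> plots (GL :: ('f \<Rightarrow> 'f) dspace) n U \<longleftrightarrow> p \<in> U \<rightarrow>\<^sub>E points GL \<and>
      (p \<in> extensional U \<and> smooth_family n U p \<and> (\<forall>u\<in>U. linear (p u))) \<and>
      (smooth_family n U (\<lambda>u. inv (p u)) \<and> (\<forall>u\<in>U. linear (inv (p u))))"
    by (simp add: GL_def Let_def L_plot_iff)
  then show ?thesis by (auto simp: GL_point_iff PiE_def)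
qed

lemma GL_restrict_plot:
  fixes p :: "vec \<Rightarrow> 'f::{real_vector, t2_space} \<Rightarrow> 'f"
  assumes "\<And>u. u \<in> U \<Longrightarrow> p u \<in> points GL" "smooth_family n U p" "smooth_family n U (\<lambda>u. inv (p u))"
  shows "restrict p U \<in> plots GL n U"
  using assms smooth_family_cong[of U "restrict p U" p n]
    smooth_family_cong[of U "\<lambda>u. inv (restrict p U u)" "\<lambda>u. inv (p u)" n]
  by (simp add: GL_plot_iff)

lemma smooth_fun_compose: "smooth_fun f \<Longrightarrow> smooth_fun g \<Longrightarrow> smooth_fun (f \<circ> g)"
  by (auto simp: smooth_fun_def)

lemma smooth_fun_id: "smooth_fun id" "smooth_fun (\<lambda>x. x)"
  by (auto simp: smooth_fun_def)

lemma GL_id: "id \<in> points (GL :: ('f::{real_vector, t2_space} \<Rightarrow> 'f) dspace)"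
  by (simp add: GL_point_iff smooth_fun_id linear_id[unfolded id_def[symmetric]] module_hom_id)

lemma GL_inv: "g \<in> points (GL :: ('f::{real_vector, t2_space} \<Rightarrow> 'f) dspace) \<Longrightarrow> inv g \<in> points GL"
  by (auto simp: GL_point_iff bij_imp_bij_inv inv_inv_eq)

lemma GL_mult:
  fixes g h :: "'f::{real_vector, t2_space} \<Rightarrow> 'f"
  assumes "g \<in> points GL" "h \<in> points GL"
  shows "g \<circ> h \<in> points GL"
  using assms by (auto simp: GL_point_iff o_inv_distrib intro: linear_compose smooth_fun_compose bij_comp)

lemma GL_bij: "g \<in> points (GL :: ('f::{real_vector, t2_space} \<Rightarrow> 'f) dspace) \<Longrightarrow> bij g"
  by (simp add: GL_point_iff)

lemma GL_linear: "g \<in> points (GL :: ('f::{real_vector, t2_space} \<Rightarrow> 'f) dspace) \<Longrightarrow> linear g"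
  by (simp add: GL_point_iff)

lemma GL_cancel:
  assumes "g \<in> points (GL :: ('f::{real_vector, t2_space} \<Rightarrow> 'f) dspace)"
  shows "inv g \<circ> g = id" "g \<circ> inv g = id" "inv g (g x) = x" "g (inv g x) = x"
  using GL_bij[OF assms]
  by (simp_all add: bij_is_inj bij_is_surj surj_f_inv_f surj_iff[symmetric] inj_iff[symmetric])

lemma GL_plot_mult:
  fixes p q :: "vec \<Rightarrow> 'f::{real_vector, t2_space} \<Rightarrow> 'f"
  assumes "p \<in> plots GL n U" "q \<in> plots GL n U"
  shows "(\<lambda>u\<in>U. p u \<circ> q u) \<in> plots GL n U"
proof (rule GL_restrict_plot)
  show "p u \<circ> q u \<in> points GL" if "u \<in> U" for u using assms that by (auto simp: GL_plot_iff GL_mult)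
  show "smooth_family n U (\<lambda>u. p u \<circ> q u)" using assms by (auto simp: GL_plot_iff intro: smooth_family_compose)
  have "smooth_family n U (\<lambda>u. inv (q u) \<circ> inv (p u))" using assms by (auto simp: GL_plot_iff intro: smooth_family_compose)
  moreover have "inv (p u \<circ> q u) = inv (q u) \<circ> inv (p u)" if "u \<in> U" for u
    using assms that by (intro o_inv_distrib) (auto simp: GL_plot_iff GL_bij)
  ultimately show "smooth_family n U (\<lambda>u. inv (p u \<circ> q u))"
    using smooth_family_cong[of U "\<lambda>u. inv (p u \<circ> q u)" "\<lambda>u. inv (q u) \<circ> inv (p u)" n] by simp
qed

lemma GL_plot_inv:
  fixes p :: "vec \<Rightarrow> 'f::{real_vector, t2_space} \<Rightarrow> 'f"
  assumes "p \<in> plots GL n U"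
  shows "(\<lambda>u\<in>U. inv (p u)) \<in> plots GL n U"
proof (rule GL_restrict_plot)
  have "inv (inv (p u)) = p u" if "u \<in> U" for u
    using assms that by (intro inv_inv_eq) (auto simp: GL_plot_iff GL_bij)
  then show "smooth_family n U (\<lambda>u. inv (inv (p u)))"
    using assms smooth_family_cong[of U "\<lambda>u. inv (inv (p u))" p n] by (simp add: GL_plot_iff)
qed (use assms in \<open>auto simp: GL_plot_iff GL_inv\<close>)

lemma diffeological_space_GL: "diffeological_space (GL :: ('f::{real_vector, t2_space} \<Rightarrow> 'f) dspace)"
  unfolding diffeological_space_def
proof (intro conjI allI ballI impI)
  fix n U p assume p: "p \<in> plots (GL :: ('f \<Rightarrow> 'f) dspace) n U"
  then show "openin (Euclidean_space n) U" "p \<in> U \<rightarrow>\<^sub>E points GL"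
    by (auto simp: GL_plot_iff smooth_family_open PiE_def)
next
  fix n U x assume "x \<in> points (GL :: ('f \<Rightarrow> 'f) dspace)" "openin (Euclidean_space n) U"
  then show "(\<lambda>u\<in>U. x) \<in> plots GL n U"
    by (intro GL_restrict_plot smooth_family_const) (auto simp: GL_point_iff)
next
  fix n U p
  assume U: "openin (Euclidean_space n) U" and p: "p \<in> U \<rightarrow>\<^sub>E points (GL :: ('f \<Rightarrow> 'f) dspace)"
    and loc: "\<forall>u\<in>U. \<exists>V. u \<in> V \<and> V \<subseteq> U \<and> restrict p V \<in> plots GL n V"
  have 1: "\<exists>V. u \<in> V \<and> smooth_family n V p \<and> smooth_family n V (\<lambda>u. inv (p u))" if "u \<in> U" for u
  proof -
    obtain V where V: "u \<in> V" "restrict p V \<in> plots GL n V" using loc \<open>u \<in> U\<close> by blast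
    then show ?thesis
      using smooth_family_cong[of V "restrict p V" p n]
        smooth_family_cong[of V "\<lambda>u. inv (restrict p V u)" "\<lambda>u. inv (p u)" n]
      by (auto simp: GL_plot_iff)
  qed
  have "smooth_family n U p" "smooth_family n U (\<lambda>u. inv (p u))"
    by (rule smooth_family_local[OF U]; use 1 in blast)+
  with p show "p \<in> plots GL n U" by (auto simp: GL_plot_iff PiE_def)
next
  fix n U p m V g
  assume p: "p \<in> plots (GL :: ('f \<Rightarrow> 'f) dspace) n U" and g: "g \<in> plots (euclidean_domain n U) m V"
  from g have g': "smooth_into m V n U g" by (simp add: euclidean_plot_iff)
  show "compose V p g \<in> plots GL m V" unfolding compose_def
  proof (rule GL_restrict_plot)
    show "smooth_family m V (\<lambda>v. p (g v))" "smooth_family m V (\<lambda>v. inv (p (g v)))"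
      using p smooth_family_reparam[OF _ g'] by (auto simp: GL_plot_iff)
  qed (use p g' in \<open>auto simp: GL_plot_iff smooth_into_def\<close>)
qed

lemma diffeological_group_GL:
  "diffeological_group (GL :: ('f::{real_vector, t2_space} \<Rightarrow> 'f) dspace) (\<circ>) id"
  unfolding diffeological_group_def
proof (intro conjI ballI exI[of _ inv])
  show "smooth_map (dprod GL GL) (GL :: ('f \<Rightarrow> 'f) dspace) (\<lambda>(g, h). g \<circ> h)"
    by (rule smooth_map_dprodI) (simp_all add: GL_mult GL_plot_mult)
  show "smooth_map GL (GL :: ('f \<Rightarrow> 'f) dspace) inv"
    unfolding smooth_map_def compose_def using GL_inv GL_plot_inv by blast
qed (auto simp: GL_id GL_cancel diffeological_space_GL o_assoc)

section \<open>Velocities of paths in GL(F), and gl(F)\<close>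

lemma velocity_eq: "velocity c v = dir_deriv 1 (\<lambda>t. c (t 0) v) (\<lambda>_. 0) e1"
proof -
  have "diff_quot 0 (\<lambda>t. c (t 0) v) (\<lambda>_. 0) = (\<lambda>h. (1 / h) *\<^sub>R (c h v - c 0 v))"
    by (simp add: diff_quot_def fun_eq_iff)
  then show ?thesis
    by (simp only: velocity_def dir_deriv_e1 partial_deriv_def)
qed

lemma GL_path_iff:
  "c \<in> points (GL_paths :: (real \<Rightarrow> 'f::{real_vector, t2_space} \<Rightarrow> 'f) dspace) \<longleftrightarrow> smooth_map nebula GL c \<and> c 0 = id"
  by (auto simp: GL_paths_def subdspace_def Cinf_def Let_def)

lemma GL_path_plot:
  fixes c :: "real \<Rightarrow> 'f::{real_vector, t2_space} \<Rightarrow> 'f"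
  assumes "c \<in> points GL_paths"
  shows "(\<lambda>t\<in>Rn 1. c (t 0)) \<in> plots GL 1 (Rn 1)"
proof -
  have "restrict (\<lambda>t. t 0) (Rn 1) \<in> plots (nebula :: real dvs) 1 (Rn 1)"
    by (intro nebula_restrict_plot open_Rn_UNIV smooth_on_coord)
  from smooth_map_plot[OF _ this] assms have "(\<lambda>t\<in>Rn 1. c (restrict (\<lambda>t. t 0) (Rn 1) t)) \<in> plots GL 1 (Rn 1)"
    by (auto simp: GL_path_iff)
  then show ?thesis by (simp cong: restrict_cong)
qed

lemma GL_path_smooth_family:
  assumes "c \<in> points GL_paths"
  shows "smooth_family 1 (Rn 1) (\<lambda>t. c (t 0))"
  using GL_path_plot[OF assms] smooth_family_cong[of "Rn 1" "\<lambda>t\<in>Rn 1. c (t 0)" "\<lambda>t. c (t 0)" 1]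
  by (simp add: GL_plot_iff)

lemma GL_path_point:
  assumes "c \<in> points GL_paths" shows "c r \<in> points GL"
  using assms by (auto simp: GL_path_iff smooth_map_def)

lemma zero_in_Rn: "(\<lambda>_. 0) \<in> Rn n"
  by (simp add: Rn_iff)

lemma linear_velocity:
  fixes c :: "real \<Rightarrow> 'f::locally_convex_space \<Rightarrow> 'f"
  assumes c: "c \<in> points GL_paths"
  shows "linear (velocity c)"
proof -
  have s: "smooth_on 1 (Rn 1) (\<lambda>t. c (t 0) v)" for v
    using smooth_familyD[OF GL_path_smooth_family[OF c] smooth_into_id[OF open_Rn_UNIV] smooth_on_const[OF open_Rn_UNIV]] .
  have lin: "c r (a *\<^sub>R v + b *\<^sub>R w) = a *\<^sub>R c r v + b *\<^sub>R c r w" for r a b v w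
    using GL_linear[OF GL_path_point[OF c]] by (simp add: linear_add linear_cmul)
  have *: "velocity c (a *\<^sub>R v + b *\<^sub>R w) = a *\<^sub>R velocity c v + b *\<^sub>R velocity c w" for a b v w
    using dir_deriv_lin[OF s s zero_in_Rn] by (simp add: velocity_eq lin)
  \<comment> \<open>Coefficients 1 and 1 give additivity, a and 0 give homogeneity.\<close>
  show ?thesis
    using *[of 1 _ 1] *[of _ _ 0] by (intro linearI) auto
qed

text \<open>A plot of \<open>GL_paths\<close> is smooth jointly in its parameter and in time, so the
  derivative at time 0 is a parametric directional derivative and depends smoothly on the remaining
  variables.\<close>

lemma GL_paths_plot_velocity:
  fixes p :: "vec \<Rightarrow> real \<Rightarrow> 'f::locally_convex_space \<Rightarrow> 'f"
  assumes p: "p \<in> plots GL_paths n V"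
  shows "smooth_family n V (\<lambda>v. velocity (p v))"
proof -
  have V: "openin (Euclidean_space n) V"
    and ps: "smooth_map (dprod (euclidean_domain n V) (nebula :: real dvs)) GL (\<lambda>(v, t). p v t)"
    using p by (auto simp: GL_paths_def subdspace_def Cinf_def Let_def)
  show ?thesis unfolding smooth_family_def
  proof (intro conjI allI impI V)
    fix m W g and f :: "vec \<Rightarrow> 'f" assume g: "smooth_into m W n V g" and f: "smooth_on m W f"
    have W: "openin (Euclidean_space m) W" using g by (simp add: smooth_into_def)
    let ?P = "prod_domain m 1 W (Rn 1)"
    note P = open_prod_domain[OF W open_Rn_UNIV[of 1]]
    note pr = smooth_into_prod_domain[OF W open_Rn_UNIV[of 1]]
    have g': "smooth_into (m + 1) ?P n V (\<lambda>w. g (vfst m w))"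
      by (rule smooth_into_trans[OF pr(1) g])
    have t': "smooth_on (m + 1) ?P (\<lambda>w. vsnd m 1 w 0)"
      using pr(2) by (simp add: smooth_into_def)
    have "(\<lambda>w\<in>?P. p (restrict (\<lambda>w. g (vfst m w)) ?P w) (restrict (\<lambda>w. vsnd m 1 w 0) ?P w)) \<in> plots GL (m + 1) ?P"
      by (rule smooth_map_dprodD[OF ps restrict_euclidean_plot[OF g'] nebula_restrict_plot[OF P t']])
         (use g' in \<open>auto simp: smooth_into_def\<close>)
    then have "smooth_family (m + 1) ?P (\<lambda>w\<in>?P. p (restrict (\<lambda>w. g (vfst m w)) ?P w) (restrict (\<lambda>w. vsnd m 1 w 0) ?P w))"
      by (simp add: GL_plot_iff)
    then have "smooth_family (m + 1) ?P (\<lambda>w. p (g (vfst m w)) (vsnd m 1 w 0))"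
      by (subst smooth_family_cong[where q="\<lambda>w\<in>?P. p (restrict (\<lambda>w. g (vfst m w)) ?P w) (restrict (\<lambda>w. vsnd m 1 w 0) ?P w)"]) auto
    from smooth_familyD[OF this smooth_into_id[OF P] smooth_into_compose[OF pr(1) W f]]
    have "smooth_on (m + 1) ?P (\<lambda>w. p (g (vfst m w)) (vsnd m 1 w 0) (f (vfst m w)))" .
    then have "smooth_on m W (\<lambda>s. dir_deriv 1 ((\<lambda>s t. p (g s) (t 0) (f s)) s) ((\<lambda>_ _. 0) s) ((\<lambda>_. e1) s))"
      by (intro smooth_parametric_dir_deriv[OF W open_Rn_UNIV, of 1 _ _ "Rn 1"] smooth_into_const W)
         (auto simp: Rn_iff)
    then show "smooth_on m W (\<lambda>w. velocity (p (g w)) (f w))"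
      by (simp add: velocity_eq)
  qed
qed

lemma gl_point_velocity:
  "X \<in> points (gl :: ('f::{real_vector, t2_space} \<Rightarrow> 'f) dvs) \<Longrightarrow> \<exists>c\<in>points GL_paths. X = velocity c"
  by (auto simp: gl_def Let_def pushforward_def)

lemma gl_point_linear: "X \<in> points (gl :: ('f::locally_convex_space \<Rightarrow> 'f) dvs) \<Longrightarrow> linear X"
  using gl_point_velocity linear_velocity by blast

text \<open>Plots of \<open>gl\<close> lift locally to families of paths, so
  \<open>GL_paths_plot_velocity\<close> applies: the inclusion of gl(F) into L(F) is smooth. The
  passage from forms to covariant derivatives uses the diffeology of gl(F) only through
  this.\<close>

lemma gl_plot_smooth_family:
  assumes "q \<in> plots (gl :: ('f::locally_convex_space \<Rightarrow> 'f) dvs) n U"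
  shows "smooth_family n U q" "\<And>u. u \<in> U \<Longrightarrow> linear (q u)"
proof -
  have U: "openin (Euclidean_space n) U" and qP: "q \<in> U \<rightarrow>\<^sub>E points gl"
    and loc: "\<forall>u\<in>U. \<exists>V. \<exists>p\<in>plots GL_paths n V. u \<in> V \<and> V \<subseteq> U \<and> (\<forall>v\<in>V. q v = velocity (p v))"
    using assms by (auto simp: gl_def Let_def pushforward_def)
  show "smooth_family n U q"
  proof (rule smooth_family_local[OF U])
    fix u assume "u \<in> U"
    then obtain V p where V: "p \<in> plots GL_paths n V" "u \<in> V" "\<forall>v\<in>V. q v = velocity (p v)"
      using loc by blast
    then have "smooth_family n V q"
      using smooth_family_cong[of V q "\<lambda>v. velocity (p v)" n] GL_paths_plot_velocity[OF V(1)] by simp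
    with V(2) show "\<exists>V. u \<in> V \<and> smooth_family n V q" by blast
  qed
  show "linear (q u)" if "u \<in> U" for u
    using qP that gl_point_linear by blast
qed

lemma gl_vs: "vadd gl = (\<lambda>l k v. l v + k v)" "vscale gl = (\<lambda>a l v. a *\<^sub>R l v)"
  by (simp_all add: gl_def L_space_def Let_def)

section \<open>The frame bundle\<close>

lemma manifold_plot_iff:
  "p \<in> plots (manifold_nebula T A) n U \<longleftrightarrow> p \<in> U \<rightarrow>\<^sub>E topspace T \<and> openin (Euclidean_space n) U \<and>
    (\<forall>W. openin T W \<longrightarrow> openin (Euclidean_space n) {u \<in> U. p u \<in> W}) \<and>
    (\<forall>(W, \<phi>)\<in>A. smooth_on n {u \<in> U. p u \<in> W} (\<phi> \<circ> p))"
proof -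
  have "continuous_map (subtopology (Euclidean_space n) U) T p \<longleftrightarrow>
      (\<forall>W. openin T W \<longrightarrow> openin (Euclidean_space n) {u \<in> U. p u \<in> W})"
    if p: "p \<in> U \<rightarrow>\<^sub>E topspace T" and U: "openin (Euclidean_space n) U"
  proof -
    have "topspace (subtopology (Euclidean_space n) U) = U"
      using open_Rn_subset[OF U] by auto
    moreover have "{u \<in> U. p u \<in> W} \<subseteq> U" for W by auto
    ultimately show ?thesis
      using p unfolding continuous_map_def by (auto simp: openin_open_subtopology[OF U])
  qed
  then show ?thesis unfolding manifold_nebula_def by auto
qed

lemma points_manifold [simp]: "points (manifold_nebula T A) = topspace T"
  by (simp add: manifold_nebula_def)

lemma diffeological_space_manifold:
  fixes A :: "('m set \<times> ('m \<Rightarrow> 'b::locally_convex_space)) set"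
  assumes "smooth_manifold T A"
  shows "diffeological_space (manifold_nebula T A)"
proof -
  have chart: "openin T W" if "(W, \<phi>) \<in> A" for W \<phi>
    using assms that unfolding smooth_manifold_def by blast
  show ?thesis unfolding diffeological_space_def
  proof (intro conjI allI ballI impI)
    fix n U p assume p: "p \<in> plots (manifold_nebula T A) n U"
    then show "openin (Euclidean_space n) U" "p \<in> U \<rightarrow>\<^sub>E points (manifold_nebula T A)"
      by (simp_all add: manifold_plot_iff)
  next
    fix n U x assume x: "x \<in> points (manifold_nebula T A)" and U: "openin (Euclidean_space n) U"
    have o: "openin (Euclidean_space n) {u \<in> U. (\<lambda>u\<in>U. x) u \<in> W}" for W
    proof -
      have "{u \<in> U. (\<lambda>u\<in>U. x) u \<in> W} = (if x \<in> W then U else {})" by auto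
      then show ?thesis using U by simp
    qed
    have "smooth_on n {u \<in> U. (\<lambda>u\<in>U. x) u \<in> W} (\<phi> \<circ> (\<lambda>u\<in>U. x))" for W and \<phi> :: "'m \<Rightarrow> 'b"
      using smooth_on_const[OF o[of W], where c="\<phi> x"]
        smooth_on_cong[OF o[of W], where f="\<lambda>_. \<phi> x" and g="\<phi> \<circ> (\<lambda>u\<in>U. x)"] by auto
    with o x U show "(\<lambda>u\<in>U. x) \<in> plots (manifold_nebula T A) n U"
      unfolding manifold_plot_iff by auto
  next
    fix n U p
    assume U: "openin (Euclidean_space n) U" and p: "p \<in> U \<rightarrow>\<^sub>E points (manifold_nebula T A)"
      and loc: "\<forall>u\<in>U. \<exists>V. u \<in> V \<and> V \<subseteq> U \<and> restrict p V \<in> plots (manifold_nebula T A) n V"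
    have o: "openin (Euclidean_space n) {u \<in> U. p u \<in> W}" if W: "openin T W" for W
    proof (subst openin_subopen, intro ballI)
      fix u assume "u \<in> {u \<in> U. p u \<in> W}"
      then obtain V where V: "u \<in> V" "V \<subseteq> U" "restrict p V \<in> plots (manifold_nebula T A) n V" "p u \<in> W"
        using loc by blast
      have eq: "{v \<in> V. restrict p V v \<in> W} = {v \<in> V. p v \<in> W}" by auto
      have "openin (Euclidean_space n) {v \<in> V. restrict p V v \<in> W}"
        using V(3) W unfolding manifold_plot_iff by blast
      then have "openin (Euclidean_space n) {v \<in> V. p v \<in> W}" by (simp only: eq)
      with V show "\<exists>S. openin (Euclidean_space n) S \<and> u \<in> S \<and> S \<subseteq> {u \<in> U. p u \<in> W}"
        by (intro exI[of _ "{v \<in> V. p v \<in> W}"]) auto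
    qed
    have "smooth_on n {u \<in> U. p u \<in> W} (\<phi> \<circ> p)" if W\<phi>: "(W, \<phi>) \<in> A" for W \<phi>
    proof (rule smooth_on_local[OF o[OF chart[OF W\<phi>]]])
      fix u assume "u \<in> {u \<in> U. p u \<in> W}"
      then obtain V where V: "u \<in> V" "V \<subseteq> U" "restrict p V \<in> plots (manifold_nebula T A) n V" "p u \<in> W"
        using loc by blast
      have eq: "{v \<in> V. restrict p V v \<in> W} = {v \<in> V. p v \<in> W}" by auto
      have o': "openin (Euclidean_space n) {v \<in> V. p v \<in> W}"
        using V(3) chart[OF W\<phi>] unfolding manifold_plot_iff eq[symmetric] by blast
      have "smooth_on n {v \<in> V. p v \<in> W} (\<phi> \<circ> restrict p V)"
        using V(3) W\<phi> unfolding manifold_plot_iff eq[symmetric] by blast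
      then have "smooth_on n {v \<in> V. p v \<in> W} (\<phi> \<circ> p)"
        using smooth_on_cong[OF o', of "\<phi> \<circ> restrict p V" "\<phi> \<circ> p"] by auto
      with o' V(1,4) show "\<exists>V. openin (Euclidean_space n) V \<and> u \<in> V \<and> smooth_on n V (\<phi> \<circ> p)" by blast
    qed
    with o U p show "p \<in> plots (manifold_nebula T A) n U" unfolding manifold_plot_iff by auto
  next
    fix n U p m V g
    assume p: "p \<in> plots (manifold_nebula T A) n U" and g: "g \<in> plots (euclidean_domain n U) m V"
    have g': "smooth_into m V n U g" using g by (simp add: euclidean_plot_iff)
    have U: "openin (Euclidean_space n) U" and V: "openin (Euclidean_space m) V"
      using p g' by (auto simp: manifold_plot_iff smooth_into_def)
    have gU: "g v \<in> U" if "v \<in> V" for v using g' that by (auto simp: smooth_into_def)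
    have o: "openin (Euclidean_space m) {v \<in> V. compose V p g v \<in> W}" if W: "openin T W" for W
    proof -
      have "openin (Euclidean_space n) {u \<in> U. p u \<in> W}"
        using p W unfolding manifold_plot_iff by blast
      from open_preimage_smooth_into[OF smooth_into_mono[OF g' open_Rn_subset[OF U]] this]
      have "openin (Euclidean_space m) {v \<in> V. g v \<in> {u \<in> U. p u \<in> W}}" .
      also have "{v \<in> V. g v \<in> {u \<in> U. p u \<in> W}} = {v \<in> V. compose V p g v \<in> W}"
        using gU by (auto simp: compose_def)
      finally show ?thesis .
    qed
    have "smooth_on m {v \<in> V. compose V p g v \<in> W} (\<phi> \<circ> compose V p g)" if W\<phi>: "(W, \<phi>) \<in> A" for W \<phi>
    proof -
      note oW = o[OF chart[OF W\<phi>]]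
      have 1: "smooth_on n {u \<in> U. p u \<in> W} (\<phi> \<circ> p)" and 2: "openin (Euclidean_space n) {u \<in> U. p u \<in> W}"
        using p W\<phi> chart[OF W\<phi>] unfolding manifold_plot_iff by auto
      have "smooth_into m {v \<in> V. compose V p g v \<in> W} n {u \<in> U. p u \<in> W} g"
        using smooth_into_subset[OF g' oW] gU by (auto simp: smooth_into_def compose_def)
      from smooth_into_compose[OF this 2 1]
      show ?thesis
        using smooth_on_cong[OF oW, of "\<lambda>w. (\<phi> \<circ> p) (g w)" "\<phi> \<circ> compose V p g"] by (auto simp: compose_def)
    qed
    moreover have "compose V p g \<in> V \<rightarrow>\<^sub>E topspace T"
      using p gU unfolding manifold_plot_iff by (auto simp: compose_def)
    ultimately show "compose V p g \<in> plots (manifold_nebula T A) m V"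
      unfolding manifold_plot_iff using o V by blast
  qed
qed

lemma linear_inv_of_bij:
  assumes "linear f" "bij f"
  shows "linear (inv f)"
proof (rule linearI)
  have inv: "inv f z = w" if "f w = z" for z w
    using that assms(2) by (auto simp: bij_is_inj)
  show "inv f (x + y) = inv f x + inv f y" for x y
    by (rule inv) (simp add: linear_add[OF assms(1)] assms(2) bij_is_surj surj_f_inv_f)
  show "inv f (r *\<^sub>R x) = r *\<^sub>R inv f x" for r x
    by (rule inv) (simp add: linear_cmul[OF assms(1)] assms(2) bij_is_surj surj_f_inv_f)
qed

section \<open>Trivializations and transition maps of a vector bundle\<close>

locale manifold_bundle =
  fixes T :: "'m topology"
    and A :: "('m set \<times> ('m \<Rightarrow> 'b::locally_convex_space)) set"
    and E :: "('m, 'e, 'f::locally_convex_space) vbundle"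
  assumes manifold: "smooth_manifold T A"
    and vb: "vector_bundle T A E"
begin

abbreviation "M \<equiv> manifold_nebula T A"

lemmas ds_M = diffeological_space_manifold[OF manifold]

lemmas vb_unfolded = vb[unfolded vector_bundle_def]

lemma ds_total: "diffeological_space (total E)"
  using vb_unfolded by (rule conjunct1)

lemma triv_exists: "x \<in> topspace T \<Longrightarrow> \<exists>W \<tau>. (W, \<tau>) \<in> trivs E \<and> x \<in> W"
  unfolding vb_unfolded[THEN conjunct2, THEN conjunct2, THEN conjunct2, THEN conjunct1, symmetric] by force

lemma triv_unfolded:
  assumes "(W, \<tau>) \<in> trivs E"
  shows "W \<in> fst ` A \<and>
    diffeo (subdspace (total E) {e. proj E e \<in> W})
      (dprod (subdspace M W) (nebula :: 'f dvs)) (\<lambda>e. (proj E e, \<tau> e)) \<and>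
    (\<forall>x\<in>W. \<forall>d\<in>fiber E x. \<forall>e\<in>fiber E x. \<forall>a.
       \<tau> (fadd E d e) = \<tau> d + \<tau> e \<and> \<tau> (fscale E a e) = a *\<^sub>R \<tau> e)"
  using bspec[OF vb_unfolded[THEN conjunct2, THEN conjunct2, THEN conjunct2, THEN conjunct2] assms]
  unfolding prod.case .

lemma
  assumes "(W, \<tau>) \<in> trivs E"
  shows triv_chart: "W \<in> fst ` A"
    and triv_diffeo: "diffeo (subdspace (total E) {e. proj E e \<in> W})
      (dprod (subdspace M W) (nebula :: 'f dvs)) (\<lambda>e. (proj E e, \<tau> e))"
    and triv_add: "x \<in> W \<Longrightarrow> d \<in> fiber E x \<Longrightarrow> e \<in> fiber E x \<Longrightarrow> \<tau> (fadd E d e) = \<tau> d + \<tau> e"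
    and triv_scale: "x \<in> W \<Longrightarrow> e \<in> fiber E x \<Longrightarrow> \<tau> (fscale E a e) = a *\<^sub>R \<tau> e"
  using triv_unfolded[OF assms] by blast+

lemma triv_open:
  assumes "(W, \<tau>) \<in> trivs E" shows "openin T W" "W \<subseteq> topspace T"
proof -
  have "\<forall>(W, \<phi>)\<in>A. openin T W" using manifold unfolding smooth_manifold_def by blast
  then show "openin T W" using triv_chart[OF assms] by auto
  then show "W \<subseteq> topspace T" by (rule openin_subset)
qed

lemma fiber_add: "x \<in> topspace T \<Longrightarrow> d \<in> fiber E x \<Longrightarrow> e \<in> fiber E x \<Longrightarrow> fadd E d e \<in> fiber E x"
  and fiber_scale: "x \<in> topspace T \<Longrightarrow> e \<in> fiber E x \<Longrightarrow> fscale E a e \<in> fiber E x"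
  using vb_unfolded[THEN conjunct2, THEN conjunct2, THEN conjunct1] by blast+

lemma triv_fiber_bij:
  assumes t: "(W, \<tau>) \<in> trivs E" and x: "x \<in> W"
  shows "bij_betw \<tau> (fiber E x) UNIV"
proof -
  have b: "bij_betw (\<lambda>e. (proj E e, \<tau> e)) (points (total E) \<inter> {e. proj E e \<in> W}) (W \<times> (UNIV :: 'f set))"
    using triv_diffeo[OF t] triv_open(2)[OF t]
    by (simp add: diffeo_def points_dprod subdspace_points Int_absorb1)
  show ?thesis unfolding bij_betw_def
  proof (intro conjI inj_onI)
    fix d e assume "d \<in> fiber E x" "e \<in> fiber E x" "\<tau> d = \<tau> e"
    then show "d = e" using b x unfolding bij_betw_def inj_on_def fiber_def by auto
  next
    show "\<tau> ` fiber E x = UNIV"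
    proof (intro equalityI subsetI UNIV_I)
      fix v
      have "(x, v) \<in> (\<lambda>e. (proj E e, \<tau> e)) ` (points (total E) \<inter> {e. proj E e \<in> W})"
        using b x unfolding bij_betw_def by auto
      then show "v \<in> \<tau> ` fiber E x" by (auto simp: fiber_def)
    qed
  qed
qed

lemma
  assumes t: "(W, \<tau>) \<in> trivs E" and x: "x \<in> W"
  shows triv_inv_in_fiber: "triv_inv E \<tau> x v \<in> fiber E x"
    and triv_triv_inv: "\<tau> (triv_inv E \<tau> x v) = v"
    and triv_inv_triv: "e \<in> fiber E x \<Longrightarrow> triv_inv E \<tau> x (\<tau> e) = e"
proof -
  note b = triv_fiber_bij[OF t x]
  have "v \<in> \<tau> ` fiber E x" using b by (simp add: bij_betw_def)
  then show "triv_inv E \<tau> x v \<in> fiber E x" "\<tau> (triv_inv E \<tau> x v) = v"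
    unfolding triv_inv_def by (rule inv_into_into, rule f_inv_into_f)
  show "e \<in> fiber E x \<Longrightarrow> triv_inv E \<tau> x (\<tau> e) = e"
    using b unfolding triv_inv_def bij_betw_def by (simp add: inv_into_f_f)
qed

lemma triv_eqI:
  assumes "(W, \<tau>) \<in> trivs E" "x \<in> W" "d \<in> fiber E x" "e \<in> fiber E x" "\<tau> d = \<tau> e"
  shows "d = e"
  using triv_inv_triv[OF assms(1,2)] assms(3-5) by metis

text \<open>Together with \<open>triv_inv_plot\<close> this reads the diffeology of \<open>E\<close>
  in a trivialization: plots have smooth fiber coordinates, and smooth fiber coordinates over a plot
  of the base give plots.\<close>

lemma triv_plot_smooth:
  assumes t: "(W, \<tau>) \<in> trivs E" and P: "P \<in> plots (total E) n V" and PW: "\<And>v. v \<in> V \<Longrightarrow> proj E (P v) \<in> W"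
  shows "smooth_on n V (\<lambda>v. \<tau> (P v))"
proof -
  have V: "openin (Euclidean_space n) V" using ds_open[OF ds_total P] .
  have "P \<in> plots (subdspace (total E) {e. proj E e \<in> W}) n V"
    using P PW by (auto simp: subdspace_plots)
  moreover have "smooth_map (subdspace (total E) {e. proj E e \<in> W})
      (dprod (subdspace M W) (nebula :: 'f dvs)) (\<lambda>e. (proj E e, \<tau> e))"
    using triv_diffeo[OF t] by (simp add: diffeo_def)
  ultimately have "(\<lambda>v\<in>V. (proj E (P v), \<tau> (P v))) \<in> plots (dprod (subdspace M W) (nebula :: 'f dvs)) n V"
    by (rule smooth_map_plot[rotated])
  then have "compose V snd (\<lambda>v\<in>V. (proj E (P v), \<tau> (P v))) \<in> plots (nebula :: 'f dvs) n V"
    by (simp add: dprod_def)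
  then have "smooth_on n V (compose V snd (\<lambda>v\<in>V. (proj E (P v), \<tau> (P v))))"
    by (simp add: nebula_plot_iff)
  then show ?thesis
    using smooth_on_cong[OF V, of "compose V snd (\<lambda>v\<in>V. (proj E (P v), \<tau> (P v)))" "\<lambda>v. \<tau> (P v)"]
    by (simp add: compose_def)
qed

lemma triv_inv_plot:
  assumes t: "(W, \<tau>) \<in> trivs E" and q: "q \<in> plots M n V" "q ` V \<subseteq> W" and f: "smooth_on n V f"
  shows "(\<lambda>v\<in>V. triv_inv E \<tau> (q v) (f v)) \<in> plots (total E) n V"
proof -
  let ?S = "subdspace (total E) {e. proj E e \<in> W}" and ?t = "\<lambda>e. (proj E e, \<tau> e)"
  have V: "openin (Euclidean_space n) V" using ds_open[OF ds_M q(1)] .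
  have qS: "q \<in> plots (subdspace M W) n V" using q by (simp add: subdspace_plots)
  have qP: "q \<in> V \<rightarrow>\<^sub>E points (subdspace M W)"
    using ds_PiE[OF ds_M q(1)] q(2) by (auto simp: subdspace_points PiE_def Pi_def)
  have "(\<lambda>v\<in>V. (q v, restrict f V v)) \<in> plots (dprod (subdspace M W) (nebula :: 'f dvs)) n V"
    by (rule dprod_plot_pair[OF qS nebula_restrict_plot[OF V f] qP]) auto
  moreover have "smooth_map (dprod (subdspace M W) (nebula :: 'f dvs)) ?S (inv_into (points ?S) ?t)"
    using triv_diffeo[OF t] by (simp add: diffeo_def)
  ultimately have "(\<lambda>v\<in>V. inv_into (points ?S) ?t ((\<lambda>v\<in>V. (q v, restrict f V v)) v)) \<in> plots ?S n V"
    by (rule smooth_map_plot[rotated])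
  \<comment> \<open>The inverse of the trivialization over all of \<open>W\<close> agrees with the
    fiberwise inverse \<open>triv_inv\<close>.\<close>
  moreover have "(\<lambda>v\<in>V. inv_into (points ?S) ?t ((\<lambda>v\<in>V. (q v, restrict f V v)) v)) = (\<lambda>v\<in>V. triv_inv E \<tau> (q v) (f v))"
  proof (intro restrict_ext)
    fix v assume v: "v \<in> V"
    then have qW: "q v \<in> W" using q(2) by auto
    have "inj_on ?t (points ?S)" using triv_diffeo[OF t] by (simp add: diffeo_def bij_betw_def)
    moreover have "triv_inv E \<tau> (q v) (f v) \<in> points ?S"
      using triv_inv_in_fiber[OF t qW] qW by (auto simp: subdspace_points fiber_def)
    moreover have "?t (triv_inv E \<tau> (q v) (f v)) = (q v, f v)"
      using triv_inv_in_fiber[OF t qW, of "f v"] triv_triv_inv[OF t qW] by (simp add: fiber_def)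
    ultimately show "inv_into (points ?S) ?t ((\<lambda>v\<in>V. (q v, restrict f V v)) v) = triv_inv E \<tau> (q v) (f v)"
      using v by (simp add: inv_into_f_eq)
  qed
  ultimately show ?thesis by (simp add: subdspace_plots)
qed

lemma triv_inv_add:
  assumes t: "(W, \<tau>) \<in> trivs E" and x: "x \<in> W"
  shows "triv_inv E \<tau> x (u + v) = fadd E (triv_inv E \<tau> x u) (triv_inv E \<tau> x v)"
    and "triv_inv E \<tau> x (a *\<^sub>R v) = fscale E a (triv_inv E \<tau> x v)"
  using triv_inv_in_fiber[OF t x] triv_triv_inv[OF t x] triv_open(2)[OF t] x
  by (auto intro!: triv_eqI[OF t x] fiber_add fiber_scale simp: triv_add[OF t x] triv_scale[OF t x])

lemma transition_smooth_family:
  assumes t: "(W, \<tau>) \<in> trivs E" and t': "(W', \<tau>') \<in> trivs E"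
    and q: "q \<in> plots M n V" "q ` V \<subseteq> W \<inter> W'"
  shows "smooth_family n V (\<lambda>v. \<tau> \<circ> triv_inv E \<tau>' (q v))"
  unfolding smooth_family_def
proof (intro conjI allI impI)
  show "openin (Euclidean_space n) V" using ds_open[OF ds_M q(1)] .
  fix m S g and f :: "vec \<Rightarrow> 'f" assume g: "smooth_into m S n V g" and f: "smooth_on m S f"
  have gV: "g s \<in> V" if "s \<in> S" for s using g that by (auto simp: smooth_into_def)
  have S: "openin (Euclidean_space m) S" using g by (simp add: smooth_into_def)
  have P: "(\<lambda>s\<in>S. triv_inv E \<tau>' ((\<lambda>s\<in>S. q (g s)) s) (f s)) \<in> plots (total E) m S"
    by (rule triv_inv_plot[OF t' ds_compose[OF ds_M q(1) g] _ f]) (use q(2) gV in auto)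
  have "smooth_on m S (\<lambda>s. \<tau> ((\<lambda>s\<in>S. triv_inv E \<tau>' ((\<lambda>s\<in>S. q (g s)) s) (f s)) s))"
  proof (rule triv_plot_smooth[OF t P])
    fix s assume s: "s \<in> S"
    then have "q (g s) \<in> W" "q (g s) \<in> W'" using q(2) gV by auto
    then show "proj E ((\<lambda>s\<in>S. triv_inv E \<tau>' ((\<lambda>s\<in>S. q (g s)) s) (f s)) s) \<in> W"
      using s triv_inv_in_fiber[OF t' \<open>q (g s) \<in> W'\<close>] by (simp add: fiber_def)
  qed
  then show "smooth_on m S (\<lambda>w. (\<tau> \<circ> triv_inv E \<tau>' (q (g w))) (f w))"
    using smooth_on_cong[OF S, of "\<lambda>s. \<tau> ((\<lambda>s\<in>S. triv_inv E \<tau>' ((\<lambda>s\<in>S. q (g s)) s) (f s)) s)"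
        "\<lambda>w. (\<tau> \<circ> triv_inv E \<tau>' (q (g w))) (f w)"] by simp
qed

text \<open>The transition in the opposite order is a two-sided inverse, so it is enough to prove
  linearity and smoothness for an arbitrary ordered pair of trivializations.\<close>

lemma transition_GL:
  assumes t: "(W, \<tau>) \<in> trivs E" and t': "(W', \<tau>') \<in> trivs E" and x: "x \<in> W" "x \<in> W'"
  shows "\<tau> \<circ> triv_inv E \<tau>' x \<in> points GL" "inv (\<tau> \<circ> triv_inv E \<tau>' x) = \<tau>' \<circ> triv_inv E \<tau> x"
proof -
  have lin: "linear (\<tau> \<circ> triv_inv E \<tau>' x)"
    if t: "(W, \<tau>) \<in> trivs E" and t': "(W', \<tau>') \<in> trivs E" and x: "x \<in> W" "x \<in> W'" for W W' \<tau> \<tau>'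
    using triv_inv_in_fiber[OF t' x(2)]
    by (intro linearI) (simp_all add: triv_inv_add[OF t' x(2)] triv_add[OF t x(1)] triv_scale[OF t x(1)])
  have sm: "smooth_fun (\<tau> \<circ> triv_inv E \<tau>' x)"
    if t: "(W, \<tau>) \<in> trivs E" and t': "(W', \<tau>') \<in> trivs E" and x: "x \<in> W" "x \<in> W'" for W W' \<tau> \<tau>'
  proof -
    \<comment> \<open>A plot on R^0 turns the statement about families into one about the single
      point \<open>x\<close>.\<close>
    have "(\<lambda>_\<in>Rn 0. x) \<in> plots M 0 (Rn 0)"
      using triv_open(2)[OF t] x by (intro ds_const[OF ds_M] open_Rn_UNIV) auto
    from transition_smooth_family[OF t t' this]
    have "smooth_family 0 (Rn 0) (\<lambda>v. \<tau> \<circ> triv_inv E \<tau>' ((\<lambda>_\<in>Rn 0. x) v))" using x by auto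
    from smooth_family_at[OF this zero_in_Rn] show ?thesis by (simp add: zero_in_Rn)
  qed
  have c: "(\<tau> \<circ> triv_inv E \<tau>' x) \<circ> (\<tau>' \<circ> triv_inv E \<tau> x) = id"
    if t: "(W, \<tau>) \<in> trivs E" and t': "(W', \<tau>') \<in> trivs E" and x: "x \<in> W" "x \<in> W'" for W W' \<tau> \<tau>'
    using triv_inv_triv[OF t' x(2) triv_inv_in_fiber[OF t x(1)]] triv_triv_inv[OF t x(1)]
    by (simp add: fun_eq_iff)
  note c1 = c[OF t t' x] and c2 = c[OF t' t x(2,1)]
  show i: "inv (\<tau> \<circ> triv_inv E \<tau>' x) = \<tau>' \<circ> triv_inv E \<tau> x"
    by (rule inv_unique_comp[OF c1 c2])
  have "bij (\<tau> \<circ> triv_inv E \<tau>' x)" by (rule o_bij[OF c2 c1])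
  then show "\<tau> \<circ> triv_inv E \<tau>' x \<in> points GL"
    unfolding GL_point_iff i using lin[OF t t' x] lin[OF t' t x(2,1)] sm[OF t t' x] sm[OF t' t x(2,1)] by blast
qed

lemma transition_plot:
  assumes t: "(W, \<tau>) \<in> trivs E" and t': "(W', \<tau>') \<in> trivs E"
    and q: "q \<in> plots M n V" "q ` V \<subseteq> W \<inter> W'"
  shows "(\<lambda>v\<in>V. \<tau> \<circ> triv_inv E \<tau>' (q v)) \<in> plots GL n V"
proof (rule GL_restrict_plot)
  show "smooth_family n V (\<lambda>v. \<tau> \<circ> triv_inv E \<tau>' (q v))" by (rule transition_smooth_family[OF assms])
  have "inv (\<tau> \<circ> triv_inv E \<tau>' (q v)) = \<tau>' \<circ> triv_inv E \<tau> (q v)" if "v \<in> V" for v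
    using q(2) that by (intro transition_GL(2)[OF t t']) auto
  moreover have "smooth_family n V (\<lambda>v. \<tau>' \<circ> triv_inv E \<tau> (q v))"
    using q(2) by (intro transition_smooth_family[OF t' t q(1)]) auto
  ultimately show "smooth_family n V (\<lambda>v. inv (\<tau> \<circ> triv_inv E \<tau>' (q v)))"
    using smooth_family_cong[of V "\<lambda>v. inv (\<tau> \<circ> triv_inv E \<tau>' (q v))" "\<lambda>v. \<tau>' \<circ> triv_inv E \<tau> (q v)" n] by simp
  show "\<tau> \<circ> triv_inv E \<tau>' (q v) \<in> points GL" if "v \<in> V" for v
    using q(2) that by (intro transition_GL(1)[OF t t']) auto
qed

lemma GL_structure: "GL_structure_group T A E"
  unfolding GL_structure_group_def
proof (clarify)
  fix W \<tau> W' \<tau>' assume t: "(W, \<tau>) \<in> trivs E" and t': "(W', \<tau>') \<in> trivs E"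
  show "smooth_map (subdspace M (W \<inter> W')) GL (\<lambda>x. \<tau> \<circ> triv_inv E \<tau>' x)"
    unfolding smooth_map_def compose_def
  proof (intro conjI allI ballI)
    show "(\<lambda>x. \<tau> \<circ> triv_inv E \<tau>' x) \<in> points (subdspace M (W \<inter> W')) \<rightarrow> points GL"
      using transition_GL(1)[OF t t'] by (auto simp: subdspace_points)
    show "(\<lambda>x\<in>U. \<tau> \<circ> triv_inv E \<tau>' (p x)) \<in> plots GL n U" if "p \<in> plots (subdspace M (W \<inter> W')) n U" for n U p
      using that by (intro transition_plot[OF t t']) (auto simp: subdspace_plots)
  qed
qed

section \<open>Frames and the diffeology of the frame bundle\<close>

lemma frame_in_GL:
  assumes t: "(W, \<tau>) \<in> trivs E" and x: "x \<in> W" and w: "w \<in> frames E x"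
  shows "\<tau> \<circ> w \<in> points GL"
proof -
  let ?F = "subdspace (total E) (fiber E x)"
  have pF: "points ?F = fiber E x" by (auto simp: subdspace_points fiber_def)
  have b: "bij_betw w UNIV (fiber E x)" and s: "smooth_map (nebula :: 'f dvs) ?F w"
    and si: "smooth_map ?F (nebula :: 'f dvs) (inv_into UNIV w)"
    and lin: "\<And>u v a. w (u + v) = fadd E (w u) (w v) \<and> w (a *\<^sub>R v) = fscale E a (w v)"
    using w by (auto simp: frames_def diffeo_def pF)
  have wf: "w v \<in> fiber E x" for v using b by (auto simp: bij_betw_def)
  have bij: "bij (\<tau> \<circ> w)" using bij_betw_trans[OF b triv_fiber_bij[OF t x]] .
  have l: "linear (\<tau> \<circ> w)"
    by (intro linearI) (simp_all add: lin triv_add[OF t x] triv_scale[OF t x] wf)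
  have s1: "smooth_fun (\<tau> \<circ> w)" unfolding smooth_fun_def
  proof (intro allI impI)
    fix n U and f :: "vec \<Rightarrow> 'f" assume U: "openin (Euclidean_space n) U" and f: "smooth_on n U f"
    from smooth_map_plot[OF s nebula_restrict_plot[OF U f]]
    have P: "(\<lambda>u\<in>U. w (restrict f U u)) \<in> plots (total E) n U" by (simp add: subdspace_plots)
    have "smooth_on n U (\<lambda>u. \<tau> ((\<lambda>u\<in>U. w (restrict f U u)) u))"
      by (rule triv_plot_smooth[OF t P]) (use wf x in \<open>auto simp: fiber_def\<close>)
    then show "smooth_on n U (\<lambda>x. (\<tau> \<circ> w) (f x))"
      using smooth_on_cong[OF U, of "\<lambda>u. \<tau> ((\<lambda>u\<in>U. w (restrict f U u)) u)" "\<lambda>x. (\<tau> \<circ> w) (f x)"] by simp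
  qed
  \<comment> \<open>The inverse passes through the fiber: \<open>triv_inv\<close> is smooth over a
    constant base plot, and smoothness of the inverse of \<open>w\<close> on the fiber is part of
    being a frame.\<close>
  have inv: "inv (\<tau> \<circ> w) v = inv_into UNIV w (triv_inv E \<tau> x v)" for v
  proof -
    have "(\<tau> \<circ> w) (inv_into UNIV w (triv_inv E \<tau> x v)) = v"
      using b triv_inv_in_fiber[OF t x, of v] triv_triv_inv[OF t x, of v]
      by (simp add: bij_betw_def f_inv_into_f)
    then show ?thesis using bij by (metis bij_inv_eq_iff)
  qed
  have "smooth_fun (inv (\<tau> \<circ> w))" unfolding smooth_fun_def inv
  proof (intro allI impI)
    fix n U and f :: "vec \<Rightarrow> 'f" assume U: "openin (Euclidean_space n) U" and f: "smooth_on n U f"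
    have "(\<lambda>_\<in>U. x) \<in> plots M n U" using triv_open(2)[OF t] x by (intro ds_const[OF ds_M] U) auto
    from triv_inv_plot[OF t this _ f] x
    have "(\<lambda>v\<in>U. triv_inv E \<tau> ((\<lambda>_\<in>U. x) v) (f v)) \<in> plots (total E) n U" by auto
    then have "(\<lambda>v\<in>U. triv_inv E \<tau> ((\<lambda>_\<in>U. x) v) (f v)) \<in> plots ?F n U"
      using triv_inv_in_fiber[OF t x] by (auto simp: subdspace_plots)
    from smooth_map_plot[OF si this]
    have "smooth_on n U (\<lambda>v\<in>U. inv_into UNIV w ((\<lambda>v\<in>U. triv_inv E \<tau> ((\<lambda>_\<in>U. x) v) (f v)) v))"
      by (simp add: nebula_plot_iff)
    then show "smooth_on n U (\<lambda>v. inv_into UNIV w (triv_inv E \<tau> x (f v)))"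
      using smooth_on_cong[OF U, of "\<lambda>v\<in>U. inv_into UNIV w ((\<lambda>v\<in>U. triv_inv E \<tau> ((\<lambda>_\<in>U. x) v) (f v)) v)"
          "\<lambda>v. inv_into UNIV w (triv_inv E \<tau> x (f v))"] by simp
  qed
  then show ?thesis using bij l s1 linear_inv_of_bij[OF l bij] by (simp add: GL_point_iff)
qed

lemma frame_in_fiber: "w \<in> frames E x \<Longrightarrow> w v \<in> fiber E x"
  by (auto simp: frames_def diffeo_def bij_betw_def subdspace_points)

lemma frame_triv_inv:
  assumes t: "(W, \<tau>) \<in> trivs E" and x: "x \<in> W" and w: "w \<in> frames E x"
  shows "triv_inv E \<tau> x \<circ> (\<tau> \<circ> w) = w"
  using triv_inv_triv[OF t x frame_in_fiber[OF w]] by (simp add: fun_eq_iff)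

text \<open>Composition with \<open>triv_inv\<close> undoes the passage from \<open>w\<close> to
  \<open>\<tau> \<circ> w\<close> of \<open>frame_in_GL\<close>; the two identify the frames over
  \<open>x\<close> with GL(F).\<close>

lemma frame_of_GL:
  assumes t: "(W, \<tau>) \<in> trivs E" and x: "x \<in> W" and g: "g \<in> points GL"
  shows "triv_inv E \<tau> x \<circ> g \<in> frames E x"
proof -
  let ?w = "triv_inv E \<tau> x \<circ> g" and ?F = "subdspace (total E) (fiber E x)"
  have pF: "points ?F = fiber E x" by (auto simp: subdspace_points fiber_def)
  have bi: "bij_betw (triv_inv E \<tau> x) UNIV (fiber E x)"
    unfolding triv_inv_def by (rule bij_betw_inv_into[OF triv_fiber_bij[OF t x]])
  then have b: "bij_betw ?w UNIV (fiber E x)"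
    using bij_betw_trans[OF GL_bij[OF g, unfolded bij_def[symmetric]] bi] by blast
  have xT: "x \<in> topspace T" using triv_open(2)[OF t] x by auto
  have inv: "inv_into UNIV ?w e = inv g (\<tau> e)" if e: "e \<in> fiber E x" for e
  proof (rule inv_into_f_eq)
    show "inj ?w" using b by (simp add: bij_betw_def)
    show "?w (inv g (\<tau> e)) = e" using GL_cancel[OF g] triv_inv_triv[OF t x e] by simp
  qed simp
  have "smooth_map (nebula :: 'f dvs) ?F ?w" unfolding smooth_map_def compose_def
  proof (intro conjI allI ballI)
    show "?w \<in> points (nebula :: 'f dvs) \<rightarrow> points ?F" unfolding pF using triv_inv_in_fiber[OF t x] by simp
    fix n U p assume p: "p \<in> plots (nebula :: 'f dvs) n U"
    then have U: "openin (Euclidean_space n) U" and "smooth_on n U p" by (auto simp: nebula_plot_iff)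
    then have f: "smooth_on n U (\<lambda>u. g (p u))" using g by (auto simp: GL_point_iff smooth_fun_def)
    have "(\<lambda>_\<in>U. x) \<in> plots M n U" using xT by (intro ds_const[OF ds_M] U) auto
    from triv_inv_plot[OF t this _ f] x
    have "(\<lambda>v\<in>U. triv_inv E \<tau> ((\<lambda>_\<in>U. x) v) (g (p v))) \<in> plots (total E) n U" by auto
    then have "(\<lambda>v\<in>U. triv_inv E \<tau> ((\<lambda>_\<in>U. x) v) (g (p v))) \<in> plots ?F n U"
      using triv_inv_in_fiber[OF t x] by (auto simp: subdspace_plots)
    then show "(\<lambda>u\<in>U. ?w (p u)) \<in> plots ?F n U" by (simp cong: restrict_cong)
  qed
  moreover have "smooth_map ?F (nebula :: 'f dvs) (inv_into UNIV ?w)" unfolding smooth_map_def compose_def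
  proof (intro conjI allI ballI)
    fix n U p assume p: "p \<in> plots ?F n U"
    then have P: "p \<in> plots (total E) n U" "\<And>u. u \<in> U \<Longrightarrow> p u \<in> fiber E x" by (auto simp: subdspace_plots)
    have U: "openin (Euclidean_space n) U" using ds_open[OF ds_total P(1)] .
    have "smooth_on n U (\<lambda>u. \<tau> (p u))"
      by (rule triv_plot_smooth[OF t P(1)]) (use P(2) x in \<open>auto simp: fiber_def\<close>)
    then have "smooth_on n U (\<lambda>u. inv g (\<tau> (p u)))" using g U by (auto simp: GL_point_iff smooth_fun_def)
    from nebula_restrict_plot[OF U this]
    have "(\<lambda>u\<in>U. inv g (\<tau> (p u))) \<in> plots (nebula :: 'f dvs) n U" .
    also have "(\<lambda>u\<in>U. inv g (\<tau> (p u))) = (\<lambda>u\<in>U. inv_into UNIV ?w (p u))"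
      by (rule restrict_ext) (simp only: inv[OF P(2)])
    finally show "(\<lambda>u\<in>U. inv_into UNIV ?w (p u)) \<in> plots (nebula :: 'f dvs) n U" .
  qed simp
  moreover have "?w (u + v) = fadd E (?w u) (?w v) \<and> ?w (a *\<^sub>R v) = fscale E a (?w v)" for u v a
    using GL_linear[OF g] by (simp add: linear_add linear_cmul triv_inv_add[OF t x])
  ultimately show ?thesis using b by (simp add: frames_def diffeo_def pF)
qed


lemma Fr_point_iff: "\<xi> \<in> points (Fr T A E) \<longleftrightarrow> fst \<xi> \<in> topspace T \<and> snd \<xi> \<in> frames E (fst \<xi>)"
  by (cases \<xi>) (auto simp: Fr_def Let_def)

text \<open>A map described by one local model on all of \<open>V\<close>; plots of the frame bundle
  have such a description near each point (\<open>Fr_plot_iff\<close>).\<close>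

definition Fr_model :: "nat \<Rightarrow> vec set \<Rightarrow> (vec \<Rightarrow> 'm \<times> ('f \<Rightarrow> 'e)) \<Rightarrow> bool" where
  "Fr_model n V p \<longleftrightarrow> (\<exists>(W, \<tau>)\<in>trivs E. \<exists>q\<in>plots (subdspace M W) n V. \<exists>g\<in>plots GL n V.
     \<forall>v\<in>V. p v = (q v, triv_inv E \<tau> (q v) \<circ> g v))"

lemma Fr_modelI:
  assumes "(W, \<tau>) \<in> trivs E" "q \<in> plots M n V" "q ` V \<subseteq> W" "g \<in> plots GL n V"
    "\<And>v. v \<in> V \<Longrightarrow> p v = (q v, triv_inv E \<tau> (q v) \<circ> g v)"
  shows "Fr_model n V p"
proof -
  have "q \<in> plots (subdspace M W) n V" using assms(2,3) by (simp add: subdspace_plots)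
  then have "\<exists>q\<in>plots (subdspace M W) n V. \<exists>g\<in>plots GL n V. \<forall>v\<in>V. p v = (q v, triv_inv E \<tau> (q v) \<circ> g v)"
    using assms(4,5) by blast
  then show ?thesis unfolding Fr_model_def using assms(1)
    by (intro bexI[of _ "(W, \<tau>)"]) simp_all
qed

lemma Fr_modelE:
  assumes "Fr_model n V p"
  obtains W \<tau> q g where "(W, \<tau>) \<in> trivs E" "q \<in> plots M n V" "q ` V \<subseteq> W" "g \<in> plots GL n V"
    "\<forall>v\<in>V. p v = (q v, triv_inv E \<tau> (q v) \<circ> g v)"
proof -
  obtain W\<tau> where 1: "W\<tau> \<in> trivs E" "case W\<tau> of (W, \<tau>) \<Rightarrow> \<exists>q\<in>plots (subdspace M W) n V. \<exists>g\<in>plots GL n V.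
     \<forall>v\<in>V. p v = (q v, triv_inv E \<tau> (q v) \<circ> g v)"
    using assms unfolding Fr_model_def by (rule bexE)
  obtain W \<tau> where W: "W\<tau> = (W, \<tau>)" by (cases W\<tau>)
  obtain q g where "q \<in> plots (subdspace M W) n V" "g \<in> plots GL n V"
    "\<forall>v\<in>V. p v = (q v, triv_inv E \<tau> (q v) \<circ> g v)"
    using 1(2) unfolding W prod.case by blast
  then show ?thesis using 1(1) unfolding W by (intro that[of W \<tau> q g]) (auto simp: subdspace_plots)
qed

lemma Fr_plot_iff:
  "p \<in> plots (Fr T A E) n U \<longleftrightarrow> p \<in> extensional U \<and> openin (Euclidean_space n) U \<and>
    (\<forall>u\<in>U. \<exists>V. u \<in> V \<and> V \<subseteq> U \<and> Fr_model n V p)"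
proof -
  have "p u \<in> Sigma (topspace T) (frames E)" if u: "u \<in> V" and m: "Fr_model n V p" for u V
  proof -
    obtain W \<tau> q g where *: "(W, \<tau>) \<in> trivs E" "q \<in> plots M n V" "q ` V \<subseteq> W" "g \<in> plots GL n V"
      "\<forall>v\<in>V. p v = (q v, triv_inv E \<tau> (q v) \<circ> g v)"
      using m by (rule Fr_modelE)
    have "q u \<in> W" "g u \<in> points GL" using *(3,4) u by (auto simp: GL_plot_iff)
    then show ?thesis using triv_open(2)[OF *(1)] frame_of_GL[OF *(1), of "q u" "g u"] bspec[OF *(5) u]
      by auto
  qed
  then have "(\<forall>u\<in>U. \<exists>V. u \<in> V \<and> V \<subseteq> U \<and> Fr_model n V p) \<Longrightarrow> p \<in> U \<rightarrow> Sigma (topspace T) (frames E)"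
    by blast
  moreover have "p \<in> plots (Fr T A E) n U \<longleftrightarrow> p \<in> U \<rightarrow>\<^sub>E Sigma (topspace T) (frames E) \<and>
      openin (Euclidean_space n) U \<and> (\<forall>u\<in>U. \<exists>V. u \<in> V \<and> V \<subseteq> U \<and> Fr_model n V p)"
    unfolding Fr_def Let_def Fr_model_def by simp
  ultimately show ?thesis unfolding PiE_def by blast
qed

lemma Fr_model_reparam:
  assumes "Fr_model n V p" "smooth_into m S n V h"
  shows "Fr_model m S (\<lambda>s. p (h s))"
proof -
  obtain W \<tau> q g where *: "(W, \<tau>) \<in> trivs E" "q \<in> plots M n V" "q ` V \<subseteq> W" "g \<in> plots GL n V"
    "\<forall>v\<in>V. p v = (q v, triv_inv E \<tau> (q v) \<circ> g v)"
    using assms(1) by (rule Fr_modelE)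
  have hV: "h s \<in> V" if "s \<in> S" for s using assms(2) that by (auto simp: smooth_into_def)
  show ?thesis
  proof (rule Fr_modelI[OF *(1)])
    show "(\<lambda>s\<in>S. q (h s)) \<in> plots M m S" by (rule ds_compose[OF ds_M *(2) assms(2)])
    show "(\<lambda>s\<in>S. g (h s)) \<in> plots GL m S" by (rule ds_compose[OF diffeological_space_GL *(4) assms(2)])
    show "(\<lambda>s\<in>S. q (h s)) ` S \<subseteq> W" using *(3) hV by auto
    show "p (h s) = ((\<lambda>s\<in>S. q (h s)) s, triv_inv E \<tau> ((\<lambda>s\<in>S. q (h s)) s) \<circ> (\<lambda>s\<in>S. g (h s)) s)" if "s \<in> S" for s
      using bspec[OF *(5) hV[OF that]] that by simp
  qed
qed

lemma Fr_model_cong: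
  assumes "\<And>v. v \<in> V \<Longrightarrow> p v = p' v"
  shows "Fr_model n V p \<longleftrightarrow> Fr_model n V p'"
  unfolding Fr_model_def using assms by (simp cong: ball_cong)

lemma Fr_model_const:
  assumes x: "\<xi> \<in> points (Fr T A E)" and U: "openin (Euclidean_space n) U"
  shows "Fr_model n U (\<lambda>_. \<xi>)"
proof -
  obtain W \<tau> where t: "(W, \<tau>) \<in> trivs E" "fst \<xi> \<in> W" using triv_exists[of "fst \<xi>"] x[unfolded Fr_point_iff] by blast
  have w: "snd \<xi> \<in> frames E (fst \<xi>)" using x by (simp add: Fr_point_iff)
  show ?thesis
  proof (rule Fr_modelI[OF t(1)])
    show "(\<lambda>_\<in>U. fst \<xi>) \<in> plots M n U" using x by (intro ds_const[OF ds_M] U) (simp add: Fr_point_iff)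
    show "(\<lambda>_\<in>U. \<tau> \<circ> snd \<xi>) \<in> plots GL n U"
      by (intro ds_const[OF diffeological_space_GL] U frame_in_GL[OF t w])
    show "\<xi> = ((\<lambda>_\<in>U. fst \<xi>) v, triv_inv E \<tau> ((\<lambda>_\<in>U. fst \<xi>) v) \<circ> (\<lambda>_\<in>U. \<tau> \<circ> snd \<xi>) v)" if "v \<in> U" for v
      using frame_triv_inv[OF t w] that by (simp add: prod_eq_iff)
  qed (use t(2) in auto)
qed

lemma Fr_model_open: "Fr_model n V p \<Longrightarrow> openin (Euclidean_space n) V"
  by (erule Fr_modelE) (rule ds_open[OF ds_M])

lemma Fr_plot_point: "p \<in> plots (Fr T A E) n U \<Longrightarrow> u \<in> U \<Longrightarrow> p u \<in> points (Fr T A E)"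
  by (auto simp: Fr_def Let_def PiE_def Pi_def)

lemma ds_Fr: "diffeological_space (Fr T A E)"
  unfolding diffeological_space_def
proof (intro conjI allI ballI impI)
  fix n U p assume p: "p \<in> plots (Fr T A E) n U"
  then show "openin (Euclidean_space n) U" by (simp add: Fr_plot_iff)
  show "p \<in> U \<rightarrow>\<^sub>E points (Fr T A E)" using p Fr_plot_point[OF p] by (simp add: Fr_plot_iff PiE_def Pi_def)
next
  fix n U x assume x: "x \<in> points (Fr T A E)" and U: "openin (Euclidean_space n) U"
  have "Fr_model n U (\<lambda>u\<in>U. x)" using Fr_model_const[OF x U] Fr_model_cong[of U "\<lambda>u\<in>U. x" "\<lambda>_. x" n] by simp
  then show "(\<lambda>u\<in>U. x) \<in> plots (Fr T A E) n U" using U by (auto simp: Fr_plot_iff)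
next
  fix n U p
  assume U: "openin (Euclidean_space n) U" and p: "p \<in> U \<rightarrow>\<^sub>E points (Fr T A E)"
    and loc: "\<forall>u\<in>U. \<exists>V. u \<in> V \<and> V \<subseteq> U \<and> restrict p V \<in> plots (Fr T A E) n V"
  have "\<exists>V. u \<in> V \<and> V \<subseteq> U \<and> Fr_model n V p" if u: "u \<in> U" for u
  proof -
    obtain V where V: "u \<in> V" "V \<subseteq> U" "restrict p V \<in> plots (Fr T A E) n V" using loc u by blast
    then obtain V' where V': "u \<in> V'" "V' \<subseteq> V" "Fr_model n V' (restrict p V)" by (auto simp: Fr_plot_iff)
    have "restrict p V v = p v" if "v \<in> V'" for v using that V'(2) by auto
    then have "Fr_model n V' p" using Fr_model_cong[of V' "restrict p V" p n] V'(3) by blast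
    with V V' show ?thesis by blast
  qed
  then show "p \<in> plots (Fr T A E) n U" using U p by (simp add: Fr_plot_iff PiE_def)
next
  fix n U p m V g
  assume p: "p \<in> plots (Fr T A E) n U" and g: "g \<in> plots (euclidean_domain n U) m V"
  have g': "smooth_into m V n U g" using g by (simp add: euclidean_plot_iff)
  have U: "openin (Euclidean_space n) U" using p by (simp add: Fr_plot_iff)
  have V: "openin (Euclidean_space m) V" using g' by (simp add: smooth_into_def)
  have "\<exists>V'. v \<in> V' \<and> V' \<subseteq> V \<and> Fr_model m V' (compose V p g)" if v: "v \<in> V" for v
  proof -
    have "g v \<in> U" using g' v by (auto simp: smooth_into_def)
    then obtain U' where U': "g v \<in> U'" "U' \<subseteq> U" "Fr_model n U' p" using p by (auto simp: Fr_plot_iff)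
    let ?V = "{v \<in> V. g v \<in> U'}"
    have o: "openin (Euclidean_space m) ?V"
      by (rule open_preimage_smooth_into[OF smooth_into_mono[OF g' open_Rn_subset[OF U]] Fr_model_open[OF U'(3)]])
    have "smooth_into m ?V n U' g" using smooth_into_subset[OF g' o] by (auto simp: smooth_into_def)
    from Fr_model_reparam[OF U'(3) this]
    have "Fr_model m ?V (compose V p g)"
      using Fr_model_cong[of ?V "\<lambda>s. p (g s)" "compose V p g" m] by (auto simp: compose_def)
    with v U' show ?thesis by (intro exI[of _ ?V]) auto
  qed
  then show "compose V p g \<in> plots (Fr T A E) m V" using V by (auto simp: Fr_plot_iff compose_def)
qed

lemma Fr_fst_plot:
  assumes P: "P \<in> plots (Fr T A E) n U"
  shows "(\<lambda>u\<in>U. fst (P u)) \<in> plots M n U"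
proof (rule ds_glue[OF ds_M])
  show "openin (Euclidean_space n) U" using P by (simp add: Fr_plot_iff)
  fix u assume u: "u \<in> U"
  then obtain V where V: "u \<in> V" "V \<subseteq> U" "Fr_model n V P" using P by (auto simp: Fr_plot_iff)
  obtain W \<tau> q g where *: "q \<in> plots M n V" "\<forall>v\<in>V. P v = (q v, triv_inv E \<tau> (q v) \<circ> g v)"
    using V(3) by (rule Fr_modelE)
  with V show "\<exists>V q. u \<in> V \<and> V \<subseteq> U \<and> q \<in> plots M n V \<and> (\<forall>v\<in>V. (\<lambda>u\<in>U. fst (P u)) v = q v)"
    by (intro exI[of _ V] exI[of _ q]) auto
qed simp

text \<open>The plot may be modelled near a point on another trivialization \<open>\<tau>'\<close>.
  There the coordinate with respect to \<open>\<tau>\<close> is the one of the model multiplied by a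
  transition map, which is a plot of \<open>GL\<close>.\<close>

lemma Fr_triv_plot:
  assumes t: "(W, \<tau>) \<in> trivs E" and P: "P \<in> plots (Fr T A E) n U" and W: "\<And>u. u \<in> U \<Longrightarrow> fst (P u) \<in> W"
  shows "(\<lambda>u\<in>U. \<tau> \<circ> snd (P u)) \<in> plots GL n U"
proof (rule ds_glue[OF diffeological_space_GL])
  show "openin (Euclidean_space n) U" using P by (simp add: Fr_plot_iff)
  fix u assume u: "u \<in> U"
  then obtain V where V: "u \<in> V" "V \<subseteq> U" "Fr_model n V P" using P by (auto simp: Fr_plot_iff)
  obtain W' \<tau>' q g where *: "(W', \<tau>') \<in> trivs E" "q \<in> plots M n V" "q ` V \<subseteq> W'" "g \<in> plots GL n V"
      "\<forall>v\<in>V. P v = (q v, triv_inv E \<tau>' (q v) \<circ> g v)"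
    using V(3) by (rule Fr_modelE)
  have "q v \<in> W" if "v \<in> V" for v
    using W[of v] V(2) *(5) that by auto
  then have "(\<lambda>v\<in>V. (\<lambda>v\<in>V. \<tau> \<circ> triv_inv E \<tau>' (q v)) v \<circ> g v) \<in> plots GL n V"
    using *(3) by (intro GL_plot_mult transition_plot[OF t *(1,2)] *(4)) auto
  moreover have "\<forall>v\<in>V. (\<lambda>u\<in>U. \<tau> \<circ> snd (P u)) v = (\<lambda>v\<in>V. (\<lambda>v\<in>V. \<tau> \<circ> triv_inv E \<tau>' (q v)) v \<circ> g v) v"
    using *(5) V(2) by (auto simp: o_assoc)
  ultimately show "\<exists>V q. u \<in> V \<and> V \<subseteq> U \<and> q \<in> plots GL n V \<and> (\<forall>v\<in>V. (\<lambda>u\<in>U. \<tau> \<circ> snd (P u)) v = q v)"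
    using V(1,2) by blast
qed simp

lemma Fr_plotI:
  assumes "(W, \<tau>) \<in> trivs E" "q \<in> plots M n V" "q ` V \<subseteq> W" "g \<in> plots GL n V"
  shows "(\<lambda>v\<in>V. (q v, triv_inv E \<tau> (q v) \<circ> g v)) \<in> plots (Fr T A E) n V"
proof -
  have "Fr_model n V (\<lambda>v\<in>V. (q v, triv_inv E \<tau> (q v) \<circ> g v))"
    by (rule Fr_modelI[OF assms]) simp
  then show ?thesis using ds_open[OF ds_M assms(2)] unfolding Fr_plot_iff by auto
qed

lemma Fr_section_plot:
  assumes "(W, \<tau>) \<in> trivs E" "q \<in> plots M n V" "q ` V \<subseteq> W"
  shows "(\<lambda>v\<in>V. (q v, triv_inv E \<tau> (q v))) \<in> plots (Fr T A E) n V"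
proof -
  have "(\<lambda>v\<in>V. (q v, triv_inv E \<tau> (q v) \<circ> (\<lambda>_\<in>V. id) v)) \<in> plots (Fr T A E) n V"
    using ds_const[OF diffeological_space_GL GL_id ds_open[OF ds_M assms(2)]]
    by (intro Fr_plotI[OF assms])
  then show ?thesis by (simp cong: restrict_cong)
qed

lemma Fr_act_plot:
  assumes P: "P \<in> plots (Fr T A E) n U" and g: "g \<in> plots GL n U"
  shows "(\<lambda>u\<in>U. Fr_act (P u) (g u)) \<in> plots (Fr T A E) n U"
proof (rule ds_glue[OF ds_Fr])
  show "openin (Euclidean_space n) U" using P by (simp add: Fr_plot_iff)
  fix u assume u: "u \<in> U"
  then obtain V where V: "u \<in> V" "V \<subseteq> U" "Fr_model n V P" using P by (auto simp: Fr_plot_iff)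
  obtain W' \<tau>' q h where *: "(W', \<tau>') \<in> trivs E" "q \<in> plots M n V" "q ` V \<subseteq> W'" "h \<in> plots GL n V"
      "\<forall>v\<in>V. P v = (q v, triv_inv E \<tau>' (q v) \<circ> h v)"
    using V(3) by (rule Fr_modelE)
  have "restrict g V \<in> plots GL n V" using ds_restrict[OF diffeological_space_GL g V(2) Fr_model_open[OF V(3)]] .
  from Fr_plotI[OF *(1-3) GL_plot_mult[OF *(4) this]]
  have "(\<lambda>v\<in>V. (q v, triv_inv E \<tau>' (q v) \<circ> (\<lambda>v\<in>V. h v \<circ> restrict g V v) v)) \<in> plots (Fr T A E) n V" .
  moreover have "\<forall>v\<in>V. (\<lambda>u\<in>U. Fr_act (P u) (g u)) v = (\<lambda>v\<in>V. (q v, triv_inv E \<tau>' (q v) \<circ> (\<lambda>v\<in>V. h v \<circ> restrict g V v) v)) v"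
    using *(5) V(2) by (auto simp: Fr_act_def o_assoc)
  ultimately show "\<exists>V q. u \<in> V \<and> V \<subseteq> U \<and> q \<in> plots (Fr T A E) n V \<and> (\<forall>v\<in>V. (\<lambda>u\<in>U. Fr_act (P u) (g u)) v = q v)"
    using V(1,2) by blast
qed simp

lemma Fr_act_point:
  assumes "\<xi> \<in> points (Fr T A E)" "g \<in> points GL"
  shows "Fr_act \<xi> g \<in> points (Fr T A E)"
proof -
  obtain W \<tau> where t: "(W, \<tau>) \<in> trivs E" "fst \<xi> \<in> W" using triv_exists[of "fst \<xi>"] assms(1)[unfolded Fr_point_iff] by blast
  have w: "snd \<xi> \<in> frames E (fst \<xi>)" using assms by (simp add: Fr_point_iff)
  have "triv_inv E \<tau> (fst \<xi>) \<circ> ((\<tau> \<circ> snd \<xi>) \<circ> g) \<in> frames E (fst \<xi>)"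
    by (intro frame_of_GL[OF t] GL_mult frame_in_GL[OF t w] assms)
  also have "triv_inv E \<tau> (fst \<xi>) \<circ> ((\<tau> \<circ> snd \<xi>) \<circ> g) = snd \<xi> \<circ> g"
    using frame_triv_inv[OF t w] by (metis comp_assoc)
  finally have "snd \<xi> \<circ> g \<in> frames E (fst \<xi>)" .
  then show ?thesis using assms(1) unfolding Fr_point_iff Fr_act_def fst_conv snd_conv by blast
qed

text \<open>A trivialization \<open>\<tau>\<close> of \<open>E\<close> over \<open>W\<close> also
  trivializes the frames over \<open>W\<close>: a frame \<open>w\<close> has the coordinate
  \<open>\<tau> \<circ> w\<close> in \<open>GL\<close>, and right composition acts on it by right
  multiplication.\<close>

lemma Fr_principal_bundle: "principal_bundle T M GL (\<circ>) id (Fr T A E) fst Fr_act"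
  unfolding principal_bundle_def
proof (intro conjI ballI impI)
  show "diffeological_space (Fr T A E)" by (rule ds_Fr)
  show "diffeological_group (GL :: ('f \<Rightarrow> 'f) dspace) (\<circ>) id" by (rule diffeological_group_GL)
  show "smooth_map (Fr T A E) M fst"
    unfolding smooth_map_def compose_def using Fr_fst_plot by (auto simp: Fr_point_iff)
  show "smooth_map (dprod (Fr T A E) GL) (Fr T A E) (\<lambda>(x, g). Fr_act x g)"
    by (rule smooth_map_dprodI) (simp_all add: Fr_act_point Fr_act_plot)
next
  fix x show "Fr_act x id = x" by (simp add: Fr_act_def)
next
  fix x :: "'m \<times> ('f \<Rightarrow> 'e)" and g :: "'f \<Rightarrow> 'f" show "fst (Fr_act x g) = fst x" by (simp add: Fr_act_def)
next
  fix x :: "'m \<times> ('f \<Rightarrow> 'e)" and g h :: "'f \<Rightarrow> 'f" show "Fr_act (Fr_act x g) h = Fr_act x (g \<circ> h)"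
    by (simp add: Fr_act_def o_assoc)
next
  fix x y assume xy: "x \<in> points (Fr T A E)" "y \<in> points (Fr T A E)" "fst x = fst y"
  obtain W \<tau> where t: "(W, \<tau>) \<in> trivs E" "fst x \<in> W" using triv_exists[of "fst x"] xy(1)[unfolded Fr_point_iff] by blast
  have w: "snd x \<in> frames E (fst x)" "snd y \<in> frames E (fst x)" using xy by (auto simp: Fr_point_iff)
  note G = frame_in_GL[OF t w(1)] frame_in_GL[OF t w(2)]
  \<comment> \<open>Frames are maps into the fiber, so the quotient of two frames is formed after
    composition with \<open>\<tau>\<close>, where both lie in \<open>GL\<close>.\<close>
  let ?g = "inv (\<tau> \<circ> snd x) \<circ> (\<tau> \<circ> snd y)"
  show "\<exists>!g. g \<in> points GL \<and> Fr_act x g = y"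
  proof (rule ex1I[of _ ?g], intro conjI)
    show "?g \<in> points GL" by (intro GL_mult GL_inv G)
    have "snd x \<circ> ?g = triv_inv E \<tau> (fst x) \<circ> (((\<tau> \<circ> snd x) \<circ> inv (\<tau> \<circ> snd x)) \<circ> (\<tau> \<circ> snd y))"
      by (subst frame_triv_inv[OF t w(1), symmetric]) (simp only: comp_assoc)
    also have "\<dots> = snd y" by (simp only: GL_cancel[OF G(1)] id_o frame_triv_inv[OF t w(2)])
    finally show "Fr_act x ?g = y" using xy(3) by (simp add: Fr_act_def prod_eq_iff)
  next
    fix g assume g: "g \<in> points GL \<and> Fr_act x g = y"
    then have "\<tau> \<circ> snd y = (\<tau> \<circ> snd x) \<circ> g" by (auto simp: Fr_act_def o_assoc)
    then have "?g = (inv (\<tau> \<circ> snd x) \<circ> (\<tau> \<circ> snd x)) \<circ> g" by (simp only: comp_assoc)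
    then show "g = ?g" by (simp only: GL_cancel[OF G(1)] id_o)
  qed
next
  fix b assume b: "b \<in> points M"
  then obtain W \<tau> where t: "(W, \<tau>) \<in> trivs E" "b \<in> W" using triv_exists[of b] by auto
  let ?S = "subdspace (Fr T A E) {x. fst x \<in> W}" and ?D = "dprod (subdspace M W) (GL :: ('f \<Rightarrow> 'f) dspace)"
  let ?f = "\<lambda>x. (fst x, \<tau> \<circ> snd x)" and ?h = "\<lambda>(x, g). (x, triv_inv E \<tau> x \<circ> g)"
  have WT: "W \<subseteq> topspace T" by (rule triv_open(2)[OF t(1)])
  have f: "?f \<xi> \<in> points ?D" "?h (?f \<xi>) = \<xi>" if "\<xi> \<in> points ?S" for \<xi>
  proof -
    have x: "fst \<xi> \<in> W" "snd \<xi> \<in> frames E (fst \<xi>)" using that by (auto simp: subdspace_points Fr_point_iff)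
    show "?f \<xi> \<in> points ?D" "?h (?f \<xi>) = \<xi>"
      using frame_in_GL[OF t(1) x] frame_triv_inv[OF t(1) x] x WT
      by (auto simp: points_dprod subdspace_points prod_eq_iff)
  qed
  have h: "?h z \<in> points ?S" "?f (?h z) = z" if "z \<in> points ?D" for z
  proof -
    obtain x g where z: "z = (x, g)" "x \<in> W" "g \<in> points GL"
      using \<open>z \<in> points ?D\<close> by (auto simp: points_dprod subdspace_points)
    show "?h z \<in> points ?S" using frame_of_GL[OF t(1) z(2,3)] z WT by (auto simp: subdspace_points Fr_point_iff)
    show "?f (?h z) = z" using triv_triv_inv[OF t(1) z(2)] z by (auto simp: fun_eq_iff)
  qed
  have bij: "bij_betw ?f (points ?S) (points ?D)"
    by (rule bij_betw_byWitness[where f'="?h"]) (use f h in auto)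
  have inv: "inv_into (points ?S) ?f z = ?h z" if z: "z \<in> points ?D" for z
    using bij h[OF z] by (intro inv_into_f_eq) (auto simp: bij_betw_def)
  have "smooth_map ?S ?D ?f" unfolding smooth_map_def compose_def
  proof (intro conjI allI ballI)
    show "?f \<in> points ?S \<rightarrow> points ?D" using f(1) by blast
    fix n U P assume "P \<in> plots ?S n U"
    then have P: "P \<in> plots (Fr T A E) n U" and PW: "\<And>u. u \<in> U \<Longrightarrow> fst (P u) \<in> W" by (auto simp: subdspace_plots)
    have 1: "(\<lambda>u\<in>U. fst (P u)) \<in> plots (subdspace M W) n U" using Fr_fst_plot[OF P] PW by (auto simp: subdspace_plots)
    note 2 = Fr_triv_plot[OF t(1) P PW]
    have "(\<lambda>u\<in>U. ((\<lambda>u\<in>U. fst (P u)) u, (\<lambda>u\<in>U. \<tau> \<circ> snd (P u)) u)) \<in> plots ?D n U"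
      using PW WT ds_PiE[OF diffeological_space_GL 2]
      by (intro dprod_plot_pair[OF 1 2]) (auto simp: subdspace_points)
    then show "(\<lambda>u\<in>U. ?f (P u)) \<in> plots ?D n U" by (simp cong: restrict_cong)
  qed
  moreover have "smooth_map ?D ?S (inv_into (points ?S) ?f)" unfolding smooth_map_def compose_def
  proof (intro conjI allI ballI)
    show "inv_into (points ?S) ?f \<in> points ?D \<rightarrow> points ?S" using inv h(1) by (metis (no_types, lifting) Pi_I)
    fix n U P assume P: "P \<in> plots ?D n U"
    then have 1: "compose U fst P \<in> plots M n U" "compose U fst P ` U \<subseteq> W" and 2: "compose U snd P \<in> plots GL n U"
      and PD: "P \<in> U \<rightarrow>\<^sub>E points ?D"
      by (auto simp: dprod_def subdspace_plots subdspace_points)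
    have "(\<lambda>u\<in>U. (compose U fst P u, triv_inv E \<tau> (compose U fst P u) \<circ> compose U snd P u)) \<in> plots (Fr T A E) n U"
      by (rule Fr_plotI[OF t(1) 1 2])
    also have "(\<lambda>u\<in>U. (compose U fst P u, triv_inv E \<tau> (compose U fst P u) \<circ> compose U snd P u)) =
        (\<lambda>u\<in>U. inv_into (points ?S) ?f (P u))"
    proof (rule restrict_ext)
      fix u assume u: "u \<in> U"
      then have "P u \<in> points ?D" using PD by auto
      from inv[OF this] u show "(compose U fst P u, triv_inv E \<tau> (compose U fst P u) \<circ> compose U snd P u) =
          inv_into (points ?S) ?f (P u)"
        by (simp add: compose_def case_prod_beta)
    qed
    finally have "(\<lambda>u\<in>U. inv_into (points ?S) ?f (P u)) \<in> plots (Fr T A E) n U" .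
    moreover have "fst (inv_into (points ?S) ?f (P u)) \<in> W" if u: "u \<in> U" for u
    proof -
      have "P u \<in> points ?D" using PD u by auto
      with inv[OF this] show ?thesis by (auto simp: case_prod_beta points_dprod subdspace_points)
    qed
    ultimately show "(\<lambda>u\<in>U. inv_into (points ?S) ?f (P u)) \<in> plots ?S n U" by (auto simp: subdspace_plots)
  qed
  ultimately have "diffeo ?S ?D ?f" using bij by (simp add: diffeo_def)
  moreover have "\<forall>x\<in>points (Fr T A E). \<forall>g\<in>points GL. fst x \<in> W \<longrightarrow> \<tau> \<circ> snd (Fr_act x g) = (\<tau> \<circ> snd x) \<circ> g"
    by (simp add: Fr_act_def o_assoc)
  ultimately show "\<exists>W \<psi>. b \<in> W \<and> openin T W \<and>
      diffeo (subdspace (Fr T A E) {x. fst x \<in> W}) (dprod (subdspace M W) GL) (\<lambda>x. (fst x, \<psi> x)) \<and>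
      (\<forall>x\<in>points (Fr T A E). \<forall>g\<in>points GL. fst x \<in> W \<longrightarrow> \<psi> (Fr_act x g) = \<psi> x \<circ> g)"
    using t(2) triv_open(1)[OF t(1)] by (intro exI[of _ W] exI[of _ "\<lambda>x. \<tau> \<circ> snd x"]) blast
qed

end

section \<open>From connection forms to covariant derivatives\<close>

lemma tangent_map_cong:
  assumes "openin (Euclidean_space m) W" "\<And>w. w \<in> W \<Longrightarrow> g w = h w" "u \<in> W"
  shows "tangent_map m n g u v = tangent_map m n h u v"
proof -
  have "dir_deriv m (\<lambda>w. g w i) u v = dir_deriv m (\<lambda>w. h w i) u v" for i
    by (rule dir_deriv_cong[OF assms(1) _ assms(3)]) (simp add: assms(2))
  then show ?thesis unfolding tangent_map_def by (intro ext if_cong refl)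
qed

lemma tangent_map_id:
  assumes "v \<in> Rn n" shows "tangent_map n n (\<lambda>w. w) u v = v"
  using assms by (auto simp: tangent_map_def dir_deriv_coord Rn_iff fun_eq_iff)

lemma one_forms_plot:
  assumes "\<theta> \<in> one_forms X V" "p \<in> plots X n U"
  shows "smooth_map (dprod (euclidean_domain n U) (euclidean_domain n (Rn n))) V (\<lambda>(u, v). \<theta> n U p u v)"
    and "u \<in> U \<Longrightarrow> v \<in> Rn n \<Longrightarrow> w \<in> Rn n \<Longrightarrow> \<theta> n U p u (\<lambda>i. a * v i + b * w i) =
      vadd V (vscale V a (\<theta> n U p u v)) (vscale V b (\<theta> n U p u w))"
    and "g \<in> plots (euclidean_domain n U) m W \<Longrightarrow> u' \<in> W \<Longrightarrow> v' \<in> Rn m \<Longrightarrow>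
      \<theta> m W (compose W p g) u' v' = \<theta> n U p (g u') (tangent_map m n g u' v')"
proof -
  note * = assms(1)[unfolded one_forms_def mem_Collect_eq, THEN spec, THEN spec, THEN bspec, OF assms(2)]
  show "smooth_map (dprod (euclidean_domain n U) (euclidean_domain n (Rn n))) V (\<lambda>(u, v). \<theta> n U p u v)"
    using * by (rule conjunct1)
  show "u \<in> U \<Longrightarrow> v \<in> Rn n \<Longrightarrow> w \<in> Rn n \<Longrightarrow> \<theta> n U p u (\<lambda>i. a * v i + b * w i) =
      vadd V (vscale V a (\<theta> n U p u v)) (vscale V b (\<theta> n U p u w))"
    using *[THEN conjunct2, THEN conjunct1] by blast
  show "g \<in> plots (euclidean_domain n U) m W \<Longrightarrow> u' \<in> W \<Longrightarrow> v' \<in> Rn m \<Longrightarrow>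
      \<theta> m W (compose W p g) u' v' = \<theta> n U p (g u') (tangent_map m n g u' v')"
    using *[THEN conjunct2, THEN conjunct2] by blast
qed

lemma one_forms_pullback:
  assumes "\<theta> \<in> one_forms X V" "p \<in> plots X n U" and g: "smooth_into m W n U g" and u: "u \<in> W" "v \<in> Rn m"
  shows "\<theta> m W (\<lambda>w\<in>W. p (g w)) u v = \<theta> n U p (g u) (tangent_map m n g u v)"
proof -
  have W: "openin (Euclidean_space m) W" using g by (simp add: smooth_into_def)
  have "(\<lambda>w\<in>W. p (g w)) = compose W p (restrict g W)"
    unfolding compose_def by (rule restrict_ext) simp
  then have "\<theta> m W (\<lambda>w\<in>W. p (g w)) u v = \<theta> n U p (restrict g W u) (tangent_map m n (restrict g W) u v)"
    using one_forms_plot(3)[OF assms(1,2) restrict_euclidean_plot[OF g] u] by (simp only:)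
  also have "tangent_map m n (restrict g W) u v = tangent_map m n g u v"
    by (rule tangent_map_cong[OF W _ u(1)]) simp
  also have "restrict g W u = g u" using u(1) by simp
  finally show ?thesis .
qed

lemma one_forms_restrict:
  assumes "\<theta> \<in> one_forms X V" "p \<in> plots X n U" and "openin (Euclidean_space n) W" "W \<subseteq> U"
    and "u \<in> W" "v \<in> Rn n"
  shows "\<theta> n W (restrict p W) u v = \<theta> n U p u v"
  using one_forms_pullback[OF assms(1,2) smooth_into_mono[OF smooth_into_id[OF assms(3)] assms(4)] assms(5,6)]
  by (simp only: tangent_map_id[OF assms(6)])

text \<open>A straight line would leave \<open>U\<close>, but elements of \<open>GL_paths\<close>
  and the test for vertical vectors need curves defined on all of R. The curve u + d sin(r/d) X has
  velocity X at 0, and its amplitude d is small enough to stay in a box around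
  \<open>u\<close>.\<close>

lemma smooth_curve_through:
  assumes U: "openin (Euclidean_space n) U" and u: "u \<in> U" and X: "X \<in> Rn n"
  obtains \<kappa> where "\<kappa> 0 = u" "\<And>r. \<kappa> r \<in> U"
    "\<And>m V f. openin (Euclidean_space m) V \<Longrightarrow> smooth_on m V f \<Longrightarrow> smooth_into m V n U (\<lambda>v. \<kappa> (f v))"
    "tangent_map 1 n (\<lambda>t. \<kappa> (t 0)) (\<lambda>_. 0) e1 = X"
proof -
  obtain e where e: "e > 0" "\<And>y. y \<in> Rn n \<Longrightarrow> (\<forall>j<n. \<bar>y j - u j\<bar> < e) \<Longrightarrow> y \<in> U"
    using open_Rn_box[OF U u] by blast
  have uR: "u \<in> Rn n" using u open_Rn_subset[OF U] by blast
  \<comment> \<open>The summand 1 makes \<open>B\<close> positive and strictly larger than every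
    \<open>\<bar>X j\<bar>\<close>, so the displacement stays below d B = e.\<close>
  define B where "B = 1 + (\<Sum>j<n. \<bar>X j\<bar>)"
  have B: "B > 0" "\<And>j. j < n \<Longrightarrow> \<bar>X j\<bar> < B"
  proof -
    have "0 \<le> (\<Sum>j<n. \<bar>X j\<bar>)" by (rule sum_nonneg) simp
    then show "B > 0" unfolding B_def by linarith
    fix j assume "j < n"
    then have "\<bar>X j\<bar> \<le> (\<Sum>j<n. \<bar>X j\<bar>)" by (intro member_le_sum) auto
    then show "\<bar>X j\<bar> < B" unfolding B_def by linarith
  qed
  define d where "d = e / B"
  have d: "d > 0" using e(1) B(1) by (simp add: d_def)
  \<comment> \<open>The k-th derivative of d sin(r/d): each differentiation contributes a factor 1/d
    and a quarter-period shift.\<close>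
  define y where "y k r = d * (1 / d) ^ k * sin (r / d + of_nat k * (pi / 2))" for k :: nat and r :: real
  have y: "has_dv (y k) (y (Suc k) r) r" for k r
  proof -
    have "(y k has_real_derivative d * (1 / d) ^ k * (cos (r / d + of_nat k * (pi / 2)) * (1 / d))) (at r)"
      unfolding y_def[abs_def] by (auto intro!: derivative_eq_intros)
    moreover have "r / d + of_nat (Suc k) * (pi / 2) = (r / d + of_nat k * (pi / 2)) + pi / 2"
      by (simp add: algebra_simps add_divide_distrib)
    then have "sin (r / d + of_nat (Suc k) * (pi / 2)) = cos (r / d + of_nat k * (pi / 2))"
      by (simp only: sin_add cos_pi_half sin_pi_half mult_zero_right mult_1_right add_0)
    then have "y (Suc k) r = d * (1 / d) ^ k * (cos (r / d + of_nat k * (pi / 2)) * (1 / d))"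
      unfolding y_def by simp
    ultimately show ?thesis by (simp only: has_dv_real_iff)
  qed
  define \<kappa> where "\<kappa> r = (\<lambda>i. u i + y 0 r * X i)" for r
  have \<kappa>R: "\<kappa> r \<in> Rn n" for r using uR X by (simp add: \<kappa>_def Rn_iff)
  have \<kappa>U: "\<kappa> r \<in> U" for r
  proof (rule e(2)[OF \<kappa>R], intro allI impI)
    fix j assume j: "j < n"
    have "\<bar>\<kappa> r j - u j\<bar> = d * \<bar>sin (r / d)\<bar> * \<bar>X j\<bar>" using d by (simp add: \<kappa>_def y_def abs_mult)
    also have "\<dots> \<le> d * 1 * \<bar>X j\<bar>" using d abs_sin_le_one[of "r / d"] by (intro mult_right_mono mult_left_mono) auto
    also have "\<dots> < d * 1 * B" using d B(2)[OF j] by simp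
    also have "\<dots> = e" using B(1) by (simp add: d_def)
    finally show "\<bar>\<kappa> r j - u j\<bar> < e" .
  qed
  have sm: "smooth_into m V n U (\<lambda>v. \<kappa> (f v))" if V: "openin (Euclidean_space m) V" and f: "smooth_on m V f" for m V f
  proof -
    have "smooth_on m V (\<lambda>v. \<kappa> (f v) i)" for i
    proof -
      have "smooth_on m V (\<lambda>v. u i + y 0 (f v) *\<^sub>R X i)"
        by (intro smooth_on_add smooth_on_scaleR smooth_on_const V smooth_on_real_curve_compose[OF V f, of y 0] y)
      then show ?thesis by (simp add: \<kappa>_def)
    qed
    with V \<kappa>U show ?thesis by (auto simp: smooth_into_def)
  qed
  have "tangent_map 1 n (\<lambda>t. \<kappa> (t 0)) (\<lambda>_. 0) e1 i = X i" for i
  proof (cases "i < n")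
    case True
    have "has_dv (\<lambda>r. u i + y 0 r *\<^sub>R X i) (0 + (y (Suc 0) 0 *\<^sub>R X i + y 0 0 *\<^sub>R 0)) 0"
      by (intro has_dv_add has_dv_const has_dv_scaleR y)
    moreover have "y (Suc 0) 0 = 1" using d by (simp add: y_def)
    ultimately have "has_pd 0 (\<lambda>t. \<kappa> (t 0) i) (X i) (\<lambda>_. 0)"
      by (simp add: has_pd_iff \<kappa>_def)
    from partial_deriv_eq[OF this] show ?thesis
      using True unfolding tangent_map_def dir_deriv_e1 by simp
  next
    case False
    then show ?thesis using X by (simp add: tangent_map_def Rn_iff)
  qed
  then have tm: "tangent_map 1 n (\<lambda>t. \<kappa> (t 0)) (\<lambda>_. 0) e1 = X" by (rule ext)
  have "\<kappa> 0 = u" by (simp add: \<kappa>_def y_def)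
  from that[OF this \<kappa>U sm tm] show thesis .
qed

text \<open>The factors 1 in the first equation make its right side an instance of the linear
  combination in \<open>one_forms\<close>.\<close>

lemma tangent_map_vjoin_diag:
  "tangent_map n (n + n) (\<lambda>w. vjoin n n w w) u X = (\<lambda>i. 1 * vjoin n n X (\<lambda>_. 0) i + 1 * vjoin n n (\<lambda>_. 0) X i)"
  "tangent_map n (n + n) (\<lambda>w. vjoin n n w a) u X = vjoin n n X (\<lambda>_. 0)"
  "tangent_map n (n + n) (\<lambda>w. vjoin n n a w) u X = vjoin n n (\<lambda>_. 0) X"
  by (auto simp: fun_eq_iff tangent_map_def vjoin_def dir_deriv_coord dir_deriv_const)

section \<open>Sections as plots of the total space\<close>

context manifold_bundle
begin

definition is_section :: "nat \<Rightarrow> vec set \<Rightarrow> (vec \<Rightarrow> 'm) \<Rightarrow> (vec \<Rightarrow> 'e) \<Rightarrow> bool" where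
  "is_section n U p Y \<longleftrightarrow> Y \<in> plots (total E) n U \<and> (\<forall>u\<in>U. proj E (Y u) = p u)"

text \<open>A smooth map defined on a Euclidean domain is the same as a plot with that domain:
  compose with the identity in one direction, reparametrize in the other.\<close>

lemma section_point_iff:
  assumes U: "openin (Euclidean_space n) U"
  shows "Y \<in> points (sections E n U p) \<longleftrightarrow> is_section n U p Y"
proof -
  have "Y \<in> extensional U \<and> smooth_map (euclidean_domain n U) (total E) Y \<longleftrightarrow> Y \<in> plots (total E) n U"
  proof (intro iffI conjI)
    assume Y: "Y \<in> extensional U \<and> smooth_map (euclidean_domain n U) (total E) Y"
    have "(\<lambda>u\<in>U. Y (restrict (\<lambda>w. w) U u)) \<in> plots (total E) n U"
      by (rule smooth_map_plot[OF Y[THEN conjunct2] restrict_euclidean_plot[OF smooth_into_id[OF U]]])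
    also have "(\<lambda>u\<in>U. Y (restrict (\<lambda>w. w) U u)) = Y" using Y by (auto simp: extensional_def)
    finally show "Y \<in> plots (total E) n U" .
  next
    assume Y: "Y \<in> plots (total E) n U"
    show "Y \<in> extensional U" using ds_PiE[OF ds_total Y] by (simp add: PiE_def)
    show "smooth_map (euclidean_domain n U) (total E) Y" unfolding smooth_map_def compose_def
    proof (intro conjI allI ballI)
      show "Y \<in> points (euclidean_domain n U) \<rightarrow> points (total E)"
        using ds_PiE[OF ds_total Y] by (simp add: PiE_def)
      fix m V g assume "g \<in> plots (euclidean_domain n U) m V"
      then show "(\<lambda>x\<in>V. Y (g x)) \<in> plots (total E) m V"
        using ds_compose[OF ds_total Y] by (simp add: euclidean_plot_iff)
    qed
  qed
  then show ?thesis
    by (auto simp: sections_def subdspace_points Cinf_def Let_def is_section_def)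
qed

lemma section_in_fiber: "is_section n U p Y \<Longrightarrow> u \<in> U \<Longrightarrow> Y u \<in> fiber E (p u)"
  using ds_PiE[OF ds_total] unfolding is_section_def fiber_def by blast

lemma section_restrict:
  assumes "is_section n U p Y" "V \<subseteq> U" "openin (Euclidean_space n) V"
  shows "is_section n V (restrict p V) (restrict Y V)"
  using assms ds_restrict[OF ds_total] unfolding is_section_def by auto

lemma section_smooth:
  assumes t: "(W, \<tau>) \<in> trivs E" and Y: "is_section n U p Y" and p: "\<And>u. u \<in> U \<Longrightarrow> p u \<in> W"
  shows "smooth_on n U (\<lambda>u. \<tau> (Y u))"
  by (rule triv_plot_smooth[OF t]) (use Y p in \<open>auto simp: is_section_def\<close>)

lemma open_chart_domain:
  assumes t: "(W, \<tau>) \<in> trivs E" and p: "p \<in> plots M n U"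
  shows "openin (Euclidean_space n) {v \<in> U. p v \<in> W}"
  using p triv_open(1)[OF t] by (simp add: manifold_plot_iff)

end

locale connection = manifold_bundle T A E
  for T :: "'m topology"
    and A :: "('m set \<times> ('m \<Rightarrow> 'b::locally_convex_space)) set"
    and E :: "('m, 'e, 'f::locally_convex_space) vbundle" +
  fixes \<theta> :: "('m \<times> ('f \<Rightarrow> 'e), 'f \<Rightarrow> 'f) form"
  assumes conn: "\<theta> \<in> connection_forms T A E"
begin

section \<open>Connection forms and their change under a change of frame\<close>

lemma form: "\<theta> \<in> one_forms (Fr T A E) gl"
  using conn by (simp add: connection_forms_def)

lemma form_equivariant:
  assumes "g \<in> points GL" "p \<in> plots (Fr T A E) n U" "u \<in> U" "X \<in> Rn n"
  shows "\<theta> n U (\<lambda>u\<in>U. Fr_act (p u) g) u X = inv g \<circ> \<theta> n U p u X \<circ> g"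
  using conn[unfolded connection_forms_def mem_Collect_eq, THEN conjunct2, THEN conjunct1] assms by blast

lemma form_vertical:
  assumes "\<xi> \<in> points (Fr T A E)" "c \<in> points GL_paths"
  shows "\<theta> 1 (Rn 1) (\<lambda>t\<in>Rn 1. Fr_act \<xi> (c (t 0))) (\<lambda>_. 0) e1 = velocity c"
  using conn[unfolded connection_forms_def mem_Collect_eq, THEN conjunct2, THEN conjunct2] assms by blast

lemma form_smooth_family:
  assumes p: "p \<in> plots (Fr T A E) n U" and u: "smooth_into m S n U u" and X: "smooth_into m S n (Rn n) X"
  shows "smooth_family m S (\<lambda>s. \<theta> n U p (u s) (X s))" "\<And>s. s \<in> S \<Longrightarrow> linear (\<theta> n U p (u s) (X s))"
proof -
  have "(\<lambda>s\<in>S. \<theta> n U p (restrict u S s) (restrict X S s)) \<in> plots gl m S"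
    by (rule smooth_map_dprodD[OF one_forms_plot(1)[OF form p] restrict_euclidean_plot[OF u] restrict_euclidean_plot[OF X]])
       (use u X in \<open>auto simp: smooth_into_def\<close>)
  note * = gl_plot_smooth_family[OF this]
  show "smooth_family m S (\<lambda>s. \<theta> n U p (u s) (X s))"
    using *(1) smooth_family_cong[of S "\<lambda>s\<in>S. \<theta> n U p (restrict u S s) (restrict X S s)" "\<lambda>s. \<theta> n U p (u s) (X s)" m] by simp
  show "linear (\<theta> n U p (u s) (X s))" if "s \<in> S" for s using *(2)[OF that] that by simp
qed

lemma form_linear:
  assumes p: "p \<in> plots (Fr T A E) n U" and u: "u \<in> U" and X: "X \<in> Rn n"
  shows "linear (\<theta> n U p u X)"
proof -
  have U: "openin (Euclidean_space n) U" using ds_open[OF ds_Fr p] .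
  show ?thesis
    by (rule form_smooth_family(2)[OF p smooth_into_const smooth_into_const, OF U u U X u])
qed

lemma form_add:
  assumes "p \<in> plots (Fr T A E) n U" "u \<in> U" "X \<in> Rn n" "X' \<in> Rn n"
  shows "\<theta> n U p u (\<lambda>i. a * X i + b * X' i) v = a *\<^sub>R \<theta> n U p u X v + b *\<^sub>R \<theta> n U p u X' v"
  using one_forms_plot(2)[OF form assms, of a b] by (simp add: gl_vs)

text \<open>The change of a connection form under a change of frame: split the tangent vector of
  \<open>u \<mapsto> P u \<cdot> g u\<close>, the diagonal of the plot \<open>(u, u') \<mapsto> P u \<cdot> g u'\<close>, into its two components.\<close>

lemma form_gauge:
  assumes P: "P \<in> plots (Fr T A E) n U" and g: "g \<in> plots GL n U" and u: "u \<in> U" and X: "X \<in> Rn n"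
  shows "\<theta> n U (\<lambda>u\<in>U. Fr_act (P u) (g u)) u X v =
    inv (g u) (\<theta> n U P u X (g u v)) + inv (g u) (dir_deriv n (\<lambda>w. g w v) u X)"
proof -
  have U: "openin (Euclidean_space n) U" using ds_open[OF ds_Fr P] .
  let ?D = "prod_domain n n U U"
  note D = open_prod_domain[OF U U]
  note pr = smooth_into_prod_domain[OF U U]
  define Q where "Q = (\<lambda>w\<in>?D. Fr_act ((\<lambda>w\<in>?D. P (vfst n w)) w) ((\<lambda>w\<in>?D. g (vsnd n n w)) w))"
  have Q: "Q \<in> plots (Fr T A E) (n + n) ?D"
    unfolding Q_def by (rule Fr_act_plot[OF ds_compose[OF ds_Fr P pr(1)] ds_compose[OF diffeological_space_GL g pr(2)]])
  have Qv: "Q (vjoin n n a b) = Fr_act (P a) (g b)" if "a \<in> U" "b \<in> U" for a b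
  proof -
    have ab: "a \<in> Rn n" "b \<in> Rn n" using that open_Rn_subset[OF U] by auto
    then have "vjoin n n a b \<in> ?D"
      using that by (simp add: prod_domain_def vjoin_in_Rn vfst_vjoin vsnd_vjoin)
    then show ?thesis using ab by (simp add: Q_def vfst_vjoin vsnd_vjoin)
  qed
  have gu: "g u \<in> points GL" using g u by (auto simp: GL_plot_iff)
  have idU: "smooth_into n U n U (\<lambda>w. w)" by (rule smooth_into_id[OF U])
  have cU: "smooth_into n U n U (\<lambda>_. u)" by (rule smooth_into_const[OF U u])
  have z: "vjoin n n X (\<lambda>_. 0) \<in> Rn (n + n)" "vjoin n n (\<lambda>_. 0) X \<in> Rn (n + n)" by (rule vjoin_in_Rn)+
  have uu: "vjoin n n u u \<in> ?D" using smooth_into_vjoin[OF idU idU U U] u by (auto simp: smooth_into_def)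
  have "\<theta> n U (\<lambda>u\<in>U. Fr_act (P u) (g u)) u X = \<theta> n U (\<lambda>w\<in>U. Q (vjoin n n w w)) u X"
    by (simp add: Qv cong: restrict_cong)
  also have "\<dots> = \<theta> (n + n) ?D Q (vjoin n n u u) (\<lambda>i. 1 * vjoin n n X (\<lambda>_. 0) i + 1 * vjoin n n (\<lambda>_. 0) X i)"
    unfolding one_forms_pullback[OF form Q smooth_into_vjoin[OF idU idU U U] u X] tangent_map_vjoin_diag(1) ..
  finally have 0: "\<theta> n U (\<lambda>u\<in>U. Fr_act (P u) (g u)) u X v =
      \<theta> (n + n) ?D Q (vjoin n n u u) (vjoin n n X (\<lambda>_. 0)) v + \<theta> (n + n) ?D Q (vjoin n n u u) (vjoin n n (\<lambda>_. 0) X) v"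
    by (simp only: form_add[OF Q uu z] scaleR_one)
  have "\<theta> (n + n) ?D Q (vjoin n n u u) (vjoin n n X (\<lambda>_. 0)) = \<theta> n U (\<lambda>w\<in>U. Q (vjoin n n w u)) u X"
    unfolding one_forms_pullback[OF form Q smooth_into_vjoin[OF idU cU U U] u X] tangent_map_vjoin_diag(2) ..
  also have "\<dots> = \<theta> n U (\<lambda>w\<in>U. Fr_act (P w) (g u)) u X"
    using u by (simp add: Qv cong: restrict_cong)
  also have "\<dots> = inv (g u) \<circ> \<theta> n U P u X \<circ> g u" by (rule form_equivariant[OF gu P u X])
  finally have 1: "\<theta> (n + n) ?D Q (vjoin n n u u) (vjoin n n X (\<lambda>_. 0)) = inv (g u) \<circ> \<theta> n U P u X \<circ> g u" .
  let ?R = "\<lambda>w\<in>U. Fr_act ((\<lambda>_\<in>U. P u) w) (g w)"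
  have R: "?R \<in> plots (Fr T A E) n U"
    by (rule Fr_act_plot[OF ds_const[OF ds_Fr Fr_plot_point[OF P u] U] g])
  have "\<theta> (n + n) ?D Q (vjoin n n u u) (vjoin n n (\<lambda>_. 0) X) = \<theta> n U (\<lambda>w\<in>U. Q (vjoin n n u w)) u X"
    unfolding one_forms_pullback[OF form Q smooth_into_vjoin[OF cU idU U U] u X] tangent_map_vjoin_diag(3) ..
  also have "(\<lambda>w\<in>U. Q (vjoin n n u w)) = ?R"
    by (rule restrict_ext) (simp add: Qv u)
  finally have 2: "\<theta> (n + n) ?D Q (vjoin n n u u) (vjoin n n (\<lambda>_. 0) X) = \<theta> n U ?R u X" .
  obtain \<kappa> where \<kappa>: "\<kappa> 0 = u" "\<And>r. \<kappa> r \<in> U"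
    "\<And>m V f. openin (Euclidean_space m) V \<Longrightarrow> smooth_on m V f \<Longrightarrow> smooth_into m V n U (\<lambda>v. \<kappa> (f v))"
    "tangent_map 1 n (\<lambda>t. \<kappa> (t 0)) (\<lambda>_. 0) e1 = X"
    using smooth_curve_through[OF U u X] by blast
  have \<kappa>s: "smooth_into 1 (Rn 1) n U (\<lambda>t. \<kappa> (t 0))"
    by (intro \<kappa>(3) open_Rn_UNIV smooth_on_coord)
  have e1: "e1 \<in> Rn 1" by (simp add: Rn_iff)
  \<comment> \<open>Multiplication by \<open>inv (g u)\<close> makes the path start at the identity.
    The curve of frames \<open>P u\<close> moved by \<open>g (\<kappa> r)\<close> is then the frame
    \<open>P u\<close> moved by \<open>g u\<close> and by \<open>c r\<close>, so
    \<open>form_vertical\<close> evaluates the form on it.\<close>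
  define c where "c r = inv (g u) \<circ> g (\<kappa> r)" for r
  have c: "c \<in> points GL_paths" unfolding GL_path_iff
  proof (intro conjI)
    show "c 0 = id" by (simp add: c_def \<kappa>(1) GL_cancel[OF gu])
    show "smooth_map nebula GL c" unfolding smooth_map_def compose_def
    proof (intro conjI allI ballI)
      show "c \<in> points nebula \<rightarrow> points GL"
        using g \<kappa>(2) by (auto simp: c_def GL_plot_iff intro!: GL_mult GL_inv[OF gu])
      fix m V f assume "f \<in> plots (nebula :: real dvs) m V"
      then have V: "openin (Euclidean_space m) V" and f: "smooth_on m V f" by (auto simp: nebula_plot_iff)
      have "(\<lambda>v\<in>V. (\<lambda>_\<in>V. inv (g u)) v \<circ> (\<lambda>v\<in>V. g (\<kappa> (f v))) v) \<in> plots GL m V"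
        by (intro GL_plot_mult ds_const[OF diffeological_space_GL GL_inv[OF gu] V] ds_compose[OF diffeological_space_GL g \<kappa>(3)[OF V f]])
      then show "(\<lambda>v\<in>V. c (f v)) \<in> plots GL m V" by (simp add: c_def cong: restrict_cong)
    qed
  qed
  have "\<theta> n U ?R u X = \<theta> 1 (Rn 1) (\<lambda>t\<in>Rn 1. ?R (\<kappa> (t 0))) (\<lambda>_. 0) e1"
    using one_forms_pullback[OF form R \<kappa>s zero_in_Rn e1] by (simp only: \<kappa>(1,4))
  also have "(\<lambda>t\<in>Rn 1. ?R (\<kappa> (t 0))) = (\<lambda>t\<in>Rn 1. Fr_act (Fr_act (P u) (g u)) (c (t 0)))"
  proof (rule restrict_ext)
    fix t
    have "(g u \<circ> inv (g u)) \<circ> g (\<kappa> (t 0)) = g (\<kappa> (t 0))" by (simp only: GL_cancel[OF gu] id_o)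
    then show "?R (\<kappa> (t 0)) = Fr_act (Fr_act (P u) (g u)) (c (t 0))"
      using \<kappa>(2) by (simp add: Fr_act_def c_def comp_assoc)
  qed
  also have "\<theta> 1 (Rn 1) (\<lambda>t\<in>Rn 1. Fr_act (Fr_act (P u) (g u)) (c (t 0))) (\<lambda>_. 0) e1 = velocity c"
    by (rule form_vertical[OF Fr_act_point[OF Fr_plot_point[OF P u] gu] c])
  finally have 3: "\<theta> n U ?R u X = velocity c" .
  have gs: "smooth_on n U (\<lambda>w. g w v)"
    using g by (intro smooth_familyD[OF _ idU smooth_on_const[OF U]]) (auto simp: GL_plot_iff)
  have "velocity c v = dir_deriv 1 (\<lambda>t. inv (g u) (g (\<kappa> (t 0)) v)) (\<lambda>_. 0) e1"
    by (simp add: velocity_eq c_def)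
  \<comment> \<open>\<open>inv (g u)\<close> need not be continuous; it passes through the
    derivative because it is smooth and linear.\<close>
  also have "\<dots> = inv (g u) (dir_deriv 1 (\<lambda>t. g (\<kappa> (t 0)) v) (\<lambda>_. 0) e1)"
    by (rule smooth_linear_dir_deriv[OF _ _ open_Rn_UNIV smooth_into_compose[OF \<kappa>s U gs] zero_in_Rn])
       (use gu in \<open>auto simp: GL_point_iff\<close>)
  also have "dir_deriv 1 (\<lambda>t. g (\<kappa> (t 0)) v) (\<lambda>_. 0) e1 = dir_deriv n (\<lambda>w. g w v) u X"
    using dir_deriv_compose[OF \<kappa>s U gs zero_in_Rn, of e1] by (simp only: \<kappa>(1,4))
  finally have 4: "velocity c v = inv (g u) (dir_deriv n (\<lambda>w. g w v) u X)" .
  show ?thesis unfolding 0 1 2 3 4 by simp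
qed

abbreviation "LF \<equiv> local_connection_form E \<theta>"

lemma LF_restrict:
  assumes "(W, \<tau>) \<in> trivs E" "q \<in> plots M n V" "q ` V \<subseteq> W" "openin (Euclidean_space n) V'" "V' \<subseteq> V" "u \<in> V'" "X \<in> Rn n"
  shows "LF \<tau> n V' (restrict q V') u X = LF \<tau> n V q u X"
proof -
  have "(\<lambda>v\<in>V'. (restrict q V' v, triv_inv E \<tau> (restrict q V' v))) = restrict (\<lambda>v\<in>V. (q v, triv_inv E \<tau> (q v))) V'"
    using assms(5) by (auto simp: fun_eq_iff)
  then show ?thesis
    unfolding local_connection_form_def
    using one_forms_restrict[OF form Fr_section_plot[OF assms(1-3)] assms(4-7)] by simp
qed

text \<open>Write the coordinate of the section as \<open>g\<close> applied to its coordinate in the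
  other trivialization. The product rule produces the derivative of \<open>g\<close>, and the
  inhomogeneous term of \<open>form_gauge\<close> absorbs exactly this.\<close>

lemma LF_change:
  assumes t: "(W, \<tau>) \<in> trivs E" and t': "(W', \<tau>') \<in> trivs E"
    and q: "q \<in> plots M n V" "q ` V \<subseteq> W \<inter> W'" and Y: "is_section n V q Y" and u: "u \<in> V" and X: "X \<in> Rn n"
  shows "dir_deriv n (\<tau> \<circ> Y) u X + LF \<tau> n V q u X (\<tau> (Y u)) =
    (\<tau> \<circ> triv_inv E \<tau>' (q u)) (dir_deriv n (\<tau>' \<circ> Y) u X + LF \<tau>' n V q u X (\<tau>' (Y u)))"
proof -
  define g where "g = (\<lambda>v\<in>V. \<tau> \<circ> triv_inv E \<tau>' (q v))"
  have g: "g \<in> plots GL n V" unfolding g_def by (rule transition_plot[OF t t' q])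
  have V: "openin (Euclidean_space n) V" using ds_open[OF ds_M q(1)] .
  have gv: "g v \<in> points GL" if "v \<in> V" for v using g that by (auto simp: GL_plot_iff)
  have qW: "q v \<in> W" "q v \<in> W'" if "v \<in> V" for v using q(2) that by auto
  let ?P = "\<lambda>v\<in>V. (q v, triv_inv E \<tau> (q v))" and ?P' = "\<lambda>v\<in>V. (q v, triv_inv E \<tau>' (q v))"
  have P: "?P \<in> plots (Fr T A E) n V" by (rule Fr_section_plot[OF t q(1)]) (use qW in auto)
  have "?P' = (\<lambda>v\<in>V. Fr_act (?P v) (g v))"
  proof (rule restrict_ext)
    fix v assume v: "v \<in> V"
    have "triv_inv E \<tau> (q v) \<circ> (\<tau> \<circ> triv_inv E \<tau>' (q v)) = triv_inv E \<tau>' (q v)"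
      using triv_inv_triv[OF t qW(1)[OF v] triv_inv_in_fiber[OF t' qW(2)[OF v]]] by (simp add: fun_eq_iff)
    then show "(q v, triv_inv E \<tau>' (q v)) = Fr_act (?P v) (g v)"
      using v by (simp add: Fr_act_def g_def)
  qed
  then have *: "LF \<tau>' n V q u X v = inv (g u) (LF \<tau> n V q u X (g u v)) + inv (g u) (dir_deriv n (\<lambda>w. g w v) u X)" for v
    unfolding local_connection_form_def using form_gauge[OF P g u X, of v] by (simp only:)
  have gY: "g v (\<tau>' (Y v)) = \<tau> (Y v)" if v: "v \<in> V" for v
    using triv_inv_triv[OF t' qW(2)[OF v] section_in_fiber[OF Y v]] v by (simp add: g_def)
  have gf: "smooth_family n V g" using g by (simp add: GL_plot_iff)
  have Ys: "smooth_on n V (\<lambda>v. \<tau>' (Y v))" by (rule section_smooth[OF t' Y qW(2)])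
  have "dir_deriv n (\<tau> \<circ> Y) u X = dir_deriv n (\<lambda>v. g v (\<tau>' (Y v))) u X"
    by (rule dir_deriv_cong[OF V _ u]) (simp add: gY)
  also have "\<dots> = dir_deriv n (\<lambda>w. g w (\<tau>' (Y u))) u X + g u (dir_deriv n (\<lambda>v. \<tau>' (Y v)) u X)"
    by (rule dir_deriv_smooth_family[OF gf GL_linear[OF gv] Ys u])
  finally have 1: "dir_deriv n (\<tau> \<circ> Y) u X = dir_deriv n (\<lambda>w. g w (\<tau>' (Y u))) u X + g u (dir_deriv n (\<tau>' \<circ> Y) u X)"
    by (simp add: o_def)
  have "g u (LF \<tau>' n V q u X (\<tau>' (Y u))) = LF \<tau> n V q u X (\<tau> (Y u)) + dir_deriv n (\<lambda>w. g w (\<tau>' (Y u))) u X"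
    by (simp add: * linear_add[OF GL_linear[OF gv[OF u]]] GL_cancel[OF gv[OF u]] gY[OF u])
  then have "dir_deriv n (\<tau> \<circ> Y) u X + LF \<tau> n V q u X (\<tau> (Y u)) =
      g u (dir_deriv n (\<tau>' \<circ> Y) u X + LF \<tau>' n V q u X (\<tau>' (Y u)))"
    by (simp add: 1 linear_add[OF GL_linear[OF gv[OF u]]])
  then show ?thesis using u by (simp add: g_def)
qed

section \<open>The covariant derivative induced by a connection form\<close>

definition local_nabla :: "'m set \<Rightarrow> ('e \<Rightarrow> 'f) \<Rightarrow> nat \<Rightarrow> vec set \<Rightarrow> (vec \<Rightarrow> 'm) \<Rightarrow> vec \<Rightarrow> vec \<Rightarrow> (vec \<Rightarrow> 'e) \<Rightarrow> 'f" where
  "local_nabla W \<tau> n U p u X Y = (let V = {v \<in> U. p v \<in> W} in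
     dir_deriv n (\<tau> \<circ> Y) u X + LF \<tau> n V (restrict p V) u X (\<tau> (Y u)))"

lemma local_nabla_restrict:
  assumes t: "(W, \<tau>) \<in> trivs E" and p: "p \<in> plots M n U" and Y: "is_section n U p Y"
    and V: "openin (Euclidean_space n) V" "V \<subseteq> U" "\<And>v. v \<in> V \<Longrightarrow> p v \<in> W" and u: "u \<in> V" and X: "X \<in> Rn n"
  shows "local_nabla W \<tau> n U p u X Y = dir_deriv n (\<tau> \<circ> restrict Y V) u X + LF \<tau> n V (restrict p V) u X (\<tau> (restrict Y V u))"
proof -
  let ?V = "{v \<in> U. p v \<in> W}"
  have o: "openin (Euclidean_space n) ?V" by (rule open_chart_domain[OF t p])
  have VV: "V \<subseteq> ?V" using V by auto
  have "restrict p ?V \<in> plots M n ?V" by (rule ds_restrict[OF ds_M p _ o]) auto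
  from LF_restrict[OF t this _ V(1) VV u X]
  have "LF \<tau> n V (restrict (restrict p ?V) V) u X = LF \<tau> n ?V (restrict p ?V) u X" by auto
  moreover have "restrict (restrict p ?V) V = restrict p V" using VV by (auto simp: fun_eq_iff)
  moreover have "dir_deriv n (\<tau> \<circ> restrict Y V) u X = dir_deriv n (\<tau> \<circ> Y) u X"
    by (rule dir_deriv_cong[OF V(1) _ u]) simp
  ultimately show ?thesis using u by (simp add: local_nabla_def Let_def)
qed

text \<open>\<open>LF_change\<close> compares the two expressions on one common domain, so both are
  first restricted to the part of \<open>U\<close> that \<open>p\<close> maps into both chart
  domains.\<close>

lemma local_nabla_change:
  assumes t: "(W, \<tau>) \<in> trivs E" and t': "(W', \<tau>') \<in> trivs E" and p: "p \<in> plots M n U" and Y: "is_section n U p Y"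
    and u: "u \<in> U" "p u \<in> W" "p u \<in> W'" and X: "X \<in> Rn n"
  shows "local_nabla W \<tau> n U p u X Y = \<tau> (triv_inv E \<tau>' (p u) (local_nabla W' \<tau>' n U p u X Y))"
proof -
  let ?V = "{v \<in> U. p v \<in> W} \<inter> {v \<in> U. p v \<in> W'}"
  have o: "openin (Euclidean_space n) ?V" by (intro open_Rn_Int open_chart_domain[OF t p] open_chart_domain[OF t' p])
  have uV: "u \<in> ?V" using u by simp
  have q: "restrict p ?V \<in> plots M n ?V" by (rule ds_restrict[OF ds_M p _ o]) auto
  have sY: "is_section n ?V (restrict p ?V) (restrict Y ?V)" by (rule section_restrict[OF Y _ o]) auto
  have "local_nabla W \<tau> n U p u X Y = dir_deriv n (\<tau> \<circ> restrict Y ?V) u X + LF \<tau> n ?V (restrict p ?V) u X (\<tau> (restrict Y ?V u))"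
    by (rule local_nabla_restrict[OF t p Y o _ _ uV X]) auto
  moreover have "local_nabla W' \<tau>' n U p u X Y = dir_deriv n (\<tau>' \<circ> restrict Y ?V) u X + LF \<tau>' n ?V (restrict p ?V) u X (\<tau>' (restrict Y ?V u))"
    by (rule local_nabla_restrict[OF t' p Y o _ _ uV X]) auto
  ultimately show ?thesis
    using LF_change[OF t t' q _ sY uV X] u by auto
qed

text \<open>An arbitrary trivialization is chosen at each point; \<open>local_nabla_change\<close>
  shows that the value does not depend on it.\<close>

definition nabla :: "('m, 'e) collection" where
  "nabla n U p u X Y = (if collection_domain M E n U p u X Y then
     (let (W, \<tau>) = SOME (W, \<tau>). (W, \<tau>) \<in> trivs E \<and> p u \<in> W in triv_inv E \<tau> (p u) (local_nabla W \<tau> n U p u X Y))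
   else undefined)"

lemma collection_domain_iff:
  "collection_domain M E n U p u X Y \<longleftrightarrow> p \<in> plots M n U \<and> u \<in> U \<and> X \<in> Rn n \<and> is_section n U p Y"
  unfolding collection_domain_def using section_point_iff[OF ds_open[OF ds_M]] by blast

lemma induced_by_iff:
  "induced_by T A E \<theta> D \<longleftrightarrow> D \<in> collections M E \<and> (\<forall>W \<tau> n U p u X Y. (W, \<tau>) \<in> trivs E \<longrightarrow>
     collection_domain M E n U p u X Y \<longrightarrow> p u \<in> W \<longrightarrow> \<tau> (D n U p u X Y) = local_nabla W \<tau> n U p u X Y)"
  unfolding induced_by_def local_nabla_def Let_def Ball_def split_paired_All prod.case by blast

lemma nabla_chart:
  assumes "collection_domain M E n U p u X Y"
  shows "\<exists>W \<tau>. (W, \<tau>) \<in> trivs E \<and> p u \<in> W \<and> nabla n U p u X Y = triv_inv E \<tau> (p u) (local_nabla W \<tau> n U p u X Y)"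
proof -
  define c where "c = (SOME (W, \<tau>). (W, \<tau>) \<in> trivs E \<and> p u \<in> W)"
  have "p u \<in> topspace T"
    using assms ds_PiE[OF ds_M] unfolding collection_domain_iff by auto
  then obtain W0 \<tau>0 where "(W0, \<tau>0) \<in> trivs E \<and> p u \<in> W0" using triv_exists by blast
  then have "case (W0, \<tau>0) of (W, \<tau>) \<Rightarrow> (W, \<tau>) \<in> trivs E \<and> p u \<in> W" by simp
  then have *: "case c of (W, \<tau>) \<Rightarrow> (W, \<tau>) \<in> trivs E \<and> p u \<in> W" unfolding c_def by (rule someI)
  obtain W \<tau> where c: "c = (W, \<tau>)" by (cases c)
  have "nabla n U p u X Y = triv_inv E \<tau> (p u) (local_nabla W \<tau> n U p u X Y)"
    unfolding nabla_def using assms c unfolding c_def[symmetric] by simp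
  then show ?thesis using * unfolding c prod.case by blast
qed

lemma nabla_induced: "induced_by T A E \<theta> nabla"
  unfolding induced_by_iff collections_def mem_Collect_eq
proof (intro conjI allI impI)
  fix n U p u X Y assume d: "collection_domain M E n U p u X Y"
  obtain W \<tau> where t: "(W, \<tau>) \<in> trivs E" "p u \<in> W"
    and n: "nabla n U p u X Y = triv_inv E \<tau> (p u) (local_nabla W \<tau> n U p u X Y)"
    using nabla_chart[OF d] by blast
  show "nabla n U p u X Y \<in> fiber E (p u)" unfolding n by (rule triv_inv_in_fiber[OF t])
  fix W' \<tau>' assume t': "(W', \<tau>') \<in> trivs E" "p u \<in> W'"
  show "\<tau>' (nabla n U p u X Y) = local_nabla W' \<tau>' n U p u X Y"
    using local_nabla_change[OF t'(1) t(1), of p n U Y u X] t'(2) t(2) d unfolding n collection_domain_iff by simp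
next
  fix n U p u X Y assume "\<not> collection_domain M E n U p u X Y"
  then show "nabla n U p u X Y = undefined" by (simp add: nabla_def)
qed

lemma collections_fiber:
  "D \<in> collections M E \<Longrightarrow> collection_domain M E n U p u X Y \<Longrightarrow> D n U p u X Y \<in> fiber E (p u)"
  by (simp add: collections_def)

lemma collections_undefined:
  "D \<in> collections M E \<Longrightarrow> \<not> collection_domain M E n U p u X Y \<Longrightarrow> D n U p u X Y = undefined"
  by (simp add: collections_def)

lemma induced_collection: "induced_by T A E \<theta> D \<Longrightarrow> D \<in> collections M E"
  by (simp add: induced_by_def)

lemma induced_chart:
  "induced_by T A E \<theta> D \<Longrightarrow> (W, \<tau>) \<in> trivs E \<Longrightarrow> collection_domain M E n U p u X Y \<Longrightarrow> p u \<in> W \<Longrightarrow>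
    \<tau> (D n U p u X Y) = local_nabla W \<tau> n U p u X Y"
  unfolding induced_by_iff by simp

text \<open>Trivializations are injective on fibers and cover the base, so the chart formulas
  determine the values on the domain; off the domain both collections are
  \<open>undefined\<close>.\<close>

lemma induced_unique:
  assumes D: "induced_by T A E \<theta> D" and D': "induced_by T A E \<theta> D'"
  shows "D = D'"
proof (intro ext)
  fix n U p u X Y
  show "D n U p u X Y = D' n U p u X Y"
  proof (cases "collection_domain M E n U p u X Y")
    case True
    obtain W \<tau> where t: "(W, \<tau>) \<in> trivs E" "p u \<in> W" using nabla_chart[OF True] by blast
    show ?thesis
      by (rule triv_eqI[OF t collections_fiber[OF induced_collection[OF D] True]
            collections_fiber[OF induced_collection[OF D'] True]])
         (simp only: induced_chart[OF D t(1) True t(2)] induced_chart[OF D' t(1) True t(2)])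
  next
    case False
    then show ?thesis
      using collections_undefined[OF induced_collection[OF D]] collections_undefined[OF induced_collection[OF D']] by simp
  qed
qed

end

section \<open>Plots of the total space and of spaces of sections\<close>

context manifold_bundle
begin

text \<open>Near each point the map is recovered from its smooth fiber coordinate by
  \<open>triv_inv_plot\<close>, and the pieces are glued.\<close>

lemma total_plotI:
  assumes \<pi>: "\<pi> \<in> plots M n U" and e: "e \<in> extensional U" "\<And>u. u \<in> U \<Longrightarrow> e u \<in> fiber E (\<pi> u)"
    and sm: "\<And>W \<tau>. (W, \<tau>) \<in> trivs E \<Longrightarrow> smooth_on n {u \<in> U. \<pi> u \<in> W} (\<lambda>u. \<tau> (e u))"
  shows "e \<in> plots (total E) n U"
proof (rule ds_glue[OF ds_total _ e(1)])
  show "openin (Euclidean_space n) U" by (rule ds_open[OF ds_M \<pi>])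
  fix u assume u: "u \<in> U"
  then have "\<pi> u \<in> topspace T" using ds_PiE[OF ds_M \<pi>] by auto
  then obtain W \<tau> where t: "(W, \<tau>) \<in> trivs E" and x: "\<pi> u \<in> W" using triv_exists by blast
  let ?V = "{u \<in> U. \<pi> u \<in> W}"
  have o: "openin (Euclidean_space n) ?V" by (rule open_chart_domain[OF t \<pi>])
  have "(\<lambda>v\<in>?V. triv_inv E \<tau> (restrict \<pi> ?V v) (\<tau> (e v))) \<in> plots (total E) n ?V"
    by (rule triv_inv_plot[OF t ds_restrict[OF ds_M \<pi> _ o] _ sm[OF t]]) auto
  moreover have "\<forall>v\<in>?V. e v = (\<lambda>v\<in>?V. triv_inv E \<tau> (restrict \<pi> ?V v) (\<tau> (e v))) v"
    using triv_inv_triv[OF t _ e(2)] by simp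
  ultimately show "\<exists>V q. u \<in> V \<and> V \<subseteq> U \<and> q \<in> plots (total E) n V \<and> (\<forall>v\<in>V. e v = q v)"
    using u x by (intro exI[of _ ?V] exI[of _ "\<lambda>v\<in>?V. triv_inv E \<tau> (restrict \<pi> ?V v) (\<tau> (e v))"]) auto
qed

lemma fiber_base: "p \<in> plots M n U \<Longrightarrow> u \<in> U \<Longrightarrow> p u \<in> topspace T"
  using ds_PiE[OF ds_M] by auto

lemma triv_lin:
  assumes t: "(W, \<tau>) \<in> trivs E" and x: "x \<in> W" and d: "d \<in> fiber E x" and e: "e \<in> fiber E x"
  shows "\<tau> (fadd E (fscale E a d) (fscale E b e)) = a *\<^sub>R \<tau> d + b *\<^sub>R \<tau> e"
proof -
  have xT: "x \<in> topspace T" using triv_open(2)[OF t] x by auto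
  show ?thesis
    using triv_add[OF t x fiber_scale[OF xT d, of a] fiber_scale[OF xT e, of b]]
    by (simp add: triv_scale[OF t x] d e)
qed

lemma section_smooth_chart:
  assumes t: "(W, \<tau>) \<in> trivs E" and p: "p \<in> plots M n U" and Y: "is_section n U p Y"
  shows "smooth_on n {v \<in> U. p v \<in> W} (\<lambda>v. \<tau> (Y v))"
proof -
  let ?V = "{v \<in> U. p v \<in> W}"
  have o: "openin (Euclidean_space n) ?V" by (rule open_chart_domain[OF t p])
  have "smooth_on n ?V (\<lambda>v. \<tau> (restrict Y ?V v))"
    by (rule section_smooth[OF t section_restrict[OF Y _ o]]) auto
  then show ?thesis using smooth_on_cong[OF o, of "\<lambda>v. \<tau> (restrict Y ?V v)" "\<lambda>v. \<tau> (Y v)"] by simp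
qed

lemma section_lin:
  assumes p: "p \<in> plots M n U" and Y: "is_section n U p Y" and Z: "is_section n U p Z"
    and f: "smooth_on n U f" and g: "smooth_on n U g"
  shows "is_section n U p (\<lambda>v\<in>U. fadd E (fscale E (f v) (Y v)) (fscale E (g v) (Z v)))"
proof -
  let ?S = "\<lambda>v\<in>U. fadd E (fscale E (f v) (Y v)) (fscale E (g v) (Z v))"
  have fib: "?S v \<in> fiber E (p v)" if v: "v \<in> U" for v
    using v fiber_base[OF p v] section_in_fiber[OF Y v] section_in_fiber[OF Z v]
    by (simp add: fiber_add fiber_scale)
  have "?S \<in> plots (total E) n U"
  proof (rule total_plotI[OF p restrict_extensional fib])
    fix W \<tau> assume t: "(W, \<tau>) \<in> trivs E"
    let ?V = "{v \<in> U. p v \<in> W}"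
    have o: "openin (Euclidean_space n) ?V" by (rule open_chart_domain[OF t p])
    have VU: "?V \<subseteq> U" by auto
    have "smooth_on n ?V (\<lambda>v. f v *\<^sub>R \<tau> (Y v) + g v *\<^sub>R \<tau> (Z v))"
      by (intro smooth_on_add smooth_on_scaleR o smooth_on_subset[OF f VU] smooth_on_subset[OF g VU]
          section_smooth_chart[OF t p Y] section_smooth_chart[OF t p Z])
    moreover have "f v *\<^sub>R \<tau> (Y v) + g v *\<^sub>R \<tau> (Z v) = \<tau> (?S v)" if v: "v \<in> ?V" for v
    proof -
      have v': "v \<in> U" "p v \<in> W" using v by auto
      show ?thesis using triv_lin[OF t v'(2) section_in_fiber[OF Y v'(1)] section_in_fiber[OF Z v'(1)]] v' by simp
    qed
    ultimately show "smooth_on n ?V (\<lambda>v. \<tau> (?S v))"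
      using smooth_on_cong[OF o, of "\<lambda>v. f v *\<^sub>R \<tau> (Y v) + g v *\<^sub>R \<tau> (Z v)" "\<lambda>v. \<tau> (?S v)"] by blast
  qed
  then show ?thesis using fib by (auto simp: is_section_def fiber_def)
qed

lemma section_scale:
  assumes p: "p \<in> plots M n U" and Y: "is_section n U p Y" and f: "smooth_on n U f"
  shows "is_section n U p (\<lambda>v\<in>U. fscale E (f v) (Y v))"
proof -
  let ?S = "\<lambda>v\<in>U. fscale E (f v) (Y v)"
  have fib: "?S v \<in> fiber E (p v)" if v: "v \<in> U" for v
    using v fiber_base[OF p v] section_in_fiber[OF Y v] by (simp add: fiber_scale)
  have "?S \<in> plots (total E) n U"
  proof (rule total_plotI[OF p restrict_extensional fib])
    fix W \<tau> assume t: "(W, \<tau>) \<in> trivs E"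
    let ?V = "{v \<in> U. p v \<in> W}"
    have o: "openin (Euclidean_space n) ?V" by (rule open_chart_domain[OF t p])
    have VU: "?V \<subseteq> U" by auto
    have "smooth_on n ?V (\<lambda>v. f v *\<^sub>R \<tau> (Y v))"
      by (intro smooth_on_scaleR o smooth_on_subset[OF f VU] section_smooth_chart[OF t p Y])
    moreover have "f v *\<^sub>R \<tau> (Y v) = \<tau> (?S v)" if v: "v \<in> ?V" for v
    proof -
      have v': "v \<in> U" "p v \<in> W" using v by auto
      show ?thesis using triv_scale[OF t v'(2) section_in_fiber[OF Y v'(1)]] v' by simp
    qed
    ultimately show "smooth_on n ?V (\<lambda>v. \<tau> (?S v))"
      using smooth_on_cong[OF o, of "\<lambda>v. f v *\<^sub>R \<tau> (Y v)" "\<lambda>v. \<tau> (?S v)"] by blast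
  qed
  then show ?thesis using fib by (auto simp: is_section_def fiber_def)
qed

lemma section_compose:
  assumes Y: "is_section n U p Y" and g: "smooth_into m V n U g"
  shows "is_section m V (\<lambda>v\<in>V. p (g v)) (\<lambda>v\<in>V. Y (g v))"
  using Y g ds_compose[OF ds_total _ g] unfolding is_section_def by (auto simp: smooth_into_def)

lemma sections_plot:
  assumes Y: "Y \<in> plots (sections E n U p) m S" and U: "openin (Euclidean_space n) U"
  shows "openin (Euclidean_space m) S" "\<And>s. s \<in> S \<Longrightarrow> is_section n U p (Y s)"
    "\<And>k V g h. smooth_into k V m S g \<Longrightarrow> smooth_into k V n U h \<Longrightarrow> (\<lambda>v\<in>V. Y (g v) (h v)) \<in> plots (total E) k V"
proof -
  have *: "Y \<in> S \<rightarrow>\<^sub>E points (sections E n U p)" "openin (Euclidean_space m) S"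
    "smooth_map (dprod (euclidean_domain m S) (euclidean_domain n U)) (total E) (\<lambda>(s, u). Y s u)"
    using Y by (auto simp: sections_def subdspace_def Cinf_def Let_def)
  show "openin (Euclidean_space m) S" by (rule *(2))
  show "is_section n U p (Y s)" if "s \<in> S" for s
    using *(1) that section_point_iff[OF U] by auto
  fix k V g h assume g: "smooth_into k V m S g" and h: "smooth_into k V n U h"
  have "(\<lambda>v\<in>V. Y (restrict g V v) (restrict h V v)) \<in> plots (total E) k V"
    by (rule smooth_map_dprodD[OF *(3) restrict_euclidean_plot[OF g] restrict_euclidean_plot[OF h]])
       (use g h in \<open>auto simp: smooth_into_def\<close>)
  also have "(\<lambda>v\<in>V. Y (restrict g V v) (restrict h V v)) = (\<lambda>v\<in>V. Y (g v) (h v))"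
    by (rule restrict_ext) simp
  finally show "(\<lambda>v\<in>V. Y (g v) (h v)) \<in> plots (total E) k V" .
qed

end

section \<open>The induced collection satisfies the axioms of a covariant derivative\<close>

context connection
begin

text \<open>The functional diffeology on sections makes \<open>Y s v\<close> smooth in
  \<open>s\<close> and \<open>v\<close> together, so the derivative term is a parametric directional
  derivative. The other term is a smooth family of linear maps applied to a smooth vector.\<close>

lemma local_nabla_smooth:
  assumes t: "(W, \<tau>) \<in> trivs E" and p: "p \<in> plots M n U" and S: "openin (Euclidean_space m) S"
    and u: "smooth_into m S n {v \<in> U. p v \<in> W} u" and X: "smooth_into m S n (Rn n) X"
    and Y: "\<And>k V g h. smooth_into k V m S g \<Longrightarrow> smooth_into k V n U h \<Longrightarrow> (\<lambda>v\<in>V. Y (g v) (h v)) \<in> plots (total E) k V"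
    and Ys: "\<And>s. s \<in> S \<Longrightarrow> is_section n U p (Y s)"
  shows "smooth_on m S (\<lambda>s. local_nabla W \<tau> n U p (u s) (X s) (Y s))"
proof -
  let ?V = "{v \<in> U. p v \<in> W}"
  have V: "openin (Euclidean_space n) ?V" by (rule open_chart_domain[OF t p])
  have VU: "?V \<subseteq> U" by auto
  let ?D = "prod_domain m n S ?V"
  note D = open_prod_domain[OF S V]
  note pr = smooth_into_prod_domain[OF S V]
  have proj: "proj E (Y s v) = p v" if "s \<in> S" "v \<in> U" for s v
    using Ys[OF that(1)] that(2) by (simp add: is_section_def)
  have uV: "u s \<in> ?V" if "s \<in> S" for s using u that by (auto simp: smooth_into_def)
  have pl: "(\<lambda>w\<in>?D. Y (vfst m w) (vsnd m n w)) \<in> plots (total E) (m + n) ?D"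
    by (rule Y[OF pr(1) smooth_into_mono[OF pr(2) VU]])
  have "smooth_on (m + n) ?D (\<lambda>w. \<tau> ((\<lambda>w\<in>?D. Y (vfst m w) (vsnd m n w)) w))"
    by (rule triv_plot_smooth[OF t pl]) (auto simp: prod_domain_def proj)
  then have "smooth_on (m + n) ?D (\<lambda>w. \<tau> (Y (vfst m w) (vsnd m n w)))"
    using smooth_on_cong[OF D, of "\<lambda>w. \<tau> ((\<lambda>w\<in>?D. Y (vfst m w) (vsnd m n w)) w)"
        "\<lambda>w. \<tau> (Y (vfst m w) (vsnd m n w))"] by simp
  from smooth_parametric_dir_deriv[OF S V this u X]
  have 1: "smooth_on m S (\<lambda>s. dir_deriv n (\<lambda>v. \<tau> (Y s v)) (u s) (X s))" .
  have q: "restrict p ?V \<in> plots M n ?V" by (rule ds_restrict[OF ds_M p VU V])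
  have P: "(\<lambda>v\<in>?V. (restrict p ?V v, triv_inv E \<tau> (restrict p ?V v))) \<in> plots (Fr T A E) n ?V"
    by (rule Fr_section_plot[OF t q]) auto
  have pl2: "(\<lambda>s\<in>S. Y s (u s)) \<in> plots (total E) m S"
    by (rule Y[OF smooth_into_id[OF S] smooth_into_mono[OF u VU]])
  have "smooth_on m S (\<lambda>s. \<tau> ((\<lambda>s\<in>S. Y s (u s)) s))"
    by (rule triv_plot_smooth[OF t pl2]) (use uV proj in auto)
  then have f: "smooth_on m S (\<lambda>s. \<tau> (Y s (u s)))"
    using smooth_on_cong[OF S, of "\<lambda>s. \<tau> ((\<lambda>s\<in>S. Y s (u s)) s)" "\<lambda>s. \<tau> (Y s (u s))"] by simp
  have 2: "smooth_on m S (\<lambda>s. LF \<tau> n ?V (restrict p ?V) (u s) (X s) (\<tau> (Y s (u s))))"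
    unfolding local_connection_form_def
    by (rule smooth_familyD[OF form_smooth_family(1)[OF P u X] smooth_into_id[OF S] f])
  show ?thesis
    using smooth_on_add[OF S 1 2] by (simp add: local_nabla_def Let_def o_def)
qed

text \<open>Each algebraic axiom is an equation between elements of one fiber and may be checked
  after applying a trivialization, where the chart formula turns it into a rule for directional
  derivatives plus linearity of the local connection form.\<close>

lemma induced_in_CD:
  assumes D: "induced_by T A E \<theta> D"
  shows "D \<in> CD T A E"
  unfolding CD_def mem_Collect_eq
proof (intro conjI allI ballI)
  show "D \<in> collections M E" by (rule induced_collection[OF D])
  fix n U p assume p: "p \<in> plots M n U"
  have U: "openin (Euclidean_space n) U" by (rule ds_open[OF ds_M p])
  have dom: "collection_domain M E n U p u X Y" if "u \<in> U" "X \<in> Rn n" "is_section n U p Y" for u X Y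
    using that p by (simp add: collection_domain_iff)
  note fib = collections_fiber[OF induced_collection[OF D] dom]
  note chart = induced_chart[OF D _ dom]
  have ex: "\<exists>W \<tau>. (W, \<tau>) \<in> trivs E \<and> p u \<in> W" if "u \<in> U" for u
    by (rule triv_exists[OF fiber_base[OF p that]])
  have VV: "openin (Euclidean_space n) {v \<in> U. p v \<in> W}" if "(W, \<tau>) \<in> trivs E" for W \<tau>
    by (rule open_chart_domain[OF that p])
  have LFlin: "linear (LF \<tau> n {v \<in> U. p v \<in> W} (restrict p {v \<in> U. p v \<in> W}) u X)"
    if t: "(W, \<tau>) \<in> trivs E" and u: "u \<in> U" "p u \<in> W" and X: "X \<in> Rn n" for W \<tau> u X
    unfolding local_connection_form_def
    by (rule form_linear[OF Fr_section_plot[OF t ds_restrict[OF ds_M p _ VV[OF t]]]]) (use u X in auto)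
  have LFadd: "LF \<tau> n {v \<in> U. p v \<in> W} (restrict p {v \<in> U. p v \<in> W}) u (\<lambda>i. a * X i + b * X' i) z =
      a *\<^sub>R LF \<tau> n {v \<in> U. p v \<in> W} (restrict p {v \<in> U. p v \<in> W}) u X z +
      b *\<^sub>R LF \<tau> n {v \<in> U. p v \<in> W} (restrict p {v \<in> U. p v \<in> W}) u X' z"
    if t: "(W, \<tau>) \<in> trivs E" and u: "u \<in> U" "p u \<in> W" and X: "X \<in> Rn n" "X' \<in> Rn n" for W \<tau> u X X' a b z
    unfolding local_connection_form_def
    by (rule form_add[OF Fr_section_plot[OF t ds_restrict[OF ds_M p _ VV[OF t]]]]) (use u X in auto)
  have linR: "(\<lambda>i. a * X i + b * X' i) \<in> Rn n" if "X \<in> Rn n" "X' \<in> Rn n" for a b X X'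
    using that by (simp add: Rn_iff)
  show "smooth_map (dprod (dprod (euclidean_domain n U) (euclidean_domain n (Rn n))) (sections E n U p))
         (total E) (\<lambda>((u, X), Y). D n U p u X Y)"
  proof (rule smooth_map_dprodI)
    fix z Y assume z: "z \<in> points (dprod (euclidean_domain n U) (euclidean_domain n (Rn n)))"
      and Y: "Y \<in> points (sections E n U p)"
    show "(case z of (u, X) \<Rightarrow> \<lambda>Y. D n U p u X Y) Y \<in> points (total E)"
      using z fib[of "fst z" "snd z" Y] section_point_iff[OF U] Y by (auto simp: points_dprod fiber_def)
  next
    fix m S P Y assume P: "P \<in> plots (dprod (euclidean_domain n U) (euclidean_domain n (Rn n))) m S"
      and Y: "Y \<in> plots (sections E n U p) m S"
    have u: "smooth_into m S n U (\<lambda>s. fst (P s))" and X: "smooth_into m S n (Rn n) (\<lambda>s. snd (P s))"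
    proof -
      have "smooth_into m S n U (compose S fst P)" "smooth_into m S n (Rn n) (compose S snd P)"
        using P by (auto simp: dprod_def euclidean_plot_iff)
      then show "smooth_into m S n U (\<lambda>s. fst (P s))" "smooth_into m S n (Rn n) (\<lambda>s. snd (P s))"
        using smooth_into_cong[of S "compose S fst P" "\<lambda>s. fst (P s)" m n U]
          smooth_into_cong[of S "compose S snd P" "\<lambda>s. snd (P s)" m n "Rn n"] by (auto simp: compose_def)
    qed
    note Ys = sections_plot[OF Y U]
    have uX: "fst (P s) \<in> U" "snd (P s) \<in> Rn n" if "s \<in> S" for s
      using u X that by (auto simp: smooth_into_def)
    let ?e = "\<lambda>s\<in>S. D n U p (fst (P s)) (snd (P s)) (Y s)"
    have "?e \<in> plots (total E) m S"
    proof (rule total_plotI[OF ds_compose[OF ds_M p u]])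
      show "?e s \<in> fiber E ((\<lambda>s\<in>S. p (fst (P s))) s)" if s: "s \<in> S" for s
        using fib[OF uX[OF s] Ys(2)[OF s]] s by simp
      fix W \<tau> assume t: "(W, \<tau>) \<in> trivs E"
      let ?S = "{s \<in> S. (\<lambda>s\<in>S. p (fst (P s))) s \<in> W}"
      have S: "openin (Euclidean_space m) ?S" by (rule open_chart_domain[OF t ds_compose[OF ds_M p u]])
      have SS: "?S \<subseteq> S" by auto
      have u': "smooth_into m ?S n {v \<in> U. p v \<in> W} (\<lambda>s. fst (P s))"
        using smooth_into_subset[OF u S SS] uX by (auto simp: smooth_into_def)
      have "smooth_on m ?S (\<lambda>s. local_nabla W \<tau> n U p (fst (P s)) (snd (P s)) (Y s))"
        by (rule local_nabla_smooth[OF t p S u' smooth_into_subset[OF X S SS]])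
           (use Ys(2,3) smooth_into_mono[OF _ SS] in auto)
      moreover have "local_nabla W \<tau> n U p (fst (P s)) (snd (P s)) (Y s) = \<tau> (?e s)" if s: "s \<in> ?S" for s
      proof -
        have s': "s \<in> S" "p (fst (P s)) \<in> W" using s by auto
        then show ?thesis using chart[OF t uX[OF s'(1)] Ys(2)[OF s'(1)] s'(2)] by simp
      qed
      ultimately show "smooth_on m ?S (\<lambda>s. \<tau> (?e s))"
        using smooth_on_cong[OF S, of "\<lambda>s. local_nabla W \<tau> n U p (fst (P s)) (snd (P s)) (Y s)" "\<lambda>s. \<tau> (?e s)"] by blast
    qed simp
    then show "(\<lambda>s\<in>S. (case P s of (u, X) \<Rightarrow> \<lambda>Y. D n U p u X Y) (Y s)) \<in> plots (total E) m S"
      by (simp add: case_prod_beta)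
  qed
  {
    fix u X X' Y and a b :: real
    assume u: "u \<in> U" and X: "X \<in> Rn n" "X' \<in> Rn n" and "Y \<in> points (sections E n U p)"
    then have Y: "is_section n U p Y" using section_point_iff[OF U] by simp
    obtain W \<tau> where t: "(W, \<tau>) \<in> trivs E" "p u \<in> W" using ex[OF u] by blast
    have pT: "p u \<in> topspace T" by (rule fiber_base[OF p u])
    show "D n U p u (\<lambda>i. a * X i + b * X' i) Y =
        fadd E (fscale E a (D n U p u X Y)) (fscale E b (D n U p u X' Y))"
    proof (rule triv_eqI[OF t fib[OF u linR[OF X] Y]])
      show "fadd E (fscale E a (D n U p u X Y)) (fscale E b (D n U p u X' Y)) \<in> fiber E (p u)"
        by (intro fiber_add fiber_scale fib u X Y pT)
      show "\<tau> (D n U p u (\<lambda>i. a * X i + b * X' i) Y) = \<tau> (fadd E (fscale E a (D n U p u X Y)) (fscale E b (D n U p u X' Y)))"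
        unfolding triv_lin[OF t fib[OF u X(1) Y] fib[OF u X(2) Y]] chart[OF t(1) u X(1) Y t(2)]
          chart[OF t(1) u X(2) Y t(2)] chart[OF t(1) u linR[OF X] Y t(2)] local_nabla_def Let_def
          LFadd[OF t(1) u t(2) X] dir_deriv_add_right
        by (simp add: algebra_simps)
    qed
  }
  {
    fix u X Y Z and a b :: real
    assume u: "u \<in> U" and X: "X \<in> Rn n" and "Y \<in> points (sections E n U p)" "Z \<in> points (sections E n U p)"
    then have Y: "is_section n U p Y" and Z: "is_section n U p Z" using section_point_iff[OF U] by simp_all
    obtain W \<tau> where t: "(W, \<tau>) \<in> trivs E" "p u \<in> W" using ex[OF u] by blast
    have pT: "p u \<in> topspace T" by (rule fiber_base[OF p u])
    let ?S = "\<lambda>v\<in>U. fadd E (fscale E a (Y v)) (fscale E b (Z v))" and ?V = "{v \<in> U. p v \<in> W}"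
    have S: "is_section n U p ?S" by (rule section_lin[OF p Y Z smooth_on_const[OF U] smooth_on_const[OF U]])
    have uV: "u \<in> ?V" using u t(2) by simp
    have Sv: "\<tau> (?S v) = a *\<^sub>R \<tau> (Y v) + b *\<^sub>R \<tau> (Z v)" if v: "v \<in> ?V" for v
    proof -
      have v': "v \<in> U" "p v \<in> W" using v by auto
      show ?thesis using triv_lin[OF t(1) v'(2) section_in_fiber[OF Y v'(1)] section_in_fiber[OF Z v'(1)]] v' by simp
    qed
    have "dir_deriv n (\<tau> \<circ> ?S) u X = dir_deriv n (\<lambda>v. a *\<^sub>R \<tau> (Y v) + b *\<^sub>R \<tau> (Z v)) u X"
      by (rule dir_deriv_cong[OF VV[OF t(1)] _ uV]) (simp only: o_def Sv)
    also have "\<dots> = a *\<^sub>R dir_deriv n (\<lambda>v. \<tau> (Y v)) u X + b *\<^sub>R dir_deriv n (\<lambda>v. \<tau> (Z v)) u X"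
      by (rule dir_deriv_lin[OF section_smooth_chart[OF t(1) p Y] section_smooth_chart[OF t(1) p Z] uV])
    finally have d: "dir_deriv n (\<tau> \<circ> ?S) u X = a *\<^sub>R dir_deriv n (\<tau> \<circ> Y) u X + b *\<^sub>R dir_deriv n (\<tau> \<circ> Z) u X"
      by (simp only: o_def)
    note L = LFlin[OF t(1) u t(2) X]
    show "D n U p u X ?S = fadd E (fscale E a (D n U p u X Y)) (fscale E b (D n U p u X Z))"
    proof (rule triv_eqI[OF t fib[OF u X S]])
      show "fadd E (fscale E a (D n U p u X Y)) (fscale E b (D n U p u X Z)) \<in> fiber E (p u)"
        by (intro fiber_add fiber_scale fib u X Y Z pT)
      show "\<tau> (D n U p u X ?S) = \<tau> (fadd E (fscale E a (D n U p u X Y)) (fscale E b (D n U p u X Z)))"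
        unfolding triv_lin[OF t fib[OF u X Y] fib[OF u X Z]] chart[OF t(1) u X Y t(2)]
          chart[OF t(1) u X Z t(2)] chart[OF t(1) u X S t(2)] local_nabla_def Let_def d Sv[OF uV]
          linear_add[OF L] linear_cmul[OF L]
        by (simp add: algebra_simps)
    qed
  }
  {
    fix f u X Y
    assume "f \<in> Cc_infinity n U" and u: "u \<in> U" and X: "X \<in> Rn n" and "Y \<in> points (sections E n U p)"
    then have f: "smooth_on n U f" and Y: "is_section n U p Y"
      using section_point_iff[OF U] by (simp_all add: Cc_infinity_def)
    obtain W \<tau> where t: "(W, \<tau>) \<in> trivs E" "p u \<in> W" using ex[OF u] by blast
    have pT: "p u \<in> topspace T" by (rule fiber_base[OF p u])
    have Yf: "Y u \<in> fiber E (p u)" by (rule section_in_fiber[OF Y u])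
    \<comment> \<open>Writing the scaled vector as a linear combination lets the additivity of the
      form and of the directional derivative apply.\<close>
    have fX: "(\<lambda>i. f u * X i) = (\<lambda>i. f u * X i + 0 * X i)" by simp
    show "D n U p u (\<lambda>i. f u * X i) Y = fscale E (f u) (D n U p u X Y)"
    proof (rule triv_eqI[OF t])
      show "D n U p u (\<lambda>i. f u * X i) Y \<in> fiber E (p u)"
        unfolding fX by (rule fib[OF u linR[OF X X] Y])
      show "fscale E (f u) (D n U p u X Y) \<in> fiber E (p u)"
        by (intro fiber_scale fib u X Y pT)
      show "\<tau> (D n U p u (\<lambda>i. f u * X i) Y) = \<tau> (fscale E (f u) (D n U p u X Y))"
        unfolding triv_scale[OF t fib[OF u X Y]] fX chart[OF t(1) u X Y t(2)]
          chart[OF t(1) u linR[OF X X] Y t(2)] local_nabla_def Let_def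
          LFadd[OF t(1) u t(2) X X] dir_deriv_add_right
        by (simp add: algebra_simps)
    qed
    let ?S = "\<lambda>v\<in>U. fscale E (f v) (Y v)" and ?V = "{v \<in> U. p v \<in> W}"
    have S: "is_section n U p ?S" by (rule section_scale[OF p Y f])
    have uV: "u \<in> ?V" using u t(2) by simp
    have Sv: "\<tau> (?S v) = f v *\<^sub>R \<tau> (Y v)" if v: "v \<in> ?V" for v
    proof -
      have v': "v \<in> U" "p v \<in> W" using v by auto
      show ?thesis using triv_scale[OF t(1) v'(2) section_in_fiber[OF Y v'(1)]] v' by simp
    qed
    have fV: "smooth_on n ?V f" by (rule smooth_on_subset[OF f]) auto
    have "dir_deriv n (\<tau> \<circ> ?S) u X = dir_deriv n (\<lambda>v. f v *\<^sub>R \<tau> (Y v)) u X"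
      by (rule dir_deriv_cong[OF VV[OF t(1)] _ uV]) (simp only: o_def Sv)
    also have "\<dots> = dir_deriv n f u X *\<^sub>R \<tau> (Y u) + f u *\<^sub>R dir_deriv n (\<lambda>v. \<tau> (Y v)) u X"
      by (rule dir_deriv_scaleR[OF fV section_smooth_chart[OF t(1) p Y] uV])
    finally have d: "dir_deriv n (\<tau> \<circ> ?S) u X = dir_deriv n f u X *\<^sub>R \<tau> (Y u) + f u *\<^sub>R dir_deriv n (\<tau> \<circ> Y) u X"
      by (simp only: o_def)
    show "D n U p u X ?S = fadd E (fscale E (dir_deriv n f u X) (Y u)) (fscale E (f u) (D n U p u X Y))"
    proof (rule triv_eqI[OF t fib[OF u X S]])
      show "fadd E (fscale E (dir_deriv n f u X) (Y u)) (fscale E (f u) (D n U p u X Y)) \<in> fiber E (p u)"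
        by (intro fiber_add fiber_scale fib u X Y pT Yf)
      show "\<tau> (D n U p u X ?S) = \<tau> (fadd E (fscale E (dir_deriv n f u X) (Y u)) (fscale E (f u) (D n U p u X Y)))"
        unfolding triv_lin[OF t Yf fib[OF u X Y]] chart[OF t(1) u X Y t(2)]
          chart[OF t(1) u X S t(2)] local_nabla_def Let_def d Sv[OF uV] linear_cmul[OF LFlin[OF t(1) u t(2) X]]
        by (simp add: algebra_simps)
    qed
  }
  fix m V g v X Y
  assume g: "g \<in> plots (euclidean_domain n U) m V" and v: "v \<in> V" and X: "X \<in> Rn m"
    and "Y \<in> points (sections E n U p)"
  then have Y: "is_section n U p Y" and g': "smooth_into m V n U g"
    using section_point_iff[OF U] by (simp_all add: euclidean_plot_iff)
  have gv: "g v \<in> U" using g' v by (auto simp: smooth_into_def)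
  let ?X = "tangent_map m n g v X"
  have X': "?X \<in> Rn n" by (rule tangent_map_in_Rn)
  obtain W \<tau> where t: "(W, \<tau>) \<in> trivs E" "p (g v) \<in> W" using ex[OF gv] by blast
  have pg: "compose V p g \<in> plots M m V" using ds_compose[OF ds_M p g'] by (simp add: compose_def)
  have Yg: "is_section m V (compose V p g) (compose V Y g)"
    using section_compose[OF Y g'] by (simp add: compose_def)
  have dom': "collection_domain M E m V (compose V p g) v X (compose V Y g)"
    using pg v X Yg by (simp add: collection_domain_iff)
  let ?U = "{u \<in> U. p u \<in> W}" and ?V = "{w \<in> V. compose V p g w \<in> W}"
  have oV: "openin (Euclidean_space m) ?V" by (rule open_chart_domain[OF t(1) pg])
  have vV: "v \<in> ?V" using v t(2) by (simp add: compose_def)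
  have g'': "smooth_into m ?V n ?U g"
  proof -
    have "g w \<in> ?U" if "w \<in> ?V" for w using g' that by (auto simp: smooth_into_def compose_def)
    moreover have "smooth_into m ?V n U g" by (rule smooth_into_subset[OF g' oV]) auto
    ultimately show ?thesis by (auto simp: smooth_into_def)
  qed
  have gU: "g w \<in> ?U" if "w \<in> ?V" for w using g'' that by (auto simp: smooth_into_def)
  have "dir_deriv m (\<tau> \<circ> compose V Y g) v X = dir_deriv m (\<lambda>w. \<tau> (Y (g w))) v X"
    by (rule dir_deriv_cong[OF oV _ vV]) (simp add: compose_def)
  also have "\<dots> = dir_deriv n (\<lambda>u. \<tau> (Y u)) (g v) ?X"
    by (rule dir_deriv_compose[OF g'' VV[OF t(1)] section_smooth_chart[OF t(1) p Y] vV])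
  finally have d: "dir_deriv m (\<tau> \<circ> compose V Y g) v X = dir_deriv n (\<tau> \<circ> Y) (g v) ?X"
    by (simp only: o_def)
  let ?P = "\<lambda>u\<in>?U. (restrict p ?U u, triv_inv E \<tau> (restrict p ?U u))"
  have P: "?P \<in> plots (Fr T A E) n ?U"
    by (rule Fr_section_plot[OF t(1) ds_restrict[OF ds_M p _ VV[OF t(1)]]]) auto
  \<comment> \<open>The local frame section over \<open>p \<circ> g\<close> is the one over
    \<open>p\<close> composed with \<open>g\<close>, so the connection form pulls back along
    \<open>g\<close>.\<close>
  have "(\<lambda>w\<in>?V. (restrict (compose V p g) ?V w, triv_inv E \<tau> (restrict (compose V p g) ?V w))) = (\<lambda>w\<in>?V. ?P (g w))"
  proof (rule restrict_ext)
    fix w assume w: "w \<in> ?V"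
    then have "w \<in> V" by simp
    have "restrict p ?U (g w) = restrict (compose V p g) ?V w"
      using gU[OF w] w \<open>w \<in> V\<close> by (simp add: compose_def)
    then show "(restrict (compose V p g) ?V w, triv_inv E \<tau> (restrict (compose V p g) ?V w)) = ?P (g w)"
      by (simp only: restrict_apply'[OF gU[OF w]])
  qed
  then have LF: "LF \<tau> m ?V (restrict (compose V p g) ?V) v X = LF \<tau> n ?U (restrict p ?U) (g v) ?X"
    unfolding local_connection_form_def using one_forms_pullback[OF form P g'' vV X] by (simp only:)
  have Yv: "compose V Y g v = Y (g v)" using v by (simp add: compose_def)
  have pv: "compose V p g v = p (g v)" using v by (simp add: compose_def)
  have fib': "D m V (compose V p g) v X (compose V Y g) \<in> fiber E (p (g v))"
    using collections_fiber[OF induced_collection[OF D] dom'] unfolding pv .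
  show "D m V (compose V p g) v X (compose V Y g) = D n U p (g v) (tangent_map m n g v X) Y"
  proof (rule triv_eqI[OF t fib' fib[OF gv X' Y]])
    have "\<tau> (D m V (compose V p g) v X (compose V Y g)) = local_nabla W \<tau> m V (compose V p g) v X (compose V Y g)"
      by (rule induced_chart[OF D t(1) dom']) (simp only: pv t(2))
    also have "\<dots> = local_nabla W \<tau> n U p (g v) ?X Y"
      unfolding local_nabla_def Let_def d LF Yv ..
    also have "\<dots> = \<tau> (D n U p (g v) ?X Y)" by (rule chart[OF t(1) gv X' Y t(2), symmetric])
    finally show "\<tau> (D m V (compose V p g) v X (compose V Y g)) = \<tau> (D n U p (g v) ?X Y)" .
  qed
qed

end

section \<open>From covariant derivatives to connection forms\<close>

definition axis :: "real \<Rightarrow> vec" where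
  "axis r = (\<lambda>i. if i = 0 then r else 0)"

lemma axis_in_Rn: "axis r \<in> Rn 1"
  by (simp add: axis_def Rn_iff)

lemma axis_eq: "t \<in> Rn 1 \<Longrightarrow> axis (t 0) = t"
  by (auto simp: axis_def Rn_iff fun_eq_iff)

lemma axis_0: "axis 0 = (\<lambda>_. 0)"
  by (simp add: axis_def)

lemma has_dv_axis_derivatives:
  fixes f :: "vec \<Rightarrow> 'a::locally_convex_space"
  assumes "smooth_on 1 (Rn 1) f"
  shows "has_dv (\<lambda>r. ((partial_deriv 0 ^^ k) f) (axis r)) (((partial_deriv 0 ^^ Suc k) f) (axis r)) r"
proof -
  have "smooth_on 1 (Rn 1) ((partial_deriv 0 ^^ k) f)"
    by (induction k) (use assms smooth_on_partial_deriv[of 1] in auto)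
  from smooth_on_has_pd[OF this _ axis_in_Rn, of 0 r]
  have "has_dv (\<lambda>s. ((partial_deriv 0 ^^ k) f) ((axis r)(0 := s))) (((partial_deriv 0 ^^ Suc k) f) (axis r)) (axis r 0)"
    by (simp add: has_pd_iff)
  moreover have "(axis r)(0 := s) = axis s" for s by (auto simp: axis_def)
  moreover have "axis r 0 = r" by (simp add: axis_def)
  ultimately show ?thesis by simp
qed

text \<open>\<open>z\<close> is the Hadamard quotient of order 0; its value at 0 is the derivative
  of \<open>f\<close>.\<close>

lemma hadamard_factor:
  fixes f :: "vec \<Rightarrow> 'a::locally_convex_space"
  assumes f: "smooth_on 1 (Rn 1) f" and f0: "f (\<lambda>_. 0) = 0"
  obtains z where "smooth_on 1 (Rn 1) z" "\<And>t. t \<in> Rn 1 \<Longrightarrow> f t = t 0 *\<^sub>R z t" "z (\<lambda>_. 0) = dir_deriv 1 f (\<lambda>_. 0) e1"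
proof -
  define y where "y k r = ((partial_deriv 0 ^^ k) f) (axis r)" for k r
  have y: "has_dv (y k) (y (Suc k) r) r" for k r
    using has_dv_axis_derivatives[OF f] by (simp add: y_def[abs_def])
  have "smooth_on 1 (Rn 1) (\<lambda>t. hadamard_quot y 0 (t 0))"
  proof (rule smooth_on_curve[OF open_Rn_UNIV])
    fix k w
    \<comment> \<open>The derivatives exist on the whole line, so any bound beyond
      \<open>\<bar>w 0\<bar>\<close> will do.\<close>
    show "has_dv (hadamard_quot y k) (hadamard_quot y (Suc k) (w 0)) (w 0)"
      by (rule has_dv_hadamard_quot[where e="\<bar>w 0\<bar> + 1"]) (use y in auto)
  qed
  moreover have "f t = t 0 *\<^sub>R hadamard_quot y 0 (t 0)" if "t \<in> Rn 1" for t
    using hadamard_quot_eq(1)[of "t 0" y] that f0 by (simp add: y_def axis_eq axis_0)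
  moreover have "hadamard_quot y 0 ((\<lambda>_. 0) 0) = dir_deriv 1 f (\<lambda>_. 0) e1"
    unfolding hadamard_quot_eq(2) dir_deriv_e1 by (simp add: y_def axis_0)
  ultimately show thesis by (rule that)
qed

section \<open>Inverses of frames, evaluation of frames, families of sections\<close>

context manifold_bundle
begin

lemma frame_bij: "w \<in> frames E x \<Longrightarrow> bij_betw w UNIV (fiber E x)"
proof -
  have "points (subdspace (total E) (fiber E x)) = fiber E x" by (auto simp: subdspace_points fiber_def)
  then show "w \<in> frames E x \<Longrightarrow> bij_betw w UNIV (fiber E x)" by (simp add: frames_def diffeo_def)
qed

lemma frame_lin:
  "w \<in> frames E x \<Longrightarrow> w (a *\<^sub>R u + b *\<^sub>R v) = fadd E (fscale E a (w u)) (fscale E b (w v))"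
  by (simp add: frames_def)

lemma frame_inv_eqI: "w \<in> frames E x \<Longrightarrow> w v = e \<Longrightarrow> inv w e = v"
  using frame_bij by (auto simp: bij_betw_def intro: inv_f_eq)

lemma frame_inv:
  assumes w: "w \<in> frames E x" and e: "e \<in> fiber E x"
  shows "w (inv w e) = e"
proof -
  have "e \<in> range w" using frame_bij[OF w] e by (simp add: bij_betw_def)
  then show ?thesis by (rule f_inv_into_f)
qed

text \<open>The inverse of a frame is a map from \<open>E\<close> to F; the right side expresses it
  through an inverse in \<open>GL\<close>, which varies smoothly along plots of frames.\<close>

lemma frame_inv_chart:
  assumes t: "(W, \<tau>) \<in> trivs E" and x: "x \<in> W" and w: "w \<in> frames E x" and e: "e \<in> fiber E x"
  shows "inv w e = inv (\<tau> \<circ> w) (\<tau> e)"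
proof -
  have "(\<tau> \<circ> w) (inv w e) = \<tau> e" using frame_inv[OF w e] by simp
  then show ?thesis
    using GL_bij[OF frame_in_GL[OF t x w]] by (metis bij_inv_eq_iff)
qed

text \<open>In a trivialization a plot of frames becomes a smooth family of linear maps, so
  evaluating it at a moving frame and a moving vector gives a smooth coordinate.\<close>

lemma Fr_eval_plot:
  assumes P: "P \<in> plots (Fr T A E) n U" and h: "smooth_into m V n U h" and f: "smooth_on m V f"
  shows "(\<lambda>v\<in>V. snd (P (h v)) (f v)) \<in> plots (total E) m V"
proof (rule total_plotI)
  have V: "openin (Euclidean_space m) V" using h by (simp add: smooth_into_def)
  have hU: "h v \<in> U" if "v \<in> V" for v using h that by (auto simp: smooth_into_def)
  have Ph: "(\<lambda>v\<in>V. P (h v)) \<in> plots (Fr T A E) m V" by (rule ds_compose[OF ds_Fr P h])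
  let ?\<pi> = "\<lambda>v\<in>V. fst ((\<lambda>v\<in>V. P (h v)) v)"
  show \<pi>: "?\<pi> \<in> plots M m V" by (rule Fr_fst_plot[OF Ph])
  show "(\<lambda>v\<in>V. snd (P (h v)) (f v)) \<in> extensional V" by (rule restrict_extensional)
  show "(\<lambda>v\<in>V. snd (P (h v)) (f v)) v \<in> fiber E (?\<pi> v)" if v: "v \<in> V" for v
    using Fr_plot_point[OF P hU[OF v]] v frame_in_fiber by (simp add: Fr_point_iff)
  fix W \<tau> assume t: "(W, \<tau>) \<in> trivs E"
  let ?V = "{v \<in> V. ?\<pi> v \<in> W}"
  have o: "openin (Euclidean_space m) ?V" by (rule open_chart_domain[OF t \<pi>])
  have VV: "?V \<subseteq> V" by auto
  have PV: "restrict (\<lambda>v\<in>V. P (h v)) ?V \<in> plots (Fr T A E) m ?V" by (rule ds_restrict[OF ds_Fr Ph VV o])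
  have "(\<lambda>v\<in>?V. \<tau> \<circ> snd (restrict (\<lambda>v\<in>V. P (h v)) ?V v)) \<in> plots GL m ?V"
    by (rule Fr_triv_plot[OF t PV]) auto
  then have "smooth_family m ?V (\<lambda>v\<in>?V. \<tau> \<circ> snd (restrict (\<lambda>v\<in>V. P (h v)) ?V v))" by (simp add: GL_plot_iff)
  from smooth_familyD[OF this smooth_into_id[OF o] smooth_on_subset[OF f VV]]
  have "smooth_on m ?V (\<lambda>w. (\<lambda>v\<in>?V. \<tau> \<circ> snd (restrict (\<lambda>v\<in>V. P (h v)) ?V v)) w (f w))" .
  moreover have "(\<lambda>v\<in>?V. \<tau> \<circ> snd (restrict (\<lambda>v\<in>V. P (h v)) ?V v)) w (f w) = \<tau> ((\<lambda>v\<in>V. snd (P (h v)) (f v)) w)"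
    if w: "w \<in> ?V" for w
    using VV w by (simp only: restrict_apply'[OF w] restrict_apply'[OF subsetD[OF VV w]] o_apply)
  ultimately show "smooth_on m ?V (\<lambda>v. \<tau> ((\<lambda>v\<in>V. snd (P (h v)) (f v)) v))"
    using smooth_on_cong[OF o, of "\<lambda>w. (\<lambda>v\<in>?V. \<tau> \<circ> snd (restrict (\<lambda>v\<in>V. P (h v)) ?V v)) w (f w)"
        "\<lambda>v. \<tau> ((\<lambda>v\<in>V. snd (P (h v)) (f v)) v)"] by blast
qed

lemma sections_plotI:
  assumes S: "openin (Euclidean_space m) S" and U: "openin (Euclidean_space n) U" and ext: "Y \<in> extensional S"
    and sec: "\<And>s. s \<in> S \<Longrightarrow> is_section n U p (Y s)"
    and sm: "\<And>k V g h. smooth_into k V m S g \<Longrightarrow> smooth_into k V n U h \<Longrightarrow> (\<lambda>v\<in>V. Y (g v) (h v)) \<in> plots (total E) k V"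
  shows "Y \<in> plots (sections E n U p) m S"
proof -
  have pt: "Y s \<in> points (sections E n U p)" if "s \<in> S" for s
    using section_point_iff[OF U] sec[OF that] by simp
  have "smooth_map (dprod (euclidean_domain m S) (euclidean_domain n U)) (total E) (\<lambda>(s, u). Y s u)"
  proof (rule smooth_map_dprodI)
    show "Y s u \<in> points (total E)" if "s \<in> points (euclidean_domain m S)" "u \<in> points (euclidean_domain n U)" for s u
      using section_in_fiber[OF sec, of s u] that by (simp add: fiber_def)
    show "(\<lambda>v\<in>V. Y (g v) (h v)) \<in> plots (total E) k V"
      if "g \<in> plots (euclidean_domain m S) k V" "h \<in> plots (euclidean_domain n U) k V" for k V g h
      using sm that by (simp add: euclidean_plot_iff)
  qed
  then show ?thesis using S ext pt
    by (auto simp: sections_def subdspace_def Cinf_def Let_def PiE_def Pi_def)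
qed

end

locale covariant_derivative = manifold_bundle T A E
  for T :: "'m topology"
    and A :: "('m set \<times> ('m \<Rightarrow> 'b::locally_convex_space)) set"
    and E :: "('m, 'e, 'f::locally_convex_space) vbundle" +
  fixes D :: "('m, 'e) collection"
  assumes cov: "D \<in> CD T A E"
begin

section \<open>Local expression of a covariant derivative\<close>

lemma D_collection: "D \<in> collections M E"
  using cov by (simp add: CD_def)

lemmas D_unfolded = cov[unfolded CD_def mem_Collect_eq, THEN conjunct2, THEN spec, THEN spec, THEN bspec]

lemma D_in_fiber:
  assumes "p \<in> plots M n U" "u \<in> U" "X \<in> Rn n" "is_section n U p Y"
  shows "D n U p u X Y \<in> fiber E (p u)"
proof -
  have "collection_domain M E n U p u X Y"
    unfolding collection_domain_def using assms section_point_iff[OF ds_open[OF ds_M assms(1)]] by simp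
  then show ?thesis using D_collection by (simp add: collections_def)
qed

lemma D_smooth:
  assumes p: "p \<in> plots M n U" and u: "smooth_into m S n U u" and X: "smooth_into m S n (Rn n) X"
    and Y: "Y \<in> plots (sections E n U p) m S"
  shows "(\<lambda>s\<in>S. D n U p (u s) (X s) (Y s)) \<in> plots (total E) m S"
proof -
  have uX: "(\<lambda>s\<in>S. (restrict u S s, restrict X S s)) \<in> plots (dprod (euclidean_domain n U) (euclidean_domain n (Rn n))) m S"
    by (rule dprod_plot_pair[OF restrict_euclidean_plot[OF u] restrict_euclidean_plot[OF X]])
       (use u X in \<open>auto simp: smooth_into_def\<close>)
  have YP: "Y \<in> S \<rightarrow>\<^sub>E points (sections E n U p)"
    using Y by (auto simp: sections_def subdspace_def Cinf_def Let_def)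
  have "(\<lambda>s\<in>S. (case (\<lambda>s\<in>S. (restrict u S s, restrict X S s)) s of (u, X) \<Rightarrow> \<lambda>Y. D n U p u X Y) (Y s)) \<in> plots (total E) m S"
    by (rule smooth_map_dprodD[OF D_unfolded[OF p, THEN conjunct1] uX Y _ YP])
       (use u X in \<open>auto simp: smooth_into_def points_dprod\<close>)
  also have "(\<lambda>s\<in>S. (case (\<lambda>s\<in>S. (restrict u S s, restrict X S s)) s of (u, X) \<Rightarrow> \<lambda>Y. D n U p u X Y) (Y s)) =
      (\<lambda>s\<in>S. D n U p (u s) (X s) (Y s))"
    by (rule restrict_ext) simp
  finally show ?thesis .
qed

lemma D_lin_vector:
  assumes p: "p \<in> plots M n U" and "u \<in> U" "X \<in> Rn n" "X' \<in> Rn n" "is_section n U p Y"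
  shows "D n U p u (\<lambda>i. a * X i + b * X' i) Y = fadd E (fscale E a (D n U p u X Y)) (fscale E b (D n U p u X' Y))"
  using D_unfolded[OF p, THEN conjunct2, THEN conjunct1] assms section_point_iff[OF ds_open[OF ds_M p]] by simp

lemma D_lin_section:
  assumes p: "p \<in> plots M n U" and "u \<in> U" "X \<in> Rn n" "is_section n U p Y" "is_section n U p Z"
  shows "D n U p u X (\<lambda>v\<in>U. fadd E (fscale E a (Y v)) (fscale E b (Z v))) =
    fadd E (fscale E a (D n U p u X Y)) (fscale E b (D n U p u X Z))"
  using D_unfolded[OF p, THEN conjunct2, THEN conjunct2, THEN conjunct1] assms section_point_iff[OF ds_open[OF ds_M p]] by blast

lemma D_Leibniz:
  assumes p: "p \<in> plots M n U" and "f \<in> Cc_infinity n U" "u \<in> U" "X \<in> Rn n" "is_section n U p Y"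
  shows "D n U p u X (\<lambda>v\<in>U. fscale E (f v) (Y v)) =
    fadd E (fscale E (dir_deriv n f u X) (Y u)) (fscale E (f u) (D n U p u X Y))"
  using D_unfolded[OF p, THEN conjunct2, THEN conjunct2, THEN conjunct2, THEN conjunct1] assms
    section_point_iff[OF ds_open[OF ds_M p]] by blast

lemma D_pullback:
  assumes p: "p \<in> plots M n U" and g: "smooth_into m V n U g" and v: "v \<in> V" and X: "X \<in> Rn m"
    and Y: "is_section n U p Y"
  shows "D m V (\<lambda>v\<in>V. p (g v)) v X (\<lambda>v\<in>V. Y (g v)) = D n U p (g v) (tangent_map m n g v X) Y"
proof -
  have V: "openin (Euclidean_space m) V" using g by (simp add: smooth_into_def)
  have "D m V (compose V p (restrict g V)) v X (compose V Y (restrict g V)) =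
      D n U p (restrict g V v) (tangent_map m n (restrict g V) v X) Y"
    using D_unfolded[OF p, THEN conjunct2, THEN conjunct2, THEN conjunct2, THEN conjunct2]
      restrict_euclidean_plot[OF g] v X Y section_point_iff[OF ds_open[OF ds_M p]] by blast
  moreover have "compose V p (restrict g V) = (\<lambda>v\<in>V. p (g v))" "compose V Y (restrict g V) = (\<lambda>v\<in>V. Y (g v))"
    unfolding compose_def by (rule restrict_ext, simp)+
  moreover have "tangent_map m n (restrict g V) v X = tangent_map m n g v X"
    by (rule tangent_map_cong[OF V _ v]) simp
  moreover have "restrict g V v = g v" using v by simp
  ultimately show ?thesis by (simp only:)
qed

text \<open>Locality of \<open>D\<close> is its compatibility with pull-back along the inclusion of
  \<open>V\<close>.\<close>

lemma D_restrict:
  assumes p: "p \<in> plots M n U" and V: "openin (Euclidean_space n) V" "V \<subseteq> U" and v: "v \<in> V" and X: "X \<in> Rn n"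
    and Y: "is_section n U p Y"
  shows "D n V (restrict p V) v X (restrict Y V) = D n U p v X Y"
  using D_pullback[OF p smooth_into_mono[OF smooth_into_id[OF V(1)] V(2)] v X Y]
  by (simp only: tangent_map_id[OF X])

text \<open>A covariant derivative acts as the derivative on a section vanishing at the point: along a
  curve such a section is \<open>t \<cdot> Z\<close> by Hadamard's lemma, and the Leibniz rule applies to
  \<open>\<chi> \<cdot> (t \<cdot> Z) = (t \<chi>) \<cdot> Z\<close> with a bump function \<open>\<chi>\<close>.\<close>

lemma D_curve_vanishing:
  assumes t: "(W, \<tau>) \<in> trivs E" and p: "p \<in> plots M 1 (Rn 1)" and pW: "\<And>u. u \<in> Rn 1 \<Longrightarrow> p u \<in> W"
    and Y: "is_section 1 (Rn 1) p Y" and Y0: "\<tau> (Y (\<lambda>_. 0)) = 0"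
  shows "\<tau> (D 1 (Rn 1) p (\<lambda>_. 0) e1 Y) = dir_deriv 1 (\<lambda>u. \<tau> (Y u)) (\<lambda>_. 0) e1"
proof -
  let ?o = "\<lambda>_::nat. 0::real"
  have o: "?o \<in> Rn 1" by (rule zero_in_Rn)
  have e1: "e1 \<in> Rn 1" by (simp add: Rn_iff)
  have pT: "p ?o \<in> topspace T" by (rule fiber_base[OF p o])
  have Ys: "smooth_on 1 (Rn 1) (\<lambda>u. \<tau> (Y u))" by (rule section_smooth[OF t Y pW])
  obtain z where z: "smooth_on 1 (Rn 1) z" "\<And>t. t \<in> Rn 1 \<Longrightarrow> \<tau> (Y t) = t 0 *\<^sub>R z t"
      "z ?o = dir_deriv 1 (\<lambda>u. \<tau> (Y u)) ?o e1"
    using hadamard_factor[OF Ys Y0] by blast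
  define Z where "Z = (\<lambda>u\<in>Rn 1. triv_inv E \<tau> (p u) (z u))"
  have Zp: "Z \<in> plots (total E) 1 (Rn 1)" unfolding Z_def
    by (rule triv_inv_plot[OF t p _ z(1)]) (use pW in auto)
  have Zf: "Z u \<in> fiber E (p u)" "\<tau> (Z u) = z u" if u: "u \<in> Rn 1" for u
    using triv_inv_in_fiber[OF t pW[OF u]] triv_triv_inv[OF t pW[OF u]] u by (simp_all only: Z_def restrict_apply')
  have Z: "is_section 1 (Rn 1) p Z" using Zp Zf(1) by (simp add: is_section_def fiber_def)
  \<comment> \<open>The coordinate alone has no compact support, and the Leibniz rule admits only
    functions in \<open>Cc_infinity\<close>.\<close>
  define f where "f w = w 0 * bump w" for w
  have f: "f \<in> Cc_infinity 1 (Rn 1)" unfolding f_def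
    by (rule bump_mult_Cc_infinity[OF smooth_on_coord[OF open_Rn_UNIV]])
  have b: "bump \<in> Cc_infinity 1 (Rn 1)"
    using bump_mult_Cc_infinity[OF smooth_on_const[OF open_Rn_UNIV, of 1 1]] by simp
  have "(\<lambda>v\<in>Rn 1. fscale E (bump v) (Y v)) = (\<lambda>v\<in>Rn 1. fscale E (f v) (Z v))"
  proof (rule restrict_ext)
    fix v assume v: "v \<in> Rn 1"
    have pv: "p v \<in> topspace T" by (rule fiber_base[OF p v])
    note Yf = section_in_fiber[OF Y v]
    show "fscale E (bump v) (Y v) = fscale E (f v) (Z v)"
    proof (rule triv_eqI[OF t pW[OF v] fiber_scale[OF pv Yf] fiber_scale[OF pv Zf(1)[OF v]]])
      show "\<tau> (fscale E (bump v) (Y v)) = \<tau> (fscale E (f v) (Z v))"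
        unfolding triv_scale[OF t pW[OF v] Yf] triv_scale[OF t pW[OF v] Zf(1)[OF v]] Zf(2)[OF v] z(2)[OF v] f_def
        by (simp add: mult.commute)
    qed
  qed
  then have eq: "D 1 (Rn 1) p ?o e1 (\<lambda>v\<in>Rn 1. fscale E (bump v) (Y v)) = D 1 (Rn 1) p ?o e1 (\<lambda>v\<in>Rn 1. fscale E (f v) (Z v))"
    by (simp only:)
  \<comment> \<open>The term with the derivative of \<open>bump\<close> carries the value of
    \<open>Y\<close> at 0 and drops out.\<close>
  have "\<tau> (D 1 (Rn 1) p ?o e1 (\<lambda>v\<in>Rn 1. fscale E (bump v) (Y v))) = bump ?o *\<^sub>R \<tau> (D 1 (Rn 1) p ?o e1 Y)"
    unfolding D_Leibniz[OF p b o e1 Y] triv_lin[OF t pW[OF o] section_in_fiber[OF Y o] D_in_fiber[OF p o e1 Y]] Y0 by simp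
  \<comment> \<open>Here \<open>f\<close> vanishes at 0 and its derivative there is
    \<open>bump\<close> at 0, so the unknown derivative of \<open>Z\<close> drops out.\<close>
  moreover have "\<tau> (D 1 (Rn 1) p ?o e1 (\<lambda>v\<in>Rn 1. fscale E (f v) (Z v))) = bump ?o *\<^sub>R z ?o"
  proof -
    have "f = (\<lambda>w. w 0 *\<^sub>R bump w)" by (simp add: f_def fun_eq_iff)
    then have "dir_deriv 1 f ?o e1 = dir_deriv 1 (\<lambda>w. w 0 *\<^sub>R bump w) ?o e1" by (simp only:)
    also have "\<dots> = bump ?o"
      unfolding dir_deriv_scaleR[OF smooth_on_coord[OF open_Rn_UNIV] smooth_bump o] by (simp add: dir_deriv_coord)
    finally have df: "dir_deriv 1 f ?o e1 = bump ?o" .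
    have f0: "f ?o = 0" by (simp add: f_def)
    show ?thesis
      unfolding D_Leibniz[OF p f o e1 Z] triv_lin[OF t pW[OF o] section_in_fiber[OF Z o] D_in_fiber[OF p o e1 Z]]
        df f0 Zf(2)[OF o] by simp
  qed
  ultimately have "bump ?o *\<^sub>R \<tau> (D 1 (Rn 1) p ?o e1 Y) = bump ?o *\<^sub>R z ?o" by (simp only: eq)
  then show ?thesis using bump_0 z(3) by simp
qed

text \<open>Pull back along a curve through \<open>u\<close> with velocity \<open>X\<close>; both
  sides are compatible with this, and \<open>D_curve_vanishing\<close> applies.\<close>

lemma D_vanishing:
  assumes t: "(W, \<tau>) \<in> trivs E" and p: "p \<in> plots M n U" and pW: "\<And>u. u \<in> U \<Longrightarrow> p u \<in> W"
    and Y: "is_section n U p Y" and u: "u \<in> U" and X: "X \<in> Rn n" and Y0: "\<tau> (Y u) = 0"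
  shows "\<tau> (D n U p u X Y) = dir_deriv n (\<lambda>u. \<tau> (Y u)) u X"
proof -
  have U: "openin (Euclidean_space n) U" by (rule ds_open[OF ds_M p])
  obtain \<kappa> where \<kappa>: "\<kappa> 0 = u" "\<And>r. \<kappa> r \<in> U"
    "\<And>m V f. openin (Euclidean_space m) V \<Longrightarrow> smooth_on m V f \<Longrightarrow> smooth_into m V n U (\<lambda>v. \<kappa> (f v))"
    "tangent_map 1 n (\<lambda>t. \<kappa> (t 0)) (\<lambda>_. 0) e1 = X"
    using smooth_curve_through[OF U u X] by blast
  have \<kappa>s: "smooth_into 1 (Rn 1) n U (\<lambda>t. \<kappa> (t 0))"
    by (intro \<kappa>(3) open_Rn_UNIV smooth_on_coord)
  have e1: "e1 \<in> Rn 1" by (simp add: Rn_iff)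
  note o = zero_in_Rn[of 1]
  let ?p = "\<lambda>t\<in>Rn 1. p (\<kappa> (t 0))" and ?Y = "\<lambda>t\<in>Rn 1. Y (\<kappa> (t 0))"
  have "\<tau> (D 1 (Rn 1) ?p (\<lambda>_. 0) e1 ?Y) = dir_deriv 1 (\<lambda>u. \<tau> (?Y u)) (\<lambda>_. 0) e1"
  proof (rule D_curve_vanishing[OF t ds_compose[OF ds_M p \<kappa>s] _ section_compose[OF Y \<kappa>s]])
    show "?p u \<in> W" if "u \<in> Rn 1" for u using that pW \<kappa>(2) by simp
    show "\<tau> (?Y (\<lambda>_. 0)) = 0" using o Y0 \<kappa>(1) by simp
  qed
  also have "D 1 (Rn 1) ?p (\<lambda>_. 0) e1 ?Y = D n U p u X Y"
    unfolding D_pullback[OF p \<kappa>s o e1 Y] \<kappa>(1,4) ..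
  also have "dir_deriv 1 (\<lambda>u. \<tau> (?Y u)) (\<lambda>_. 0) e1 = dir_deriv 1 (\<lambda>t. \<tau> (Y (\<kappa> (t 0)))) (\<lambda>_. 0) e1"
    by (rule dir_deriv_cong[OF open_Rn_UNIV _ o]) simp
  also have "\<dots> = dir_deriv n (\<lambda>u. \<tau> (Y u)) u X"
    using dir_deriv_compose[OF \<kappa>s U section_smooth[OF t Y pW] o] by (simp only: \<kappa>(1,4))
  finally show ?thesis .
qed

lemma constant_section:
  assumes t: "(W, \<tau>) \<in> trivs E" and p: "p \<in> plots M n U" and pW: "\<And>u. u \<in> U \<Longrightarrow> p u \<in> W"
  shows "is_section n U p (\<lambda>v\<in>U. triv_inv E \<tau> (p v) z)"
proof -
  have "(\<lambda>v\<in>U. triv_inv E \<tau> (p v) z) \<in> plots (total E) n U"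
    by (rule triv_inv_plot[OF t p _ smooth_on_const[OF ds_open[OF ds_M p]]]) (use pW in auto)
  then show ?thesis
    using triv_inv_in_fiber[OF t pW] by (simp add: is_section_def fiber_def)
qed

text \<open>Subtract from \<open>Y\<close> the section with constant coordinate
  \<open>\<tau> (Y u)\<close>. The difference vanishes at \<open>u\<close>, so
  \<open>D_vanishing\<close> computes its derivative. The remaining term depends on \<open>Y\<close>
  only through its value at \<open>u\<close>.\<close>

lemma D_chart:
  assumes t: "(W, \<tau>) \<in> trivs E" and p: "p \<in> plots M n U" and pW: "\<And>u. u \<in> U \<Longrightarrow> p u \<in> W"
    and Y: "is_section n U p Y" and u: "u \<in> U" and X: "X \<in> Rn n"
  shows "\<tau> (D n U p u X Y) = dir_deriv n (\<lambda>u. \<tau> (Y u)) u X + \<tau> (D n U p u X (\<lambda>v\<in>U. triv_inv E \<tau> (p v) (\<tau> (Y u))))"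
proof -
  have U: "openin (Euclidean_space n) U" by (rule ds_open[OF ds_M p])
  let ?C = "\<lambda>v\<in>U. triv_inv E \<tau> (p v) (\<tau> (Y u))"
  \<comment> \<open>The difference is written with coefficients 1 and -1 because fibers come with
    \<open>fadd\<close> and \<open>fscale\<close> only.\<close>
  let ?S = "\<lambda>v\<in>U. fadd E (fscale E 1 (Y v)) (fscale E (- 1) (?C v))"
  have C: "is_section n U p ?C" by (rule constant_section[OF t p pW])
  have S: "is_section n U p ?S"
    by (rule section_lin[OF p Y C smooth_on_const[OF U] smooth_on_const[OF U]])
  have Cv: "\<tau> (?C v) = \<tau> (Y u)" if v: "v \<in> U" for v
    using triv_triv_inv[OF t pW[OF v]] v by simp
  have Sv: "\<tau> (?S v) = 1 *\<^sub>R \<tau> (Y v) + (- 1) *\<^sub>R \<tau> (Y u)" if v: "v \<in> U" for v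
    unfolding restrict_apply'[OF v, of "\<lambda>v. fadd E (fscale E 1 (Y v)) (fscale E (- 1) (?C v))"]
      triv_lin[OF t pW[OF v] section_in_fiber[OF Y v] section_in_fiber[OF C v]] Cv[OF v] ..
  have "\<tau> (?S u) = 0" using Sv[OF u] by simp
  from D_vanishing[OF t p pW S u X this]
  have "\<tau> (D n U p u X ?S) = dir_deriv n (\<lambda>u. \<tau> (?S u)) u X" .
  also have "\<dots> = dir_deriv n (\<lambda>v. 1 *\<^sub>R \<tau> (Y v) + (- 1) *\<^sub>R \<tau> (Y u)) u X"
    by (rule dir_deriv_cong[OF U Sv u])
  also have "\<dots> = 1 *\<^sub>R dir_deriv n (\<lambda>v. \<tau> (Y v)) u X + (- 1) *\<^sub>R dir_deriv n (\<lambda>_. \<tau> (Y u)) u X"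
    by (rule dir_deriv_lin[OF section_smooth[OF t Y pW] smooth_on_const[OF U] u])
  also have "\<dots> = dir_deriv n (\<lambda>v. \<tau> (Y v)) u X" by (simp add: dir_deriv_const)
  finally have 1: "\<tau> (D n U p u X ?S) = dir_deriv n (\<lambda>v. \<tau> (Y v)) u X" .
  have "\<tau> (D n U p u X ?S) = 1 *\<^sub>R \<tau> (D n U p u X Y) + (- 1) *\<^sub>R \<tau> (D n U p u X ?C)"
    unfolding D_lin_section[OF p u X Y C] triv_lin[OF t pW[OF u] D_in_fiber[OF p u X Y] D_in_fiber[OF p u X C]] ..
  with 1 show ?thesis by (simp add: algebra_simps)
qed

section \<open>The connection form of a covariant derivative\<close>

definition form_of :: "('m \<times> ('f \<Rightarrow> 'e), 'f \<Rightarrow> 'f) form" where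
  "form_of n U P u X v = inv (snd (P u)) (D n U (\<lambda>u\<in>U. fst (P u)) u X (\<lambda>u\<in>U. snd (P u) v))"

lemma frame_section:
  assumes P: "P \<in> plots (Fr T A E) n U"
  shows "is_section n U (\<lambda>u\<in>U. fst (P u)) (\<lambda>u\<in>U. snd (P u) v)"
proof -
  have U: "openin (Euclidean_space n) U" by (rule ds_open[OF ds_Fr P])
  have "(\<lambda>u\<in>U. snd (P u) v) \<in> plots (total E) n U"
    by (rule Fr_eval_plot[OF P smooth_into_id[OF U] smooth_on_const[OF U]])
  moreover have "snd (P u) v \<in> fiber E (fst (P u))" if "u \<in> U" for u
    using Fr_plot_point[OF P that] frame_in_fiber by (simp add: Fr_point_iff)
  ultimately show ?thesis by (simp add: is_section_def fiber_def)
qed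

lemma frame_at:
  assumes "P \<in> plots (Fr T A E) n U" "u \<in> U"
  shows "snd (P u) \<in> frames E (fst (P u))"
  using Fr_plot_point[OF assms] by (simp add: Fr_point_iff)

lemma D_frame_in_fiber:
  assumes P: "P \<in> plots (Fr T A E) n U" and u: "u \<in> U" and X: "X \<in> Rn n"
  shows "D n U (\<lambda>u\<in>U. fst (P u)) u X (\<lambda>u\<in>U. snd (P u) v) \<in> fiber E (fst (P u))"
  using D_in_fiber[OF Fr_fst_plot[OF P] u X frame_section[OF P]] u by simp

text \<open>This is the familiar relation of the connection matrix: the derivative of a frame is the
  frame times the matrix. Identities for \<open>form_of\<close> are obtained by applying the
  injective map \<open>snd (P u)\<close> to both sides (\<open>form_of_eqI\<close>).\<close>

lemma frame_form_of:
  assumes P: "P \<in> plots (Fr T A E) n U" and u: "u \<in> U" and X: "X \<in> Rn n"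
  shows "snd (P u) (form_of n U P u X v) = D n U (\<lambda>u\<in>U. fst (P u)) u X (\<lambda>u\<in>U. snd (P u) v)"
  unfolding form_of_def by (rule frame_inv[OF frame_at[OF P u] D_frame_in_fiber[OF P u X]])

lemma form_of_eqI:
  assumes P: "P \<in> plots (Fr T A E) n U" and u: "u \<in> U"
    and "snd (P u) z = D n U (\<lambda>u\<in>U. fst (P u)) u X (\<lambda>u\<in>U. snd (P u) v)"
  shows "form_of n U P u X v = z"
  unfolding form_of_def by (rule frame_inv_eqI[OF frame_at[OF P u] assms(3)])

lemma form_of_linear:
  assumes P: "P \<in> plots (Fr T A E) n U" and u: "u \<in> U" and X: "X \<in> Rn n"
  shows "linear (form_of n U P u X)"
proof -
  have *: "form_of n U P u X (a *\<^sub>R v + b *\<^sub>R w) = a *\<^sub>R form_of n U P u X v + b *\<^sub>R form_of n U P u X w" for a b v w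
  proof (rule form_of_eqI[OF P u])
    have "(\<lambda>u\<in>U. snd (P u) (a *\<^sub>R v + b *\<^sub>R w)) =
        (\<lambda>x\<in>U. fadd E (fscale E a ((\<lambda>u\<in>U. snd (P u) v) x)) (fscale E b ((\<lambda>u\<in>U. snd (P u) w) x)))"
      by (rule restrict_ext) (simp add: frame_lin[OF frame_at[OF P]])
    then show "snd (P u) (a *\<^sub>R form_of n U P u X v + b *\<^sub>R form_of n U P u X w) =
        D n U (\<lambda>u\<in>U. fst (P u)) u X (\<lambda>u\<in>U. snd (P u) (a *\<^sub>R v + b *\<^sub>R w))"
      unfolding frame_lin[OF frame_at[OF P u]] frame_form_of[OF P u X]
      by (simp only: D_lin_section[OF Fr_fst_plot[OF P] u X frame_section[OF P] frame_section[OF P]])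
  qed
  show ?thesis using *[of 1 _ 1] *[of _ _ 0] by (intro linearI) auto
qed

text \<open>Frames evaluated at moving vectors form a plot of sections, so smoothness of
  \<open>D\<close> applies. What remains is the inverse frame, which \<open>frame_inv_chart\<close>
  turns into the inverse of a plot of \<open>GL\<close>.\<close>

lemma form_of_smooth:
  assumes P: "P \<in> plots (Fr T A E) n U" and u: "smooth_into m S n U u" and X: "smooth_into m S n (Rn n) X"
    and f: "smooth_on m S f"
  shows "smooth_on m S (\<lambda>s. form_of n U P (u s) (X s) (f s))"
proof -
  have U: "openin (Euclidean_space n) U" by (rule ds_open[OF ds_Fr P])
  have S: "openin (Euclidean_space m) S" using u by (simp add: smooth_into_def)
  \<comment> \<open>For each \<open>s\<close> the vector \<open>f s\<close> is frozen while
    \<open>D\<close> differentiates in \<open>u\<close>; the dependence on \<open>s\<close> enters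
    only through the parameter of the plot of sections.\<close>
  let ?p = "\<lambda>u\<in>U. fst (P u)" and ?Y = "\<lambda>s\<in>S. (\<lambda>u\<in>U. snd (P u) (f s))"
  have p: "?p \<in> plots M n U" by (rule Fr_fst_plot[OF P])
  have uU: "u s \<in> U" "X s \<in> Rn n" if "s \<in> S" for s using u X that by (auto simp: smooth_into_def)
  have "?Y \<in> plots (sections E n U ?p) m S"
  proof (rule sections_plotI[OF S U restrict_extensional])
    show "is_section n U ?p (?Y s)" if "s \<in> S" for s using frame_section[OF P] that by simp
    fix k V g h assume g: "smooth_into k V m S g" and h: "smooth_into k V n U h"
    have "(\<lambda>v\<in>V. snd (P (h v)) (f (g v))) \<in> plots (total E) k V"
      by (rule Fr_eval_plot[OF P h smooth_into_compose[OF g S f]])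
    also have "(\<lambda>v\<in>V. snd (P (h v)) (f (g v))) = (\<lambda>v\<in>V. ?Y (g v) (h v))"
      by (rule restrict_ext) (use g h in \<open>auto simp: smooth_into_def\<close>)
    finally show "(\<lambda>v\<in>V. ?Y (g v) (h v)) \<in> plots (total E) k V" .
  qed
  from D_smooth[OF p u X this]
  have e: "(\<lambda>s\<in>S. D n U ?p (u s) (X s) (?Y s)) \<in> plots (total E) m S" (is "?e \<in> _") .
  have ev: "?e s = D n U ?p (u s) (X s) (\<lambda>x\<in>U. snd (P x) (f s))" if "s \<in> S" for s using that by simp
  have ef: "?e s \<in> fiber E (fst (P (u s)))" if s: "s \<in> S" for s
    unfolding ev[OF s] by (rule D_frame_in_fiber[OF P uU[OF s]])
  have Pu: "(\<lambda>s\<in>S. P (u s)) \<in> plots (Fr T A E) m S" by (rule ds_compose[OF ds_Fr P u])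
  have \<pi>: "(\<lambda>s\<in>S. fst ((\<lambda>s\<in>S. P (u s)) s)) \<in> plots M m S" (is "?\<pi> \<in> _") by (rule Fr_fst_plot[OF Pu])
  show ?thesis
  proof (rule smooth_on_local[OF S])
    fix s assume s: "s \<in> S"
    obtain W \<tau> where t: "(W, \<tau>) \<in> trivs E" and x: "?\<pi> s \<in> W"
      using triv_exists[OF fiber_base[OF \<pi> s]] by blast
    let ?S = "{s \<in> S. ?\<pi> s \<in> W}"
    have o: "openin (Euclidean_space m) ?S" by (rule open_chart_domain[OF t \<pi>])
    have SS: "?S \<subseteq> S" by auto
    have PS: "restrict (\<lambda>s\<in>S. P (u s)) ?S \<in> plots (Fr T A E) m ?S" by (rule ds_restrict[OF ds_Fr Pu SS o])
    have "(\<lambda>v\<in>?S. \<tau> \<circ> snd (restrict (\<lambda>s\<in>S. P (u s)) ?S v)) \<in> plots GL m ?S" (is "?g \<in> _")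
      by (rule Fr_triv_plot[OF t PS]) auto
    then have g: "smooth_family m ?S (\<lambda>v. inv (?g v))" by (simp add: GL_plot_iff)
    have eS: "restrict ?e ?S \<in> plots (total E) m ?S" by (rule ds_restrict[OF ds_total e SS o])
    have "smooth_on m ?S (\<lambda>s. \<tau> (restrict ?e ?S s))"
    proof (rule triv_plot_smooth[OF t eS])
      fix v assume v: "v \<in> ?S"
      then have "v \<in> S" "fst (P (u v)) \<in> W" by auto
      then show "proj E (restrict ?e ?S v) \<in> W" using ef[of v] v by (simp add: fiber_def)
    qed
    from smooth_familyD[OF g smooth_into_id[OF o] this]
    have "smooth_on m ?S (\<lambda>s. inv (?g s) (\<tau> (restrict ?e ?S s)))" .
    moreover have "inv (?g v) (\<tau> (restrict ?e ?S v)) = form_of n U P (u v) (X v) (f v)" if v: "v \<in> ?S" for v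
    proof -
      have v': "v \<in> S" "fst (P (u v)) \<in> W" using v by auto
      have "form_of n U P (u v) (X v) (f v) = inv (\<tau> \<circ> snd (P (u v))) (\<tau> (?e v))"
        unfolding form_of_def ev[OF v'(1), symmetric]
        by (rule frame_inv_chart[OF t v'(2) frame_at[OF P uU(1)[OF v'(1)]] ef[OF v'(1)]])
      moreover have "?g v = \<tau> \<circ> snd (P (u v))" "restrict ?e ?S v = ?e v" using v v'(1) by simp_all
      ultimately show ?thesis by (simp only:)
    qed
    ultimately have "smooth_on m ?S (\<lambda>s. form_of n U P (u s) (X s) (f s))"
      using smooth_on_cong[OF o, of "\<lambda>s. inv (?g s) (\<tau> (restrict ?e ?S s))" "\<lambda>s. form_of n U P (u s) (X s) (f s)"] by blast
    with o s x show "\<exists>V. openin (Euclidean_space m) V \<and> s \<in> V \<and> smooth_on m V (\<lambda>s. form_of n U P (u s) (X s) (f s))"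
      by blast
  qed
qed

lemma form_of_smooth_family:
  assumes P: "P \<in> plots (Fr T A E) n U" and u: "smooth_into m S n U u" and X: "smooth_into m S n (Rn n) X"
  shows "smooth_family m S (\<lambda>s. form_of n U P (u s) (X s))"
  unfolding smooth_family_def
proof (intro conjI allI impI)
  show "openin (Euclidean_space m) S" using u by (simp add: smooth_into_def)
  fix k R g and f :: "vec \<Rightarrow> 'f" assume g: "smooth_into k R m S g" and f: "smooth_on k R f"
  show "smooth_on k R (\<lambda>w. form_of n U P (u (g w)) (X (g w)) (f w))"
    by (rule form_of_smooth[OF P smooth_into_trans[OF g u] smooth_into_trans[OF g X] f])
qed

lemma form_of_pullback:
  assumes P: "P \<in> plots (Fr T A E) n U" and g: "g \<in> plots (euclidean_domain n U) m W" and u: "u \<in> W" and X: "X \<in> Rn m"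
  shows "form_of m W (compose W P g) u X = form_of n U P (g u) (tangent_map m n g u X)"
proof
  fix v
  have g': "smooth_into m W n U g" using g by (simp add: euclidean_plot_iff)
  have gU: "g w \<in> U" if "w \<in> W" for w using g' that by (auto simp: smooth_into_def)
  have "(\<lambda>x\<in>W. fst (compose W P g x)) = (\<lambda>w\<in>W. (\<lambda>x\<in>U. fst (P x)) (g w))"
    by (rule restrict_ext) (simp add: compose_def gU)
  moreover have "(\<lambda>x\<in>W. snd (compose W P g x) v) = (\<lambda>w\<in>W. (\<lambda>x\<in>U. snd (P x) v) (g w))"
    by (rule restrict_ext) (simp add: compose_def gU)
  moreover have "snd (compose W P g u) = snd (P (g u))" using u by (simp add: compose_def)
  ultimately show "form_of m W (compose W P g) u X v = form_of n U P (g u) (tangent_map m n g u X) v"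
    unfolding form_of_def by (simp only: D_pullback[OF Fr_fst_plot[OF P] g' u X frame_section[OF P]])
qed

text \<open>Under \<open>gl = L_space\<close>, points and plots of \<open>gl\<close> are
  characterised by linearity and \<open>smooth_family\<close>; otherwise a local lift to paths in
  \<open>GL\<close> would have to be found.\<close>

lemma form_of_in_one_forms:
  assumes gl: "(gl :: ('f \<Rightarrow> 'f) dvs) = L_space"
  shows "form_of \<in> one_forms (Fr T A E) gl"
  unfolding one_forms_def mem_Collect_eq
proof (intro allI ballI conjI)
  fix n U P assume P: "P \<in> plots (Fr T A E) n U"
  show "smooth_map (dprod (euclidean_domain n U) (euclidean_domain n (Rn n))) gl (\<lambda>(u, v). form_of n U P u v)"
  proof (rule smooth_map_dprodI)
    fix u X assume "u \<in> points (euclidean_domain n U)" "X \<in> points (euclidean_domain n (Rn n))"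
    then have u: "u \<in> U" and X: "X \<in> Rn n" by simp_all
    \<comment> \<open>A constant family on R^0 extracts the smoothness of the single map
      \<open>form_of n U P u X\<close>.\<close>
    have "smooth_family 0 (Rn 0) (\<lambda>_. form_of n U P u X)"
      by (rule form_of_smooth_family[OF P smooth_into_const[OF open_Rn_UNIV u] smooth_into_const[OF open_Rn_UNIV X]])
    from smooth_family_at[OF this zero_in_Rn]
    show "form_of n U P u X \<in> points gl"
      unfolding gl L_point_iff using form_of_linear[OF P u X] by blast
  next
    fix m S u X assume "u \<in> plots (euclidean_domain n U) m S" "X \<in> plots (euclidean_domain n (Rn n)) m S"
    then have u: "smooth_into m S n U u" and X: "smooth_into m S n (Rn n) X" by (simp_all add: euclidean_plot_iff)
    have "smooth_family m S (\<lambda>s\<in>S. form_of n U P (u s) (X s))"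
      using form_of_smooth_family[OF P u X]
        smooth_family_cong[of S "\<lambda>s\<in>S. form_of n U P (u s) (X s)" "\<lambda>s. form_of n U P (u s) (X s)" m] by simp
    moreover have "linear (form_of n U P (u s) (X s))" if "s \<in> S" for s
      using u X that by (intro form_of_linear[OF P]) (auto simp: smooth_into_def)
    ultimately show "(\<lambda>s\<in>S. form_of n U P (u s) (X s)) \<in> plots gl m S"
      unfolding gl L_plot_iff by simp
  qed
  fix u X X' and a b :: real assume u: "u \<in> U" and X: "X \<in> Rn n" "X' \<in> Rn n"
  show "form_of n U P u (\<lambda>i. a * X i + b * X' i) =
      vadd gl (vscale gl a (form_of n U P u X)) (vscale gl b (form_of n U P u X'))"
    unfolding gl_vs
  proof
    fix v
    show "form_of n U P u (\<lambda>i. a * X i + b * X' i) v = a *\<^sub>R form_of n U P u X v + b *\<^sub>R form_of n U P u X' v"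
      by (rule form_of_eqI[OF P u])
         (simp only: D_lin_vector[OF Fr_fst_plot[OF P] u X frame_section[OF P]] frame_lin[OF frame_at[OF P u]]
           frame_form_of[OF P u X(1)] frame_form_of[OF P u X(2)])
  qed
next
  fix n U P m W g u X
  assume "P \<in> plots (Fr T A E) n U" "g \<in> plots (euclidean_domain n U) m W" "u \<in> W" "X \<in> Rn m"
  then show "form_of m W (compose W P g) u X = form_of n U P (g u) (tangent_map m n g u X)"
    by (rule form_of_pullback)
qed

text \<open>Both the curve and the section are pulled back from R^0, where the only tangent vector
  is 0 and \<open>D\<close> vanishes by linearity in the vector. It removes the second term of
  \<open>D_chart\<close> along curves inside one fiber of the frame bundle.\<close>

lemma D_constant:
  assumes t: "(W, \<tau>) \<in> trivs E" and x: "x \<in> W"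
  shows "\<tau> (D 1 (Rn 1) (\<lambda>_\<in>Rn 1. x) (\<lambda>_. 0) e1 (\<lambda>_\<in>Rn 1. triv_inv E \<tau> x z)) = 0"
proof -
  let ?p = "\<lambda>_\<in>Rn 0. x" and ?C = "\<lambda>_\<in>Rn 0. triv_inv E \<tau> x z" and ?o = "\<lambda>_::nat. 0::real"
  have xT: "x \<in> topspace T" using triv_open(2)[OF t] x by auto
  have p: "?p \<in> plots M 0 (Rn 0)" using xT by (intro ds_const[OF ds_M] open_Rn_UNIV) simp
  have o: "?o \<in> Rn n" for n by (rule zero_in_Rn)
  have "is_section 0 (Rn 0) ?p (\<lambda>v\<in>Rn 0. triv_inv E \<tau> (?p v) z)"
    by (rule constant_section[OF t p]) (use x in simp)
  also have "(\<lambda>v\<in>Rn 0. triv_inv E \<tau> (?p v) z) = ?C" by (rule restrict_ext) simp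
  finally have C: "is_section 0 (Rn 0) ?p ?C" .
  have g: "smooth_into 1 (Rn 1) 0 (Rn 0) (\<lambda>_. ?o)" by (rule smooth_into_const[OF open_Rn_UNIV o])
  have e1: "e1 \<in> Rn 1" by (simp add: Rn_iff)
  have "D 1 (Rn 1) (\<lambda>v\<in>Rn 1. ?p ?o) ?o e1 (\<lambda>v\<in>Rn 1. ?C ?o) = D 0 (Rn 0) ?p ?o (tangent_map 1 0 (\<lambda>_. ?o) ?o e1) ?C"
    by (rule D_pullback[OF p g o e1 C])
  \<comment> \<open>The zero vector is written as a combination with coefficients 0, so that
    \<open>D_lin_vector\<close> yields a zero element of the fiber.\<close>
  also have "tangent_map 1 0 (\<lambda>_. ?o) ?o e1 = (\<lambda>i. 0 * ?o i + 0 * ?o i)"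
    by (simp add: tangent_map_def)
  also have "D 0 (Rn 0) ?p ?o (\<lambda>i. 0 * ?o i + 0 * ?o i) ?C =
      fadd E (fscale E 0 (D 0 (Rn 0) ?p ?o ?o ?C)) (fscale E 0 (D 0 (Rn 0) ?p ?o ?o ?C))"
    by (rule D_lin_vector[OF p o o o C])
  finally have "D 1 (Rn 1) (\<lambda>_\<in>Rn 1. x) ?o e1 (\<lambda>_\<in>Rn 1. triv_inv E \<tau> x z) =
      fadd E (fscale E 0 (D 0 (Rn 0) ?p ?o ?o ?C)) (fscale E 0 (D 0 (Rn 0) ?p ?o ?o ?C))"
    by (simp only: restrict_apply'[OF o])
  moreover have "D 0 (Rn 0) ?p ?o ?o ?C \<in> fiber E x"
    using D_in_fiber[OF p o o C] by (simp only: restrict_apply'[OF o])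
  ultimately show ?thesis using triv_lin[OF t x] by simp
qed

text \<open>Equivariance: the section that the frame moved by \<open>g\<close> assigns to
  \<open>v\<close> is the one the old frame assigns to \<open>g v\<close>. For vertical curves the
  base point is constant, so by \<open>D_chart\<close> and \<open>D_constant\<close> the derivative
  \<open>D\<close> is the derivative of the fiber coordinate, and the smooth linear map
  \<open>\<tau> \<circ> snd \<xi>\<close> passes through it.\<close>

lemma form_of_connection:
  assumes gl: "(gl :: ('f \<Rightarrow> 'f) dvs) = L_space"
  shows "form_of \<in> connection_forms T A E"
  unfolding connection_forms_def mem_Collect_eq
proof (intro conjI ballI allI)
  show "form_of \<in> one_forms (Fr T A E) gl" by (rule form_of_in_one_forms[OF gl])
next
  fix g :: "'f \<Rightarrow> 'f" and n U P u X
  assume g: "g \<in> points GL" and P: "P \<in> plots (Fr T A E) n U" and u: "u \<in> U" and X: "X \<in> Rn n"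
  have U: "openin (Euclidean_space n) U" by (rule ds_open[OF ds_Fr P])
  let ?Q = "\<lambda>u\<in>U. Fr_act (P u) g"
  have "(\<lambda>u\<in>U. Fr_act (P u) ((\<lambda>_\<in>U. g) u)) \<in> plots (Fr T A E) n U"
    by (rule Fr_act_plot[OF P ds_const[OF diffeological_space_GL g U]])
  also have "(\<lambda>u\<in>U. Fr_act (P u) ((\<lambda>_\<in>U. g) u)) = ?Q" by (rule restrict_ext) simp
  finally have Q: "?Q \<in> plots (Fr T A E) n U" .
  show "form_of n U ?Q u X = inv g \<circ> form_of n U P u X \<circ> g"
  proof
    fix v
    have 1: "(\<lambda>u\<in>U. fst (?Q u)) = (\<lambda>u\<in>U. fst (P u))" "(\<lambda>u\<in>U. snd (?Q u) v) = (\<lambda>u\<in>U. snd (P u) (g v))"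
      by (rule restrict_ext, simp add: Fr_act_def)+
    have "snd (?Q u) (inv g (form_of n U P u X (g v))) = snd (P u) (form_of n U P u X (g v))"
      using u by (simp add: Fr_act_def GL_cancel[OF g])
    also have "\<dots> = D n U (\<lambda>u\<in>U. fst (?Q u)) u X (\<lambda>u\<in>U. snd (?Q u) v)"
      unfolding 1 by (rule frame_form_of[OF P u X])
    finally show "form_of n U ?Q u X v = (inv g \<circ> form_of n U P u X \<circ> g) v"
      using form_of_eqI[OF Q u] by simp
  qed
next
  fix \<xi> and c :: "real \<Rightarrow> 'f \<Rightarrow> 'f"
  assume \<xi>: "\<xi> \<in> points (Fr T A E)" and c: "c \<in> points GL_paths"
  let ?P = "\<lambda>t\<in>Rn 1. Fr_act \<xi> (c (t 0))" and ?o = "\<lambda>_::nat. 0::real"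
  have o: "?o \<in> Rn 1" by (rule zero_in_Rn)
  have e1: "e1 \<in> Rn 1" by (simp add: Rn_iff)
  have "(\<lambda>t\<in>Rn 1. Fr_act ((\<lambda>_\<in>Rn 1. \<xi>) t) ((\<lambda>t\<in>Rn 1. c (t 0)) t)) \<in> plots (Fr T A E) 1 (Rn 1)"
    by (rule Fr_act_plot[OF ds_const[OF ds_Fr \<xi> open_Rn_UNIV] GL_path_plot[OF c]])
  also have "(\<lambda>t\<in>Rn 1. Fr_act ((\<lambda>_\<in>Rn 1. \<xi>) t) ((\<lambda>t\<in>Rn 1. c (t 0)) t)) = ?P" by (rule restrict_ext) simp
  finally have P: "?P \<in> plots (Fr T A E) 1 (Rn 1)" .
  have w: "snd \<xi> \<in> frames E (fst \<xi>)" using \<xi> by (simp add: Fr_point_iff)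
  obtain W \<tau> where t: "(W, \<tau>) \<in> trivs E" "fst \<xi> \<in> W" using triv_exists[of "fst \<xi>"] \<xi>[unfolded Fr_point_iff] by blast
  have G: "\<tau> \<circ> snd \<xi> \<in> points GL" by (rule frame_in_GL[OF t w])
  have c0: "c 0 = id" using c by (simp add: GL_path_iff)
  have P0: "snd (?P ?o) = snd \<xi>" using o by (simp add: Fr_act_def c0)
  have p: "(\<lambda>t\<in>Rn 1. fst (?P t)) = (\<lambda>_\<in>Rn 1. fst \<xi>)" by (rule restrict_ext) (simp add: Fr_act_def)
  show "form_of 1 (Rn 1) ?P ?o e1 = velocity c"
  proof
    fix v
    let ?Y = "\<lambda>t\<in>Rn 1. snd (?P t) v"
    have cs: "smooth_on 1 (Rn 1) (\<lambda>t. c (t 0) v)"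
      by (rule smooth_familyD[OF GL_path_smooth_family[OF c] smooth_into_id[OF open_Rn_UNIV] smooth_on_const[OF open_Rn_UNIV]])
    have pp: "(\<lambda>_\<in>Rn 1. fst \<xi>) \<in> plots M 1 (Rn 1)" and Y: "is_section 1 (Rn 1) (\<lambda>_\<in>Rn 1. fst \<xi>) ?Y"
      using Fr_fst_plot[OF P] frame_section[OF P, of v] unfolding p .
    have Yv: "\<tau> (?Y t) = (\<tau> \<circ> snd \<xi>) (c (t 0) v)" if "t \<in> Rn 1" for t using that by (simp add: Fr_act_def)
    have pW: "(\<lambda>_\<in>Rn 1. fst \<xi>) u \<in> W" if "u \<in> Rn 1" for u using that t(2) by simp
    have "(\<lambda>t\<in>Rn 1. triv_inv E \<tau> ((\<lambda>_\<in>Rn 1. fst \<xi>) t) (\<tau> (?Y ?o))) = (\<lambda>_\<in>Rn 1. triv_inv E \<tau> (fst \<xi>) (\<tau> (?Y ?o)))"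
      by (rule restrict_ext) simp
    then have "\<tau> (D 1 (Rn 1) (\<lambda>_\<in>Rn 1. fst \<xi>) ?o e1 ?Y) = dir_deriv 1 (\<lambda>t. \<tau> (?Y t)) ?o e1"
      using D_chart[OF t(1) pp pW Y o e1] D_constant[OF t, of "\<tau> (?Y ?o)"] by simp
    also have "\<dots> = dir_deriv 1 (\<lambda>t. (\<tau> \<circ> snd \<xi>) (c (t 0) v)) ?o e1"
      by (rule dir_deriv_cong[OF open_Rn_UNIV Yv o])
    also have "\<dots> = (\<tau> \<circ> snd \<xi>) (velocity c v)"
      unfolding velocity_eq
      using G by (intro smooth_linear_dir_deriv[where l="\<tau> \<circ> snd \<xi>", OF _ _ open_Rn_UNIV cs o]) (simp_all add: GL_point_iff)
    finally have "\<tau> (snd \<xi> (velocity c v)) = \<tau> (D 1 (Rn 1) (\<lambda>_\<in>Rn 1. fst \<xi>) ?o e1 ?Y)" by simp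
    moreover have "D 1 (Rn 1) (\<lambda>_\<in>Rn 1. fst \<xi>) ?o e1 ?Y \<in> fiber E (fst \<xi>)"
      using D_in_fiber[OF pp o e1 Y] by (simp only: restrict_apply'[OF o])
    ultimately have "snd \<xi> (velocity c v) = D 1 (Rn 1) (\<lambda>_\<in>Rn 1. fst \<xi>) ?o e1 ?Y"
      using triv_eqI[OF t frame_in_fiber[OF w]] by blast
    then show "form_of 1 (Rn 1) ?P ?o e1 v = velocity c v"
      by (intro form_of_eqI[OF P o]) (simp only: p P0)
  qed
qed

text \<open>In the frame given by a trivialization, fixed vectors correspond to sections with
  constant coordinate. Hence the second term of \<open>D_chart\<close> is the local connection form
  of \<open>form_of\<close> applied to \<open>\<tau> (Y u)\<close>.\<close>

lemma form_of_induces: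
  assumes gl: "(gl :: ('f \<Rightarrow> 'f) dvs) = L_space"
  shows "induced_by T A E form_of D"
proof -
  interpret connection T A E form_of
    by unfold_locales (rule form_of_connection[OF gl])
  show ?thesis unfolding induced_by_iff
  proof (intro conjI allI impI)
    show "D \<in> collections M E" by (rule D_collection)
    fix W \<tau> n U p u X Y
    assume t: "(W, \<tau>) \<in> trivs E" and d: "collection_domain M E n U p u X Y" and pu: "p u \<in> W"
    have p: "p \<in> plots M n U" and u: "u \<in> U" and X: "X \<in> Rn n" and Y: "is_section n U p Y"
      using d by (simp_all add: collection_domain_iff)
    let ?V = "{v \<in> U. p v \<in> W}"
    have V: "openin (Euclidean_space n) ?V" by (rule open_chart_domain[OF t p])
    have VU: "?V \<subseteq> U" by auto
    have uV: "u \<in> ?V" using u pu by simp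
    let ?q = "restrict p ?V" and ?Y = "restrict Y ?V"
    have q: "?q \<in> plots M n ?V" by (rule ds_restrict[OF ds_M p VU V])
    have qW: "?q v \<in> W" if "v \<in> ?V" for v using that by simp
    have sY: "is_section n ?V ?q ?Y" by (rule section_restrict[OF Y VU V])
    let ?P = "\<lambda>v\<in>?V. (?q v, triv_inv E \<tau> (?q v))" and ?z = "\<tau> (Y u)"
    have P: "?P \<in> plots (Fr T A E) n ?V" by (rule Fr_section_plot[OF t q]) (use qW in auto)
    have "\<tau> (D n U p u X Y) = \<tau> (D n ?V ?q u X ?Y)"
      unfolding D_restrict[OF p V VU uV X Y] ..
    also have "\<dots> = dir_deriv n (\<lambda>u. \<tau> (?Y u)) u X + \<tau> (D n ?V ?q u X (\<lambda>v\<in>?V. triv_inv E \<tau> (?q v) (\<tau> (?Y u))))"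
      by (rule D_chart[OF t q qW sY uV X])
    also have "dir_deriv n (\<lambda>u. \<tau> (?Y u)) u X = dir_deriv n (\<tau> \<circ> Y) u X"
      by (rule dir_deriv_cong[OF V _ uV]) simp
    also have "\<tau> (?Y u) = ?z" using uV by simp
    also have "\<tau> (D n ?V ?q u X (\<lambda>v\<in>?V. triv_inv E \<tau> (?q v) ?z)) = form_of n ?V ?P u X ?z"
    proof -
      have 1: "(\<lambda>v\<in>?V. fst (?P v)) = ?q" "(\<lambda>v\<in>?V. snd (?P v) ?z) = (\<lambda>v\<in>?V. triv_inv E \<tau> (?q v) ?z)"
        by (rule restrict_ext, simp)+
      have "snd (?P u) (form_of n ?V ?P u X ?z) = D n ?V ?q u X (\<lambda>v\<in>?V. triv_inv E \<tau> (?q v) ?z)"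
        using frame_form_of[OF P uV X, of ?z] unfolding 1 .
      moreover have "snd (?P u) = triv_inv E \<tau> (p u)" using uV by simp
      ultimately show ?thesis using triv_triv_inv[OF t pu, of "form_of n ?V ?P u X ?z"] by (simp only:)
    qed
    finally show "\<tau> (D n U p u X Y) = local_nabla W \<tau> n U p u X Y"
      unfolding local_nabla_def Let_def local_connection_form_def .
  qed
qed

end

theorem theorem6p4:
  fixes T :: "'m topology"
    and A :: "('m set \<times> ('m \<Rightarrow> 'b::locally_convex_space)) set"
    and E :: "('m, 'e, 'f::complete_locally_convex_space) vbundle"
    and S :: "('f, real) form set"
  assumes "S \<subseteq> one_forms (nebula :: 'f dvs) (nebula :: real dvs)"
    and "separated_by S"
    and "smooth_manifold T A"
    and "vector_bundle T A E"
  shows "GL_structure_group T A E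
       \<and> principal_bundle T (manifold_nebula T A) GL (\<circ>) id (Fr T A E) fst Fr_act
       \<and> (GL_diffeological_Lie_group TYPE('f) \<longrightarrow>
            (\<forall>\<theta>\<in>connection_forms T A E. \<exists>!D. induced_by T A E \<theta> D)
          \<and> CD_GL T A E \<subseteq> CD T A E
          \<and> ((gl :: ('f \<Rightarrow> 'f) dvs) = L_space \<longrightarrow> CD_GL T A E = CD T A E))"
proof -
  interpret manifold_bundle T A E
    by unfold_locales (use assms in auto)
  have conn: "connection T A E \<theta>" if "\<theta> \<in> connection_forms T A E" for \<theta>
    by unfold_locales (rule that)
  have ex1: "\<exists>!D. induced_by T A E \<theta> D" if "\<theta> \<in> connection_forms T A E" for \<theta>
    using connection.nabla_induced[OF conn[OF that]] connection.induced_unique[OF conn[OF that]] by blast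
  have sub: "CD_GL T A E \<subseteq> CD T A E"
    using connection.induced_in_CD[OF conn] unfolding CD_GL_def by blast
  have sup: "CD T A E \<subseteq> CD_GL T A E" if gl: "(gl :: ('f \<Rightarrow> 'f) dvs) = L_space"
  proof
    fix D assume "D \<in> CD T A E"
    then interpret covariant_derivative T A E D by unfold_locales
    show "D \<in> CD_GL T A E"
      unfolding CD_GL_def using form_of_connection[OF gl] form_of_induces[OF gl] by blast
  qed
  show ?thesis using GL_structure Fr_principal_bundle ex1 sub sup by blast
qed

end
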